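(* Let $\Omega\subset\mathbb{R}^2$ be a bounded domain, let $T>0$, and let $\Phi=\Phi(\mathbf{x})\in C^1(\overline\Omega)$ be a given time-independent potential. Let $\varrho_0>0$ and $\vartheta_0>0$ be given constants. Then there exists $\mathbf{u}_0\in L^\infty(\Omega;\mathbb{R}^2)$ such that the complete Euler system driven by the potential $\Phi$, with impermeability boundary condition, admits infinitely many entropy (weak) solutions $[\varrho,\mathbf{m},E]$ on $(0,T)\times\Omega$ originating from the initial data $[\varrho_0,\mathbf{m}_0,E_0]$, where $$\mathbf{m}_0=\varrho_0\mathbf{u}_0,\qquad E_0=\tfrac12\varrho_0|\mathbf{u}_0|^2+\varrho_0e(\varrho_0,\vartheta_0).$$ In addition, for these solutions the renormalized entropy balance holds as an equality, i.e. $$\int_0^T\!\!\int_\Omega\left[\varrho Z(s)\,\partial_t\varphi+Z(s)\,\mathbf{m}\cdot\nabla_x\varphi\right]d\mathbf{x}\,dt=-\int_\Omega\varrho_0Z(s(\varrho_0,\vartheta_0))\,\varphi(0,\cdot)\,d\mathbf{x}$$ for any $\varphi\in C_c^\infty([0,T)\times\mathbb{R}^2)$ (not necessarily non-negative) and any $Z\in C^2(\mathbb{R})$ with $Z'\ge0$, $Z''\le0$ and $Z\le Z_\infty$ on $\mathbb{R}$ for some constant $Z_\infty$.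
   Context: **Thermodynamics.** The pressure $p=p(\varrho,\vartheta)>0$, the specific internal energy $e=e(\varrho,\vartheta)$ and the specific entropy $s=s(\varrho,\vartheta)$ are given smooth functions of the density $\varrho>0$ and the temperature $\vartheta>0$, related by Gibbs' equation $\vartheta\,Ds=De+p\,D(1/\varrho)$, with $\partial_\vartheta e(\varrho,\vartheta)>0$. The conservative variables are $\varrho$, the momentum $\mathbf{m}=\varrho\mathbf{u}$, and the total energy $E=\frac12\frac{|\mathbf{m}|^2}{\varrho}+\varrho e(\varrho,\vartheta)$. Given $[\varrho,\mathbf{m},E]$, the temperature $\vartheta$ is determined by $\varrho e(\varrho,\vartheta)=E-\frac12\frac{|\mathbf{m}|^2}{\varrho}$, and $p$ and $s$ below denote $p(\varrho,\vartheta)$ and $s(\varrho,\vartheta)$ for this $\vartheta$. $C^1(\overline\Omega)$ denotes restrictions to $\overline\Omega$ of $C^1$ functions on $\mathbb{R}^2$. **Entropy (weak) solution.** A trio $[\varrho,\mathbf{m},E]$ of measurable functions on $(0,T)\times\Omega$ (all integrals below being assumed well defined) is an entropy (weak) solution of the Euler system driven by $\Phi$ with initial data $[\varrho_0,\mathbf{m}_0,E_0]$ if: 1. $\varrho\ge0$ a.e. and $\int_0^T\int_\Omega[\varrho\,\partial_t\varphi+\mathbf{m}\cdot\nabla_x\varphi]\,d\mathbf{x}\,dt=-\int_\Omega\varrho_0\varphi(0,\cdot)\,d\mathbf{x}$ for any $\varphi\in C_c^\infty([0,T)\times\mathbb{R}^2)$; 2. $\mathbf{m}=0$ whenever $\varrho=0$,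 and $\int_0^T\int_\Omega\left[\mathbf{m}\cdot\partial_t\boldsymbol\varphi+\frac{\mathbf{m}\otimes\mathbf{m}}{\varrho}:\nabla_x\boldsymbol\varphi+p\,\mathrm{div}_x\boldsymbol\varphi\right]d\mathbf{x}\,dt=-\int_\Omega\mathbf{m}_0\cdot\boldsymbol\varphi(0,\cdot)\,d\mathbf{x}-\int_0^T\int_\Omega\varrho\nabla_x\Phi\cdot\boldsymbol\varphi\,d\mathbf{x}\,dt$ for any $\boldsymbol\varphi\in C_c^\infty([0,T)\times\overline\Omega;\mathbb{R}^2)$ with $\boldsymbol\varphi\cdot\mathbf{n}|_{\partial\Omega}=0$ ($\mathbf{n}$ the outer normal; if $\partial\Omega$ is not regular this condition is understood as $\int_\Omega(\psi\,\mathrm{div}_x\boldsymbol\varphi+\boldsymbol\varphi\cdot\nabla_x\psi)\,d\mathbf{x}=0$ for all $\psi\in C_c^\infty(\mathbb{R}^2)$ and all times); 3. $\int_0^T\int_\Omega\left[E\,\partial_t\varphi+(E+p)\frac{\mathbf{m}}{\varrho}\cdot\nabla_x\varphi\right]d\mathbf{x}\,dt=-\int_\Omega E_0\varphi(0,\cdot)\,d\mathbf{x}-\int_0^T\int_\Omega\nabla_x\Phi\cdot\mathbf{m}\,\varphi\,d\mathbf{x}\,dt$ for any $\varphi\in C_c^\infty([0,T)\times\mathbb{R}^2)$; 4. $\int_0^T\int_\Omega\left[\varrho Z(s)\,\partial_t\varphi+Z(s)\,\mathbf{m}\cdot\nabla_x\varphi\right]d\mathbf{x}\,dt\le-\int_\Omega\varrho_0Z(s_0)\varphi(0,\cdot)\,d\mathbf{x}$,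 where $s_0$ is the entropy determined by $[\varrho_0,\mathbf{m}_0,E_0]$, for any $\varphi\in C_c^\infty([0,T)\times\mathbb{R}^2)$ with $\varphi\ge0$ and any $Z\in C^2(\mathbb{R})$ with $Z'\ge0$, $Z''\le0$, $Z\le Z_\infty$ for some constant $Z_\infty$. Solutions are identified if they agree a.e. in $(0,T)\times\Omega$. *)

theory Defs
  imports "HOL-Analysis.Analysis"
begin

section \<open>Smoothness, differential operators and function spaces\<close>

text \<open>
  \<open>Ck_on k S f\<close>: f is k times continuously differentiable on the open set S.  It is meant for
  finite-dimensional domains, where continuity of all iterated directional derivatives is the
  usual notion.
\<close>

primrec Ck_on ::
  "nat \<Rightarrow> 'a::real_normed_vector set \<Rightarrow> ('a \<Rightarrow> 'b::real_normed_vector) \<Rightarrow> bool" where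
  "Ck_on 0 S f \<longleftrightarrow> continuous_on S f"
| "Ck_on (Suc k) S f \<longleftrightarrow>
     (\<forall>x\<in>S. f differentiable (at x)) \<and> (\<forall>v. Ck_on k S (\<lambda>x. frechet_derivative f (at x) v))"

definition smooth_on ::
  "'a::real_normed_vector set \<Rightarrow> ('a \<Rightarrow> 'b::real_normed_vector) \<Rightarrow> bool" where
  "smooth_on S f \<longleftrightarrow> (\<forall>k. Ck_on k S f)"

definition grad :: "(real^2 \<Rightarrow> real) \<Rightarrow> real^2 \<Rightarrow> real^2" where
  "grad f x = (\<chi> i. frechet_derivative f (at x) (axis i 1))"

definition divergence :: "(real^2 \<Rightarrow> real^2) \<Rightarrow> real^2 \<Rightarrow> real" where
  "divergence v x = trace (jacobian v (at x))"

definition time_deriv ::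
  "(real \<times> (real^2) \<Rightarrow> 'b::real_normed_vector) \<Rightarrow> real \<Rightarrow> real^2 \<Rightarrow> 'b" where
  "time_deriv \<phi> t x = vector_derivative (\<lambda>\<tau>. \<phi> (\<tau>, x)) (at t)"

text \<open>The contraction \<open>A : B\<close> of matrices is the library's inner product on \<^typ>\<open>real^2^2\<close>.\<close>

definition tensor :: "real^2 \<Rightarrow> real^2 \<Rightarrow> real^2^2" where
  "tensor a b = (\<chi> i j. a $ i * b $ j)"

text \<open>Functions whose values on the closure of \<open>\<Omega>\<close> are those of a C1 function on the plane.\<close>

definition C1_closure :: "(real^2) set \<Rightarrow> (real^2 \<Rightarrow> real) set" where
  "C1_closure \<Omega> = {f. \<exists>g. Ck_on 1 UNIV g \<and> (\<forall>x\<in>closure \<Omega>. f x = g x)}"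

definition Linfty :: "(real^2) set \<Rightarrow> (real^2 \<Rightarrow> real^2) set" where
  "Linfty \<Omega> = {u. set_borel_measurable lebesgue \<Omega> u \<and>
                  (\<exists>C. AE x in lebesgue. x \<in> \<Omega> \<longrightarrow> norm (u x) \<le> C)}"

definition Cc_smooth :: "(real^2 \<Rightarrow> real) set" where
  "Cc_smooth = {\<psi>. smooth_on UNIV \<psi> \<and> (\<exists>K. compact K \<and> (\<forall>x. x \<notin> K \<longrightarrow> \<psi> x = 0))}"

text \<open>
  Smooth functions on \<open>[0,T) \<times> A\<close> with compact support in \<open>[0,T) \<times> A\<close>, where A is the plane or the
  closure of a domain.  Smoothness up to the boundary means being the restriction of a smooth
  function; \<open>\<phi>\<close> is that extension, and only its values on \<open>[0,T) \<times> A\<close> are constrained.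
\<close>

definition test_functions ::
  "real \<Rightarrow> (real^2) set \<Rightarrow> (real \<times> (real^2) \<Rightarrow> 'b::real_normed_vector) set" where
  "test_functions T A = {\<phi>. smooth_on UNIV \<phi> \<and>
     (\<exists>K. compact K \<and> K \<subseteq> {0..<T} \<times> A \<and> (\<forall>z \<in> ({0..<T} \<times> A) - K. \<phi> z = 0))}"

section \<open>The impermeability condition\<close>

text \<open>
  n is the outer unit normal at a boundary point near which \<open>\<Omega>\<close> is the sublevel set of a C1
  function with nonvanishing gradient.
\<close>

definition outer_normal :: "(real^2) set \<Rightarrow> real^2 \<Rightarrow> real^2 \<Rightarrow> bool" where
  "outer_normal \<Omega> x n \<longleftrightarrow> x \<in> frontier \<Omega> \<and>
     (\<exists>U g. open U \<and> x \<in> U \<and> Ck_on 1 U g \<and> (\<forall>y\<in>U. grad g y \<noteq> 0) \<and>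
        \<Omega> \<inter> U = {y\<in>U. g y < 0} \<and> n = grad g x /\<^sub>R norm (grad g x))"

definition regular_boundary :: "(real^2) set \<Rightarrow> bool" where
  "regular_boundary \<Omega> \<longleftrightarrow> (\<forall>x\<in>frontier \<Omega>. \<exists>n. outer_normal \<Omega> x n)"

text \<open>
  Vanishing normal component on the boundary: pointwise if the boundary is C1, in the weak sense
  otherwise.
\<close>

definition zero_normal_trace :: "(real^2) set \<Rightarrow> (real^2 \<Rightarrow> real^2) \<Rightarrow> bool" where
  "zero_normal_trace \<Omega> v \<longleftrightarrow>
     (if regular_boundary \<Omega>
      then \<forall>x\<in>frontier \<Omega>. \<forall>n. outer_normal \<Omega> x n \<longrightarrow> v x \<bullet> n = 0
      else \<forall>\<psi>\<in>Cc_smooth.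
             set_lebesgue_integral lebesgue \<Omega> (\<lambda>x. \<psi> x * divergence v x + v x \<bullet> grad \<psi> x) = 0)"

section \<open>Thermodynamics\<close>

text \<open>
  The functions p, e, s take the pair of density and temperature; nothing is assumed about them
  outside the open quadrant of positive arguments.
\<close>

definition thermodynamics ::
  "(real \<times> real \<Rightarrow> real) \<Rightarrow> (real \<times> real \<Rightarrow> real) \<Rightarrow> (real \<times> real \<Rightarrow> real) \<Rightarrow> bool" where
  "thermodynamics p e s \<longleftrightarrow>
     smooth_on ({0<..} \<times> {0<..}) p \<and> smooth_on ({0<..} \<times> {0<..}) e \<and>
     smooth_on ({0<..} \<times> {0<..}) s \<and>
     (\<forall>\<rho> > 0. \<forall>\<theta> > 0.
        p (\<rho>, \<theta>) > 0 \<and>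
        (\<forall>h. \<theta> * frechet_derivative s (at (\<rho>, \<theta>)) h =
             frechet_derivative e (at (\<rho>, \<theta>)) h +
             p (\<rho>, \<theta>) * frechet_derivative (\<lambda>(r, _). 1 / r) (at (\<rho>, \<theta>)) h) \<and>
        deriv (\<lambda>\<tau>. e (\<rho>, \<tau>)) \<theta> > 0)"

definition is_temperature ::
  "(real \<times> real \<Rightarrow> real) \<Rightarrow> real \<Rightarrow> real^2 \<Rightarrow> real \<Rightarrow> real \<Rightarrow> bool" where
  "is_temperature e \<rho> m E \<theta> \<longleftrightarrow> \<theta> > 0 \<and> \<rho> * e (\<rho>, \<theta>) = E - 1/2 * (norm m)\<^sup>2 / \<rho>"

definition temperature :: "(real \<times> real \<Rightarrow> real) \<Rightarrow> real \<Rightarrow> real^2 \<Rightarrow> real \<Rightarrow> real" where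
  "temperature e \<rho> m E = (THE \<theta>. is_temperature e \<rho> m E \<theta>)"

text \<open>
  The temperature is not determined in vacuum (\<open>\<rho> = 0\<close>); there the pressure is set to 0.  The
  value chosen for the entropy in vacuum is irrelevant, since it only enters multiplied by
  \<open>\<rho>\<close> or by m.
\<close>

definition state_pressure ::
  "(real \<times> real \<Rightarrow> real) \<Rightarrow> (real \<times> real \<Rightarrow> real) \<Rightarrow> real \<Rightarrow> real^2 \<Rightarrow> real \<Rightarrow> real" where
  "state_pressure p e \<rho> m E = (if \<rho> > 0 then p (\<rho>, temperature e \<rho> m E) else 0)"

definition state_entropy ::
  "(real \<times> real \<Rightarrow> real) \<Rightarrow> (real \<times> real \<Rightarrow> real) \<Rightarrow> real \<Rightarrow> real^2 \<Rightarrow> real \<Rightarrow> real" where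
  "state_entropy e s \<rho> m E = (if \<rho> > 0 then s (\<rho>, temperature e \<rho> m E) else 0)"

section \<open>Entropy solutions of the complete Euler system\<close>

text \<open>
  Fields are functions on space-time.  Iterated integrals over \<open>(0,T)\<close> and \<open>\<Omega>\<close> are integrals over the
  product set; since the Bochner integral is 0 for non-integrable functions, each balance asserts
  integrability explicitly.  Division by 0 yields 0, so fluxes such as \<open>m \<otimes> m / \<rho>\<close> vanish in vacuum.
\<close>

definition mass_balance ::
  "real \<Rightarrow> (real^2) set \<Rightarrow> (real^2 \<Rightarrow> real) \<Rightarrow>
   (real \<times> (real^2) \<Rightarrow> real) \<Rightarrow> (real \<times> (real^2) \<Rightarrow> real^2) \<Rightarrow> bool" where
  "mass_balance T \<Omega> \<rho>0 \<rho> m \<longleftrightarrow>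
     (\<forall>\<phi> \<in> test_functions T UNIV.
        let f = (\<lambda>(t, x). \<rho> (t, x) * time_deriv \<phi> t x + m (t, x) \<bullet> grad (\<lambda>y. \<phi> (t, y)) x);
            f0 = (\<lambda>x. \<rho>0 x * \<phi> (0, x))
        in set_integrable lebesgue ({0<..<T} \<times> \<Omega>) f \<and> set_integrable lebesgue \<Omega> f0 \<and>
           set_lebesgue_integral lebesgue ({0<..<T} \<times> \<Omega>) f = - set_lebesgue_integral lebesgue \<Omega> f0)"

definition momentum_balance ::
  "(real \<times> real \<Rightarrow> real) \<Rightarrow> (real \<times> real \<Rightarrow> real) \<Rightarrow> real \<Rightarrow> (real^2) set \<Rightarrow> (real^2 \<Rightarrow> real) \<Rightarrow>
   (real^2 \<Rightarrow> real^2) \<Rightarrow>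
   (real \<times> (real^2) \<Rightarrow> real) \<Rightarrow> (real \<times> (real^2) \<Rightarrow> real^2) \<Rightarrow> (real \<times> (real^2) \<Rightarrow> real) \<Rightarrow> bool" where
  "momentum_balance p e T \<Omega> \<Phi> m0 \<rho> m E \<longleftrightarrow>
     (\<forall>\<phi> \<in> test_functions T (closure \<Omega>).
        (\<forall>t\<in>{0..<T}. zero_normal_trace \<Omega> (\<lambda>x. \<phi> (t, x))) \<longrightarrow>
        (let f = (\<lambda>(t, x). m (t, x) \<bullet> time_deriv \<phi> t x
                   + (tensor (m (t, x)) (m (t, x)) /\<^sub>R \<rho> (t, x)) \<bullet> jacobian (\<lambda>y. \<phi> (t, y)) (at x)
                   + state_pressure p e (\<rho> (t, x)) (m (t, x)) (E (t, x))
                       * divergence (\<lambda>y. \<phi> (t, y)) x);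
             f0 = (\<lambda>x. m0 x \<bullet> \<phi> (0, x));
             g = (\<lambda>(t, x). \<rho> (t, x) * (grad \<Phi> x \<bullet> \<phi> (t, x)))
         in set_integrable lebesgue ({0<..<T} \<times> \<Omega>) f \<and> set_integrable lebesgue \<Omega> f0 \<and>
            set_integrable lebesgue ({0<..<T} \<times> \<Omega>) g \<and>
            set_lebesgue_integral lebesgue ({0<..<T} \<times> \<Omega>) f =
              - set_lebesgue_integral lebesgue \<Omega> f0
              - set_lebesgue_integral lebesgue ({0<..<T} \<times> \<Omega>) g))"

definition energy_balance ::
  "(real \<times> real \<Rightarrow> real) \<Rightarrow> (real \<times> real \<Rightarrow> real) \<Rightarrow> real \<Rightarrow> (real^2) set \<Rightarrow> (real^2 \<Rightarrow> real) \<Rightarrow>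
   (real^2 \<Rightarrow> real) \<Rightarrow>
   (real \<times> (real^2) \<Rightarrow> real) \<Rightarrow> (real \<times> (real^2) \<Rightarrow> real^2) \<Rightarrow> (real \<times> (real^2) \<Rightarrow> real) \<Rightarrow> bool" where
  "energy_balance p e T \<Omega> \<Phi> E0 \<rho> m E \<longleftrightarrow>
     (\<forall>\<phi> \<in> test_functions T UNIV.
        let f = (\<lambda>(t, x). E (t, x) * time_deriv \<phi> t x
                   + (E (t, x) + state_pressure p e (\<rho> (t, x)) (m (t, x)) (E (t, x)))
                       * ((m (t, x) /\<^sub>R \<rho> (t, x)) \<bullet> grad (\<lambda>y. \<phi> (t, y)) x));
            f0 = (\<lambda>x. E0 x * \<phi> (0, x));
            g = (\<lambda>(t, x). (grad \<Phi> x \<bullet> m (t, x)) * \<phi> (t, x))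
        in set_integrable lebesgue ({0<..<T} \<times> \<Omega>) f \<and> set_integrable lebesgue \<Omega> f0 \<and>
           set_integrable lebesgue ({0<..<T} \<times> \<Omega>) g \<and>
           set_lebesgue_integral lebesgue ({0<..<T} \<times> \<Omega>) f =
             - set_lebesgue_integral lebesgue \<Omega> f0
             - set_lebesgue_integral lebesgue ({0<..<T} \<times> \<Omega>) g)"

definition renormalizers :: "(real \<Rightarrow> real) set" where
  "renormalizers = {Z. Ck_on 2 UNIV Z \<and> (\<forall>r. deriv Z r \<ge> 0) \<and> (\<forall>r. deriv (deriv Z) r \<le> 0) \<and>
                       (\<exists>Zinf. \<forall>r. Z r \<le> Zinf)}"

definition entropy_integrand ::
  "(real \<times> real \<Rightarrow> real) \<Rightarrow> (real \<times> real \<Rightarrow> real) \<Rightarrow> (real \<Rightarrow> real) \<Rightarrow>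
   (real \<times> (real^2) \<Rightarrow> real) \<Rightarrow> (real \<times> (real^2) \<Rightarrow> real^2) \<Rightarrow> (real \<times> (real^2) \<Rightarrow> real) \<Rightarrow>
   (real \<times> (real^2) \<Rightarrow> real) \<Rightarrow> real \<times> (real^2) \<Rightarrow> real" where
  "entropy_integrand e s Z \<rho> m E \<phi> = (\<lambda>(t, x).
     let Zs = Z (state_entropy e s (\<rho> (t, x)) (m (t, x)) (E (t, x)))
     in \<rho> (t, x) * Zs * time_deriv \<phi> t x + Zs * (m (t, x) \<bullet> grad (\<lambda>y. \<phi> (t, y)) x))"

definition entropy_inequality ::
  "(real \<times> real \<Rightarrow> real) \<Rightarrow> (real \<times> real \<Rightarrow> real) \<Rightarrow> real \<Rightarrow> (real^2) set \<Rightarrow>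
   (real^2 \<Rightarrow> real) \<Rightarrow> (real^2 \<Rightarrow> real^2) \<Rightarrow> (real^2 \<Rightarrow> real) \<Rightarrow>
   (real \<times> (real^2) \<Rightarrow> real) \<Rightarrow> (real \<times> (real^2) \<Rightarrow> real^2) \<Rightarrow> (real \<times> (real^2) \<Rightarrow> real) \<Rightarrow> bool" where
  "entropy_inequality e s T \<Omega> \<rho>0 m0 E0 \<rho> m E \<longleftrightarrow>
     (\<forall>Z \<in> renormalizers. \<forall>\<phi> \<in> test_functions T UNIV.
        (\<forall>z \<in> {0..<T} \<times> UNIV. \<phi> z \<ge> 0) \<longrightarrow>
        (let f = entropy_integrand e s Z \<rho> m E \<phi>;
             f0 = (\<lambda>x. \<rho>0 x * Z (state_entropy e s (\<rho>0 x) (m0 x) (E0 x)) * \<phi> (0, x))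
         in set_integrable lebesgue ({0<..<T} \<times> \<Omega>) f \<and> set_integrable lebesgue \<Omega> f0 \<and>
            set_lebesgue_integral lebesgue ({0<..<T} \<times> \<Omega>) f
              \<le> - set_lebesgue_integral lebesgue \<Omega> f0))"

definition entropy_solution ::
  "(real \<times> real \<Rightarrow> real) \<Rightarrow> (real \<times> real \<Rightarrow> real) \<Rightarrow> (real \<times> real \<Rightarrow> real) \<Rightarrow>
   real \<Rightarrow> (real^2) set \<Rightarrow> (real^2 \<Rightarrow> real) \<Rightarrow>
   (real^2 \<Rightarrow> real) \<Rightarrow> (real^2 \<Rightarrow> real^2) \<Rightarrow> (real^2 \<Rightarrow> real) \<Rightarrow>
   (real \<times> (real^2) \<Rightarrow> real) \<Rightarrow> (real \<times> (real^2) \<Rightarrow> real^2) \<Rightarrow> (real \<times> (real^2) \<Rightarrow> real) \<Rightarrow> bool" where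
  "entropy_solution p e s T \<Omega> \<Phi> \<rho>0 m0 E0 \<rho> m E \<longleftrightarrow>
     set_borel_measurable lebesgue ({0<..<T} \<times> \<Omega>) \<rho> \<and>
     set_borel_measurable lebesgue ({0<..<T} \<times> \<Omega>) m \<and>
     set_borel_measurable lebesgue ({0<..<T} \<times> \<Omega>) E \<and>
     (AE z in lebesgue. z \<in> {0<..<T} \<times> \<Omega> \<longrightarrow>
        \<rho> z \<ge> 0 \<and> (\<rho> z = 0 \<longrightarrow> m z = 0) \<and>
        (\<rho> z > 0 \<longrightarrow> (\<exists>\<theta>. is_temperature e (\<rho> z) (m z) (E z) \<theta>))) \<and>
     mass_balance T \<Omega> \<rho>0 \<rho> m \<and>
     momentum_balance p e T \<Omega> \<Phi> m0 \<rho> m E \<and>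
     energy_balance p e T \<Omega> \<Phi> E0 \<rho> m E \<and>
     entropy_inequality e s T \<Omega> \<rho>0 m0 E0 \<rho> m E"

definition ae_equal ::
  "real \<Rightarrow> (real^2) set \<Rightarrow>
   (real \<times> (real^2) \<Rightarrow> real) \<times> (real \<times> (real^2) \<Rightarrow> real^2) \<times> (real \<times> (real^2) \<Rightarrow> real) \<Rightarrow>
   (real \<times> (real^2) \<Rightarrow> real) \<times> (real \<times> (real^2) \<Rightarrow> real^2) \<times> (real \<times> (real^2) \<Rightarrow> real) \<Rightarrow> bool" where
  "ae_equal T \<Omega> = (\<lambda>(\<rho>, m, E) (\<rho>', m', E').
     AE z in lebesgue. z \<in> {0<..<T} \<times> \<Omega> \<longrightarrow> \<rho> z = \<rho>' z \<and> m z = m' z \<and> E z = E' z)"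

end

theory Submission
  imports Defs
begin

text \<open>
  The solutions are isothermal with constant density: \<open>\<rho> = \<rho>0\<close>,
  \<open>\<theta> = \<theta>0\<close>, \<open>m = \<rho>0 v\<close>. Pressure and entropy are then constants,
  and writing \<open>q = |v|\<^sup>2/2\<close> the system reduces to \<open>div v = 0\<close>,
  \<open>\<partial>\<^sub>t v + div (v \<otimes> v) = \<nabla>\<Phi>\<close> and an energy balance. Suppose that
  \<open>q = \<Phi> + C\<close> with a constant C. Since
  \<open>v \<otimes> v = (v \<otimes> v - q I) + q I\<close> and \<open>\<nabla>q = \<nabla>\<Phi>\<close>, the
  isotropic part absorbs the force, and the momentum equation becomes
  \<open>\<partial>\<^sub>t v + div (v \<otimes> v - q I) = 0\<close>. The energy
  \<open>\<rho>0 (q + e(\<rho>0, \<theta>0))\<close> does not depend on time, so the energy equation follows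
  from \<open>div v = 0\<close> and \<open>\<nabla>q = \<nabla>\<Phi>\<close>. A function Z of the constant
  entropy is transported by the divergence-free field v, which gives the entropy balance as an equality.

  It remains to find infinitely many weak solutions v of the reduced system with prescribed modulus
  \<open>|v|\<^sup>2 = 2q\<close> and a common initial value of the same modulus. This is done by convex
  integration in the style of De Lellis and Szekelyhidi. Identify v with a complex number m and a symmetric
  traceless matrix with a complex number u; then \<open>v \<otimes> v - |v|\<^sup>2/2 I\<close> becomes
  \<open>m\<^sup>2/2\<close>. A pair \<open>(m, u)\<close> solving the linear system is a strict subsolution if
  the largest eigenvalue \<open>|m|\<^sup>2/2 + |u - m\<^sup>2/2|\<close> of \<open>v \<otimes> v - U\<close> is
  below q; if the modulus constraint \<open>|m|\<^sup>2 = 2q\<close> is attained in the limit, then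
  \<open>u = m\<^sup>2/2\<close> is forced.

  The linear system has compactly supported, rapidly oscillating solutions close to plane waves
  (\<open>packet_main\<close>), and at each state there is a wave direction along which the amplitude may be of
  the order of the gap \<open>q - |m|\<^sup>2/2\<close> (\<open>wave_direction\<close>). By the Riemann-Lebesgue
  lemma the packets are nearly orthogonal to any finite set of continuous fields; placed on disjoint Vitali
  balls they raise the square norm of m by at least a fixed multiple of the integral of the squared gap
  (\<open>perturbation_step\<close>). Iterating, the almost orthogonal increments have bounded square norm, so
  the gaps tend to 0 and m converges strongly (\<open>saturation\<close>).

  This procedure is used twice. On the slice \<open>t = 0\<close>, with supports shrinking to the slice, it
  produces an initial value of modulus \<open>sqrt (2q)\<close> together with a subsolution that is still strict
  for \<open>t > 0\<close> (\<open>saturated_initial_data\<close>). In the slab, with supports in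
  \<open>t > 0\<close>, it saturates that subsolution (\<open>saturated_solution\<close>) while nearly
  preserving a chosen linear functional; starting from subsolutions on which the functional takes well separated
  values gives infinitely many solutions.

  The linear balances hold against all C1 test functions, so v has vanishing normal trace. The isotropic part
  \<open>q div \<phi>\<close>, however, has to be integrated by parts over an arbitrary bounded open set, which
  is where the impermeability of the test field enters (\<open>zero_normal_trace_pairing\<close>): if the
  boundary is C1 this is the divergence theorem for tangential fields, otherwise the weak condition extends from
  smooth test functions to C1 functions by mollification.
\<close>

section \<open>A smooth bump and its derivatives\<close>

text \<open>
  The functions \<open>s\<^sup>a (1 - s\<^sup>2)\<^sup>-\<^sup>n exp (- 1 / (1 - s\<^sup>2))\<close>, extended
  by 0. Their span is closed under differentiation, which provides all derivatives of the bump at once.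
\<close>

definition bump_term :: "nat \<Rightarrow> nat \<Rightarrow> real \<Rightarrow> real" where
  "bump_term a n s = (if \<bar>s\<bar> < 1 then s ^ a * inverse (1 - s\<^sup>2) ^ n * exp (- inverse (1 - s\<^sup>2)) else 0)"

inductive_set bump_space :: "(real \<Rightarrow> real) set" where
  bump_term: "(\<lambda>s. c * bump_term a n s) \<in> bump_space"
| add: "f \<in> bump_space \<Longrightarrow> g \<in> bump_space \<Longrightarrow> (\<lambda>s. f s + g s) \<in> bump_space"

lemma exp_lower_bound_term:
  assumes "0 \<le> (x::real)"
  shows "x ^ k / fact k \<le> exp x"
proof -
  have "(\<Sum>n\<in>{k}. x ^ n /\<^sub>R fact n) \<le> (\<Sum>n. x ^ n /\<^sub>R fact n)"
    using assms by (intro sum_le_suminf summable_exp_generic) auto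
  then show ?thesis by (simp add: exp_def divide_inverse mult.commute)
qed

text \<open>
  The exponential beats every power of \<open>1 - s\<^sup>2\<close>; a quadratic bound at the end points
  suffices for differentiability there.
\<close>

lemma bump_term_quadratic:
  assumes "\<bar>s0\<bar> = 1"
  shows "\<bar>bump_term a n s\<bar> \<le> 9 * fact (n + 2) * (s - s0)\<^sup>2"
proof (cases "\<bar>s\<bar> < 1")
  case True
  define w where "w = 1 - s\<^sup>2"
  have w: "0 < w" using True by (simp add: w_def abs_square_less_1)
  define c :: real where "c = fact (n+2)"
  have c: "c > 0" unfolding c_def by (rule fact_gt_zero)
  have "inverse w ^ (n+2) / c \<le> exp (inverse w)"
    unfolding c_def using w by (intro exp_lower_bound_term) simp
  then have "inverse w ^ (n+2) \<le> c * exp (inverse w)"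
    using c by (simp only: divide_le_eq mult.commute if_True)
  then have "inverse w ^ (n+2) * exp (- inverse w) \<le> (c * exp (inverse w)) * exp (- inverse w)"
    by (rule mult_right_mono) simp
  then have "inverse w ^ (n+2) * exp (- inverse w) \<le> c"
    by (simp only: mult.assoc exp_add[symmetric]) simp
  then have "w\<^sup>2 * (inverse w ^ (n+2) * exp (- inverse w)) \<le> w\<^sup>2 * c"
    by (rule mult_left_mono) simp
  moreover have "w\<^sup>2 * (inverse w ^ (n+2) * exp (- inverse w)) = (w * inverse w) ^ 2 * (inverse w ^ n * exp (- inverse w))"
    by (simp only: power_add power_mult_distrib ac_simps)
  then have "w\<^sup>2 * (inverse w ^ (n+2) * exp (- inverse w)) = inverse w ^ n * exp (- inverse w)"
    using w by simp
  ultimately have le: "inverse w ^ n * exp (- inverse w) \<le> fact (n+2) * w\<^sup>2"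
    unfolding c_def[symmetric] by (simp only: mult.commute)
  have "\<bar>s ^ a\<bar> \<le> 1" using True by (simp add: power_abs power_le_one)
  then have "\<bar>bump_term a n s\<bar> \<le> 1 * (inverse w ^ n * exp (- inverse w))"
    using True w unfolding bump_term_def w_def[symmetric]
    by (simp add: abs_mult mult.assoc mult_right_mono del: exp_minus)
  also have "\<dots> \<le> fact (n+2) * w\<^sup>2" using le by (simp only: mult_1)
  also have "\<dots> \<le> fact (n+2) * (9 * (s - s0)\<^sup>2)"
  proof (rule mult_left_mono)
    show "w\<^sup>2 \<le> 9 * (s - s0)\<^sup>2"
    proof -
    have "w = (s0 - s) * (s0 + s)" using assms by (auto simp: w_def abs_if algebra_simps power2_eq_square split: if_splits)
    then have "w\<^sup>2 = (s - s0)\<^sup>2 * (s0 + s)\<^sup>2" by (simp add: power_mult_distrib power2_commute)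
    moreover have "(s0 + s)\<^sup>2 \<le> 3\<^sup>2" using assms True by (intro abs_le_square_iff[THEN iffD1]) auto
    ultimately show ?thesis using mult_left_mono[of "(s0 + s)\<^sup>2" 9 "(s - s0)\<^sup>2"] by (simp add: mult.commute)
    qed
  qed simp
  also have "\<dots> = 9 * fact (n+2) * (s - s0)\<^sup>2" by (metis mult.assoc mult.commute)
  finally show ?thesis .
qed (simp add: bump_term_def)

lemma has_derivative_zero_of_quadratic:
  assumes "\<And>s. \<bar>f s\<bar> \<le> C * (s - s0)\<^sup>2"
  shows "(f has_real_derivative 0) (at (s0::real))"
proof -
  have z: "f s0 = 0" using assms[of s0] by simp
  have "((\<lambda>s. C * \<bar>s - s0\<bar>) \<longlongrightarrow> C * \<bar>s0 - s0\<bar>) (at s0)" by (intro tendsto_intros)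
  then have l: "((\<lambda>s. C * \<bar>s - s0\<bar>) \<longlongrightarrow> 0) (at s0)" by simp
  have "((\<lambda>s. (f s - f s0) / (s - s0)) \<longlongrightarrow> 0) (at s0)"
  proof (rule Lim_null_comparison[OF _ l])
    show "\<forall>\<^sub>F s in at s0. norm ((f s - f s0) / (s - s0)) \<le> C * \<bar>s - s0\<bar>"
      unfolding eventually_at_filter
    proof (intro always_eventually allI impI)
      fix s assume "s \<noteq> s0"
      then have "C * (s - s0)\<^sup>2 / \<bar>s - s0\<bar> = C * \<bar>s - s0\<bar>" by (simp add: power2_eq_square field_simps abs_if)
      moreover have "norm ((f s - f s0) / (s - s0)) \<le> C * (s - s0)\<^sup>2 / \<bar>s - s0\<bar>"
        using assms[of s] z by (simp add: abs_divide divide_right_mono)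
      ultimately show "norm ((f s - f s0) / (s - s0)) \<le> C * \<bar>s - s0\<bar>" by simp
    qed
  qed
  then show ?thesis by (simp add: has_field_derivative_iff)
qed

lemma bump_term_derivative:
  "(bump_term a n has_real_derivative
     (real a * bump_term (a - 1) n s + (2 * real n * bump_term (a + 1) (n + 1) s +
       (- 2) * bump_term (a + 1) (n + 2) s))) (at s)"
proof (cases "\<bar>s\<bar> = 1")
  case True
  then have "(bump_term a n has_real_derivative 0) (at s)"
    by (intro has_derivative_zero_of_quadratic[where C = "9 * fact (n + 2)"] bump_term_quadratic)
  then show ?thesis using True by (simp add: bump_term_def)
next
  case False
  show ?thesis
  proof (cases "\<bar>s\<bar> < 1")
    case True
    have w: "1 - s\<^sup>2 > 0" using True by (simp add: abs_square_less_1)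
    have "((\<lambda>s. s ^ a * inverse (1 - s\<^sup>2) ^ n * exp (- inverse (1 - s\<^sup>2))) has_real_derivative
     (real a * bump_term (a - 1) n s + (2 * real n * bump_term (a + 1) (n + 1) s +
       (- 2) * bump_term (a + 1) (n + 2) s))) (at s)"
    proof -
      define v where "v = (\<lambda>s::real. inverse (1 - s\<^sup>2))"
      have v': "(v has_real_derivative 2 * s * v s ^ 2) (at s)"
        unfolding v_def using w by (auto intro!: derivative_eq_intros simp: power2_eq_square field_simps)
      have "((\<lambda>s. s ^ a * v s ^ n * exp (- v s)) has_real_derivative
         (real a * s ^ (a - 1) * v s ^ n + s ^ a * (real n * v s ^ (n - 1) * (2 * s * v s ^ 2))) * exp (- v s)
          + s ^ a * v s ^ n * (exp (- v s) * (- (2 * s * v s ^ 2)))) (at s)"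
        by (auto intro!: derivative_eq_intros v')
      moreover have "real n * v s ^ (n - 1) * (2 * s * v s ^ 2) = 2 * real n * s * v s ^ (n + 1)"
        by (cases n) (simp_all add: power2_eq_square)
      ultimately have "((\<lambda>s. s ^ a * v s ^ n * exp (- v s)) has_real_derivative
         (real a * s ^ (a - 1) * v s ^ n + s ^ a * (2 * real n * s * v s ^ (n + 1))) * exp (- v s)
          + s ^ a * v s ^ n * (exp (- v s) * (- (2 * s * v s ^ 2)))) (at s)" by (simp only:)
      moreover have "bump_term b k s = s ^ b * v s ^ k * exp (- v s)" for b k
        using True by (simp add: bump_term_def v_def)
      then have "(real a * s ^ (a - 1) * v s ^ n + s ^ a * (2 * real n * s * v s ^ (n + 1))) * exp (- v s)
          + s ^ a * v s ^ n * (exp (- v s) * (- (2 * s * v s ^ 2))) = (real a * bump_term (a - 1) n s + (2 * real n * bump_term (a + 1) (n + 1) s +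
       (- 2) * bump_term (a + 1) (n + 2) s))"
        by (simp add: algebra_simps power2_eq_square)
      ultimately have "((\<lambda>s. s ^ a * v s ^ n * exp (- v s)) has_real_derivative
        (real a * bump_term (a - 1) n s + (2 * real n * bump_term (a + 1) (n + 1) s +
       (- 2) * bump_term (a + 1) (n + 2) s))) (at s)"
        by (simp only:)
      then show ?thesis unfolding v_def .
    qed
    moreover have "\<forall>\<^sub>F x in nhds s. bump_term a n x = x ^ a * inverse (1 - x\<^sup>2) ^ n * exp (- inverse (1 - x\<^sup>2))"
    proof -
      have "s \<in> {-1<..<1}" using True by auto
      then have "\<forall>\<^sub>F x in nhds s. x \<in> {-1<..<1}" by (intro eventually_nhds_in_open) auto
      then show ?thesis by (rule eventually_mono) (auto simp: bump_term_def)
    qed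
    ultimately show ?thesis by (subst DERIV_cong_ev[OF refl _ refl])
  next
    case F: False
    with False have "\<bar>s\<bar> > 1" by simp
    then have "s \<in> - {-1..1}" by auto
    then have "\<forall>\<^sub>F x in nhds s. x \<in> - {-1..1}" by (intro eventually_nhds_in_open) auto
    then have "\<forall>\<^sub>F x in nhds s. bump_term a n x = 0"
      by (rule eventually_mono) (auto simp: bump_term_def)
    moreover have "((\<lambda>x. 0) has_real_derivative 0) (at s)" by simp
    ultimately have "(bump_term a n has_real_derivative 0) (at s)"
      by (subst DERIV_cong_ev[OF refl _ refl])
    then show ?thesis using F by (simp add: bump_term_def)
  qed
qed

lemma bump_space_derivative:
  assumes "f \<in> bump_space"
  shows "\<exists>g\<in>bump_space. \<forall>s. (f has_real_derivative g s) (at s)"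
  using assms
proof induction
  case (bump_term c a n)
  let ?g = "\<lambda>s. (c * real a) * bump_term (a - 1) n s + ((c * 2 * real n) * bump_term (a + 1) (n + 1) s +
       (c * - 2) * bump_term (a + 1) (n + 2) s)"
  have "?g \<in> bump_space" by (intro bump_space.intros)
  moreover have "((\<lambda>s. c * bump_term a n s) has_real_derivative ?g s) (at s)" for s
    using DERIV_cmult[OF bump_term_derivative, of c a n s] by (simp add: algebra_simps)
  ultimately show ?case by (intro bexI[of _ ?g]) blast+
next
  case (add f g)
  then obtain f' g' where "f' \<in> bump_space" "g' \<in> bump_space"
    "\<forall>s. (f has_real_derivative f' s) (at s)" "\<forall>s. (g has_real_derivative g' s) (at s)" by blast
  then show ?case by (intro bexI[of _ "\<lambda>s. f' s + g' s"]) (auto intro: bump_space.intros DERIV_add)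
qed

lemma bump_space_support: "f \<in> bump_space \<Longrightarrow> \<bar>s\<bar> \<ge> 1 \<Longrightarrow> f s = 0"
  by (induction rule: bump_space.induct) (auto simp: bump_term_def)

lemma bump_sequence_exists:
  "\<exists>\<beta> :: nat \<Rightarrow> real \<Rightarrow> real. \<beta> 0 = bump_term 0 0 \<and> (\<forall>j. \<beta> j \<in> bump_space) \<and>
     (\<forall>j s. (\<beta> j has_real_derivative \<beta> (Suc j) s) (at s))"
proof -
  have 0: "bump_term 0 0 \<in> bump_space" using bump_space.bump_term[of 1 0 0] by simp
  obtain \<beta> where "\<forall>n. (\<beta> n \<in> bump_space \<and> (n = 0 \<longrightarrow> \<beta> n = bump_term 0 0)) \<and> (\<forall>s. (\<beta> n has_real_derivative \<beta> (Suc n) s) (at s))"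
    using dependent_nat_choice[of "\<lambda>n f. f \<in> bump_space \<and> (n = 0 \<longrightarrow> f = bump_term 0 0)" "\<lambda>n f g. \<forall>s. (f has_real_derivative g s) (at s)"]
      bump_space_derivative 0 by (metis nat.distinct(1))
  then show ?thesis by blast
qed

text \<open>
  \<open>bump j\<close> is the j-th derivative of the standard bump on \<open>[-1,1]\<close>, characterised by
  consecutive members being related by differentiation.
\<close>

definition bump :: "nat \<Rightarrow> real \<Rightarrow> real" where
  "bump = (SOME \<beta>. \<beta> 0 = bump_term 0 0 \<and> (\<forall>j. \<beta> j \<in> bump_space) \<and>
     (\<forall>j s. (\<beta> j has_real_derivative \<beta> (Suc j) s) (at s)))"

lemma bump_spec:
  "bump 0 = bump_term 0 0 \<and> (\<forall>j. bump j \<in> bump_space) \<and> (\<forall>j s. (bump j has_real_derivative bump (Suc j) s) (at s))"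
  unfolding bump_def by (rule someI_ex[OF bump_sequence_exists])

lemma bump_derivative: "(bump j has_real_derivative bump (Suc j) s) (at s)"
  using bump_spec by blast

lemma bump_outside: "\<bar>s\<bar> \<ge> 1 \<Longrightarrow> bump j s = 0"
  using bump_spec bump_space_support by blast

lemma bump_range: "0 \<le> bump 0 s" "bump 0 s \<le> 1"
proof -
  have "inverse (1 - s\<^sup>2) > 0" if "\<bar>s\<bar> < 1" using that by (simp add: abs_square_less_1)
  then show "0 \<le> bump 0 s" "bump 0 s \<le> 1"
    using bump_spec by (auto simp: bump_term_def)
qed

lemma bump_inner: "\<bar>s\<bar> \<le> 1/2 \<Longrightarrow> exp (- 4/3) \<le> bump 0 s"
proof -
  assume s: "\<bar>s\<bar> \<le> 1/2"
  then have "s\<^sup>2 \<le> (1/2)\<^sup>2" by (metis abs_le_square_iff abs_of_pos half_gt_zero_iff zero_less_one)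
  then have "inverse (1 - s\<^sup>2) \<le> inverse (3/4)" by (intro le_imp_inverse_le) (auto simp: power2_eq_square)
  then show ?thesis using s bump_spec by (simp add: bump_term_def)
qed

lemma bump_continuous: "continuous_on UNIV (bump j)"
  using bump_derivative by (meson DERIV_isCont continuous_at_imp_continuous_on)

lemma bump_bounded: "\<exists>C. \<forall>s. \<bar>bump j s\<bar> \<le> C"
proof -
  have "compact (bump j ` {-1..1})"
    by (intro compact_continuous_image continuous_on_subset[OF bump_continuous]) auto
  then obtain C where C: "\<forall>y\<in>bump j ` {-1..1}. norm y \<le> C" using compact_imp_bounded bounded_iff by blast
  have "\<bar>bump j s\<bar> \<le> max C 0" for s
    using C bump_outside[of s j] by (cases "\<bar>s\<bar> \<le> 1") (force simp: abs_le_iff)+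
  then show ?thesis by blast
qed

section \<open>Integration\<close>

lemma set_integrable_bounded:
  fixes f :: "'a::euclidean_space \<Rightarrow> real"
  assumes "A \<in> sets borel" "bounded A" "set_borel_measurable borel A f" "\<And>y. y \<in> A \<Longrightarrow> \<bar>f y\<bar> \<le> B"
  shows "set_integrable lborel A f"
  unfolding set_integrable_def
proof (rule Bochner_Integration.integrable_bound)
  show "integrable lborel (\<lambda>y. indicator A y * B)"
    using assms(1,2) emeasure_bounded_finite[OF assms(2)]
    by (intro integrable_mult_left integrable_real_indicator) auto
  show "(\<lambda>y. indicator A y *\<^sub>R f y) \<in> borel_measurable lborel"
    using assms(3) by (simp add: set_borel_measurable_def)
  show "AE y in lborel. norm (indicator A y *\<^sub>R f y) \<le> norm (indicator A y * B)"
    using assms(4) by (intro AE_I2) (force simp: indicator_def)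
qed

lemma continuous_bounded_on_bounded:
  fixes f :: "'a::euclidean_space \<Rightarrow> 'b::real_normed_vector"
  assumes "bounded A" "continuous_on UNIV f"
  obtains B where "B > 0" "\<And>y. y \<in> A \<Longrightarrow> norm (f y) \<le> B"
proof -
  have "compact (f ` closure A)" using assms
    by (intro compact_continuous_image) (auto intro: continuous_on_subset)
  then obtain B where "\<forall>y\<in>f ` closure A. norm y \<le> B" using compact_imp_bounded bounded_iff by blast
  then have "norm (f y) \<le> max B 1" if "y \<in> A" for y using that closure_subset by fastforce
  then show ?thesis using that[of "max B 1"] by auto
qed

lemma set_measurable_continuous_on_open:
  fixes f :: "'a::euclidean_space \<Rightarrow> 'b::euclidean_space"
  assumes "open A" "continuous_on A f"
  shows "set_borel_measurable borel A f"
  using assms borel_measurable_continuous_on_indicator[of A f] by (simp add: set_borel_measurable_def)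

lemma set_measurable_mult:
  fixes f g :: "'a \<Rightarrow> real"
  assumes "set_borel_measurable M A f" "set_borel_measurable M A g"
  shows "set_borel_measurable M A (\<lambda>y. f y * g y)"
proof -
  have "(\<lambda>y. indicator A y *\<^sub>R (f y * g y)) = (\<lambda>y. (indicator A y *\<^sub>R f y) * (indicator A y *\<^sub>R g y))"
    by (auto simp: indicator_def)
  then show ?thesis using assms unfolding set_borel_measurable_def by (simp only: borel_measurable_times)
qed

lemma set_measurable_add:
  fixes f g :: "'a \<Rightarrow> 'b::euclidean_space"
  assumes "set_borel_measurable M A f" "set_borel_measurable M A g"
  shows "set_borel_measurable M A (\<lambda>y. f y + g y)"
  using assms unfolding set_borel_measurable_def by (simp only: scaleR_add_right borel_measurable_add)

lemma set_measurable_UNIV: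
  fixes f :: "'a::euclidean_space \<Rightarrow> 'b::euclidean_space"
  assumes "A \<in> sets borel" "f \<in> borel_measurable borel"
  shows "set_borel_measurable borel A f"
  using assms unfolding set_borel_measurable_def by simp

lemma integral_translation_lborel:
  fixes F :: "'a::euclidean_space \<Rightarrow> real"
  assumes "F \<in> borel_measurable borel"
  shows "(\<integral>y. F (y + a) \<partial>lborel) = (\<integral>y. F y \<partial>lborel)"
proof -
  have "(\<integral>y. F y \<partial>lborel) = (\<integral>y. F y \<partial>distr lborel borel ((+) a))" by (simp add: lborel_distr_plus)
  also have "\<dots> = (\<integral>y. F (a + y) \<partial>lborel)" using assms by (intro integral_distr) auto
  finally show ?thesis by (simp add: add.commute)
qed

text \<open>
  The integral over S of a shifted function is unchanged if S is invariant under shifts in the direction v;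
  differentiating this in the shift gives integration by parts without boundary terms. S is a half space
  \<open>t > 0\<close> or the whole space in the applications.
\<close>

lemma integral_directional_derivative_eq_0:
  fixes f :: "'a::euclidean_space \<Rightarrow> real"
  assumes d: "\<And>y. (f has_derivative F y) (at y)"
    and c: "continuous_on UNIV (\<lambda>y. F y v)"
    and K: "compact K" "\<And>y. y \<notin> K \<Longrightarrow> f y = 0"
    and S: "S \<in> sets borel" "\<And>y h. y + h *\<^sub>R v \<in> S \<longleftrightarrow> y \<in> S"
  shows "set_lebesgue_integral lborel S (\<lambda>y. F y v) = 0"
proof -
  have F0: "F y v = 0" if "y \<notin> K" for y
  proof -
    have "open (- K)" using K(1) by (simp add: compact_imp_closed open_Compl)
    then have "(f has_derivative (\<lambda>_. 0)) (at y)"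
      using that K(2) by (intro has_derivative_transform_within_open[OF has_derivative_const, of "-K" y]) auto
    then show ?thesis using has_derivative_unique[OF d] by metis
  qed
  obtain R where R: "R > 0" "\<And>y. y \<in> K \<Longrightarrow> norm y \<le> R"
    using compact_imp_bounded[OF K(1)] by (meson bounded_pos)
  obtain C where C: "C > 0" "\<And>y. y \<in> cball 0 R \<Longrightarrow> norm (F y v) \<le> C"
    using continuous_bounded_on_bounded[OF _ c, of "cball 0 R"] by auto
  have C': "\<bar>F y v\<bar> \<le> C" for y
    using C R(2)[of y] F0[of y] by (cases "y \<in> K") auto
  define R' where "R' = R + norm v"
  have line: "((\<lambda>h. f (y + h *\<^sub>R v)) has_real_derivative F (y + s *\<^sub>R v) v) (at s)" for y s
  proof -
    have "((\<lambda>h. f (y + h *\<^sub>R v)) has_derivative (\<lambda>h. F (y + s *\<^sub>R v) (h *\<^sub>R v))) (at s)"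
      by (rule has_derivative_compose[OF _ d, of "\<lambda>h. y + h *\<^sub>R v"]) (auto intro!: derivative_eq_intros)
    moreover have "F (y + s *\<^sub>R v) (h *\<^sub>R v) = F (y + s *\<^sub>R v) v * h" for h
      using linear_cmul[OF has_derivative_linear[OF d]] by (simp add: mult.commute)
    ultimately show ?thesis by (simp add: has_field_derivative_def)
  qed
  define h where "h n = 1 / real (Suc n)" for n
  have h: "0 < h n" "h n \<le> 1" for n by (auto simp: h_def)
  have h0: "h \<longlonglongrightarrow> 0" unfolding h_def using LIMSEQ_inverse_real_of_nat by (simp add: inverse_eq_divide)
  have fm: "f \<in> borel_measurable borel"
    by (intro borel_measurable_continuous_onI continuous_at_imp_continuous_on ballI has_derivative_continuous[OF d])
  have Fm: "(\<lambda>y. F y v) \<in> borel_measurable borel" using c by (rule borel_measurable_continuous_onI)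
  let ?g = "\<lambda>n y. indicator S y * ((f (y + h n *\<^sub>R v) - f y) / h n)"
  have int: "integrable lborel (\<lambda>y. indicator S y * f y)"
  proof -
    obtain B where B: "\<And>y. y \<in> K \<Longrightarrow> norm (f y) \<le> B"
      using continuous_bounded_on_bounded[OF compact_imp_bounded[OF K(1)], of f] d
      by (metis continuous_at_imp_continuous_on has_derivative_continuous)
    have "set_integrable lborel (S \<inter> K) f"
      using B S(1) K(1) fm
      by (intro set_integrable_bounded[of _ _ B] set_measurable_UNIV sets.Int) (auto intro: bounded_subset compact_imp_bounded borel_compact)
    moreover have "indicator (S \<inter> K) y * f y = indicator S y * f y" for y using K(2) by (auto simp: indicator_def)
    ultimately show ?thesis by (simp add: set_integrable_def)
  qed
  have gint: "(\<integral>y. ?g n y \<partial>lborel) = 0" for n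
  proof -
    have m: "(\<lambda>y. indicator S y * f y) \<in> borel_measurable borel" using fm S(1) by measurable
    have int2: "integrable lborel (\<lambda>y. indicator S (y + h n *\<^sub>R v) * f (y + h n *\<^sub>R v))"
    proof -
      have "integrable (distr lborel borel ((+) (h n *\<^sub>R v))) (\<lambda>y. indicator S y * f y)"
        using int by (simp add: lborel_distr_plus)
      then show ?thesis by (subst (asm) integrable_distr_eq) (use m in \<open>auto simp: add.commute\<close>)
    qed
    have "(\<integral>y. ?g n y \<partial>lborel) = (\<integral>y. (indicator S (y + h n *\<^sub>R v) * f (y + h n *\<^sub>R v) - indicator S y * f y) / h n \<partial>lborel)"
      using S(2) by (intro Bochner_Integration.integral_cong) (auto simp: indicator_def diff_divide_distrib)
    also have "\<dots> = ((\<integral>y. indicator S (y + h n *\<^sub>R v) * f (y + h n *\<^sub>R v) \<partial>lborel) - (\<integral>y. indicator S y * f y \<partial>lborel)) / h n"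
      using int int2 by simp
    also have "\<dots> = 0" using integral_translation_lborel[OF m, of "h n *\<^sub>R v"] by simp
    finally show ?thesis .
  qed
  have "(\<lambda>n. \<integral>y. ?g n y \<partial>lborel) \<longlonglongrightarrow> (\<integral>y. indicator S y * F y v \<partial>lborel)"
  proof (rule integral_dominated_convergence)
    show "(\<lambda>y. indicator S y * F y v) \<in> borel_measurable lborel" using Fm S(1) by simp
    show "?g n \<in> borel_measurable lborel" for n using fm S(1) by simp
    show "integrable lborel (\<lambda>y. indicator (cball (0::'a) R') y * C)"
      using emeasure_bounded_finite[of "cball (0::'a) R'"]
      by (intro integrable_mult_left integrable_real_indicator) auto
    show "AE y in lborel. (\<lambda>n. ?g n y) \<longlonglongrightarrow> indicator S y * F y v"
    proof (intro AE_I2 tendsto_mult tendsto_const)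
      fix y
      have "((\<lambda>t. (f (y + t *\<^sub>R v) - f y) / t) \<longlongrightarrow> F y v) (at 0)"
        using line[of y 0] by (simp add: has_field_derivative_iff)
      moreover have "filterlim h (at 0) sequentially" using h0 h(1) by (simp add: filterlim_at less_imp_neq[symmetric] less_imp_le)
      ultimately show "(\<lambda>n. (f (y + h n *\<^sub>R v) - f y) / h n) \<longlonglongrightarrow> F y v"
        by (rule filterlim_compose)
    qed
    show "AE y in lborel. norm (?g n y) \<le> indicator (cball 0 R') y * C" for n
    proof (rule AE_I2)
      fix y
      show "norm (?g n y) \<le> indicator (cball 0 R') y * C"
      proof (cases "y \<in> cball 0 R'")
        case True
        obtain z where "0 < z" "z < h n" "f (y + h n *\<^sub>R v) - f (y + 0 *\<^sub>R v) = (h n - 0) * F (y + z *\<^sub>R v) v"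
          using MVT2[of 0 "h n" "\<lambda>s. f (y + s *\<^sub>R v)" "\<lambda>s. F (y + s *\<^sub>R v) v"] h(1)[of n] line by auto
        then have "(f (y + h n *\<^sub>R v) - f y) / h n = F (y + z *\<^sub>R v) v" using h(1)[of n] by simp
        then have "\<bar>(f (y + h n *\<^sub>R v) - f y) / h n\<bar> \<le> C" using C' by simp
        then show ?thesis using True C(1) by (simp add: indicator_def)
      next
        case False
        have "norm (h n *\<^sub>R v) \<le> norm v" using h[of n] by (simp add: mult_left_le_one_le)
        moreover have "norm y \<le> norm (y + h n *\<^sub>R v) + norm (h n *\<^sub>R v)" using norm_triangle_ineq4[of "y + h n *\<^sub>R v" "h n *\<^sub>R v"] by simp
        moreover have "norm y > R + norm v" using False by (simp add: R'_def)
        moreover have "0 \<le> norm v" by simp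
        ultimately have "norm y > R" "norm (y + h n *\<^sub>R v) > R" by linarith+
        then have "y \<notin> K" "y + h n *\<^sub>R v \<notin> K" using R(2)[of y] R(2)[of "y + h n *\<^sub>R v"] by linarith+
        then show ?thesis using K(2) False by (simp add: indicator_def)
      qed
    qed
  qed
  then have "(\<lambda>n. 0) \<longlonglongrightarrow> (\<integral>y. indicator S y * F y v \<partial>lborel)" by (simp only: gint)
  then have "(\<integral>y. indicator S y * F y v \<partial>lborel) = 0" by (simp add: LIMSEQ_const_iff)
  then show ?thesis by (simp add: set_lebesgue_integral_def)
qed

lemma set_integral_product_iterated:
  fixes f :: "real \<times> 'b::euclidean_space \<Rightarrow> real"
  assumes "set_integrable lborel (A \<times> B) f"
  shows "set_lebesgue_integral lborel (A \<times> B) f =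
    (LINT x:B|lborel. (LINT t:A|lborel. f (t, x)))"
    and "set_lebesgue_integral lborel (A \<times> B) f =
    (LINT t:A|lborel. (LINT x:B|lborel. f (t, x)))"
proof -
  let ?g = "\<lambda>(t, x). indicator (A \<times> B) (t, x) *\<^sub>R f (t, x)"
  have i: "integrable (lborel \<Otimes>\<^sub>M lborel) ?g"
    using assms by (simp add: set_integrable_def lborel_prod case_prod_beta')
  have "set_lebesgue_integral lborel (A \<times> B) f = integral\<^sup>L (lborel \<Otimes>\<^sub>M lborel) ?g"
    by (simp add: set_lebesgue_integral_def lborel_prod case_prod_beta')
  also have "\<dots> = (\<integral>x. (\<integral>t. indicator (A \<times> B) (t, x) *\<^sub>R f (t, x) \<partial>lborel) \<partial>lborel)"
    using i by (intro lborel_pair.integral_snd[where f = "\<lambda>t x. indicator (A \<times> B) (t, x) *\<^sub>R f (t, x)", symmetric])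
  also have "\<dots> = (LINT x:B|lborel. (LINT t:A|lborel. f (t, x)))"
    unfolding set_lebesgue_integral_def
    by (intro Bochner_Integration.integral_cong) (auto simp: indicator_def)
  finally show "set_lebesgue_integral lborel (A \<times> B) f =
    (LINT x:B|lborel. (LINT t:A|lborel. f (t, x)))" .
  have "set_lebesgue_integral lborel (A \<times> B) f = integral\<^sup>L (lborel \<Otimes>\<^sub>M lborel) ?g"
    by (simp add: set_lebesgue_integral_def lborel_prod case_prod_beta')
  also have "\<dots> = (\<integral>t. (\<integral>x. indicator (A \<times> B) (t, x) *\<^sub>R f (t, x) \<partial>lborel) \<partial>lborel)"
    using i by (intro lborel_pair.integral_fst[where f = "\<lambda>t x. indicator (A \<times> B) (t, x) *\<^sub>R f (t, x)", symmetric])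
  also have "\<dots> = (LINT t:A|lborel. (LINT x:B|lborel. f (t, x)))"
    unfolding set_lebesgue_integral_def
    by (intro Bochner_Integration.integral_cong) (auto simp: indicator_def)
  finally show "set_lebesgue_integral lborel (A \<times> B) f =
    (LINT t:A|lborel. (LINT x:B|lborel. f (t, x)))" .
qed

text \<open>
  Fubini and the fundamental theorem of calculus in time, with a weight that depends on the position only.
\<close>

lemma integral_time_derivative:
  fixes F Ft :: "real \<times> 'b::euclidean_space \<Rightarrow> real"
  assumes d: "\<And>t x. ((\<lambda>\<tau>. F (\<tau>, x)) has_real_derivative Ft (t, x)) (at t)"
    and c: "continuous_on UNIV Ft"
    and w: "set_borel_measurable borel \<Omega> w" "\<And>x. x \<in> \<Omega> \<Longrightarrow> \<bar>w x\<bar> \<le> W"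
    and \<Omega>: "\<Omega> \<in> sets borel" "bounded \<Omega>" and T: "0 < T"
  shows "(LINT y:{0<..<T} \<times> \<Omega>|lborel. w (snd y) * Ft y) =
    (LINT x:\<Omega>|lborel. w x * (F (T, x) - F (0, x)))"
proof -
  have b: "bounded ({0<..<T} \<times> \<Omega>)" using \<Omega> by (intro bounded_Times) auto
  obtain B where B: "\<And>y. y \<in> {0<..<T} \<times> \<Omega> \<Longrightarrow> norm (Ft y) \<le> B"
    using continuous_bounded_on_bounded[OF b c] by metis
  have wm: "set_borel_measurable borel ({0<..<T} \<times> \<Omega>) (\<lambda>y. w (snd y))"
  proof -
    have "(\<lambda>x. indicator \<Omega> x *\<^sub>R w x) \<in> borel_measurable borel" using w(1) by (simp add: set_borel_measurable_def)
    then have "(\<lambda>y::real\<times>'b. indicator {0<..<T} (fst y) * (indicator \<Omega> (snd y) *\<^sub>R w (snd y))) \<in> borel_measurable borel"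
      unfolding borel_prod[symmetric] by measurable
    moreover have "(\<lambda>y::real\<times>'b. indicator {0<..<T} (fst y) * (indicator \<Omega> (snd y) *\<^sub>R w (snd y))) =
      (\<lambda>y. indicator ({0<..<T} \<times> \<Omega>) y *\<^sub>R w (snd y))" by (auto simp: indicator_def)
    ultimately show ?thesis by (simp add: set_borel_measurable_def)
  qed
  have "set_integrable lborel ({0<..<T} \<times> \<Omega>) (\<lambda>y. w (snd y) * Ft y)"
  proof (rule set_integrable_bounded[of _ _ "\<bar>W\<bar> * \<bar>B\<bar>"])
    show "{0<..<T} \<times> \<Omega> \<in> sets borel" using \<Omega>(1) by (simp add: borel_prod[symmetric])
    then show "set_borel_measurable borel ({0<..<T} \<times> \<Omega>) (\<lambda>y. w (snd y) * Ft y)"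
      by (intro set_measurable_mult wm set_measurable_UNIV borel_measurable_continuous_onI[OF c])
    show "\<bar>w (snd y) * Ft y\<bar> \<le> \<bar>W\<bar> * \<bar>B\<bar>" if "y \<in> {0<..<T} \<times> \<Omega>" for y
      unfolding abs_mult using that w(2)[of "snd y"] B[OF that] by (intro mult_mono) auto
  qed (fact b)
  then have "(LINT y:{0<..<T} \<times> \<Omega>|lborel. w (snd y) * Ft y) =
    (LINT x:\<Omega>|lborel. (LINT t:{0<..<T}|lborel. w x * Ft (t, x)))"
    using set_integral_product_iterated(1)[of "{0<..<T}" \<Omega> "\<lambda>y. w (snd y) * Ft y"] by simp
  also have "\<dots> = (LINT x:\<Omega>|lborel. w x * (F (T, x) - F (0, x)))"
  proof -
    have "(LINT t:{0<..<T}|lborel. w x * Ft (t, x)) = w x * (F (T, x) - F (0, x))" for x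
    proof -
      have "continuous_on UNIV (\<lambda>t. Ft (t, x))"
        by (intro continuous_on_compose2[OF c] continuous_intros) auto
      then have cx: "isCont (\<lambda>t. Ft (t, x)) t" for t
        by (simp add: continuous_on_eq_continuous_at)
      have "(LINT t:{0<..<T}|lborel. Ft (t, x)) = (LINT t:{0..T}|lborel. Ft (t, x))"
        unfolding set_lebesgue_integral_def
      proof (rule integral_cong_AE)
        have "AE t in lborel. t \<noteq> 0 \<and> t \<noteq> T" by (intro AE_conjI AE_lborel_singleton)
        then show "AE t in lborel. indicator {0<..<T} t *\<^sub>R Ft (t, x) = indicator {0..T} t *\<^sub>R Ft (t, x)"
          by (rule AE_mp) (auto simp: indicator_def)
        have "continuous_on UNIV (\<lambda>t. Ft (t, x))" by (intro continuous_on_compose2[OF c] continuous_intros) auto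
        then have "(\<lambda>t. Ft (t, x)) \<in> borel_measurable borel" by (rule borel_measurable_continuous_onI)
        then show "(\<lambda>t. indicator {0<..<T} t *\<^sub>R Ft (t, x)) \<in> borel_measurable lborel"
          "(\<lambda>t. indicator {0..T} t *\<^sub>R Ft (t, x)) \<in> borel_measurable lborel" by auto
      qed
      also have "\<dots> = F (T, x) - F (0, x)"
        unfolding set_lebesgue_integral_def
        using integral_FTC_Icc_real[of 0 T "\<lambda>t. F (t, x)" "\<lambda>t. Ft (t, x)"] d cx T
        by (simp add: mult.commute)
      finally show ?thesis by (simp add: set_lebesgue_integral_def)
    qed
    then show ?thesis by (simp only:)
  qed
  finally show ?thesis .
qed

section \<open>Conservation laws in weak form\<close>

lemma C1_D:
  assumes "Ck_on 1 UNIV f"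
  shows "(f has_derivative frechet_derivative f (at y)) (at y)"
    and "continuous_on UNIV (\<lambda>y. frechet_derivative f (at y) v)"
    and "continuous_on UNIV f"
proof -
  from assms have d: "\<And>y. f differentiable (at y)" by (simp add: One_nat_def)
  then show "(f has_derivative frechet_derivative f (at y)) (at y)" by (simp add: frechet_derivative_works)
  from assms show "continuous_on UNIV (\<lambda>y. frechet_derivative f (at y) v)" by (simp add: One_nat_def)
  show "continuous_on UNIV f" using d by (simp add: continuous_at_imp_continuous_on differentiable_imp_continuous_within)
qed

lemma C1_I:
  assumes "\<And>y. (f has_derivative F y) (at y)" "\<And>v. continuous_on UNIV (\<lambda>y. F y v)"
  shows "Ck_on 1 UNIV f"
proof -
  have "frechet_derivative f (at y) = F y" for y using frechet_derivative_at[OF assms(1)] by simp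
  then show ?thesis using assms by (auto simp: One_nat_def differentiable_def)
qed

lemma C1_mult:
  fixes f g :: "'a::real_normed_vector \<Rightarrow> real"
  assumes "Ck_on 1 UNIV f" "Ck_on 1 UNIV g"
  shows "Ck_on 1 UNIV (\<lambda>y. f y * g y)"
    and "frechet_derivative (\<lambda>y. f y * g y) (at y) v = f y * frechet_derivative g (at y) v + frechet_derivative f (at y) v * g y"
proof -
  have d: "((\<lambda>y. f y * g y) has_derivative (\<lambda>v. f y * frechet_derivative g (at y) v + frechet_derivative f (at y) v * g y)) (at y)" for y
    using has_derivative_mult[OF C1_D(1)[OF assms(1), of y] C1_D(1)[OF assms(2), of y]] .
  then show "Ck_on 1 UNIV (\<lambda>y. f y * g y)"
    using C1_D(2,3)[OF assms(1)] C1_D(2,3)[OF assms(2)] by (intro C1_I[OF d] continuous_intros) auto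
  show "frechet_derivative (\<lambda>y. f y * g y) (at y) v = f y * frechet_derivative g (at y) v + frechet_derivative f (at y) v * g y"
    by (simp add: frechet_derivative_at[OF d, symmetric])
qed

lemma derivative_outside_support:
  assumes "(f has_derivative F) (at y)" "closed K" "\<And>y. y \<notin> K \<Longrightarrow> f y = 0" "y \<notin> K"
  shows "F v = 0"
proof -
  have "(f has_derivative (\<lambda>_. 0)) (at y)"
    using assms by (intro has_derivative_transform_within_open[OF has_derivative_const, of "-K" y]) auto
  then have "F = (\<lambda>_. 0)" using has_derivative_unique[OF assms(1)] by blast
  then show ?thesis by simp
qed

type_synonym spacetime = "real \<times> (real^2)"

definition pd :: "(spacetime \<Rightarrow> real) \<Rightarrow> spacetime \<Rightarrow> spacetime \<Rightarrow> real" where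
  "pd \<phi> v y = frechet_derivative \<phi> (at y) v"

definition tdir :: spacetime where "tdir = (1, 0)"
definition xdir :: "2 \<Rightarrow> spacetime" where "xdir i = (0, axis i 1)"

text \<open>
  The weak form of \<open>\<partial>\<^sub>t g0 + \<partial>\<^sub>1 g1 + \<partial>\<^sub>2 g2 = 0\<close> in
  \<open>(0,T) \<times> \<Omega>\<close> with initial value i, zero flux through the boundary of
  \<open>\<Omega>\<close> and zero final value: this is the effect of testing with all C1 functions on the plane
  and all times.
\<close>

definition balance :: "real \<Rightarrow> (real^2) set \<Rightarrow> (spacetime \<Rightarrow> real) \<Rightarrow> (spacetime \<Rightarrow> real) \<Rightarrow>
    (spacetime \<Rightarrow> real) \<Rightarrow> (real^2 \<Rightarrow> real) \<Rightarrow> bool" where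
  "balance T \<Omega> g0 g1 g2 i \<longleftrightarrow> (\<forall>\<phi>. Ck_on 1 UNIV \<phi> \<longrightarrow>
     (LINT y:{0<..<T} \<times> \<Omega>|lborel. g0 y * pd \<phi> tdir y + g1 y * pd \<phi> (xdir 1) y + g2 y * pd \<phi> (xdir 2) y) =
     - (LINT x:\<Omega>|lborel. i x * \<phi> (0, x)))"

lemma slab_borel: "open \<Omega> \<Longrightarrow> {0<..<T::real} \<times> (\<Omega> :: (real^2) set) \<in> sets borel"
  by (intro borel_open open_Times) auto

lemma slab_bounded: "bounded \<Omega> \<Longrightarrow> bounded ({0<..<T::real} \<times> (\<Omega> :: (real^2) set))"
  by (intro bounded_Times) auto

lemma set_integrable_continuous:
  fixes f :: "'a::euclidean_space \<Rightarrow> real"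
  assumes "A \<in> sets borel" "bounded A" "continuous_on UNIV f"
  shows "set_integrable lborel A f"
proof -
  obtain B where "\<And>y. y \<in> A \<Longrightarrow> norm (f y) \<le> B"
    using continuous_bounded_on_bounded[OF assms(2,3)] by metis
  then show ?thesis using assms
    by (intro set_integrable_bounded[of _ _ B] set_measurable_UNIV borel_measurable_continuous_onI) auto
qed

lemma time_derivative:
  assumes "Ck_on 1 UNIV \<phi>"
  shows "((\<lambda>\<tau>. \<phi> (\<tau>, x)) has_vector_derivative frechet_derivative \<phi> (at (t, x)) tdir) (at t)"
proof -
  have "((\<lambda>\<tau>. (\<tau>, x)) has_derivative (\<lambda>v. (v, 0))) (at t)" by (auto intro!: derivative_eq_intros)
  from has_derivative_compose[OF this C1_D(1)[OF assms]]
  have d: "((\<lambda>\<tau>. \<phi> (\<tau>, x)) has_derivative (\<lambda>v. frechet_derivative \<phi> (at (t, x)) (v, 0))) (at t)" .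
  have "frechet_derivative \<phi> (at (t, x)) (v, 0) = v *\<^sub>R frechet_derivative \<phi> (at (t, x)) tdir" for v
    using linear_scale[OF has_derivative_linear[OF C1_D(1)[OF assms]], of "(t, x)" v tdir] by (simp add: tdir_def)
  with d show ?thesis by (simp add: has_vector_derivative_def)
qed

lemma integral_div_compact_support:
  fixes g0 :: "spacetime \<Rightarrow> real"
  assumes \<Omega>: "open \<Omega>" "bounded \<Omega>" and T: "0 < T" and f: "Ck_on 1 UNIV f"
    and K: "compact K" "K \<subseteq> {-T<..<T} \<times> \<Omega>" "\<And>y. y \<notin> K \<Longrightarrow> f y = 0"
  shows "(LINT y:{0<..<T} \<times> \<Omega>|lborel. pd f (xdir i) y) = 0"
    and "(LINT y:{0<..<T} \<times> \<Omega>|lborel. pd f tdir y) = - (LINT x:\<Omega>|lborel. f (0, x))"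
proof -
  have S: "({0<..} :: real set) \<times> (UNIV :: (real^2) set) \<in> sets borel" by (intro borel_open open_Times) auto
  have "(LINT y:({0<..} \<times> UNIV)|lborel. frechet_derivative f (at y) (xdir i)) = 0"
    by (rule integral_directional_derivative_eq_0[OF C1_D(1)[OF f] C1_D(2)[OF f] K(1,3) S]) (auto simp: xdir_def)
  moreover have "indicator ({0<..} \<times> UNIV) y *\<^sub>R frechet_derivative f (at y) (xdir i) =
      indicator ({0<..<T} \<times> \<Omega>) y *\<^sub>R pd f (xdir i) y" for y
  proof (cases "y \<in> K")
    case True
    then have "y \<in> {-T<..<T} \<times> \<Omega>" using K(2) by blast
    then show ?thesis by (auto simp: indicator_def pd_def)
  next
    case False
    then show ?thesis using derivative_outside_support[OF C1_D(1)[OF f] compact_imp_closed[OF K(1)] K(3)]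
      by (auto simp: pd_def)
  qed
  ultimately show "(LINT y:{0<..<T} \<times> \<Omega>|lborel. pd f (xdir i) y) = 0"
    by (simp add: set_lebesgue_integral_def)
  have td: "((\<lambda>\<tau>. f (\<tau>, x)) has_real_derivative pd f tdir (t, x)) (at t)" for t x
    unfolding pd_def has_real_derivative_iff_has_vector_derivative by (rule time_derivative[OF f])
  have "(LINT y:{0<..<T} \<times> \<Omega>|lborel. 1 * pd f tdir y) = (LINT x:\<Omega>|lborel. 1 * (f (T, x) - f (0, x)))"
    using \<Omega> T C1_D(2)[OF f] by (intro integral_time_derivative[where W = 1 and w = "\<lambda>_. 1", OF td]) (auto simp: pd_def intro!: set_measurable_UNIV)
  also have "\<dots> = (LINT x:\<Omega>|lborel. - f (0, x))"
  proof -
    have "f (T, x) = 0" for x using K(2,3) by (auto intro!: K(3))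
    then show ?thesis by simp
  qed
  finally show "(LINT y:{0<..<T} \<times> \<Omega>|lborel. pd f tdir y) = - (LINT x:\<Omega>|lborel. f (0, x))"
    by (simp add: set_lebesgue_integral_def)
qed

text \<open>
  The flux has compact support in the doubled slab \<open>(-T,T) \<times> \<Omega>\<close>, so the only boundary
  contribution comes from \<open>t = 0\<close>, which may cut through the support.
\<close>

lemma balance_of_divergence_free:
  assumes \<Omega>: "open \<Omega>" "bounded \<Omega>" and T: "0 < T"
    and g: "Ck_on 1 UNIV g0" "Ck_on 1 UNIV g1" "Ck_on 1 UNIV g2"
    and K: "compact K" "K \<subseteq> {-T<..<T} \<times> \<Omega>" "\<And>y. y \<notin> K \<Longrightarrow> g0 y = 0 \<and> g1 y = 0 \<and> g2 y = 0"
    and div: "\<And>y. pd g0 tdir y + pd g1 (xdir 1) y + pd g2 (xdir 2) y = 0"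
  shows "balance T \<Omega> g0 g1 g2 (\<lambda>x. g0 (0, x))"
  unfolding balance_def
proof (intro allI impI)
  fix \<phi> :: "spacetime \<Rightarrow> real" assume \<phi>: "Ck_on 1 UNIV \<phi>"
  let ?R = "{0<..<T} \<times> \<Omega>"
  have int: "set_integrable lborel ?R (\<lambda>y. pd (\<lambda>y. g y * \<phi> y) v y)" if "Ck_on 1 UNIV g" for g v
    using C1_D(2)[OF C1_mult(1)[OF that \<phi>]] \<Omega>
    by (intro set_integrable_continuous slab_borel slab_bounded) (auto simp: pd_def)
  have "g0 y * pd \<phi> tdir y + g1 y * pd \<phi> (xdir 1) y + g2 y * pd \<phi> (xdir 2) y =
    pd (\<lambda>y. g0 y * \<phi> y) tdir y + pd (\<lambda>y. g1 y * \<phi> y) (xdir 1) y + pd (\<lambda>y. g2 y * \<phi> y) (xdir 2) y" for y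
  proof -
    have "(pd g0 tdir y + pd g1 (xdir 1) y + pd g2 (xdir 2) y) * \<phi> y = 0" by (simp add: div)
    then show ?thesis unfolding pd_def C1_mult(2)[OF g(1) \<phi>] C1_mult(2)[OF g(2) \<phi>] C1_mult(2)[OF g(3) \<phi>]
      by (simp add: algebra_simps)
  qed
  then have "(LINT y:?R|lborel. g0 y * pd \<phi> tdir y + g1 y * pd \<phi> (xdir 1) y + g2 y * pd \<phi> (xdir 2) y) =
    (LINT y:?R|lborel. pd (\<lambda>y. g0 y * \<phi> y) tdir y + pd (\<lambda>y. g1 y * \<phi> y) (xdir 1) y + pd (\<lambda>y. g2 y * \<phi> y) (xdir 2) y)"
    by (simp only:)
  also have "\<dots> = (LINT y:?R|lborel. pd (\<lambda>y. g0 y * \<phi> y) tdir y) + (LINT y:?R|lborel. pd (\<lambda>y. g1 y * \<phi> y) (xdir 1) y)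
     + (LINT y:?R|lborel. pd (\<lambda>y. g2 y * \<phi> y) (xdir 2) y)"
    using int[OF g(1)] int[OF g(2)] int[OF g(3)] by (simp add: set_integral_add)
  also have "(LINT y:?R|lborel. pd (\<lambda>y. g0 y * \<phi> y) tdir y) = - (LINT x:\<Omega>|lborel. g0 (0, x) * \<phi> (0, x))"
    using K by (intro integral_div_compact_support(2)[OF \<Omega> T C1_mult(1)[OF g(1) \<phi>] K(1,2)]) auto
  also have "(LINT y:?R|lborel. pd (\<lambda>y. g1 y * \<phi> y) (xdir 1) y) = 0"
    using K by (intro integral_div_compact_support(1)[OF \<Omega> T C1_mult(1)[OF g(2) \<phi>] K(1,2)]) auto
  also have "(LINT y:?R|lborel. pd (\<lambda>y. g2 y * \<phi> y) (xdir 2) y) = 0"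
    using K by (intro integral_div_compact_support(1)[OF \<Omega> T C1_mult(1)[OF g(3) \<phi>] K(1,2)]) auto
  finally show "(LINT y:?R|lborel. g0 y * pd \<phi> tdir y + g1 y * pd \<phi> (xdir 1) y + g2 y * pd \<phi> (xdir 2) y) =
     - (LINT x:\<Omega>|lborel. g0 (0, x) * \<phi> (0, x))" by simp
qed

text \<open>
  Boundedness together with measurability makes every pairing with a continuous function integrable on the
  bounded sets that occur, and the property is stable under products.
\<close>

definition bounded_measurable :: "'a::euclidean_space set \<Rightarrow> ('a \<Rightarrow> real) \<Rightarrow> bool" where
  "bounded_measurable A f \<longleftrightarrow> set_borel_measurable borel A f \<and> (\<exists>B. \<forall>y\<in>A. \<bar>f y\<bar> \<le> B)"

lemma bounded_measurable_continuous:
  assumes "A \<in> sets borel" "bounded A" "continuous_on UNIV f"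
  shows "bounded_measurable A f"
  unfolding bounded_measurable_def
  using continuous_bounded_on_bounded[OF assms(2,3)] assms
  by (metis borel_measurable_continuous_onI real_norm_def set_measurable_UNIV)

lemma bounded_measurable_mult:
  assumes "bounded_measurable A f" "bounded_measurable A g"
  shows "bounded_measurable A (\<lambda>y. f y * g y)"
proof -
  obtain B C where "\<forall>y\<in>A. \<bar>f y\<bar> \<le> B" "\<forall>y\<in>A. \<bar>g y\<bar> \<le> C"
    using assms unfolding bounded_measurable_def by blast
  then have "\<forall>y\<in>A. \<bar>f y * g y\<bar> \<le> \<bar>B\<bar> * \<bar>C\<bar>"
    unfolding abs_mult by (intro ballI mult_mono) force+
  then show ?thesis using assms set_measurable_mult unfolding bounded_measurable_def by blast
qed

lemma bounded_measurable_add: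
  assumes "bounded_measurable A f" "bounded_measurable A g"
  shows "bounded_measurable A (\<lambda>y. f y + g y)"
proof -
  obtain B C where "\<forall>y\<in>A. \<bar>f y\<bar> \<le> B" "\<forall>y\<in>A. \<bar>g y\<bar> \<le> C"
    using assms unfolding bounded_measurable_def by blast
  then have "\<forall>y\<in>A. \<bar>f y + g y\<bar> \<le> B + C" by (force intro: order_trans[OF abs_triangle_ineq] add_mono)
  then show ?thesis using assms set_measurable_add unfolding bounded_measurable_def by blast
qed

lemma bounded_measurable_integrable:
  assumes "A \<in> sets borel" "bounded A" "bounded_measurable A f"
  shows "set_integrable lborel A f"
  using assms set_integrable_bounded unfolding bounded_measurable_def by blast

lemma balance_integrable:
  assumes \<Omega>: "open \<Omega>" "bounded \<Omega>" and \<phi>: "Ck_on 1 UNIV \<phi>"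
    and g: "bounded_measurable ({0<..<T} \<times> \<Omega>) g0" "bounded_measurable ({0<..<T} \<times> \<Omega>) g1" "bounded_measurable ({0<..<T} \<times> \<Omega>) g2"
  shows "set_integrable lborel ({0<..<T} \<times> \<Omega>) (\<lambda>y. g0 y * pd \<phi> tdir y + g1 y * pd \<phi> (xdir 1) y + g2 y * pd \<phi> (xdir 2) y)"
proof -
  have "bounded_measurable ({0<..<T} \<times> \<Omega>) (pd \<phi> v)" for v
    using C1_D(2)[OF \<phi>] \<Omega> by (intro bounded_measurable_continuous slab_borel slab_bounded) (auto simp: pd_def)
  then show ?thesis using \<Omega> g
    by (intro bounded_measurable_integrable slab_borel slab_bounded bounded_measurable_add bounded_measurable_mult)
qed

lemma initial_integrable:
  assumes \<Omega>: "open \<Omega>" "bounded \<Omega>" and \<phi>: "continuous_on UNIV \<phi>" and i: "bounded_measurable \<Omega> i"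
  shows "set_integrable lborel \<Omega> (\<lambda>x. i x * \<phi> (0::real, x))"
proof -
  have "bounded_measurable \<Omega> (\<lambda>x. \<phi> (0, x))"
    using \<Omega> by (intro bounded_measurable_continuous continuous_on_compose2[OF \<phi>] continuous_intros) auto
  then show ?thesis using \<Omega> i by (intro bounded_measurable_integrable bounded_measurable_mult) auto
qed

lemma balance_add:
  assumes \<Omega>: "open \<Omega>" "bounded \<Omega>"
    and g: "bounded_measurable ({0<..<T} \<times> \<Omega>) g0" "bounded_measurable ({0<..<T} \<times> \<Omega>) g1" "bounded_measurable ({0<..<T} \<times> \<Omega>) g2" "bounded_measurable \<Omega> i"
    and h: "bounded_measurable ({0<..<T} \<times> \<Omega>) h0" "bounded_measurable ({0<..<T} \<times> \<Omega>) h1" "bounded_measurable ({0<..<T} \<times> \<Omega>) h2" "bounded_measurable \<Omega> j"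
    and b: "balance T \<Omega> g0 g1 g2 i" "balance T \<Omega> h0 h1 h2 j"
  shows "balance T \<Omega> (\<lambda>y. g0 y + h0 y) (\<lambda>y. g1 y + h1 y) (\<lambda>y. g2 y + h2 y) (\<lambda>x. i x + j x)"
  unfolding balance_def
proof (intro allI impI)
  fix \<phi> :: "spacetime \<Rightarrow> real" assume \<phi>: "Ck_on 1 UNIV \<phi>"
  let ?R = "{0<..<T} \<times> \<Omega>"
  have "(LINT y:?R|lborel. (g0 y + h0 y) * pd \<phi> tdir y + (g1 y + h1 y) * pd \<phi> (xdir 1) y + (g2 y + h2 y) * pd \<phi> (xdir 2) y)
    = (LINT y:?R|lborel. (g0 y * pd \<phi> tdir y + g1 y * pd \<phi> (xdir 1) y + g2 y * pd \<phi> (xdir 2) y) + (h0 y * pd \<phi> tdir y + h1 y * pd \<phi> (xdir 1) y + h2 y * pd \<phi> (xdir 2) y))"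
    by (simp add: algebra_simps)
  also have "\<dots> = - (LINT x:\<Omega>|lborel. i x * \<phi> (0, x)) + - (LINT x:\<Omega>|lborel. j x * \<phi> (0, x))"
    using b \<phi> balance_integrable[OF \<Omega> \<phi> g(1-3)] balance_integrable[OF \<Omega> \<phi> h(1-3)]
    by (subst set_integral_add) (auto simp: balance_def)
  also have "\<dots> = - (LINT x:\<Omega>|lborel. (i x + j x) * \<phi> (0, x))"
    using initial_integrable[OF \<Omega> C1_D(3)[OF \<phi>] g(4)] initial_integrable[OF \<Omega> C1_D(3)[OF \<phi>] h(4)]
    by (simp add: distrib_right set_integral_add)
  finally show "(LINT y:?R|lborel. (g0 y + h0 y) * pd \<phi> tdir y + (g1 y + h1 y) * pd \<phi> (xdir 1) y + (g2 y + h2 y) * pd \<phi> (xdir 2) y)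
    = - (LINT x:\<Omega>|lborel. (i x + j x) * \<phi> (0, x))" .
qed

lemma set_integral_dominated_limit:
  fixes f :: "nat \<Rightarrow> 'a::euclidean_space \<Rightarrow> real"
  assumes A: "A \<in> sets borel" "bounded A"
    and m: "\<And>n. set_borel_measurable borel A (f n)" "set_borel_measurable borel A g"
    and B: "\<And>n y. y \<in> A \<Longrightarrow> \<bar>f n y\<bar> \<le> B"
    and lim: "AE y in lborel. y \<in> A \<longrightarrow> (\<lambda>n. f n y) \<longlonglongrightarrow> g y"
  shows "(\<lambda>n. LINT y:A|lborel. f n y) \<longlonglongrightarrow> (LINT y:A|lborel. g y)"
  unfolding set_lebesgue_integral_def
proof (rule integral_dominated_convergence[where w = "\<lambda>y. indicator A y * B"])
  show "(\<lambda>y. indicator A y *\<^sub>R g y) \<in> borel_measurable lborel" "\<And>n. (\<lambda>y. indicator A y *\<^sub>R f n y) \<in> borel_measurable lborel"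
    using m by (auto simp: set_borel_measurable_def)
  show "integrable lborel (\<lambda>y. indicator A y * B)"
    using A emeasure_bounded_finite[OF A(2)] by (intro integrable_mult_left integrable_real_indicator) auto
  show "AE y in lborel. (\<lambda>n. indicator A y *\<^sub>R f n y) \<longlonglongrightarrow> indicator A y *\<^sub>R g y"
    using lim by (rule AE_mp) (auto simp: indicator_def)
  show "AE y in lborel. norm (indicator A y *\<^sub>R f n y) \<le> indicator A y * B" for n
    using B by (auto simp: indicator_def)
qed

text \<open>
  Bounded almost everywhere convergence passes to the limit in linear balances. The three fluxes are indexed by
  a natural number so that they are treated uniformly.
\<close>

lemma balance_limit:
  assumes \<Omega>: "open \<Omega>" "bounded \<Omega>"
    and g: "\<And>n k. set_borel_measurable borel ({0<..<T} \<times> \<Omega>) (g n k)" "\<And>n k y. y \<in> {0<..<T} \<times> \<Omega> \<Longrightarrow> \<bar>g n k y\<bar> \<le> B"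
    and G: "\<And>k. bounded_measurable ({0<..<T} \<times> \<Omega>) (G k)"
    and lim: "\<And>k. AE y in lborel. y \<in> {0<..<T} \<times> \<Omega> \<longrightarrow> (\<lambda>n. g n k y) \<longlonglongrightarrow> G k y"
    and i: "\<And>n. set_borel_measurable borel \<Omega> (i n)" "\<And>n x. x \<in> \<Omega> \<Longrightarrow> \<bar>i n x\<bar> \<le> B"
    and I: "bounded_measurable \<Omega> I"
    and limi: "AE x in lborel. x \<in> \<Omega> \<longrightarrow> (\<lambda>n. i n x) \<longlonglongrightarrow> I x"
    and b: "\<And>n. balance T \<Omega> (g n 0) (g n 1) (g n (2::nat)) (i n)"
  shows "balance T \<Omega> (G 0) (G 1) (G 2) I"
  unfolding balance_def
proof (intro allI impI)
  fix \<phi> :: "spacetime \<Rightarrow> real" assume \<phi>: "Ck_on 1 UNIV \<phi>"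
  let ?R = "{0<..<T} \<times> \<Omega>"
  let ?J = "\<lambda>g y. g 0 y * pd \<phi> tdir y + g 1 y * pd \<phi> (xdir 1) y + g (2::nat) y * pd \<phi> (xdir 2) y"
  have R: "?R \<in> sets borel" "bounded ?R" using \<Omega> slab_borel slab_bounded by auto
  have c: "continuous_on UNIV (pd \<phi> v)" for v using C1_D(2)[OF \<phi>] by (simp add: pd_def)
  obtain C0 C1 C2 where C: "C0 > 0" "C1 > 0" "C2 > 0" "\<And>y. y \<in> ?R \<Longrightarrow> norm (pd \<phi> tdir y) \<le> C0"
    "\<And>y. y \<in> ?R \<Longrightarrow> norm (pd \<phi> (xdir 1) y) \<le> C1" "\<And>y. y \<in> ?R \<Longrightarrow> norm (pd \<phi> (xdir 2) y) \<le> C2"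
    using continuous_bounded_on_bounded[OF R(2) c] by metis
  have pm: "set_borel_measurable borel ?R (pd \<phi> v)" for v
    using c R by (intro set_measurable_UNIV borel_measurable_continuous_onI)
  have "(\<lambda>n. LINT y:?R|lborel. ?J (g n) y) \<longlonglongrightarrow> (LINT y:?R|lborel. ?J G y)"
  proof (rule set_integral_dominated_limit[OF R, where B = "\<bar>B\<bar> * C0 + \<bar>B\<bar> * C1 + \<bar>B\<bar> * C2"])
    show "set_borel_measurable borel ?R (?J (g n))" for n
      by (intro set_measurable_add set_measurable_mult g pm)
    show "set_borel_measurable borel ?R (?J G)"
      using G by (intro set_measurable_add set_measurable_mult pm) (auto simp: bounded_measurable_def)
    show "\<bar>?J (g n) y\<bar> \<le> \<bar>B\<bar> * C0 + \<bar>B\<bar> * C1 + \<bar>B\<bar> * C2" if y: "y \<in> ?R" for n y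
    proof -
      have *: "\<bar>g n k y * p\<bar> \<le> \<bar>B\<bar> * C" if "\<bar>p\<bar> \<le> C" for k p C
        unfolding abs_mult using g(2)[OF y, of n k] that by (intro mult_mono) auto
      show ?thesis using C(4-6)[OF y]
        by (intro order_trans[OF abs_triangle_ineq] add_mono order_trans[OF abs_triangle_ineq] add_mono *) auto
    qed
    show "AE y in lborel. y \<in> ?R \<longrightarrow> (\<lambda>n. ?J (g n) y) \<longlonglongrightarrow> ?J G y"
      using lim[of 0] lim[of 1] lim[of 2] by eventually_elim (auto intro!: tendsto_intros)
  qed
  moreover have "(LINT y:?R|lborel. ?J (g n) y) = - (LINT x:\<Omega>|lborel. i n x * \<phi> (0, x))" for n
    using b[of n] \<phi> unfolding balance_def by blast
  ultimately have "(\<lambda>n. - (LINT x:\<Omega>|lborel. i n x * \<phi> (0, x))) \<longlonglongrightarrow> (LINT y:?R|lborel. ?J G y)"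
    by (simp only:)
  moreover have "(\<lambda>n. - (LINT x:\<Omega>|lborel. i n x * \<phi> (0, x))) \<longlonglongrightarrow> - (LINT x:\<Omega>|lborel. I x * \<phi> (0, x))"
  proof (rule tendsto_minus)
    have c0: "continuous_on UNIV (\<lambda>x. \<phi> (0, x))" by (intro continuous_on_compose2[OF C1_D(3)[OF \<phi>]] continuous_intros) auto
    obtain D where D: "D > 0" "\<And>x. x \<in> \<Omega> \<Longrightarrow> norm (\<phi> (0, x)) \<le> D"
      using continuous_bounded_on_bounded[OF \<Omega>(2) c0] by metis
    have pm0: "set_borel_measurable borel \<Omega> (\<lambda>x. \<phi> (0, x))"
      using c0 \<Omega> by (intro set_measurable_UNIV borel_measurable_continuous_onI) auto
    show "(\<lambda>n. LINT x:\<Omega>|lborel. i n x * \<phi> (0, x)) \<longlonglongrightarrow> (LINT x:\<Omega>|lborel. I x * \<phi> (0, x))"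
    proof (rule set_integral_dominated_limit[where B = "\<bar>B\<bar> * D"])
      show "\<Omega> \<in> sets borel" "bounded \<Omega>" using \<Omega> by auto
      show "set_borel_measurable borel \<Omega> (\<lambda>x. i n x * \<phi> (0, x))" for n by (intro set_measurable_mult i pm0)
      show "set_borel_measurable borel \<Omega> (\<lambda>x. I x * \<phi> (0, x))"
        using I by (intro set_measurable_mult pm0) (auto simp: bounded_measurable_def)
      show "\<bar>i n x * \<phi> (0, x)\<bar> \<le> \<bar>B\<bar> * D" if "x \<in> \<Omega>" for n x
        unfolding abs_mult using i(2)[OF that, of n] D(2)[OF that] by (intro mult_mono) auto
      show "AE x in lborel. x \<in> \<Omega> \<longrightarrow> (\<lambda>n. i n x * \<phi> (0, x)) \<longlonglongrightarrow> I x * \<phi> (0, x)"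
        using limi by eventually_elim (auto intro!: tendsto_intros)
    qed
  qed
  ultimately show "(LINT y:?R|lborel. G 0 y * pd \<phi> tdir y + G 1 y * pd \<phi> (xdir 1) y + G 2 y * pd \<phi> (xdir 2) y) = - (LINT x:\<Omega>|lborel. I x * \<phi> (0, x))"
    by (rule LIMSEQ_unique)
qed

section \<open>Localized plane waves\<close>

text \<open>
  A state \<open>(m, u)\<close> encodes the velocity \<open>(Re m, Im m)\<close> and the symmetric traceless
  matrix with rows \<open>(Re u, Im u)\<close> and \<open>(Im u, - Re u)\<close>.
\<close>

type_synonym state = "complex \<times> complex"

text \<open>
  With \<open>b(s) = bump 0 ((s - c) / r)\<close>, the k-th derivative of
  \<open>b(s) exp (i N \<omega> s)\<close> is \<open>N\<^sup>k a\<^sub>k(s) exp (i N \<omega> s)\<close>;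
  \<open>osc N \<omega> c r k j\<close> is the j-th derivative of the amplitude \<open>a\<^sub>k\<close>, and
  \<open>wave\<close> is the rescaled k-th derivative. The scaling keeps all of them bounded as N grows.
\<close>

fun osc :: "real \<Rightarrow> real \<Rightarrow> real \<Rightarrow> real \<Rightarrow> nat \<Rightarrow> nat \<Rightarrow> real \<Rightarrow> complex" where
  "osc N \<omega> c r 0 j s = of_real (bump j ((s - c) / r) / r ^ j)"
| "osc N \<omega> c r (Suc k) j s = osc N \<omega> c r k (Suc j) s / of_real N + \<i> * of_real \<omega> * osc N \<omega> c r k j s"

definition wave :: "real \<Rightarrow> real \<Rightarrow> real \<Rightarrow> real \<Rightarrow> nat \<Rightarrow> real \<Rightarrow> complex" where
  "wave N \<omega> c r k s = osc N \<omega> c r k 0 s * cis (N * \<omega> * s)"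

lemma osc_derivative:
  assumes "r \<noteq> 0"
  shows "(osc N \<omega> c r k j has_vector_derivative osc N \<omega> c r k (Suc j) s) (at s)"
proof (induction k arbitrary: j)
  case 0
  have "((\<lambda>s. bump j ((s - c) / r) / r ^ j) has_real_derivative bump (Suc j) ((s - c) / r) / r ^ Suc j) (at s)"
  proof -
    have "((\<lambda>s. (s - c) / r) has_real_derivative 1 / r) (at s)"
      using DERIV_cdivide[OF DERIV_diff[OF DERIV_ident DERIV_const]] by simp
    from DERIV_cdivide[OF DERIV_chain2[OF bump_derivative this], of j "r ^ j"] show ?thesis
      by (simp add: mult.commute)
  qed
  then show ?case unfolding osc.simps has_vector_derivative_complex_iff by simp
next
  case (Suc k)
  have "((\<lambda>s. osc N \<omega> c r k (Suc j) s * inverse (of_real N) + \<i> * of_real \<omega> * osc N \<omega> c r k j s) has_vector_derivative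
      osc N \<omega> c r k (Suc (Suc j)) s * inverse (of_real N) + \<i> * of_real \<omega> * osc N \<omega> c r k (Suc j) s) (at s)"
    by (intro has_vector_derivative_add has_vector_derivative_mult_left has_vector_derivative_mult_right Suc)
  then show ?case by (simp add: divide_inverse)
qed

lemma wave_derivative:
  assumes "r \<noteq> 0" "N \<noteq> 0"
  shows "(wave N \<omega> c r k has_vector_derivative of_real N * wave N \<omega> c r (Suc k) s) (at s)"
proof -
  have "((\<lambda>s. cis (N * \<omega> * s)) has_vector_derivative (N * \<omega>) *\<^sub>R (\<i> * cis (N * \<omega> * s))) (at s)"
    by (auto intro!: derivative_eq_intros simp: has_vector_derivative_def)
  then have "((\<lambda>s. osc N \<omega> c r k 0 s * cis (N * \<omega> * s)) has_vector_derivative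
     osc N \<omega> c r k 0 s * ((N * \<omega>) *\<^sub>R (\<i> * cis (N * \<omega> * s))) + osc N \<omega> c r k (Suc 0) s * cis (N * \<omega> * s)) (at s)"
    by (intro has_vector_derivative_mult osc_derivative assms)
  moreover have "osc N \<omega> c r k 0 s * ((N * \<omega>) *\<^sub>R (\<i> * cis (N * \<omega> * s))) + osc N \<omega> c r k (Suc 0) s * cis (N * \<omega> * s)
     = of_real N * wave N \<omega> c r (Suc k) s"
    using assms(2) by (simp add: wave_def scaleR_conv_of_real field_simps)
  ultimately show ?thesis unfolding wave_def[abs_def] by simp
qed

lemma osc_outside:
  assumes "0 < r" "r \<le> \<bar>s - c\<bar>"
  shows "osc N \<omega> c r k j s = 0"
proof (induction k arbitrary: j)
  case 0
  have "\<bar>(s - c) / r\<bar> \<ge> 1" using assms by simp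
  then show ?case by (simp add: bump_outside)
qed auto

lemma osc_bounded:
  assumes "0 < r"
  shows "\<exists>C\<ge>0. \<forall>N\<ge>1. \<forall>s. norm (osc N \<omega> c r k j s) \<le> C"
proof (induction k arbitrary: j)
  case 0
  obtain C where C: "\<And>s. \<bar>bump j s\<bar> \<le> C" using bump_bounded by blast
  have "norm (osc N \<omega> c r 0 j s) \<le> C / r ^ j" for N s
    using C[of "(s - c) / r"] assms by (simp add: norm_divide norm_power divide_right_mono)
  moreover have "C / r ^ j \<ge> 0" using C[of 0] assms by simp
  ultimately show ?case by blast
next
  case (Suc k)
  obtain C D where C: "C \<ge> 0" "\<forall>N\<ge>1. \<forall>s. norm (osc N \<omega> c r k (Suc j) s) \<le> C"
    and D: "D \<ge> 0" "\<forall>N\<ge>1. \<forall>s. norm (osc N \<omega> c r k j s) \<le> D" using Suc by metis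
  have "norm (osc N \<omega> c r (Suc k) j s) \<le> C + \<bar>\<omega>\<bar> * D" if "N \<ge> 1" for N s
  proof -
    have "norm (osc N \<omega> c r k (Suc j) s / of_real N) \<le> C / 1"
      unfolding norm_divide using C that by (intro frac_le) auto
    moreover have "norm (\<i> * of_real \<omega> * osc N \<omega> c r k j s) \<le> \<bar>\<omega>\<bar> * D"
      using D that by (simp add: norm_mult mult_left_mono)
    ultimately show ?thesis by (auto intro: order_trans[OF norm_triangle_ineq])
  qed
  then show ?case using C(1) D(1) by (intro exI[of _ "C + \<bar>\<omega>\<bar> * D"]) auto
qed

text \<open>
  A derivative that hits the cutoff rather than the exponential loses a factor N.
\<close>

lemma osc_main:
  assumes "0 < r"
  shows "\<exists>C\<ge>0. \<forall>N\<ge>1. \<forall>s. norm (osc N \<omega> c r k 0 s - (\<i> * of_real \<omega>) ^ k * of_real (bump 0 ((s - c) / r))) \<le> C / N"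
proof (induction k)
  case 0
  show ?case by (intro exI[of _ 0]) auto
next
  case (Suc k)
  obtain C where C: "C \<ge> 0" "\<forall>N\<ge>1. \<forall>s. norm (osc N \<omega> c r k 0 s - (\<i> * of_real \<omega>) ^ k * of_real (bump 0 ((s - c) / r))) \<le> C / N"
    using Suc by blast
  obtain D where D: "D \<ge> 0" "\<forall>N\<ge>1. \<forall>s. norm (osc N \<omega> c r k 1 s) \<le> D" using osc_bounded[OF assms] by blast
  have "norm (osc N \<omega> c r (Suc k) 0 s - (\<i> * of_real \<omega>) ^ Suc k * of_real (bump 0 ((s - c) / r))) \<le> (D + \<bar>\<omega>\<bar> * C) / N" if "N \<ge> 1" for N s
  proof -
    have "osc N \<omega> c r (Suc k) 0 s - (\<i> * of_real \<omega>) ^ Suc k * of_real (bump 0 ((s - c) / r)) =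
      osc N \<omega> c r k 1 s / of_real N + (\<i> * of_real \<omega>) * (osc N \<omega> c r k 0 s - (\<i> * of_real \<omega>) ^ k * of_real (bump 0 ((s - c) / r)))"
      by (simp add: algebra_simps)
    also have "norm \<dots> \<le> D / N + \<bar>\<omega>\<bar> * (C / N)"
    proof (intro order_trans[OF norm_triangle_ineq] add_mono)
      show "norm (osc N \<omega> c r k 1 s / of_real N) \<le> D / N"
        unfolding norm_divide using D that by (intro frac_le) auto
      show "norm (\<i> * complex_of_real \<omega> * (osc N \<omega> c r k 0 s - (\<i> * of_real \<omega>) ^ k * of_real (bump 0 ((s - c) / r)))) \<le> \<bar>\<omega>\<bar> * (C / N)"
        unfolding norm_mult using C that by (intro mult_mono) auto
    qed
    finally show ?thesis by (simp add: add_divide_distrib)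
  qed
  then show ?case using C(1) D(1) by (intro exI[of _ "D + \<bar>\<omega>\<bar> * C"]) auto
qed

definition cutoff :: "spacetime \<Rightarrow> real \<Rightarrow> spacetime \<Rightarrow> real" where
  "cutoff y0 r y = bump 0 ((fst y - fst y0) / r) * bump 0 ((snd y $ 1 - snd y0 $ 1) / r) * bump 0 ((snd y $ 2 - snd y0 $ 2) / r)"

text \<open>
  The derivative \<open>\<partial>\<^sub>t\<^sup>k \<partial>\<^sub>1\<^sup>l \<partial>\<^sub>2\<^sup>m\<close>
  of \<open>Re (i cutoff(y) exp (i N \<omega> \<bullet> y))\<close>, divided by
  \<open>N\<^sup>k\<^sup>+\<^sup>l\<^sup>+\<^sup>m\<close>. The factor i turns third derivatives into cosines.
\<close>

definition potential :: "real \<Rightarrow> spacetime \<Rightarrow> spacetime \<Rightarrow> real \<Rightarrow> nat \<Rightarrow> nat \<Rightarrow> nat \<Rightarrow> spacetime \<Rightarrow> real" where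
  "potential N \<omega> y0 r k l m y = Re (\<i> * (wave N (fst \<omega>) (fst y0) r k (fst y) *
     wave N (snd \<omega> $ 1) (snd y0 $ 1) r l (snd y $ 1) * wave N (snd \<omega> $ 2) (snd y0 $ 2) r m (snd y $ 2)))"

lemma inner_spacetime: "(\<omega> :: spacetime) \<bullet> y = fst \<omega> * fst y + snd \<omega> $ 1 * snd y $ 1 + snd \<omega> $ 2 * snd y $ 2"
  by (simp add: inner_prod_def inner_vec_def sum_2)

lemma wave_compose_derivative:
  assumes "r \<noteq> 0" "N \<noteq> 0" "bounded_linear L"
  shows "((\<lambda>y. wave N \<omega> c r k (L y)) has_derivative (\<lambda>v. of_real (L v) * (of_real N * wave N \<omega> c r (Suc k) (L y)))) (at y)"
  using has_derivative_compose[OF bounded_linear_imp_has_derivative[OF assms(3)] wave_derivative[OF assms(1,2), unfolded has_vector_derivative_def]]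
  by (simp add: scaleR_conv_of_real)

lemma bounded_linear_coordinates:
  "bounded_linear (fst :: spacetime \<Rightarrow> real)" "bounded_linear (\<lambda>y::spacetime. snd y $ i)"
  by (auto intro: bounded_linear_fst bounded_linear_compose[OF bounded_linear_vec_nth bounded_linear_snd, unfolded o_def])

lemma potential_derivative:
  assumes "0 < r" "0 < N"
  shows "(potential N \<omega> y0 r k l m has_derivative (\<lambda>v. N * (fst v * potential N \<omega> y0 r (Suc k) l m y +
     snd v $ 1 * potential N \<omega> y0 r k (Suc l) m y + snd v $ 2 * potential N \<omega> y0 r k l (Suc m) y))) (at y)"
proof -
  let ?A = "\<lambda>k y. wave N (fst \<omega>) (fst y0) r k (fst y)" and ?B = "\<lambda>l y. wave N (snd \<omega> $ 1) (snd y0 $ 1) r l (snd y $ 1)"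
    and ?C = "\<lambda>m y. wave N (snd \<omega> $ 2) (snd y0 $ 2) r m (snd y $ 2)"
  have nz: "r \<noteq> 0" "N \<noteq> 0" using assms by auto
  note A = wave_compose_derivative[OF nz bounded_linear_coordinates(1)]
    and B = wave_compose_derivative[OF nz bounded_linear_coordinates(2)]
  have "((\<lambda>y. Re (\<i> * (?A k y * ?B l y * ?C m y))) has_derivative
     (\<lambda>v. Re (\<i> * (?A k y * ?B l y * (of_real (snd v $ 2) * (of_real N * ?C (Suc m) y)) +
       (?A k y * (of_real (snd v $ 1) * (of_real N * ?B (Suc l) y)) + of_real (fst v) * (of_real N * ?A (Suc k) y) * ?B l y) * ?C m y)))) (at y)"
    by (intro has_derivative_Re has_derivative_mult_right has_derivative_mult A B)
  moreover have "Re (\<i> * (?A k y * ?B l y * (of_real (snd v $ 2) * (of_real N * ?C (Suc m) y)) +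
       (?A k y * (of_real (snd v $ 1) * (of_real N * ?B (Suc l) y)) + of_real (fst v) * (of_real N * ?A (Suc k) y) * ?B l y) * ?C m y)) =
     N * (fst v * potential N \<omega> y0 r (Suc k) l m y +
     snd v $ 1 * potential N \<omega> y0 r k (Suc l) m y + snd v $ 2 * potential N \<omega> y0 r k l (Suc m) y)" for v :: spacetime
  proof -
    have *: "Re (\<i> * (a * b * (of_real v2 * (of_real N * c')) + (a * (of_real v1 * (of_real N * b')) + of_real v0 * (of_real N * a') * b) * c))
      = N * (v0 * Re (\<i> * (a' * b * c)) + v1 * Re (\<i> * (a * b' * c)) + v2 * Re (\<i> * (a * b * c')))"
      for a b c a' b' c' and v0 v1 v2 :: real
      by (simp add: algebra_simps)
    show ?thesis unfolding potential_def by (rule *)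
  qed
  ultimately show ?thesis unfolding potential_def[abs_def] by simp
qed

lemma potential_continuous:
  assumes "0 < r" "0 < N"
  shows "continuous_on UNIV (potential N \<omega> y0 r k l m)"
  by (intro continuous_at_imp_continuous_on ballI has_derivative_continuous[OF potential_derivative[OF assms]])

lemma potential_C1:
  assumes "0 < r" "0 < N"
  shows "Ck_on 1 UNIV (potential N \<omega> y0 r k l m)"
  by (intro C1_I[OF potential_derivative[OF assms]] continuous_intros potential_continuous assms)

lemma potential_pd:
  assumes "0 < r" "0 < N"
  shows "pd (potential N \<omega> y0 r k l m) tdir y = N * potential N \<omega> y0 r (Suc k) l m y"
    "pd (potential N \<omega> y0 r k l m) (xdir 1) y = N * potential N \<omega> y0 r k (Suc l) m y"
    "pd (potential N \<omega> y0 r k l m) (xdir 2) y = N * potential N \<omega> y0 r k l (Suc m) y"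
  by (simp_all add: pd_def frechet_derivative_at[OF potential_derivative[OF assms], symmetric] tdir_def xdir_def axis_def)

definition cube :: "spacetime \<Rightarrow> real \<Rightarrow> spacetime set" where
  "cube y0 r = {y. \<bar>fst y - fst y0\<bar> \<le> r \<and> \<bar>snd y $ 1 - snd y0 $ 1\<bar> \<le> r \<and> \<bar>snd y $ 2 - snd y0 $ 2\<bar> \<le> r}"

lemma cube_subset_cball: "0 \<le> r \<Longrightarrow> cube y0 r \<subseteq> cball y0 (2 * r)"
proof
  fix y assume y: "y \<in> cube y0 r" and r: "0 \<le> r"
  have "(norm (y - y0))\<^sup>2 = (fst y - fst y0)\<^sup>2 + (snd y $ 1 - snd y0 $ 1)\<^sup>2 + (snd y $ 2 - snd y0 $ 2)\<^sup>2"
    unfolding power2_norm_eq_inner inner_spacetime by (simp add: power2_eq_square)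
  also have "\<dots> \<le> r\<^sup>2 + r\<^sup>2 + r\<^sup>2"
    using y r unfolding cube_def by (intro add_mono) (auto simp: abs_le_square_iff[symmetric])
  also have "\<dots> \<le> (2 * r)\<^sup>2" by (simp add: power2_eq_square)
  finally have "norm (y - y0) \<le> 2 * r" by (rule power2_le_imp_le) (use r in simp)
  then show "y \<in> cball y0 (2 * r)" by (simp add: dist_norm norm_minus_commute)
qed

lemma compact_cube: "compact (cube y0 r)"
proof -
  have "closed (cube y0 r)" unfolding cube_def
    by (intro closed_Collect_conj closed_Collect_le continuous_intros)
  moreover have "bounded (cube y0 r)"
  proof (cases "0 \<le> r")
    case True show ?thesis by (rule bounded_subset[OF bounded_cball cube_subset_cball[OF True]])
  next
    case False
    then have "cube y0 r = {}" by (auto simp: cube_def)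
    then show ?thesis by simp
  qed
  ultimately show ?thesis by (simp add: compact_eq_bounded_closed)
qed

lemma potential_outside: "0 < r \<Longrightarrow> y \<notin> cube y0 r \<Longrightarrow> potential N \<omega> y0 r k l m y = 0"
  by (auto simp: cube_def potential_def wave_def osc_outside)

lemma cutoff_outside: "0 < r \<Longrightarrow> y \<notin> cube y0 r \<Longrightarrow> cutoff y0 r y = 0"
proof -
  assume r: "0 < r" and y: "y \<notin> cube y0 r"
  have "r < \<bar>a - b\<bar> \<Longrightarrow> bump 0 ((a - b) / r) = 0" for a b using r by (intro bump_outside) simp
  then show ?thesis using y by (auto simp: cube_def cutoff_def)
qed

lemma cutoff_range: "0 \<le> cutoff y0 r y" "cutoff y0 r y \<le> 1"
  unfolding cutoff_def using bump_range by (auto intro!: mult_le_one mult_nonneg_nonneg)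

lemma cutoff_continuous: "r \<noteq> 0 \<Longrightarrow> continuous_on UNIV (cutoff y0 r)"
  unfolding cutoff_def[abs_def] by (intro continuous_intros continuous_on_compose2[OF bump_continuous]) auto

lemma cutoff_inner: "0 < r \<Longrightarrow> y \<in> cube y0 (r / 2) \<Longrightarrow> exp (- 4/3) ^ 3 \<le> cutoff y0 r y"
proof -
  assume r: "0 < r" and y: "y \<in> cube y0 (r / 2)"
  have *: "\<bar>a - b\<bar> \<le> r / 2 \<Longrightarrow> exp (- 4/3) \<le> bump 0 ((a - b) / r)" for a b
    using r by (intro bump_inner) (simp add: field_simps)
  have "exp (- 4/3) * exp (- 4/3) * exp (- 4/3) \<le> cutoff y0 r y"
    unfolding cutoff_def using y bump_range(1) by (intro mult_mono * mult_nonneg_nonneg) (auto simp: cube_def)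
  then show ?thesis by (simp add: power3_eq_cube)
qed

lemma potential_main:
  assumes "0 < r" "k + l + m = 3"
  shows "\<exists>C\<ge>0. \<forall>N\<ge>1. \<forall>y. \<bar>potential N \<omega> y0 r k l m y -
     fst \<omega> ^ k * (snd \<omega> $ 1) ^ l * (snd \<omega> $ 2) ^ m * cutoff y0 r y * cos (N * (\<omega> \<bullet> y))\<bar> \<le> C / N"
proof -
  let ?A = "\<lambda>N y. osc N (fst \<omega>) (fst y0) r k 0 (fst y)" and ?a = "\<lambda>y. (\<i> * of_real (fst \<omega>)) ^ k * of_real (bump 0 ((fst y - fst y0) / r))"
  let ?B = "\<lambda>N y. osc N (snd \<omega> $ 1) (snd y0 $ 1) r l 0 (snd y $ 1)" and ?b = "\<lambda>y. (\<i> * of_real (snd \<omega> $ 1)) ^ l * of_real (bump 0 ((snd y $ 1 - snd y0 $ 1) / r))"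
  let ?C = "\<lambda>N y. osc N (snd \<omega> $ 2) (snd y0 $ 2) r m 0 (snd y $ 2)" and ?c = "\<lambda>y. (\<i> * of_real (snd \<omega> $ 2)) ^ m * of_real (bump 0 ((snd y $ 2 - snd y0 $ 2) / r))"
  obtain A' where A': "A' \<ge> 0" "\<forall>N\<ge>1. \<forall>s. norm (osc N (fst \<omega>) (fst y0) r k 0 s - (\<i> * of_real (fst \<omega>)) ^ k * of_real (bump 0 ((s - fst y0) / r))) \<le> A' / N" using osc_main[OF assms(1)] by blast
  obtain B' where B': "B' \<ge> 0" "\<forall>N\<ge>1. \<forall>s. norm (osc N (snd \<omega> $ 1) (snd y0 $ 1) r l 0 s - (\<i> * of_real (snd \<omega> $ 1)) ^ l * of_real (bump 0 ((s - snd y0 $ 1) / r))) \<le> B' / N" using osc_main[OF assms(1)] by blast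
  obtain C' where C': "C' \<ge> 0" "\<forall>N\<ge>1. \<forall>s. norm (osc N (snd \<omega> $ 2) (snd y0 $ 2) r m 0 s - (\<i> * of_real (snd \<omega> $ 2)) ^ m * of_real (bump 0 ((s - snd y0 $ 2) / r))) \<le> C' / N" using osc_main[OF assms(1)] by blast
  obtain B2 where B2: "B2 \<ge> 0" "\<forall>N\<ge>1. \<forall>s. norm (osc N (snd \<omega> $ 1) (snd y0 $ 1) r l 0 s) \<le> B2" using osc_bounded[OF assms(1)] by blast
  obtain C2 where C2: "C2 \<ge> 0" "\<forall>N\<ge>1. \<forall>s. norm (osc N (snd \<omega> $ 2) (snd y0 $ 2) r m 0 s) \<le> C2" using osc_bounded[OF assms(1)] by blast
  let ?D = "A' * B2 * C2 + \<bar>fst \<omega>\<bar> ^ k * B' * C2 + \<bar>fst \<omega>\<bar> ^ k * \<bar>snd \<omega> $ 1\<bar> ^ l * C'"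
  have "\<bar>potential N \<omega> y0 r k l m y - fst \<omega> ^ k * (snd \<omega> $ 1) ^ l * (snd \<omega> $ 2) ^ m * cutoff y0 r y * cos (N * (\<omega> \<bullet> y))\<bar> \<le> ?D / N"
    if N: "N \<ge> 1" for N y
  proof -
    let ?e = "cis (N * (\<omega> \<bullet> y))"
    have e: "cis (N * fst \<omega> * fst y) * cis (N * snd \<omega> $ 1 * snd y $ 1) * cis (N * snd \<omega> $ 2 * snd y $ 2) = ?e"
      by (simp add: cis_mult inner_spacetime algebra_simps)
    have pot: "potential N \<omega> y0 r k l m y = Re (\<i> * (?A N y * ?B N y * ?C N y) * ?e)"
      unfolding potential_def wave_def e[symmetric] by (simp only: ac_simps)
    have i3: "\<i> ^ k * \<i> ^ l * \<i> ^ m = - \<i>" unfolding power_add[symmetric] assms(2) by (simp add: power3_eq_cube)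
    have "?a y * ?b y * ?c y = (\<i> ^ k * \<i> ^ l * \<i> ^ m) * of_real (fst \<omega> ^ k * (snd \<omega> $ 1) ^ l * (snd \<omega> $ 2) ^ m * cutoff y0 r y)"
      by (simp add: power_mult_distrib cutoff_def)
    then have "Re (\<i> * (?a y * ?b y * ?c y) * ?e) = Re (of_real (fst \<omega> ^ k * (snd \<omega> $ 1) ^ l * (snd \<omega> $ 2) ^ m * cutoff y0 r y) * ?e)"
      unfolding i3 by simp
    then have mn: "fst \<omega> ^ k * (snd \<omega> $ 1) ^ l * (snd \<omega> $ 2) ^ m * cutoff y0 r y * cos (N * (\<omega> \<bullet> y)) = Re (\<i> * (?a y * ?b y * ?c y) * ?e)"
      by simp
    have "\<bar>potential N \<omega> y0 r k l m y - fst \<omega> ^ k * (snd \<omega> $ 1) ^ l * (snd \<omega> $ 2) ^ m * cutoff y0 r y * cos (N * (\<omega> \<bullet> y))\<bar>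
      = \<bar>Re (\<i> * (?A N y * ?B N y * ?C N y - ?a y * ?b y * ?c y) * ?e)\<bar>"
      unfolding pot mn by (simp only: left_diff_distrib right_diff_distrib minus_complex.simps)
    also have "\<dots> \<le> norm (\<i> * (?A N y * ?B N y * ?C N y - ?a y * ?b y * ?c y) * ?e)" by (rule abs_Re_le_cmod)
    also have "\<dots> = norm (?A N y * ?B N y * ?C N y - ?a y * ?b y * ?c y)" by (simp add: norm_mult)
    also have "?A N y * ?B N y * ?C N y - ?a y * ?b y * ?c y =
      (?A N y - ?a y) * ?B N y * ?C N y + ?a y * (?B N y - ?b y) * ?C N y + ?a y * ?b y * (?C N y - ?c y)"
      by (simp only: left_diff_distrib right_diff_distrib) simp
    also have "norm \<dots> \<le> (A' / N) * B2 * C2 + \<bar>fst \<omega>\<bar> ^ k * (B' / N) * C2 + \<bar>fst \<omega>\<bar> ^ k * \<bar>snd \<omega> $ 1\<bar> ^ l * (C' / N)"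
    proof -
      have na: "norm (?a y) \<le> \<bar>fst \<omega>\<bar> ^ k" and nb: "norm (?b y) \<le> \<bar>snd \<omega> $ 1\<bar> ^ l"
        using bump_range by (auto simp: norm_mult norm_power intro!: mult_right_le_one_le)
      have "norm ((?A N y - ?a y) * ?B N y * ?C N y) \<le> (A' / N) * B2 * C2"
        unfolding norm_mult using A' B2 C2 N by (intro mult_mono) auto
      moreover have "norm (?a y * (?B N y - ?b y) * ?C N y) \<le> \<bar>fst \<omega>\<bar> ^ k * (B' / N) * C2"
        unfolding norm_mult[of _ "?C N y"] norm_mult[of "?a y" "?B N y - ?b y"] using na B' C2 N by (intro mult_mono) auto
      moreover have "norm (?a y * ?b y * (?C N y - ?c y)) \<le> \<bar>fst \<omega>\<bar> ^ k * \<bar>snd \<omega> $ 1\<bar> ^ l * (C' / N)"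
        unfolding norm_mult[of _ "?C N y - ?c y"] norm_mult[of "?a y" "?b y"] using na nb C' N by (intro mult_mono) auto
      ultimately show ?thesis by (intro order_trans[OF norm_triangle_ineq] add_mono order_trans[OF norm_triangle_ineq] add_mono)
    qed
    finally show ?thesis by (simp add: add_divide_distrib)
  qed
  then show ?thesis using A' B' C' B2 C2 by (intro exI[of _ ?D]) auto
qed

section \<open>Subsolutions and perturbations\<close>

lemma C1_lincomb:
  fixes f g :: "spacetime \<Rightarrow> real"
  assumes "Ck_on 1 UNIV f" "Ck_on 1 UNIV g"
  shows "Ck_on 1 UNIV (\<lambda>y. a * f y + b * g y)"
    and "pd (\<lambda>y. a * f y + b * g y) v y = a * pd f v y + b * pd g v y"
proof -
  have d: "((\<lambda>y. a * f y + b * g y) has_derivative (\<lambda>v. a * frechet_derivative f (at y) v + b * frechet_derivative g (at y) v)) (at y)" for y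
    by (intro has_derivative_add has_derivative_mult_right C1_D(1) assms)
  then show "Ck_on 1 UNIV (\<lambda>y. a * f y + b * g y)"
    using C1_D(2,3)[OF assms(1)] C1_D(2,3)[OF assms(2)] by (intro C1_I[OF d] continuous_intros) auto
  show "pd (\<lambda>y. a * f y + b * g y) v y = a * pd f v y + b * pd g v y"
    unfolding pd_def by (simp add: frechet_derivative_at[OF d, symmetric])
qed

text \<open>
  The linear system \<open>div v = 0\<close>, \<open>\<partial>\<^sub>t v + div U = 0\<close> in the complex
  encoding of v and U.
\<close>

definition weak_euler :: "real \<Rightarrow> (real^2) set \<Rightarrow> (spacetime \<Rightarrow> state) \<Rightarrow> (real^2 \<Rightarrow> complex) \<Rightarrow> bool" where
  "weak_euler T \<Omega> z i \<longleftrightarrow>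
     balance T \<Omega> (\<lambda>_. 0) (\<lambda>y. Re (fst (z y))) (\<lambda>y. Im (fst (z y))) (\<lambda>_. 0) \<and>
     balance T \<Omega> (\<lambda>y. Re (fst (z y))) (\<lambda>y. Re (snd (z y))) (\<lambda>y. Im (snd (z y))) (\<lambda>x. Re (i x)) \<and>
     balance T \<Omega> (\<lambda>y. Im (fst (z y))) (\<lambda>y. Im (snd (z y))) (\<lambda>y. - Re (snd (z y))) (\<lambda>x. Im (i x))"

text \<open>
  Solutions of the linear system with compact support in D, carrying their own initial trace. D may reach below
  \<open>t = 0\<close>: this is how initial values get modified.
\<close>

definition perturbation :: "real \<Rightarrow> (real^2) set \<Rightarrow> spacetime set \<Rightarrow> (spacetime \<Rightarrow> state) \<Rightarrow> bool" where
  "perturbation T \<Omega> D p \<longleftrightarrow> continuous_on UNIV p \<and>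
     (\<exists>K. compact K \<and> K \<subseteq> D \<and> (\<forall>y. y \<notin> K \<longrightarrow> p y = 0)) \<and> weak_euler T \<Omega> p (\<lambda>x. fst (p (0, x)))"

lemma bounded_measurable_minus: "bounded_measurable A f \<Longrightarrow> bounded_measurable A (\<lambda>y. - f y)"
  using bounded_measurable_mult[of A "\<lambda>_. -1" f]
  by (auto simp: bounded_measurable_def set_borel_measurable_def)

lemma bounded_measurable_Re_Im:
  assumes "set_borel_measurable borel A f" "\<And>y. y \<in> A \<Longrightarrow> norm (f y) \<le> B"
  shows "bounded_measurable A (\<lambda>y. Re (f y))" "bounded_measurable A (\<lambda>y. Im (f y))"
proof -
  have "(\<lambda>y. indicator A y *\<^sub>R f y) \<in> borel_measurable borel" using assms(1) by (simp add: set_borel_measurable_def)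
  then have "(\<lambda>y. Re (indicator A y *\<^sub>R f y)) \<in> borel_measurable borel" "(\<lambda>y. Im (indicator A y *\<^sub>R f y)) \<in> borel_measurable borel"
    by (rule measurable_compose; intro borel_measurable_continuous_onI continuous_intros)+
  then show "bounded_measurable A (\<lambda>y. Re (f y))" "bounded_measurable A (\<lambda>y. Im (f y))"
    using assms(2) unfolding bounded_measurable_def set_borel_measurable_def
    by (auto intro: order_trans[OF abs_Re_le_cmod] order_trans[OF abs_Im_le_cmod])
qed

definition bounded_field :: "spacetime set \<Rightarrow> (spacetime \<Rightarrow> state) \<Rightarrow> bool" where
  "bounded_field A z \<longleftrightarrow> set_borel_measurable borel A z \<and> (\<exists>B. \<forall>y\<in>A. norm (z y) \<le> B)"

lemma bounded_field_components:
  assumes "bounded_field A z"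
  shows "bounded_measurable A (\<lambda>y. Re (fst (z y)))" "bounded_measurable A (\<lambda>y. Im (fst (z y)))"
    "bounded_measurable A (\<lambda>y. Re (snd (z y)))" "bounded_measurable A (\<lambda>y. Im (snd (z y)))"
proof -
  obtain B where B: "\<And>y. y \<in> A \<Longrightarrow> norm (z y) \<le> B" using assms unfolding bounded_field_def by blast
  have m: "(\<lambda>y. indicator A y *\<^sub>R z y) \<in> borel_measurable borel" using assms by (simp add: bounded_field_def set_borel_measurable_def)
  then have "(\<lambda>y. fst (indicator A y *\<^sub>R z y)) \<in> borel_measurable borel" "(\<lambda>y. snd (indicator A y *\<^sub>R z y)) \<in> borel_measurable borel"
    by (rule measurable_compose; intro borel_measurable_continuous_onI continuous_intros)+
  then have "set_borel_measurable borel A (\<lambda>y. fst (z y))" "set_borel_measurable borel A (\<lambda>y. snd (z y))"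
    by (simp_all add: set_borel_measurable_def)
  moreover have "norm (fst (z y)) \<le> B" "norm (snd (z y)) \<le> B" if "y \<in> A" for y
    using B[OF that] norm_fst_le[of "fst (z y)" "snd (z y)"] norm_snd_le[of "snd (z y)" "fst (z y)"] by auto
  ultimately show "bounded_measurable A (\<lambda>y. Re (fst (z y)))" "bounded_measurable A (\<lambda>y. Im (fst (z y)))"
    "bounded_measurable A (\<lambda>y. Re (snd (z y)))" "bounded_measurable A (\<lambda>y. Im (snd (z y)))"
    using bounded_measurable_Re_Im[of A "\<lambda>y. fst (z y)" B] bounded_measurable_Re_Im[of A "\<lambda>y. snd (z y)" B] by blast+
qed

lemma bounded_field_continuous:
  assumes "A \<in> sets borel" "bounded A" "continuous_on UNIV z"
  shows "bounded_field A z"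
  unfolding bounded_field_def
  using continuous_bounded_on_bounded[OF assms(2,3)] assms
  by (metis borel_measurable_continuous_onI set_measurable_UNIV)

lemma weak_euler_add_perturbation:
  assumes \<Omega>: "open \<Omega>" "bounded \<Omega>"
    and z: "bounded_field ({0<..<T} \<times> \<Omega>) z" "weak_euler T \<Omega> z i"
    and i: "bounded_measurable \<Omega> (\<lambda>x. Re (i x))" "bounded_measurable \<Omega> (\<lambda>x. Im (i x))"
    and p: "perturbation T \<Omega> D p"
  shows "weak_euler T \<Omega> (\<lambda>y. z y + p y) (\<lambda>x. i x + fst (p (0, x)))"
proof -
  have R: "{0<..<T} \<times> \<Omega> \<in> sets borel" "bounded ({0<..<T} \<times> \<Omega>)" using \<Omega> slab_borel slab_bounded by auto
  have pc: "continuous_on UNIV p" using p by (simp add: perturbation_def)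
  note zb = bounded_field_components[OF z(1)]
  note pb = bounded_field_components[OF bounded_field_continuous[OF R pc]]
  have p0: "continuous_on UNIV (\<lambda>x. fst (p (0, x)))" by (intro continuous_on_fst continuous_on_compose2[OF pc] continuous_intros) auto
  have ib: "bounded_measurable \<Omega> (\<lambda>x. Re (fst (p (0, x))))" "bounded_measurable \<Omega> (\<lambda>x. Im (fst (p (0, x))))"
    using \<Omega> p0 by (auto intro!: bounded_measurable_continuous continuous_intros)
  have zero: "bounded_measurable A (\<lambda>_. 0)" for A :: "'c::euclidean_space set"
    by (auto simp: bounded_measurable_def set_borel_measurable_def)
  have "weak_euler T \<Omega> p (\<lambda>x. fst (p (0, x)))" using p by (simp add: perturbation_def)
  then show ?thesis using z(2) unfolding weak_euler_def
    using balance_add[OF \<Omega> zero zb(1,2) zero zero pb(1,2) zero]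
      balance_add[OF \<Omega> zb(1,3,4) i(1) pb(1,3,4) ib(1)]
      balance_add[OF \<Omega> zb(2,4) bounded_measurable_minus[OF zb(3)] i(2) pb(2,4) bounded_measurable_minus[OF pb(3)] ib(2)]
    by simp
qed

lemma perturbation_0: "perturbation T \<Omega> D (\<lambda>_. 0)"
  by (auto simp: perturbation_def weak_euler_def balance_def set_lebesgue_integral_def intro!: exI[of _ "{}"])

lemma perturbation_add:
  assumes \<Omega>: "open \<Omega>" "bounded \<Omega>" and p: "perturbation T \<Omega> D p" "perturbation T \<Omega> D q"
  shows "perturbation T \<Omega> D (\<lambda>y. p y + q y)"
proof -
  have R: "{0<..<T} \<times> \<Omega> \<in> sets borel" "bounded ({0<..<T} \<times> \<Omega>)" using \<Omega> slab_borel slab_bounded by auto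
  have pc: "continuous_on UNIV p" "continuous_on UNIV q" using p by (simp_all add: perturbation_def)
  have p0: "continuous_on UNIV (\<lambda>x. fst (p (0, x)))" by (intro continuous_on_fst continuous_on_compose2[OF pc(1)] continuous_intros) auto
  have "weak_euler T \<Omega> (\<lambda>y. p y + q y) (\<lambda>x. fst (p (0, x)) + fst (q (0, x)))"
    using p(1) \<Omega> p0 by (intro weak_euler_add_perturbation[OF \<Omega> bounded_field_continuous[OF R pc(1)] _ _ _ p(2)])
      (auto simp: perturbation_def intro!: bounded_measurable_continuous continuous_intros)
  moreover obtain K L where "compact K" "K \<subseteq> D" "\<forall>y. y \<notin> K \<longrightarrow> p y = 0" "compact L" "L \<subseteq> D" "\<forall>y. y \<notin> L \<longrightarrow> q y = 0"
    using p unfolding perturbation_def by blast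
  then have "compact (K \<union> L) \<and> K \<union> L \<subseteq> D \<and> (\<forall>y. y \<notin> K \<union> L \<longrightarrow> p y + q y = 0)" by auto
  moreover have "continuous_on UNIV (\<lambda>y. p y + q y)" using pc by (intro continuous_intros)
  ultimately show ?thesis unfolding perturbation_def by (simp only: fst_add) blast
qed

lemma perturbation_sum:
  assumes "open \<Omega>" "bounded \<Omega>" "finite I" "\<And>i. i \<in> I \<Longrightarrow> perturbation T \<Omega> D (p i)"
  shows "perturbation T \<Omega> D (\<lambda>y. \<Sum>i\<in>I. p i y)"
  using assms(3,4) by (induction I rule: finite_induct) (auto intro: perturbation_0 perturbation_add[OF assms(1,2)])

lemma perturbation_scale:
  assumes "perturbation T \<Omega> D p"
  shows "perturbation T \<Omega> D (\<lambda>y. a *\<^sub>R p y)"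
proof -
  have b: "balance T \<Omega> (\<lambda>y. a * g0 y) (\<lambda>y. a * g1 y) (\<lambda>y. a * g2 y) (\<lambda>x. a * i x)" if "balance T \<Omega> g0 g1 g2 i" for g0 g1 g2 i
  proof -
    have e: "a * g0 y * A + a * g1 y * B + a * g2 y * C = a * (g0 y * A + g1 y * B + g2 y * C)" for y A B C by (simp add: algebra_simps)
    show ?thesis unfolding balance_def e set_integral_mult_right mult.assoc[of a "i _"]
      using that unfolding balance_def by simp
  qed
  have "weak_euler T \<Omega> p (\<lambda>x. fst (p (0, x)))" using assms by (simp add: perturbation_def)
  then have "weak_euler T \<Omega> (\<lambda>y. a *\<^sub>R p y) (\<lambda>x. fst (a *\<^sub>R p (0, x)))"
    unfolding weak_euler_def using b[of "\<lambda>_. 0" _ _ "\<lambda>_. 0"] b[of "\<lambda>y. Re (fst (p y))"] b[of "\<lambda>y. Im (fst (p y))" _ "\<lambda>y. - Re (snd (p y))"] by simp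
  moreover have "continuous_on UNIV (\<lambda>y. a *\<^sub>R p y)" using assms by (auto simp: perturbation_def intro!: continuous_intros)
  moreover have "\<exists>K. compact K \<and> K \<subseteq> D \<and> (\<forall>y. y \<notin> K \<longrightarrow> a *\<^sub>R p y = 0)"
  proof -
    obtain K where "compact K" "K \<subseteq> D" "\<forall>y. y \<notin> K \<longrightarrow> p y = 0" using assms unfolding perturbation_def by blast
    then show ?thesis by (intro exI[of _ K]) simp
  qed
  ultimately show ?thesis unfolding perturbation_def by blast
qed

lemma perturbation_mono: "perturbation T \<Omega> D p \<Longrightarrow> D \<subseteq> D' \<Longrightarrow> perturbation T \<Omega> D' p"
  unfolding perturbation_def by blast

text \<open>
  With \<open>\<psi>\<close> the potential,
  \<open>v = (- \<partial>\<^sub>2 \<Delta>\<psi>, \<partial>\<^sub>1 \<Delta>\<psi>)\<close> is divergence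
  free, and
  \<open>u = (2 \<partial>\<^sub>t \<partial>\<^sub>1 \<partial>\<^sub>2 \<psi>, \<partial>\<^sub>t (\<partial>\<^sub>2\<^sup>2 - \<partial>\<^sub>1\<^sup>2) \<psi>)\<close>
  satisfies \<open>\<partial>\<^sub>t v + div U = 0\<close> identically.
\<close>

definition packet :: "real \<Rightarrow> spacetime \<Rightarrow> spacetime \<Rightarrow> real \<Rightarrow> real \<Rightarrow> spacetime \<Rightarrow> state" where
  "packet N \<omega> y0 r s y = (let X = (\<lambda>k l m. potential N \<omega> y0 r k l m y) in
     (Complex ((- s) * X 0 2 1 + (- s) * X 0 0 3) (s * X 0 3 0 + s * X 0 1 2),
      Complex (s * X 1 1 1 + s * X 1 1 1) (s * X 1 0 2 + (- s) * X 1 2 0)))"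

lemma packet_perturbation:
  assumes \<Omega>: "open \<Omega>" "bounded \<Omega>" and T: "0 < T" and r: "0 < r" and N: "0 < N"
    and D: "cube y0 r \<subseteq> D" "D \<subseteq> {-T<..<T} \<times> \<Omega>"
  shows "perturbation T \<Omega> D (packet N \<omega> y0 r s)"
proof -
  let ?X = "potential N \<omega> y0 r"
  note P = potential_C1[OF r N]
  have out: "y \<notin> cube y0 r \<Longrightarrow> ?X k l m y = 0" for k l m y using potential_outside[OF r] .
  have K: "cube y0 r \<subseteq> {-T<..<T} \<times> \<Omega>" using D by blast
  have C0: "Ck_on 1 UNIV (\<lambda>_::spacetime. 0::real)" by (intro C1_I[of _ "\<lambda>_ _. 0"]) auto
  have pd0: "pd (\<lambda>_. 0) v y = 0" for v y by (simp add: pd_def)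
  note B = balance_of_divergence_free[OF \<Omega> T _ _ _ compact_cube K]
  have "balance T \<Omega> (\<lambda>_. 0) (\<lambda>y. (- s) * ?X 0 2 1 y + (- s) * ?X 0 0 3 y) (\<lambda>y. s * ?X 0 3 0 y + s * ?X 0 1 2 y) (\<lambda>x. (\<lambda>_. 0) (0::real, x))"
    by (rule B) (intro C1_lincomb P C0, intro C1_lincomb P C0, intro C1_lincomb P C0, simp add: out,
        simp only: C1_lincomb(2)[OF P P] pd0 potential_pd[OF r N], simp add: numeral_eq_Suc algebra_simps)
  moreover have "balance T \<Omega> (\<lambda>y. (- s) * ?X 0 2 1 y + (- s) * ?X 0 0 3 y) (\<lambda>y. s * ?X 1 1 1 y + s * ?X 1 1 1 y)
     (\<lambda>y. s * ?X 1 0 2 y + (- s) * ?X 1 2 0 y) (\<lambda>x. (\<lambda>y. (- s) * ?X 0 2 1 y + (- s) * ?X 0 0 3 y) (0, x))"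
    by (rule B) (intro C1_lincomb P C0, intro C1_lincomb P C0, intro C1_lincomb P C0, simp add: out,
        simp only: C1_lincomb(2)[OF P P] pd0 potential_pd[OF r N], simp add: numeral_eq_Suc algebra_simps)
  moreover have "balance T \<Omega> (\<lambda>y. s * ?X 0 3 0 y + s * ?X 0 1 2 y) (\<lambda>y. s * ?X 1 0 2 y + (- s) * ?X 1 2 0 y)
     (\<lambda>y. (- s) * ?X 1 1 1 y + (- s) * ?X 1 1 1 y) (\<lambda>x. (\<lambda>y. s * ?X 0 3 0 y + s * ?X 0 1 2 y) (0, x))"
    by (rule B) (intro C1_lincomb P C0, intro C1_lincomb P C0, intro C1_lincomb P C0, simp add: out,
        simp only: C1_lincomb(2)[OF P P] pd0 potential_pd[OF r N], simp add: numeral_eq_Suc algebra_simps)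
  ultimately have "weak_euler T \<Omega> (packet N \<omega> y0 r s) (\<lambda>x. fst (packet N \<omega> y0 r s (0, x)))"
    by (simp add: weak_euler_def packet_def Let_def)
  moreover have "continuous_on UNIV (packet N \<omega> y0 r s)"
    unfolding packet_def[abs_def] Let_def Complex_eq by (intro continuous_intros potential_continuous r N)
  moreover have "y \<notin> cube y0 r \<Longrightarrow> packet N \<omega> y0 r s y = 0" for y by (simp add: packet_def out Let_def zero_prod_def complex_eq_iff)
  ultimately show ?thesis unfolding perturbation_def using compact_cube D(1) by blast
qed

lemma packet_outside: "0 < r \<Longrightarrow> y \<notin> cube y0 r \<Longrightarrow> packet N \<omega> y0 r s y = 0"
  by (simp add: packet_def potential_outside Let_def zero_prod_def complex_eq_iff)

text \<open>
  For the frequency \<open>\<omega> = (\<beta>, - i a)\<close>, read as a vector, the leading part of a packet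
  is a plane wave in the direction \<open>(a, i \<beta> a\<^sup>2)\<close>; all other terms are of order
  \<open>1/N\<close>.
\<close>

lemma packet_main:
  assumes r: "0 < r" and a: "norm a = 1" and \<omega>: "\<omega> = (\<beta>, vector [Im a, - Re a])"
  shows "\<exists>C\<ge>0. \<forall>N\<ge>1. \<forall>y. norm (packet N \<omega> y0 r s y -
     (s * cutoff y0 r y * cos (N * (\<omega> \<bullet> y))) *\<^sub>R (a, \<i> * of_real \<beta> * a\<^sup>2)) \<le> C / N"
proof -
  have f: "fst \<omega> = \<beta>" "snd \<omega> $ 1 = Im a" "snd \<omega> $ 2 = - Re a" by (simp_all add: \<omega>)
  let ?E = "\<lambda>k l m. \<beta> ^ k * Im a ^ l * (- Re a) ^ m"
  have "\<exists>C\<ge>0. \<forall>N\<ge>1. \<forall>y. \<bar>potential N \<omega> y0 r k l m y - ?E k l m * cutoff y0 r y * cos (N * (\<omega> \<bullet> y))\<bar> \<le> C / N" if "k + l + m = 3" for k l m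
    using potential_main[OF r that, of \<omega> y0] unfolding f .
  then obtain C where C: "\<And>k l m. k + l + m = 3 \<Longrightarrow> C k l m \<ge> 0 \<and> (\<forall>N\<ge>1. \<forall>y. \<bar>potential N \<omega> y0 r k l m y - ?E k l m * cutoff y0 r y * cos (N * (\<omega> \<bullet> y))\<bar> \<le> C k l m / N)"
    by metis
  let ?D = "\<bar>s\<bar> * (C 0 2 1 + C 0 0 3 + C 0 3 0 + C 0 1 2 + C 1 1 1 + C 1 1 1 + C 1 0 2 + C 1 2 0)"
  have aa: "(Re a)\<^sup>2 + (Im a)\<^sup>2 = 1" using a by (simp add: cmod_power2[symmetric])
  have "norm (packet N \<omega> y0 r s y - (s * cutoff y0 r y * cos (N * (\<omega> \<bullet> y))) *\<^sub>R (a, \<i> * of_real \<beta> * a\<^sup>2)) \<le> ?D / N" if N: "N \<ge> 1" for N y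
  proof -
    define k where "k = cutoff y0 r y * cos (N * (\<omega> \<bullet> y))"
    define d where "d k' l m = potential N \<omega> y0 r k' l m y - ?E k' l m * k" for k' l m
    have d: "\<bar>d k' l m\<bar> \<le> C k' l m / N" if "k' + l + m = 3" for k' l m
      using C[OF that, THEN conjunct2, rule_format, OF N, of y] unfolding d_def k_def by (simp only: mult.assoc)
    have eq: "packet N \<omega> y0 r s y - (s * k) *\<^sub>R (a, \<i> * of_real \<beta> * a\<^sup>2) =
      (Complex ((- s) * d 0 2 1 + (- s) * d 0 0 3) (s * d 0 3 0 + s * d 0 1 2),
       Complex (s * d 1 1 1 + s * d 1 1 1) (s * d 1 0 2 + (- s) * d 1 2 0))"
    proof -
      have 1: "- s * (Im a ^ 2 * (- Re a) * k) + - s * ((- Re a) ^ 3 * k) = s * k * Re a"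
      proof -
        have "- s * (Im a ^ 2 * (- Re a) * k) + - s * ((- Re a) ^ 3 * k) = s * k * Re a * ((Re a)\<^sup>2 + (Im a)\<^sup>2)"
          by (simp add: power2_eq_square power3_eq_cube algebra_simps)
        then show ?thesis by (simp add: aa)
      qed
      have 2: "s * (Im a ^ 3 * k) + s * (Im a * (- Re a) ^ 2 * k) = s * k * Im a"
      proof -
        have "s * (Im a ^ 3 * k) + s * (Im a * (- Re a) ^ 2 * k) = s * k * Im a * ((Re a)\<^sup>2 + (Im a)\<^sup>2)"
          by (simp add: power2_eq_square power3_eq_cube algebra_simps)
        then show ?thesis by (simp add: aa)
      qed
      show ?thesis using 1 2
        by (simp add: packet_def Let_def d_def complex_eq_iff prod_eq_iff algebra_simps) (simp add: power2_eq_square algebra_simps)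
    qed
    have "norm (packet N \<omega> y0 r s y - (s * k) *\<^sub>R (a, \<i> * of_real \<beta> * a\<^sup>2)) \<le>
      norm (Complex ((- s) * d 0 2 1 + (- s) * d 0 0 3) (s * d 0 3 0 + s * d 0 1 2)) +
      norm (Complex (s * d 1 1 1 + s * d 1 1 1) (s * d 1 0 2 + (- s) * d 1 2 0))"
      unfolding eq by (rule norm_Pair_le)
    also have "\<dots> \<le> (\<bar>(- s) * d 0 2 1 + (- s) * d 0 0 3\<bar> + \<bar>s * d 0 3 0 + s * d 0 1 2\<bar>) + (\<bar>s * d 1 1 1 + s * d 1 1 1\<bar> + \<bar>s * d 1 0 2 + (- s) * d 1 2 0\<bar>)"
      by (intro add_mono order_trans[OF cmod_le]) auto
    also have "\<dots> \<le> (\<bar>s\<bar> * \<bar>d 0 2 1\<bar> + \<bar>s\<bar> * \<bar>d 0 0 3\<bar> + (\<bar>s\<bar> * \<bar>d 0 3 0\<bar> + \<bar>s\<bar> * \<bar>d 0 1 2\<bar>)) + ((\<bar>s\<bar> * \<bar>d 1 1 1\<bar> + \<bar>s\<bar> * \<bar>d 1 1 1\<bar>) + (\<bar>s\<bar> * \<bar>d 1 0 2\<bar> + \<bar>s\<bar> * \<bar>d 1 2 0\<bar>))"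
      by (intro add_mono order_trans[OF abs_triangle_ineq]) (auto simp: abs_mult)
    also have "\<dots> \<le> (\<bar>s\<bar> * (C 0 2 1 / N) + \<bar>s\<bar> * (C 0 0 3 / N) + (\<bar>s\<bar> * (C 0 3 0 / N) + \<bar>s\<bar> * (C 0 1 2 / N))) + ((\<bar>s\<bar> * (C 1 1 1 / N) + \<bar>s\<bar> * (C 1 1 1 / N)) + (\<bar>s\<bar> * (C 1 0 2 / N) + \<bar>s\<bar> * (C 1 2 0 / N)))"
      by (intro add_mono mult_left_mono d) auto
    also have "\<dots> = ?D / N" by (simp only: distrib_left add_divide_distrib times_divide_eq_right add.assoc)
    finally show ?thesis by (simp add: k_def mult.assoc)
  qed
  moreover have "?D \<ge> 0" using C by (intro mult_nonneg_nonneg add_nonneg_nonneg) auto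
  ultimately show ?thesis by blast
qed

section \<open>The relaxed constraint\<close>

text \<open>
  The largest eigenvalue of \<open>v \<otimes> v - U\<close>: the traceless part of this matrix is encoded by
  \<open>m\<^sup>2/2 - u\<close>, and its eigenvalues are plus and minus the modulus of that number.
\<close>

definition energy :: "state \<Rightarrow> real" where
  "energy z = (norm (fst z))\<^sup>2 / 2 + norm (snd z - (fst z)\<^sup>2 / 2)"

lemma energy_continuous: "continuous_on UNIV energy"
  unfolding energy_def[abs_def] by (intro continuous_intros) auto

lemma energy_bounds:
  assumes "energy z < q" "q \<le> Q"
  shows "(norm (fst z))\<^sup>2 / 2 < q" "norm (fst z) \<le> sqrt (2 * Q)" "norm (snd z) \<le> 2 * Q" "norm z \<le> sqrt (2 * Q) + 2 * Q"
proof -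
  have 1: "(norm (fst z))\<^sup>2 / 2 + norm (snd z - (fst z)\<^sup>2 / 2) < q" using assms by (simp add: energy_def)
  then show a: "(norm (fst z))\<^sup>2 / 2 < q" using norm_ge_zero[of "snd z - (fst z)\<^sup>2 / 2"] by linarith
  show b: "norm (fst z) \<le> sqrt (2 * Q)" using a assms(2) by (intro real_le_rsqrt) simp
  have "norm (snd z) \<le> norm (snd z - (fst z)\<^sup>2 / 2) + norm ((fst z)\<^sup>2 / 2)" using norm_triangle_sub[of "snd z" "(fst z)\<^sup>2 / 2"] by simp
  also have "norm ((fst z)\<^sup>2 / 2) = (norm (fst z))\<^sup>2 / 2" by (simp add: norm_divide norm_power)
  finally show c: "norm (snd z) \<le> 2 * Q" using 1 assms(2) zero_le_power2[of "norm (fst z)"] norm_ge_zero[of "snd z - (fst z)\<^sup>2 / 2"] by linarith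
  show "norm z \<le> sqrt (2 * Q) + 2 * Q" using norm_Pair_le[of "fst z" "snd z"] b c by simp
qed

text \<open>
  Write \<open>u - m\<^sup>2/2 = |W| a\<^sup>2\<close> with a unit number a, and let \<open>\<beta>\<close> be
  the component of m orthogonal to a. Moving by \<open>\<sigma> (a, i \<beta> a\<^sup>2)\<close> changes
  \<open>|m|\<^sup>2/2\<close> by some \<open>t/2\<close> and turns \<open>|W|\<close> into
  \<open>||W| - t/2|\<close>, so the energy grows only if t exceeds \<open>2|W|\<close>, and then it stays below
  q as long as t is smaller than the gap.
\<close>

lemma wave_direction:
  assumes e: "energy (m, u) < q" and q: "0 < q" "q \<le> Q"
  shows "\<exists>a \<beta>. norm a = 1 \<and> (\<forall>\<sigma>. \<bar>\<sigma>\<bar> \<le> (q - (norm m)\<^sup>2 / 2) / (4 * sqrt Q) \<longrightarrow>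
     energy ((m, u) + \<sigma> *\<^sub>R (a, \<i> * of_real \<beta> * a\<^sup>2)) < q)"
proof -
  define W where "W = u - m\<^sup>2 / 2"
  define g where "g = q - (norm m)\<^sup>2 / 2"
  have g: "0 < g" "g \<le> Q" using energy_bounds(1)[OF e order_refl] q zero_le_power2[of "norm m"] unfolding g_def fst_conv by linarith+
  obtain a where a: "norm a = 1" "W = of_real (norm W) * a\<^sup>2"
  proof -
    define b where "b = (if W = 0 then 1 else W / of_real (norm W))"
    have "norm (csqrt b) = 1" by (simp add: b_def norm_divide)
    moreover have "W = of_real (norm W) * (csqrt b)\<^sup>2" by (simp add: b_def)
    ultimately show ?thesis using that by blast
  qed
  define m1 where "m1 = Re (m * cnj a)"
  define \<beta> where "\<beta> = Im (m * cnj a)"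
  have aa: "a * cnj a = 1" using a(1) by (simp add: complex_norm_square[symmetric])
  have m: "m = (of_real m1 + \<i> * of_real \<beta>) * a"
  proof -
    have "of_real m1 + \<i> * of_real \<beta> = m * cnj a" unfolding m1_def \<beta>_def by (rule complex_eq[symmetric])
    then show ?thesis using aa by (simp add: mult.assoc mult.commute[of "cnj a"])
  qed
  have m1: "\<bar>m1\<bar> \<le> norm m" unfolding m1_def using abs_Re_le_cmod[of "m * cnj a"] a(1) by (simp add: norm_mult)
  have "energy ((m, u) + \<sigma> *\<^sub>R (a, \<i> * of_real \<beta> * a\<^sup>2)) < q" if \<sigma>: "\<bar>\<sigma>\<bar> \<le> g / (4 * sqrt Q)" for \<sigma>
  proof -
    define t where "t = 2 * m1 * \<sigma> + \<sigma>\<^sup>2"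
    have nm: "(norm (m + \<sigma> *\<^sub>R a))\<^sup>2 = (norm m)\<^sup>2 + t"
    proof -
      have "m + \<sigma> *\<^sub>R a = (of_real (m1 + \<sigma>) + \<i> * of_real \<beta>) * a" by (subst m) (simp add: algebra_simps scaleR_conv_of_real)
      then have "(norm (m + \<sigma> *\<^sub>R a))\<^sup>2 = (m1 + \<sigma>)\<^sup>2 + \<beta>\<^sup>2" using a(1) by (simp add: norm_mult cmod_power2)
      moreover have "(norm m)\<^sup>2 = m1\<^sup>2 + \<beta>\<^sup>2" by (subst m) (simp add: norm_mult cmod_power2 a(1))
      ultimately show ?thesis by (simp add: t_def power2_eq_square algebra_simps)
    qed
    have "u + \<sigma> *\<^sub>R (\<i> * of_real \<beta> * a\<^sup>2) - (m + \<sigma> *\<^sub>R a)\<^sup>2 / 2 = W + \<sigma> *\<^sub>R (\<i> * of_real \<beta> * a\<^sup>2 - m * a) - (\<sigma>\<^sup>2 / 2) *\<^sub>R a\<^sup>2"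
      by (simp add: W_def scaleR_conv_of_real power2_eq_square algebra_simps add_divide_distrib)
    also have "\<i> * of_real \<beta> * a\<^sup>2 - m * a = - (of_real m1 * a\<^sup>2)" by (subst m) (simp add: power2_eq_square algebra_simps)
    also have "W + \<sigma> *\<^sub>R (- (of_real m1 * a\<^sup>2)) - (\<sigma>\<^sup>2 / 2) *\<^sub>R a\<^sup>2 = of_real (norm W - t / 2) * a\<^sup>2"
      by (subst a(2)) (simp add: t_def scaleR_conv_of_real algebra_simps add_divide_distrib)
    finally have "norm (u + \<sigma> *\<^sub>R (\<i> * of_real \<beta> * a\<^sup>2) - (m + \<sigma> *\<^sub>R a)\<^sup>2 / 2) = \<bar>norm W - t / 2\<bar>"
      by (simp add: norm_mult norm_power a(1) del: of_real_diff)
    then have en: "energy ((m, u) + \<sigma> *\<^sub>R (a, \<i> * of_real \<beta> * a\<^sup>2)) = ((norm m)\<^sup>2 + t) / 2 + \<bar>norm W - t / 2\<bar>"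
      using nm by (simp add: energy_def)
    have "t < g"
    proof -
      have Q: "0 < Q" using q by simp
      have s: "\<bar>\<sigma>\<bar> * sqrt Q \<le> g / 4" using \<sigma> Q by (simp add: field_simps)
      have "norm m \<le> sqrt (2 * Q)" using energy_bounds(2)[OF e q(2)] by simp
      also have "\<dots> \<le> 3/2 * sqrt Q" by (rule real_le_lsqrt) (use Q in \<open>auto simp: power_mult_distrib power2_eq_square\<close>)
      finally have "\<bar>m1\<bar> \<le> 3/2 * sqrt Q" using m1 by simp
      then have "\<bar>m1\<bar> * \<bar>\<sigma>\<bar> \<le> 3/2 * sqrt Q * \<bar>\<sigma>\<bar>" by (intro mult_right_mono) auto
      also have "\<dots> \<le> 3/8 * g" using s by (simp add: mult.commute)
      finally have 1: "2 * m1 * \<sigma> \<le> 3/4 * g" using abs_ge_self[of "m1 * \<sigma>"] by (simp add: abs_mult)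
      have "(\<bar>\<sigma>\<bar> * sqrt Q)\<^sup>2 \<le> (g / 4)\<^sup>2" using s Q by (intro power_mono) auto
      moreover have "(\<bar>\<sigma>\<bar> * sqrt Q)\<^sup>2 = \<sigma>\<^sup>2 * Q" using Q by (simp add: power_mult_distrib)
      moreover have "(g / 4)\<^sup>2 = g * g / 16" by (simp add: power2_eq_square)
      ultimately have "\<sigma>\<^sup>2 * Q \<le> g * g / 16" by simp
      also have "\<dots> \<le> g * Q / 16" using g by simp
      finally have "\<sigma>\<^sup>2 \<le> g / 16" using Q by simp
      then show ?thesis using 1 g unfolding t_def by linarith
    qed
    moreover have "(norm m)\<^sup>2 / 2 + norm W < q" using e by (simp add: energy_def W_def)
    moreover have "\<bar>norm W - t / 2\<bar> = norm W - t / 2 \<or> \<bar>norm W - t / 2\<bar> = t / 2 - norm W" by linarith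
    moreover have "(A + t) / 2 + x < q" if "t < q - A / 2" "A / 2 + w < q" "0 \<le> w" "x = w - t / 2 \<or> x = t / 2 - w" for A w x :: real
      using that by (auto simp: add_divide_distrib)
    ultimately show ?thesis unfolding en g_def by (meson norm_ge_zero)
  qed
  then show ?thesis using a(1) unfolding g_def by blast
qed

section \<open>Adding oscillations to a strict subsolution\<close>

lemma set_integrable_bounded_finite:
  fixes f :: "'a \<Rightarrow> real"
  assumes "A \<in> sets M" "emeasure M A < \<infinity>" "set_borel_measurable M A f" "\<And>y. y \<in> A \<Longrightarrow> \<bar>f y\<bar> \<le> B"
  shows "set_integrable M A f" "\<bar>LINT y:A|M. f y\<bar> \<le> B * measure M A"
proof -
  have B: "integrable M (\<lambda>y. indicator A y * B)"
    using assms(1,2) by (intro integrable_mult_left integrable_real_indicator) auto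
  show i: "set_integrable M A f"
    unfolding set_integrable_def
  proof (rule Bochner_Integration.integrable_bound[OF B])
    show "(\<lambda>y. indicator A y *\<^sub>R f y) \<in> borel_measurable M"
      using assms(3) by (simp add: set_borel_measurable_def)
    show "AE y in M. norm (indicator A y *\<^sub>R f y) \<le> norm (indicator A y * B)"
      using assms(4) by (intro AE_I2) (force simp: indicator_def)
  qed
  have "\<bar>LINT y:A|M. f y\<bar> \<le> (\<integral>y. indicator A y * B \<partial>M)"
    unfolding set_lebesgue_integral_def
  proof (rule order_trans[OF integral_abs_bound integral_mono])
    show "integrable M (\<lambda>y. \<bar>indicator A y *\<^sub>R f y\<bar>)" using i by (simp add: set_integrable_def)
    show "\<bar>indicator A y *\<^sub>R f y\<bar> \<le> indicator A y * B" for y using assms(4) by (auto simp: indicator_def)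
  qed (fact B)
  then show "\<bar>LINT y:A|M. f y\<bar> \<le> B * measure M A" using assms(1) by (simp add: mult.commute)
qed

lemma continuous_extension_by_zero:
  fixes g :: "'a::euclidean_space \<Rightarrow> 'b::real_normed_vector"
  assumes "open A" "continuous_on A g" "compact K" "K \<subseteq> A" "\<And>y. y \<in> A - K \<Longrightarrow> g y = 0"
  shows "continuous_on UNIV (\<lambda>y. if y \<in> A then g y else 0)"
proof -
  have "continuous_on (A \<union> - K) (\<lambda>y. if y \<in> A then g y else 0)"
  proof (rule continuous_on_open_Un[OF assms(1)])
    show "open (- K)" using assms(3) by (simp add: compact_imp_closed open_Compl)
    show "continuous_on A (\<lambda>y. if y \<in> A then g y else 0)"
      using assms(2) by (rule continuous_on_eq) auto
    have "continuous_on (- K) (\<lambda>y. 0 :: 'b)" by simp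
    then show "continuous_on (- K) (\<lambda>y. if y \<in> A then g y else 0)"
      by (rule continuous_on_eq) (use assms(5) in auto)
  qed
  moreover have "A \<union> - K = UNIV" using assms(4) by auto
  ultimately show ?thesis by simp
qed

text \<open>
  Convex integration is run with respect to two measures on space-time, Lebesgue measure and the surface measure
  of the slice \<open>t = 0\<close>. What it needs is invariance under spatial shifts, for the Riemann-Lebesgue
  lemma, and Vitali coverings of open sets by balls with centres in Y that carry a fixed part of their mass in
  the middle, for the placement of packets.
\<close>

locale oscillation_measure =
  fixes \<mu> :: "spacetime measure" and Y :: "spacetime set" and c :: real
  assumes sets_\<mu>[measurable_cong, simp]: "sets \<mu> = sets borel"
    and finite_\<mu>: "\<And>A. bounded A \<Longrightarrow> A \<in> sets borel \<Longrightarrow> emeasure \<mu> A < \<infinity>"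
    and shift: "\<And>(F :: spacetime \<Rightarrow> real) h. F \<in> borel_measurable borel \<Longrightarrow> (\<integral>y. F (y + (0, h)) \<partial>\<mu>) = (\<integral>y. F y \<partial>\<mu>)"
    and c_pos: "0 < c"
    and doubling: "\<And>y0 r. y0 \<in> Y \<Longrightarrow> 0 < r \<Longrightarrow> c * measure \<mu> (cball y0 r) \<le> measure \<mu> (cube y0 (r / 4))"
    and vitali: "\<And>D \<rho> \<epsilon>. open D \<Longrightarrow> bounded D \<Longrightarrow> (\<And>y. y \<in> D \<Longrightarrow> \<rho> y > 0) \<Longrightarrow> \<epsilon> > 0 \<Longrightarrow>
       \<exists>C r. finite C \<and> C \<subseteq> Y \<inter> D \<and> (\<forall>y\<in>C. 0 < r y \<and> r y \<le> \<rho> y \<and> cball y (r y) \<subseteq> D) \<and>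
         disjoint_family_on (\<lambda>y. cball y (r y)) C \<and> measure \<mu> (D - (\<Union>y\<in>C. cball y (r y))) \<le> \<epsilon>"
begin

lemma space_\<mu>[simp]: "space \<mu> = UNIV"
  using sets_eq_imp_space_eq[OF sets_\<mu>] by simp

lemma set_measurable_\<mu>: "set_borel_measurable \<mu> A f = set_borel_measurable borel A f"
  by (simp add: set_borel_measurable_def measurable_cong_sets[OF sets_\<mu> refl])

text \<open>
  A spatial shift by half a period changes the sign of the cosine. The shift stays within a time slice, so the
  lemma also covers the slice \<open>t = 0\<close>.
\<close>

lemma riemann_lebesgue:
  assumes f: "continuous_on UNIV f" and K: "compact K" "\<And>y. y \<notin> K \<Longrightarrow> f y = 0" and \<omega>: "snd \<omega> \<noteq> 0"
  shows "(\<lambda>n. \<integral>y. f y * cos (real n * (\<omega> \<bullet> y)) \<partial>\<mu>) \<longlonglongrightarrow> 0"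
proof (rule LIMSEQ_I)
  let ?c = "\<lambda>(n::nat) y. cos (real n * (\<omega> \<bullet> y))"
  fix \<epsilon> :: real assume \<epsilon>: "\<epsilon> > 0"
  obtain R where R: "R > 0" "\<And>y. y \<in> K \<Longrightarrow> norm y \<le> R"
    using compact_imp_bounded[OF K(1)] by (meson bounded_pos)
  define B where "B = cball (0::spacetime) (R + 1)"
  have B: "B \<in> sets borel" "emeasure \<mu> B < \<infinity>" unfolding B_def using finite_\<mu>[OF bounded_cball, of 0 "R + 1"] by auto
  define M where "M = measure \<mu> B"
  have M: "M \<ge> 0" by (simp add: M_def)
  have "uniformly_continuous_on (cball 0 (R + 2)) f"
    by (intro compact_uniformly_continuous continuous_on_subset[OF f]) auto
  then obtain \<delta> where \<delta>: "\<delta> > 0" "\<And>y y'. y \<in> cball 0 (R + 2) \<Longrightarrow> y' \<in> cball 0 (R + 2) \<Longrightarrow> dist y' y < \<delta> \<Longrightarrow> dist (f y') (f y) < \<epsilon> / (M + 1)"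
    unfolding uniformly_continuous_on_def using \<epsilon> M by (metis add_nonneg_pos divide_pos_pos zero_less_one)
  define x where "x = snd \<omega>"
  have xx: "norm x > 0" using \<omega> by (simp add: x_def)
  obtain n0 :: nat where n0: "real n0 > pi / (norm x * min \<delta> 1)" using reals_Archimedean2 by blast
  have fm: "f \<in> borel_measurable borel" using f by (rule borel_measurable_continuous_onI)
  have fcos: "(\<lambda>y. f y * ?c n y) \<in> borel_measurable borel" for n
    by (intro borel_measurable_continuous_onI continuous_intros f)
  have "norm ((\<integral>y. f y * ?c n y \<partial>\<mu>) - 0) < \<epsilon>" if n: "n \<ge> Suc n0" for n
  proof -
    (* the shift advances the phase by exactly pi *)
    define h where "h = (pi / (real n * (norm x)\<^sup>2)) *\<^sub>R x"
    have n0': "real n > 0" using n by simp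
    have "norm h = pi / (real n * norm x)" using n0' xx by (simp add: h_def power2_eq_square)
    also have "\<dots> < min \<delta> 1"
    proof -
      have "pi < real n0 * (norm x * min \<delta> 1)" using n0 xx \<delta>(1) by (simp add: pos_divide_less_eq)
      also have "\<dots> \<le> real n * (norm x * min \<delta> 1)" using n xx \<delta>(1) by (intro mult_right_mono) auto
      finally have "pi < min \<delta> 1 * (real n * norm x)" by (simp only: ac_simps)
      then show ?thesis using n0' xx by (simp only: pos_divide_less_eq mult_pos_pos)
    qed
    finally have h: "norm h < \<delta>" "norm h < 1" by auto
    have phase: "cos (real n * (\<omega> \<bullet> (y + (0, h)))) = - ?c n y" for y
    proof -
      have "\<omega> \<bullet> (0, h) = pi / real n" using n0' xx
        by (simp add: inner_prod_def h_def x_def[symmetric] power2_norm_eq_inner)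
      then have "real n * (\<omega> \<bullet> (y + (0, h))) = real n * (\<omega> \<bullet> y) + pi" using n0' by (simp add: inner_add_right distrib_left)
      then show ?thesis by simp
    qed
    let ?I = "\<integral>y. f y * ?c n y \<partial>\<mu>"
    have supp: "f y = 0 \<and> f (y + (0, h)) = 0" if "y \<notin> B" for y
    proof -
      have "norm y > R + 1" using that by (simp add: B_def)
      moreover have "norm y \<le> norm (y + (0, h)) + norm (0 :: real, h)" using norm_triangle_ineq4[of "y + (0, h)" "(0, h)"] by simp
      moreover have "norm (0 :: real, h) = norm h" by (simp add: norm_Pair)
      ultimately have "norm y > R" "norm (y + (0, h)) > R" using h by linarith+
      then show ?thesis using K(2) R(2) by fastforce
    qed
    have fb: "\<exists>C. \<forall>y\<in>B. \<bar>f y\<bar> \<le> C"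
      using continuous_bounded_on_bounded[OF _ f, of B] unfolding B_def by (metis bounded_cball real_norm_def)
    have i1: "integrable \<mu> (\<lambda>y. f y * ?c n y)"
    proof -
      obtain C where C: "\<forall>y\<in>B. \<bar>f y\<bar> \<le> C" using fb by blast
      have "\<bar>f y * ?c n y\<bar> \<le> C" if "y \<in> B" for y
        unfolding abs_mult using C that mult_mono[of "\<bar>f y\<bar>" C "\<bar>?c n y\<bar>" 1] by force
      then have "set_integrable \<mu> B (\<lambda>y. f y * ?c n y)"
        using B fcos by (intro set_integrable_bounded_finite(1)[of _ _ _ C]) (auto simp: set_measurable_\<mu> intro!: set_measurable_UNIV)
      moreover have "indicator B y *\<^sub>R (f y * ?c n y) = f y * ?c n y" for y
        using supp[of y] by (cases "y \<in> B") auto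
      ultimately show ?thesis by (simp only: set_integrable_def)
    qed
    have dm: "(\<lambda>y. (f y - f (y + (0, h))) * ?c n y) \<in> borel_measurable borel"
      by (intro borel_measurable_continuous_onI continuous_intros f continuous_on_compose2[OF f]) auto
    have small: "\<bar>(f y - f (y + (0, h))) * ?c n y\<bar> \<le> \<epsilon> / (M + 1)" if "y \<in> B" for y
    proof -
      have "norm (y + (0, h)) \<le> norm y + norm h" using norm_triangle_ineq[of y "(0, h)"] by (simp add: norm_Pair)
      then have "dist (f (y + (0, h))) (f y) < \<epsilon> / (M + 1)" using that h
      proof (intro \<delta>(2))
        show "y \<in> cball 0 (R + 2)" "y + (0, h) \<in> cball 0 (R + 2)"
          using \<open>norm (y + (0, h)) \<le> norm y + norm h\<close> that h unfolding B_def mem_cball dist_0_norm by linarith+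
        show "dist (y + (0, h)) y < \<delta>" using h by (simp add: dist_norm norm_Pair)
      qed
      then have "\<bar>f y - f (y + (0, h))\<bar> \<le> \<epsilon> / (M + 1)" by (simp add: dist_real_def abs_minus_commute)
      then show ?thesis unfolding abs_mult using mult_mono[of "\<bar>f y - f (y + (0, h))\<bar>" "\<epsilon> / (M + 1)" "\<bar>?c n y\<bar>" 1] by force
    qed
    have sB: "set_integrable \<mu> B (\<lambda>y. (f y - f (y + (0, h))) * ?c n y)"
       "\<bar>LINT y:B|\<mu>. (f y - f (y + (0, h))) * ?c n y\<bar> \<le> \<epsilon> / (M + 1) * M"
      unfolding M_def using B dm small unfolding M_def
      by (intro set_integrable_bounded_finite; auto simp: set_measurable_\<mu> intro!: set_measurable_UNIV)+
    have eqB: "indicator B y *\<^sub>R ((f y - f (y + (0, h))) * ?c n y) = (f y - f (y + (0, h))) * ?c n y" for y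
      using supp[of y] by (cases "y \<in> B") auto
    have i2: "integrable \<mu> (\<lambda>y. (f y - f (y + (0, h))) * ?c n y)"
      using sB(1) by (simp only: set_integrable_def eqB)
    have b2: "\<bar>\<integral>y. (f y - f (y + (0, h))) * ?c n y \<partial>\<mu>\<bar> \<le> \<epsilon> / (M + 1) * M"
      using sB(2) by (simp only: set_lebesgue_integral_def eqB)
    have "?I = (\<integral>y. f (y + (0, h)) * cos (real n * (\<omega> \<bullet> (y + (0, h)))) \<partial>\<mu>)" using shift[OF fcos] by simp
    also have "\<dots> = (\<integral>y. - (f (y + (0, h)) * ?c n y) \<partial>\<mu>)" by (simp add: phase)
    also have "\<dots> = (\<integral>y. (f y - f (y + (0, h))) * ?c n y - f y * ?c n y \<partial>\<mu>)"
      by (simp add: algebra_simps)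
    also have "\<dots> = (\<integral>y. (f y - f (y + (0, h))) * ?c n y \<partial>\<mu>) - ?I"
      by (rule Bochner_Integration.integral_diff[OF i2 i1])
    finally have "2 * \<bar>?I\<bar> \<le> \<epsilon> / (M + 1) * M" using b2 by simp
    also have "\<dots> < 2 * \<epsilon>"
    proof -
      have "\<epsilon> * M < 2 * \<epsilon> * (M + 1)"
      proof -
        have "0 < M * \<epsilon> + 2 * \<epsilon>" using \<epsilon> M by (intro add_nonneg_pos) auto
        then show ?thesis by (simp add: algebra_simps)
      qed
      then show ?thesis using M by (simp add: field_simps)
    qed
    finally show ?thesis by simp
  qed
  then show "\<exists>no. \<forall>n\<ge>no. norm ((\<integral>y. f y * ?c n y \<partial>\<mu>) - 0) < \<epsilon>" by blast
qed

lemma set_integral_small: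
  assumes A: "A \<in> sets borel" "bounded A" and m: "\<And>n. set_borel_measurable borel A (F n)"
    and b: "\<And>n y. n \<ge> 1 \<Longrightarrow> y \<in> A \<Longrightarrow> \<bar>F n y\<bar> \<le> C / real n"
  shows "(\<lambda>n. LINT y:A|\<mu>. F n y) \<longlonglongrightarrow> 0"
proof (rule Lim_null_comparison)
  show "\<forall>\<^sub>F n in sequentially. norm (LINT y:A|\<mu>. F n y) \<le> C / real n * measure \<mu> A"
    unfolding eventually_sequentially
  proof (intro exI[of _ 1] allI impI)
    fix n :: nat assume "1 \<le> n"
    then show "norm (LINT y:A|\<mu>. F n y) \<le> C / real n * measure \<mu> A"
      using A m b finite_\<mu>[OF A(2,1)] set_integrable_bounded_finite(2)[of A \<mu> "F n" "C / real n"]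
      by (simp add: set_measurable_\<mu>)
  qed
  have "(\<lambda>n. C * measure \<mu> A * inverse (real n)) \<longlonglongrightarrow> C * measure \<mu> A * 0"
    by (intro tendsto_intros lim_inverse_n)
  then show "(\<lambda>n. C / real n * measure \<mu> A) \<longlonglongrightarrow> 0" by (simp add: field_simps)
qed

lemma set_integrable_continuous_\<mu>:
  fixes f :: "spacetime \<Rightarrow> real"
  assumes "A \<in> sets borel" "bounded A" "continuous_on UNIV f"
  shows "set_integrable \<mu> A f"
proof -
  obtain B where "\<And>y. y \<in> A \<Longrightarrow> norm (f y) \<le> B"
    using continuous_bounded_on_bounded[OF assms(2,3)] by metis
  then show ?thesis using assms finite_\<mu>[OF assms(2,1)]
    by (intro set_integrable_bounded_finite(1)[of _ _ _ B]) (auto simp: set_measurable_\<mu> intro!: set_measurable_UNIV borel_measurable_continuous_onI)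
qed

text \<open>
  The square of the cosine is one half plus an oscillating term; hence packets tend weakly to 0 while their
  square norms converge to a positive number.
\<close>

lemma packet_integrals:
  assumes V: "open V" "bounded V" and r: "0 < r" and cube: "cube y0 r \<subseteq> V"
    and a: "norm a = 1" and \<omega>: "\<omega> = (\<beta>, vector [Im a, - Re a])"
  shows "continuous_on V h \<Longrightarrow> (\<lambda>n. LINT y:V|\<mu>. h y \<bullet> fst (packet (real n) \<omega> y0 r s y)) \<longlonglongrightarrow> 0" (is "_ \<Longrightarrow> ?lin h")
    and "(\<lambda>n. LINT y:V|\<mu>. (norm (fst (packet (real n) \<omega> y0 r s y)))\<^sup>2) \<longlonglongrightarrow> s\<^sup>2 / 2 * (LINT y:V|\<mu>. (cutoff y0 r y)\<^sup>2)" (is ?quad)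
proof -
  let ?c = "\<lambda>(n::nat) y. cos (real n * (\<omega> \<bullet> y))"
  obtain C where C: "C \<ge> 0" "\<And>N y. N \<ge> 1 \<Longrightarrow> norm (packet N \<omega> y0 r s y -
     (s * cutoff y0 r y * cos (N * (\<omega> \<bullet> y))) *\<^sub>R (a, \<i> * of_real \<beta> * a\<^sup>2)) \<le> C / N"
    using packet_main[OF r a \<omega>, of y0 s] by blast
  define p where "p n y = fst (packet (real n) \<omega> y0 r s y)" for n :: nat and y
  define A where "A n y = (s * cutoff y0 r y * ?c n y) *\<^sub>R a" for n :: nat and y
  have close: "norm (p n y - A n y) \<le> C / real n" if "n \<ge> 1" for n y
  proof -
    have "norm (p n y - A n y) \<le> norm (packet (real n) \<omega> y0 r s y - (s * cutoff y0 r y * ?c n y) *\<^sub>R (a, \<i> * of_real \<beta> * a\<^sup>2))"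
      unfolding p_def A_def by (metis (no_types, lifting) fst_diff fst_scaleR fst_conv norm_fst_le prod.collapse)
    also have "\<dots> \<le> C / real n" using C(2)[of "real n" y] that by simp
    finally show ?thesis .
  qed
  have sx: "snd \<omega> \<noteq> 0"
  proof
    assume "snd \<omega> = 0"
    then have v: "(vector [Im a, - Re a] :: real^2) = 0" unfolding \<omega> snd_conv .
    have "(vector [Im a, - Re a] :: real^2) $ 1 = 0" "(vector [Im a, - Re a] :: real^2) $ 2 = 0" unfolding v by simp_all
    then have "a = 0" by (simp add: complex_eq_iff)
    then show False using a by simp
  qed
  have Vb: "V \<in> sets borel" using V by auto
  have pc: "continuous_on UNIV (p n)" if "n \<ge> 1" for n
    unfolding p_def[abs_def] packet_def Let_def Complex_eq fst_conv using that r by (intro continuous_intros potential_continuous) auto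
  have Ac: "continuous_on UNIV (A n)" for n
    unfolding A_def[abs_def] using r by (intro continuous_intros cutoff_continuous) auto
  have out: "p n y = 0" "A n y = 0" if "y \<notin> cube y0 r" for n y
    using that packet_outside[OF r that] cutoff_outside[OF r that] by (simp_all add: p_def A_def)
  have Ab: "norm (A n y) \<le> \<bar>s\<bar>" for n y
  proof -
    have "\<bar>cutoff y0 r y\<bar> * \<bar>?c n y\<bar> \<le> 1 * 1"
      using cutoff_range[of y0 r y] by (intro mult_mono) auto
    then have "\<bar>s\<bar> * (\<bar>cutoff y0 r y\<bar> * \<bar>?c n y\<bar>) \<le> \<bar>s\<bar> * 1" by (intro mult_left_mono) auto
    then show ?thesis by (simp add: A_def a abs_mult mult.assoc)
  qed
  have sm: "set_borel_measurable borel V f" if "continuous_on V f" for f :: "spacetime \<Rightarrow> real"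
    using set_measurable_continuous_on_open[OF V(1) that] .
  have sub: "continuous_on UNIV f \<Longrightarrow> continuous_on V f" for f :: "spacetime \<Rightarrow> 'c::real_normed_vector"
    using continuous_on_subset by blast
  show "?lin h" if h: "continuous_on V h"
  proof -
    have hc: "continuous_on (cube y0 r) h" using h cube continuous_on_subset by blast
    have "compact (h ` cube y0 r)" using compact_continuous_image[OF hc compact_cube] .
    then obtain M where M: "\<forall>w\<in>h ` cube y0 r. norm w \<le> M" using compact_imp_bounded bounded_iff by blast
    define f where "f y = (if y \<in> V then (h y \<bullet> a) * (s * cutoff y0 r y) else 0)" for y
    have fc: "continuous_on UNIV f" unfolding f_def[abs_def]
      by (rule continuous_extension_by_zero[OF V(1) _ compact_cube cube]) (use h r cutoff_outside[OF r] in \<open>auto intro!: continuous_intros sub[OF cutoff_continuous]\<close>)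
    have fz: "f y = 0" if "y \<notin> cube y0 r" for y using cutoff_outside[OF r that] by (simp add: f_def)
    have 1: "(\<lambda>n. \<integral>y. f y * ?c n y \<partial>\<mu>) \<longlonglongrightarrow> 0"
      by (rule riemann_lebesgue[OF fc compact_cube fz sx])
    have 2: "(\<lambda>n. LINT y:V|\<mu>. if n = 0 then 0 else h y \<bullet> (p n y - A n y)) \<longlonglongrightarrow> 0"
    proof (rule set_integral_small[OF Vb V(2), where C = "\<bar>M\<bar> * C"])
      show "set_borel_measurable borel V (\<lambda>y. if n = 0 then 0 else h y \<bullet> (p n y - A n y))" for n
        by (cases "n = 0") (auto intro!: sm continuous_intros h sub[OF pc] sub[OF Ac])
      show "\<bar>if n = 0 then 0 else h y \<bullet> (p n y - A n y)\<bar> \<le> \<bar>M\<bar> * C / real n" if "1 \<le> n" "y \<in> V" for n y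
      proof (cases "y \<in> cube y0 r")
        case True
        then have "norm (h y) \<le> \<bar>M\<bar>" using M by fastforce
        then have "norm (h y) * norm (p n y - A n y) \<le> \<bar>M\<bar> * (C / real n)" using close[OF that(1)] by (intro mult_mono) auto
        then show ?thesis using that Cauchy_Schwarz_ineq2[of "h y" "p n y - A n y"] by simp
      next
        case False then show ?thesis using out C(1) by simp
      qed
    qed
    have "(LINT y:V|\<mu>. h y \<bullet> p n y) = (LINT y:V|\<mu>. if n = 0 then 0 else h y \<bullet> (p n y - A n y)) + (\<integral>y. f y * ?c n y \<partial>\<mu>)" if n: "n \<ge> 1" for n
    proof -
      have e: "indicator V y *\<^sub>R (h y \<bullet> A n y) = f y * ?c n y" for y
        by (auto simp: indicator_def A_def f_def)
      have z: "continuous_on UNIV (\<lambda>y. if y \<in> V then h y \<bullet> g y else 0)" if "continuous_on UNIV g" "\<And>y. y \<notin> cube y0 r \<Longrightarrow> g y = 0" for g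
        by (rule continuous_extension_by_zero[OF V(1) _ compact_cube cube]) (use h that in \<open>auto intro!: continuous_on_inner intro: sub\<close>)
      have "set_integrable \<mu> V (\<lambda>y. if y \<in> V then h y \<bullet> (p n y - A n y) else 0)"
        by (intro set_integrable_continuous_\<mu> z Vb V continuous_intros pc[OF n] Ac) (auto simp: out)
      moreover have "set_integrable \<mu> V (\<lambda>y. if y \<in> V then h y \<bullet> A n y else 0)"
        by (intro set_integrable_continuous_\<mu> z Vb V continuous_intros Ac) (auto simp: out)
      ultimately have i: "set_integrable \<mu> V (\<lambda>y. h y \<bullet> (p n y - A n y))" "set_integrable \<mu> V (\<lambda>y. h y \<bullet> A n y)"
        by (auto intro: set_integrable_cong[OF refl refl, THEN iffD1, rotated])
      have "(LINT y:V|\<mu>. h y \<bullet> p n y) = (LINT y:V|\<mu>. h y \<bullet> (p n y - A n y) + h y \<bullet> A n y)" by (simp add: inner_diff_right)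
      also have "\<dots> = (LINT y:V|\<mu>. h y \<bullet> (p n y - A n y)) + (LINT y:V|\<mu>. h y \<bullet> A n y)" using i by (rule set_integral_add)
      also have "(LINT y:V|\<mu>. h y \<bullet> A n y) = (\<integral>y. f y * ?c n y \<partial>\<mu>)"
        unfolding set_lebesgue_integral_def e ..
      finally show ?thesis using n by simp
    qed
    then have "\<forall>\<^sub>F n in sequentially. (LINT y:V|\<mu>. if n = 0 then 0 else h y \<bullet> (p n y - A n y)) + (\<integral>y. f y * ?c n y \<partial>\<mu>) = (LINT y:V|\<mu>. h y \<bullet> p n y)"
      unfolding eventually_sequentially by (intro exI[of _ 1]) auto
    moreover have "(\<lambda>n. (LINT y:V|\<mu>. if n = 0 then 0 else h y \<bullet> (p n y - A n y)) + (\<integral>y. f y * ?c n y \<partial>\<mu>)) \<longlonglongrightarrow> 0 + 0"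
      by (intro tendsto_add 1 2)
    ultimately show ?thesis unfolding p_def[symmetric] using tendsto_cong[THEN iffD1] by fastforce
  qed
  show ?quad
  proof -
    define f where "f y = s\<^sup>2 / 2 * (cutoff y0 r y)\<^sup>2" for y
    have fc: "continuous_on UNIV f" unfolding f_def[abs_def] using r by (intro continuous_intros cutoff_continuous) auto
    have fz: "f y = 0" if "y \<notin> cube y0 r" for y using cutoff_outside[OF r that] by (simp add: f_def)
    have sx2: "snd (2 *\<^sub>R \<omega>) \<noteq> 0" using sx by simp
    have 1: "(\<lambda>n. \<integral>y. f y * cos (real n * ((2 *\<^sub>R \<omega>) \<bullet> y)) \<partial>\<mu>) \<longlonglongrightarrow> 0"
      by (rule riemann_lebesgue[OF fc compact_cube fz sx2])
    have 2: "(\<lambda>n. LINT y:V|\<mu>. if n = 0 then 0 else (norm (p n y))\<^sup>2 - (norm (A n y))\<^sup>2) \<longlonglongrightarrow> 0"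
    proof (rule set_integral_small[OF Vb V(2), where C = "C * (C + 2 * \<bar>s\<bar>)"])
      show "set_borel_measurable borel V (\<lambda>y. if n = 0 then 0 else (norm (p n y))\<^sup>2 - (norm (A n y))\<^sup>2)" for n
        by (cases "n = 0") (auto intro!: sm continuous_intros sub[OF pc] sub[OF Ac])
      show "\<bar>if n = 0 then 0 else (norm (p n y))\<^sup>2 - (norm (A n y))\<^sup>2\<bar> \<le> C * (C + 2 * \<bar>s\<bar>) / real n" if n: "1 \<le> n" and "y \<in> V" for n y
      proof -
        have "\<bar>norm (p n y) - norm (A n y)\<bar> \<le> C / real n" using close[OF n] norm_triangle_ineq3[of "p n y" "A n y"] by (meson order_trans)
        moreover have "C / real n \<le> C" using n frac_le[of C C 1 "real n"] C(1) by simp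
        ultimately have "\<bar>norm (p n y) - norm (A n y)\<bar> * \<bar>norm (p n y) + norm (A n y)\<bar> \<le> C / real n * (C + 2 * \<bar>s\<bar>)"
          using Ab[of n y] C(1) by (intro mult_mono) auto
        moreover have "(norm (p n y))\<^sup>2 - (norm (A n y))\<^sup>2 = (norm (p n y) - norm (A n y)) * (norm (p n y) + norm (A n y))"
          by (simp add: power2_eq_square algebra_simps)
        ultimately show ?thesis using n by (simp add: abs_mult)
      qed
    qed
    have "(LINT y:V|\<mu>. (norm (p n y))\<^sup>2) = (LINT y:V|\<mu>. if n = 0 then 0 else (norm (p n y))\<^sup>2 - (norm (A n y))\<^sup>2)
       + ((\<integral>y. f y * cos (real n * ((2 *\<^sub>R \<omega>) \<bullet> y)) \<partial>\<mu>) + s\<^sup>2 / 2 * (LINT y:V|\<mu>. (cutoff y0 r y)\<^sup>2))" if n: "n \<ge> 1" for n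
    proof -
      have "(norm (A n y))\<^sup>2 = f y * cos (real n * ((2 *\<^sub>R \<omega>) \<bullet> y)) + s\<^sup>2 / 2 * (cutoff y0 r y)\<^sup>2" for y
      proof -
        have *: "cos (real n * ((2 *\<^sub>R \<omega>) \<bullet> y)) = 2 * (?c n y)\<^sup>2 - 1"
          using cos_double_cos[of "real n * (\<omega> \<bullet> y)"] by (simp add: algebra_simps)
        have "(norm (A n y))\<^sup>2 = s\<^sup>2 * (cutoff y0 r y)\<^sup>2 * (?c n y)\<^sup>2"
          by (simp add: A_def a power_mult_distrib)
        then show ?thesis unfolding f_def * by (simp add: field_simps)
      qed
      then have "(LINT y:V|\<mu>. (norm (p n y))\<^sup>2) = (LINT y:V|\<mu>. ((norm (p n y))\<^sup>2 - (norm (A n y))\<^sup>2) + (f y * cos (real n * ((2 *\<^sub>R \<omega>) \<bullet> y)) + s\<^sup>2 / 2 * (cutoff y0 r y)\<^sup>2))"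
        by simp
      also have "\<dots> = (LINT y:V|\<mu>. (norm (p n y))\<^sup>2 - (norm (A n y))\<^sup>2) + ((LINT y:V|\<mu>. f y * cos (real n * ((2 *\<^sub>R \<omega>) \<bullet> y))) + (LINT y:V|\<mu>. s\<^sup>2 / 2 * (cutoff y0 r y)\<^sup>2))"
      proof -
        have "set_integrable \<mu> V (\<lambda>y. (norm (p n y))\<^sup>2 - (norm (A n y))\<^sup>2)"
          "set_integrable \<mu> V (\<lambda>y. f y * cos (real n * ((2 *\<^sub>R \<omega>) \<bullet> y)))"
          "set_integrable \<mu> V (\<lambda>y. s\<^sup>2 / 2 * (cutoff y0 r y)\<^sup>2)"
          using r by (intro set_integrable_continuous_\<mu> Vb V continuous_intros pc[OF n] Ac fc cutoff_continuous; simp)+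
        then show ?thesis by (simp only: set_integral_add)
      qed
      also have "(LINT y:V|\<mu>. f y * cos (real n * ((2 *\<^sub>R \<omega>) \<bullet> y))) = (\<integral>y. f y * cos (real n * ((2 *\<^sub>R \<omega>) \<bullet> y)) \<partial>\<mu>)"
        unfolding set_lebesgue_integral_def using fz cube by (intro Bochner_Integration.integral_cong) (auto simp: indicator_def)
      finally show ?thesis using n by simp
    qed
    then have "\<forall>\<^sub>F n in sequentially. (LINT y:V|\<mu>. if n = 0 then 0 else (norm (p n y))\<^sup>2 - (norm (A n y))\<^sup>2)
       + ((\<integral>y. f y * cos (real n * ((2 *\<^sub>R \<omega>) \<bullet> y)) \<partial>\<mu>) + s\<^sup>2 / 2 * (LINT y:V|\<mu>. (cutoff y0 r y)\<^sup>2)) = (LINT y:V|\<mu>. (norm (p n y))\<^sup>2)"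
      unfolding eventually_sequentially by (intro exI[of _ 1]) (metis (no_types, lifting))
    moreover have "(\<lambda>n. (LINT y:V|\<mu>. if n = 0 then 0 else (norm (p n y))\<^sup>2 - (norm (A n y))\<^sup>2)
       + ((\<integral>y. f y * cos (real n * ((2 *\<^sub>R \<omega>) \<bullet> y)) \<partial>\<mu>) + s\<^sup>2 / 2 * (LINT y:V|\<mu>. (cutoff y0 r y)\<^sup>2))) \<longlonglongrightarrow> 0 + (0 + s\<^sup>2 / 2 * (LINT y:V|\<mu>. (cutoff y0 r y)\<^sup>2))"
      by (intro tendsto_add 1 2 tendsto_const)
    ultimately show ?thesis unfolding p_def[symmetric] using tendsto_cong[THEN iffD1] by fastforce
  qed
qed

end

lemma set_measurable_continuous_on:
  fixes f :: "'a::euclidean_space \<Rightarrow> 'b::euclidean_space"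
  assumes "A \<in> sets borel" "continuous_on A f"
  shows "set_borel_measurable borel A f"
  using assms borel_measurable_continuous_on_indicator[of A f] by (simp add: set_borel_measurable_def)

text \<open>
  How far the modulus of m is from its prescribed value; strict positivity makes room for a packet.
\<close>

definition gap :: "(spacetime \<Rightarrow> real) \<Rightarrow> (spacetime \<Rightarrow> state) \<Rightarrow> spacetime \<Rightarrow> real" where
  "gap q z y = q y - (norm (fst (z y)))\<^sup>2 / 2"

definition subsolution :: "spacetime set \<Rightarrow> (spacetime \<Rightarrow> real) \<Rightarrow> real \<Rightarrow> (spacetime \<Rightarrow> state) \<Rightarrow> bool" where
  "subsolution V q Q z \<longleftrightarrow> continuous_on V z \<and> continuous_on V q \<and> (\<forall>y\<in>V. energy (z y) < q y \<and> q y \<le> Q)"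

lemma energy_nonneg: "0 \<le> energy z" by (simp add: energy_def)

lemma gap_bounds:
  assumes "subsolution V q Q z" "y \<in> V"
  shows "0 < gap q z y" "gap q z y \<le> Q" "0 < q y" "q y \<le> Q"
proof -
  have e: "energy (z y) < q y" "q y \<le> Q" using assms by (auto simp: subsolution_def)
  show "0 < q y" "q y \<le> Q" using e energy_nonneg[of "z y"] by auto
  show "0 < gap q z y" using energy_bounds(1)[OF e(1) order_refl] by (simp add: gap_def)
  show "gap q z y \<le> Q" using e(2) zero_le_power2[of "norm (fst (z y))"] unfolding gap_def by linarith
qed

lemma gap_continuous: "subsolution V q Q z \<Longrightarrow> continuous_on V (gap q z)"
  unfolding gap_def[abs_def] subsolution_def by (auto intro!: continuous_intros)

context oscillation_measure
begin

text \<open>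
  The factor \<open>1 / (32 Q)\<close> is half the squared relative amplitude \<open>1 / (4 sqrt Q)\<close> of
  \<open>wave_direction\<close>; the remaining 4 pays for the variation of the gap on a small ball, c for the
  passage to the inner cube, and the exponential is the size of the cutoff there.
\<close>

definition gain :: "real \<Rightarrow> real" where "gain Q = (exp (- 4/3) ^ 3)\<^sup>2 * c / (128 * Q)"

lemma gap_integrable:
  assumes "subsolution V q Q z" "A \<subseteq> V" "A \<in> sets borel" "bounded A"
  shows "set_integrable \<mu> A (\<lambda>y. (gap q z y)\<^sup>2)"
proof (rule set_integrable_bounded_finite(1)[where B = "Q\<^sup>2"])
  have "continuous_on A (gap q z)" using gap_continuous[OF assms(1)] assms(2) continuous_on_subset by blast
  then show "set_borel_measurable \<mu> A (\<lambda>y. (gap q z y)\<^sup>2)"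
    unfolding set_measurable_\<mu> by (intro set_measurable_continuous_on assms continuous_intros)
  show "\<bar>(gap q z y)\<^sup>2\<bar> \<le> Q\<^sup>2" if "y \<in> A" for y
    using gap_bounds[OF assms(1), of y] that assms(2) by (auto intro!: power_mono)
qed (use assms finite_\<mu> in auto)

text \<open>
  The radius depends only on the continuity of z and q at \<open>y0\<close>, and the frequency is chosen last:
  this order permits a Vitali covering with these radii before the tolerances are fixed.
\<close>

lemma local_perturbation:
  assumes \<Omega>: "open \<Omega>" "bounded \<Omega>" and T: "0 < T"
    and V: "open V" "V \<subseteq> {-T<..<T} \<times> \<Omega>" and D: "open D" "D \<subseteq> V"
    and z: "subsolution V q Q z" and y0: "y0 \<in> Y" "y0 \<in> D"
  shows "\<exists>\<rho>>0. \<forall>r H \<delta>. 0 < r \<longrightarrow> r \<le> \<rho> \<longrightarrow> finite H \<longrightarrow> (\<forall>h\<in>H. continuous_on V h) \<longrightarrow> 0 < \<delta> \<longrightarrow> cball y0 r \<subseteq> D \<longrightarrow>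
     (\<exists>p. perturbation T \<Omega> D p \<and> (\<forall>y. y \<notin> cball y0 r \<longrightarrow> p y = 0) \<and> (\<forall>y\<in>V. energy (z y + p y) < q y) \<and>
       (\<forall>h\<in>H. \<bar>LINT y:V|\<mu>. h y \<bullet> fst (p y)\<bar> \<le> \<delta>) \<and>
       gain Q * (LINT y:cball y0 r|\<mu>. (gap q z y)\<^sup>2) - \<delta> \<le> (LINT y:V|\<mu>. (norm (fst (p y)))\<^sup>2))"
proof -
  have y0V: "y0 \<in> V" using y0 D by blast
  have bV: "bounded V" using \<Omega>(2) by (intro bounded_subset[OF _ V(2)] bounded_Times) auto
  have Vb: "V \<in> sets borel" using V by auto
  define g0 where "g0 = gap q z y0"
  have g0: "0 < g0" "g0 \<le> Q" and q0: "0 < q y0" "q y0 \<le> Q" using gap_bounds[OF z y0V] by (auto simp: g0_def)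
  have Q: "0 < Q" using g0 by simp
  define s where "s = g0 / (4 * sqrt Q)"
  have s: "0 < s" using g0 Q by (simp add: s_def)
  have e0: "energy (fst (z y0), snd (z y0)) < q y0" using z y0V by (auto simp: subsolution_def)
  obtain a b where ab: "norm a = 1" "\<And>\<sigma>. \<bar>\<sigma>\<bar> \<le> s \<Longrightarrow> energy (z y0 + \<sigma> *\<^sub>R (a, \<i> * of_real b * a\<^sup>2)) < q y0"
    using wave_direction[OF e0 q0] unfolding s_def g0_def gap_def by auto
  define w where "w = (a, \<i> * of_real b * a\<^sup>2)"
  define \<omega> where "\<omega> = (b, vector [Im a, - Re a] :: real^2)"
  (* the segment of admissible states is compact, so a whole neighbourhood of it is admissible *)
  define S where "S = (\<lambda>\<sigma>. (z y0 + \<sigma> *\<^sub>R w, q y0)) ` {-s..s}"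
  have S1: "compact S" unfolding S_def by (intro compact_continuous_image continuous_intros) auto
  have S2: "open {(Z::state, k::real). energy Z < k}"
    unfolding case_prod_beta' by (intro open_Collect_less continuous_intros continuous_on_compose2[OF energy_continuous]) auto
  have S3: "S \<subseteq> {(Z::state, k::real). energy Z < k}" using ab(2) by (auto simp: S_def w_def)
  obtain \<epsilon> where \<epsilon>: "\<epsilon> > 0" "(\<Union>x\<in>S. ball x \<epsilon>) \<subseteq> {(Z::state, k::real). energy Z < k}"
    using compact_subset_open_imp_ball_epsilon_subset[OF S1 S2 S3] by blast
  have cont: "isCont (\<lambda>y. (z y, q y)) y0" "isCont (gap q z) y0"
    using z gap_continuous[OF z] y0V V(1) by (auto simp: subsolution_def continuous_on_eq_continuous_at)
  obtain \<rho>1 where \<rho>1: "\<rho>1 > 0" "\<And>y. dist y y0 < \<rho>1 \<Longrightarrow> dist (z y, q y) (z y0, q y0) < \<epsilon> / 2"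
    using cont(1) \<epsilon>(1) unfolding continuous_at_eps_delta by (meson half_gt_zero)
  obtain \<rho>2 where \<rho>2: "\<rho>2 > 0" "\<And>y. dist y y0 < \<rho>2 \<Longrightarrow> dist (gap q z y) g0 < g0"
    using cont(2) g0 unfolding continuous_at_eps_delta g0_def by meson
  define \<rho> where "\<rho> = min \<rho>1 \<rho>2 / 2"
  have \<rho>: "\<rho> > 0" "\<rho> < \<rho>1" "\<rho> < \<rho>2" using \<rho>1 \<rho>2 by (auto simp: \<rho>_def min_def)
  show ?thesis
  proof (intro exI[of _ \<rho>] conjI allI impI \<rho>(1))
    fix r :: real and H :: "(spacetime \<Rightarrow> complex) set" and \<delta> :: real
    assume r: "0 < r" "r \<le> \<rho>" and H: "finite H" "\<forall>h\<in>H. continuous_on V h" and \<delta>: "0 < \<delta>" and rD: "cball y0 r \<subseteq> D"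
    have r2: "0 < r / 2" using r by simp
    have cb: "cube y0 (r / 2) \<subseteq> cball y0 r" using cube_subset_cball[of "r / 2" y0] r by simp
    have cV: "cube y0 (r / 2) \<subseteq> V" "cball y0 r \<subseteq> V" using cb rD D by auto
    obtain C where C: "C \<ge> 0" "\<And>N y. N \<ge> 1 \<Longrightarrow> norm (packet N \<omega> y0 (r / 2) s y -
       (s * cutoff y0 (r / 2) y * cos (N * (\<omega> \<bullet> y))) *\<^sub>R w) \<le> C / N"
      using packet_main[OF r2 ab(1), of \<omega> b y0 s] unfolding w_def \<omega>_def by blast
    let ?p = "\<lambda>n::nat. packet (real n) \<omega> y0 (r / 2) s"
    let ?K = "LINT y:V|\<mu>. (cutoff y0 (r / 2) y)\<^sup>2"
    note PI = packet_integrals[OF V(1) bV r2 cV(1) ab(1), of \<omega> b, unfolded \<omega>_def, OF refl, folded \<omega>_def]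
    have ev1: "\<forall>\<^sub>F n in sequentially. \<forall>h\<in>H. \<bar>LINT y:V|\<mu>. h y \<bullet> fst (?p n y)\<bar> \<le> \<delta>"
    proof (rule eventually_ball_finite[OF H(1)], rule ballI)
      fix h assume "h \<in> H"
      then have "(\<lambda>n. LINT y:V|\<mu>. h y \<bullet> fst (?p n y)) \<longlonglongrightarrow> 0" using PI(1) H(2) by blast
      from tendstoD[OF this \<delta>] show "\<forall>\<^sub>F n in sequentially. \<bar>LINT y:V|\<mu>. h y \<bullet> fst (?p n y)\<bar> \<le> \<delta>"
        by (rule eventually_mono) (simp add: dist_real_def)
    qed
    have ev2: "\<forall>\<^sub>F n in sequentially. s\<^sup>2 / 2 * ?K - \<delta> \<le> (LINT y:V|\<mu>. (norm (fst (?p n y)))\<^sup>2)"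
      using tendstoD[OF PI(2)[of s] \<delta>] by (rule eventually_mono) (auto simp: dist_real_def abs_less_iff)
    have ev3: "\<forall>\<^sub>F n in sequentially. 1 \<le> n \<and> C / real n < \<epsilon> / 2"
    proof (rule eventually_conj[OF eventually_ge_at_top])
      have "(\<lambda>n. C * inverse (real n)) \<longlonglongrightarrow> C * 0" by (intro tendsto_intros lim_inverse_n)
      then have "\<forall>\<^sub>F n in sequentially. C * inverse (real n) < \<epsilon> / 2" using \<epsilon>(1) by (intro order_tendstoD(2)[where a = "\<epsilon> / 2"]) auto
      then show "\<forall>\<^sub>F n in sequentially. C / real n < \<epsilon> / 2" by (simp only: divide_inverse)
    qed
    obtain n where n: "\<forall>h\<in>H. \<bar>LINT y:V|\<mu>. h y \<bullet> fst (?p n y)\<bar> \<le> \<delta>"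
      "s\<^sup>2 / 2 * ?K - \<delta> \<le> (LINT y:V|\<mu>. (norm (fst (?p n y)))\<^sup>2)" "1 \<le> n" "C / real n < \<epsilon> / 2"
      using eventually_happens'[OF sequentially_bot eventually_conj[OF ev1 eventually_conj[OF ev2 ev3]]] by (elim exE conjE) (rule that)
    have "perturbation T \<Omega> D (?p n)"
      using n(3) cb rD D V by (intro packet_perturbation[OF \<Omega> T r2]) auto
    moreover have "?p n y = 0" if "y \<notin> cball y0 r" for y
      using that cb by (intro packet_outside[OF r2]) auto
    moreover have "energy (z y + ?p n y) < q y" if "y \<in> V" for y
    proof (cases "y \<in> cube y0 (r / 2)")
      case True
      then have "dist y y0 < \<rho>1" using cb r \<rho> by (auto simp: dist_commute)
      then have d1: "dist (z y, q y) (z y0, q y0) < \<epsilon> / 2" by (rule \<rho>1(2))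
      define \<sigma> where "\<sigma> = s * cutoff y0 (r / 2) y * cos (real n * (\<omega> \<bullet> y))"
      have "\<bar>cutoff y0 (r / 2) y\<bar> * \<bar>cos (real n * (\<omega> \<bullet> y))\<bar> \<le> 1 * 1"
        using cutoff_range[of y0 "r / 2" y] by (intro mult_mono) auto
      then have "\<bar>\<sigma>\<bar> \<le> s" using s mult_left_mono[of _ 1 s] by (simp add: \<sigma>_def abs_mult mult.assoc)
      then have inS: "(z y0 + \<sigma> *\<^sub>R w, q y0) \<in> S" by (auto simp: S_def intro!: image_eqI[of _ _ \<sigma>])
      have d2: "norm (?p n y - \<sigma> *\<^sub>R w) < \<epsilon> / 2" unfolding \<sigma>_def
        by (rule order_le_less_trans[OF C(2) n(4)]) (use n(3) in simp)
      have "dist (z y0 + \<sigma> *\<^sub>R w, q y0) (z y + ?p n y, q y) = norm ((z y - z y0, q y - q y0) + (?p n y - \<sigma> *\<^sub>R w, 0))"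
        by (subst dist_commute) (simp add: dist_norm algebra_simps)
      also have "\<dots> \<le> norm (z y - z y0, q y - q y0) + norm (?p n y - \<sigma> *\<^sub>R w, 0::real)" by (rule norm_triangle_ineq)
      also have "norm (?p n y - \<sigma> *\<^sub>R w, 0::real) = norm (?p n y - \<sigma> *\<^sub>R w)" by (simp add: norm_Pair)
      also have "norm (z y - z y0, q y - q y0) = dist (z y, q y) (z y0, q y0)" by (simp add: dist_norm)
      finally have "dist (z y0 + \<sigma> *\<^sub>R w, q y0) (z y + ?p n y, q y) < \<epsilon>" using d1 d2 by linarith
      then have "(z y + ?p n y, q y) \<in> ball (z y0 + \<sigma> *\<^sub>R w, q y0) \<epsilon>" by (simp only: mem_ball)
      then show ?thesis using \<epsilon>(2) inS by blast
    next
      case False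
      then show ?thesis using packet_outside[OF r2 False] z that by (simp add: subsolution_def)
    qed
    moreover have "gain Q * (LINT y:cball y0 r|\<mu>. (gap q z y)\<^sup>2) \<le> s\<^sup>2 / 2 * ?K"
    proof -
      let ?k = "exp (- 4/3) ^ 3 :: real"
      have cc: "cube y0 (r / 4) \<in> sets borel" using compact_cube by (simp add: borel_compact)
      have bcc: "bounded (cube y0 (r / 4))" using compact_cube compact_imp_bounded by blast
      have cV4: "cube y0 (r / 4) \<subseteq> V" using cV(1) r by (auto simp: cube_def)
      have A: "(LINT y:cball y0 r|\<mu>. (gap q z y)\<^sup>2) \<le> 4 * g0\<^sup>2 * measure \<mu> (cball y0 r)"
      proof -
        have "(gap q z y)\<^sup>2 \<le> 4 * g0\<^sup>2" if "y \<in> cball y0 r" for y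
        proof -
          have "dist y y0 < \<rho>2" using that r \<rho> by (simp add: dist_commute)
          then have "gap q z y \<le> 2 * g0" using \<rho>2(2) by (fastforce simp: dist_real_def)
          moreover have "0 \<le> gap q z y" using gap_bounds(1)[OF z, of y] that cV by auto
          ultimately have "(gap q z y)\<^sup>2 \<le> (2 * g0)\<^sup>2" by (rule power_mono)
          then show ?thesis by (simp add: power_mult_distrib)
        qed
        moreover have "set_borel_measurable \<mu> (cball y0 r) (\<lambda>y. (gap q z y)\<^sup>2)"
          using gap_integrable[OF z cV(2)] by (auto simp: set_integrable_def set_borel_measurable_def)
        ultimately have "\<bar>LINT y:cball y0 r|\<mu>. (gap q z y)\<^sup>2\<bar> \<le> 4 * g0\<^sup>2 * measure \<mu> (cball y0 r)"
          using finite_\<mu>[OF bounded_cball, of y0 r] by (intro set_integrable_bounded_finite(2)) auto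
        then show ?thesis by simp
      qed
      have B: "?k\<^sup>2 * measure \<mu> (cube y0 (r / 4)) \<le> ?K"
      proof -
        have i: "integrable \<mu> (\<lambda>y. indicator (cube y0 (r / 4)) y * ?k\<^sup>2)"
          using cc finite_\<mu>[OF bcc cc] by (intro integrable_mult_left integrable_real_indicator) auto
        have "set_integrable \<mu> V (\<lambda>y. (cutoff y0 (r / 2) y)\<^sup>2)"
          using r by (intro set_integrable_continuous_\<mu> Vb bV continuous_intros cutoff_continuous) auto
        then have "(\<integral>y. indicator (cube y0 (r / 4)) y * ?k\<^sup>2 \<partial>\<mu>) \<le> ?K"
          unfolding set_lebesgue_integral_def set_integrable_def
        proof (rule integral_mono[OF i])
          fix y
          have "?k\<^sup>2 \<le> (cutoff y0 (r / 2) y)\<^sup>2" if "y \<in> cube y0 (r / 4)"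
            using cutoff_inner[OF r2, of y y0] that by (intro power_mono) auto
          then show "indicator (cube y0 (r / 4)) y * ?k\<^sup>2 \<le> indicator V y *\<^sub>R (cutoff y0 (r / 2) y)\<^sup>2"
            using cV4 by (auto simp: indicator_def)
        qed
        then show ?thesis using cc by (simp add: mult.commute)
      qed
      have "gain Q * (LINT y:cball y0 r|\<mu>. (gap q z y)\<^sup>2) \<le> gain Q * (4 * g0\<^sup>2 * measure \<mu> (cball y0 r))"
        using A c_pos Q by (intro mult_left_mono) (auto simp: gain_def)
      also have "\<dots> = g0\<^sup>2 / (32 * Q) * (?k\<^sup>2 * (c * measure \<mu> (cball y0 r)))" by (simp add: gain_def)
      also have "\<dots> \<le> g0\<^sup>2 / (32 * Q) * (?k\<^sup>2 * measure \<mu> (cube y0 (r / 4)))"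
        using doubling[OF y0(1) r(1)] Q by (intro mult_left_mono) auto
      also have "\<dots> \<le> g0\<^sup>2 / (32 * Q) * ?K" using B Q by (intro mult_left_mono) auto
      also have "g0\<^sup>2 / (32 * Q) = s\<^sup>2 / 2" using Q by (simp add: s_def power_divide power_mult_distrib)
      finally show ?thesis .
    qed
    ultimately show "\<exists>p. perturbation T \<Omega> D p \<and> (\<forall>y. y \<notin> cball y0 r \<longrightarrow> p y = 0) \<and> (\<forall>y\<in>V. energy (z y + p y) < q y) \<and>
       (\<forall>h\<in>H. \<bar>LINT y:V|\<mu>. h y \<bullet> fst (p y)\<bar> \<le> \<delta>) \<and>
       gain Q * (LINT y:cball y0 r|\<mu>. (gap q z y)\<^sup>2) - \<delta> \<le> (LINT y:V|\<mu>. (norm (fst (p y)))\<^sup>2)"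
      using n(1,2) by (intro exI[of _ "?p n"]) auto
  qed
qed

lemma perturbation_pairing_integrable:
  assumes V: "open V" "bounded V" and p: "perturbation T \<Omega> D p" "D \<subseteq> V" and h: "continuous_on V h"
  shows "set_integrable \<mu> V (\<lambda>y. h y \<bullet> fst (p y))"
proof -
  have Vb: "V \<in> sets borel" using V by auto
  obtain K where K: "compact K" "K \<subseteq> D" "\<forall>y. y \<notin> K \<longrightarrow> p y = 0" using p(1) unfolding perturbation_def by blast
  have pc: "continuous_on UNIV p" using p(1) unfolding perturbation_def by blast
  have "continuous_on UNIV (\<lambda>y. if y \<in> V then h y \<bullet> fst (p y) else 0)"
  proof (rule continuous_extension_by_zero[OF V(1) _ K(1)])
    show "continuous_on V (\<lambda>y. h y \<bullet> fst (p y))"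
      by (intro continuous_on_inner continuous_on_fst h continuous_on_subset[OF pc]) auto
    show "K \<subseteq> V" using K(2) p(2) by blast
    show "h y \<bullet> fst (p y) = 0" if "y \<in> V - K" for y using K(3)[rule_format, of y] that by simp
  qed
  then have "set_integrable \<mu> V (\<lambda>y. if y \<in> V then h y \<bullet> fst (p y) else 0)" by (intro set_integrable_continuous_\<mu> Vb V)
  then show ?thesis by (auto intro: set_integrable_cong[OF refl refl, THEN iffD1, rotated])
qed

text \<open>
  Packets on disjoint balls do not interact, so the strict inequality for the energy survives the superposition
  and the gains add up; the uncovered part of D is small enough for its gap to be negligible.
\<close>

lemma perturbation_step:
  assumes \<Omega>: "open \<Omega>" "bounded \<Omega>" and T: "0 < T"
    and V: "open V" "V \<subseteq> {-T<..<T} \<times> \<Omega>" and D: "open D" "D \<subseteq> V" "measure \<mu> (V - D) = 0"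
    and z: "subsolution V q Q z" and Q: "0 < Q"
    and H: "finite H" "\<And>h. h \<in> H \<Longrightarrow> continuous_on V h" and \<delta>: "0 < \<delta>"
  shows "\<exists>p. perturbation T \<Omega> D p \<and> (\<forall>y\<in>V. energy (z y + p y) < q y) \<and>
       (\<forall>h\<in>H. \<bar>LINT y:V|\<mu>. h y \<bullet> fst (p y)\<bar> \<le> \<delta>) \<and>
       gain Q * (LINT y:V|\<mu>. (gap q z y)\<^sup>2) - \<delta> \<le> (LINT y:V|\<mu>. (norm (fst (p y)))\<^sup>2)"
proof -
  have bV: "bounded V" using \<Omega>(2) by (intro bounded_subset[OF _ V(2)] bounded_Times) auto
  have bD: "bounded D" using bV D(2) bounded_subset by blast
  have Vb: "V \<in> sets borel" "D \<in> sets borel" using V D by auto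
  have gp: "0 < gain Q" using Q c_pos by (simp add: gain_def)
  define P where "P y0 \<rho> \<longleftrightarrow> \<rho> > 0 \<and> (\<forall>r H \<delta>. 0 < r \<longrightarrow> r \<le> \<rho> \<longrightarrow> finite H \<longrightarrow> (\<forall>h\<in>H. continuous_on V h) \<longrightarrow> 0 < \<delta> \<longrightarrow> cball y0 r \<subseteq> D \<longrightarrow>
     (\<exists>p. perturbation T \<Omega> D p \<and> (\<forall>y. y \<notin> cball y0 r \<longrightarrow> p y = 0) \<and> (\<forall>y\<in>V. energy (z y + p y) < q y) \<and>
       (\<forall>h\<in>H. \<bar>LINT y:V|\<mu>. h y \<bullet> fst (p y)\<bar> \<le> \<delta>) \<and>
       gain Q * (LINT y:cball y0 r|\<mu>. (gap q z y)\<^sup>2) - \<delta> \<le> (LINT y:V|\<mu>. (norm (fst (p y)))\<^sup>2)))" for y0 \<rho>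
  have "\<exists>\<rho>. P y0 \<rho>" if "y0 \<in> Y" "y0 \<in> D" for y0
    using local_perturbation[OF \<Omega> T V D(1,2) z that] unfolding P_def by blast
  then obtain \<rho> where \<rho>: "\<And>y0. y0 \<in> Y \<Longrightarrow> y0 \<in> D \<Longrightarrow> P y0 (\<rho> y0)" by metis
  define \<rho>' where "\<rho>' y = (if y \<in> Y \<inter> D then \<rho> y else 1)" for y
  have \<rho>': "\<rho>' y > 0" for y using \<rho> by (auto simp: \<rho>'_def P_def)
  define \<epsilon> where "\<epsilon> = \<delta> / (2 * gain Q * Q\<^sup>2)"
  have \<epsilon>: "\<epsilon> > 0" using \<delta> gp Q by (simp add: \<epsilon>_def)
  have "\<exists>C r. finite C \<and> C \<subseteq> Y \<inter> D \<and> (\<forall>y\<in>C. 0 < r y \<and> r y \<le> \<rho>' y \<and> cball y (r y) \<subseteq> D) \<and>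
      disjoint_family_on (\<lambda>y. cball y (r y)) C \<and> measure \<mu> (D - (\<Union>y\<in>C. cball y (r y))) \<le> \<epsilon>"
    by (rule vitali[OF D(1) bD \<rho>' \<epsilon>])
  then obtain C r where C0: "finite C" "C \<subseteq> Y \<inter> D" "\<forall>y\<in>C. 0 < r y \<and> r y \<le> \<rho>' y \<and> cball y (r y) \<subseteq> D"
    "disjoint_family_on (\<lambda>y. cball y (r y)) C" "measure \<mu> (D - (\<Union>y\<in>C. cball y (r y))) \<le> \<epsilon>"
    by (elim exE conjE) (rule that)
  note C = C0(1,2) C0(3)[rule_format] C0(4,5)
  define \<delta>' where "\<delta>' = \<delta> / (2 * (1 + real (card C)))"
  have \<delta>': "\<delta>' > 0" "real (card C) * \<delta>' \<le> \<delta> / 2" using \<delta> by (auto simp: \<delta>'_def field_simps)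
  define R where "R y0 p \<longleftrightarrow> perturbation T \<Omega> D p \<and> (\<forall>y. y \<notin> cball y0 (r y0) \<longrightarrow> p y = 0) \<and> (\<forall>y\<in>V. energy (z y + p y) < q y) \<and>
       (\<forall>h\<in>H. \<bar>LINT y:V|\<mu>. h y \<bullet> fst (p y)\<bar> \<le> \<delta>') \<and>
       gain Q * (LINT y:cball y0 (r y0)|\<mu>. (gap q z y)\<^sup>2) - \<delta>' \<le> (LINT y:V|\<mu>. (norm (fst (p y)))\<^sup>2)" for y0 p
  have "\<exists>p. R y0 p" if "y0 \<in> C" for y0
  proof -
    have "P y0 (\<rho> y0)" "0 < r y0" "r y0 \<le> \<rho> y0" "cball y0 (r y0) \<subseteq> D"
    proof -
      have "y0 \<in> Y \<inter> D" using C(2) that by blast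
      then show "P y0 (\<rho> y0)" "0 < r y0" "r y0 \<le> \<rho> y0" "cball y0 (r y0) \<subseteq> D"
        using \<rho>[of y0] C(3)[OF that] unfolding \<rho>'_def by simp_all
    qed
    then show ?thesis using H \<delta>'(1) unfolding P_def R_def by blast
  qed
  then obtain p where R: "\<And>i. i \<in> C \<Longrightarrow> R i (p i)" by metis
  have p: "\<And>i. i \<in> C \<Longrightarrow> perturbation T \<Omega> D (p i)" "\<And>i y. i \<in> C \<Longrightarrow> y \<notin> cball i (r i) \<Longrightarrow> p i y = 0"
    "\<And>i y. i \<in> C \<Longrightarrow> y \<in> V \<Longrightarrow> energy (z y + p i y) < q y"
    "\<And>i h. i \<in> C \<Longrightarrow> h \<in> H \<Longrightarrow> \<bar>LINT y:V|\<mu>. h y \<bullet> fst (p i y)\<bar> \<le> \<delta>'"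
    "\<And>i. i \<in> C \<Longrightarrow> gain Q * (LINT y:cball i (r i)|\<mu>. (gap q z y)\<^sup>2) - \<delta>' \<le> (LINT y:V|\<mu>. (norm (fst (p i y)))\<^sup>2)"
    using R unfolding R_def by blast+
  define s where "s y = (\<Sum>i\<in>C. p i y)" for y
  have single: "(\<forall>i\<in>C. p i y = 0) \<or> (\<exists>i\<in>C. \<forall>j\<in>C - {i}. p j y = 0)" for y
  proof (cases "\<exists>i\<in>C. y \<in> cball i (r i)")
    case True
    then obtain i where i: "i \<in> C" "y \<in> cball i (r i)" by blast
    have "p j y = 0" if "j \<in> C - {i}" for j
    proof -
      have "cball i (r i) \<inter> cball j (r j) = {}" using C(4) i(1) that by (auto simp: disjoint_family_on_def)
      then show ?thesis using p(2)[of j y] i(2) that by blast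
    qed
    then show ?thesis using i(1) by blast
  next
    case False then show ?thesis using p(2) by blast
  qed
  have sum1: "(\<Sum>j\<in>C. f j) = f i" if "i \<in> C" "\<forall>j\<in>C - {i}. f j = 0" for f :: "spacetime \<Rightarrow> 'z::comm_monoid_add" and i
    using that C(1) by (simp add: sum.remove)
  have pc: "continuous_on UNIV (\<lambda>y. fst (p i y))" if "i \<in> C" for i
    using p(1)[OF that] by (auto simp: perturbation_def intro!: continuous_intros)
  have "perturbation T \<Omega> D s" unfolding s_def[abs_def] by (rule perturbation_sum[OF \<Omega> C(1) p(1)])
  moreover have "energy (z y + s y) < q y" if "y \<in> V" for y
    using single[of y]
  proof (elim disjE bexE)
    assume "\<forall>i\<in>C. p i y = 0"
    then show ?thesis using z that by (simp add: s_def subsolution_def)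
  next
    fix i assume i: "i \<in> C" "\<forall>j\<in>C - {i}. p j y = 0"
    then have "s y = p i y" unfolding s_def by (intro sum1) auto
    then show ?thesis using p(3)[OF i(1) that] by simp
  qed
  moreover have "\<bar>LINT y:V|\<mu>. h y \<bullet> fst (s y)\<bar> \<le> \<delta>" if h: "h \<in> H" for h
  proof -
    have int: "set_integrable \<mu> V (\<lambda>y. h y \<bullet> fst (p i y))" if "i \<in> C" for i
      by (rule perturbation_pairing_integrable[OF V(1) bV p(1)[OF that] D(2) H(2)[OF h]])
    have "(LINT y:V|\<mu>. h y \<bullet> fst (s y)) = (LINT y:V|\<mu>. (\<Sum>i\<in>C. h y \<bullet> fst (p i y)))" by (simp add: s_def fst_sum inner_sum_right)
    also have "\<dots> = (\<Sum>i\<in>C. LINT y:V|\<mu>. h y \<bullet> fst (p i y))"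
      using int unfolding set_lebesgue_integral_def set_integrable_def by (simp only: scaleR_sum_right Bochner_Integration.integral_sum)
    also have "\<bar>\<dots>\<bar> \<le> (\<Sum>i\<in>C. \<delta>')" by (rule order_trans[OF sum_abs sum_mono]) (use p(4) h in auto)
    also have "\<dots> \<le> \<delta>" using \<delta>' \<delta> by simp
    finally show ?thesis .
  qed
  moreover have "gain Q * (LINT y:V|\<mu>. (gap q z y)\<^sup>2) - \<delta> \<le> (LINT y:V|\<mu>. (norm (fst (s y)))\<^sup>2)"
  proof -
    have sq: "(norm (fst (s y)))\<^sup>2 = (\<Sum>i\<in>C. (norm (fst (p i y)))\<^sup>2)" for y
      using single[of y]
    proof (elim disjE bexE)
      assume "\<forall>i\<in>C. p i y = 0"
      then show ?thesis by (simp add: s_def)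
    next
      fix i assume i: "i \<in> C" "\<forall>j\<in>C - {i}. p j y = 0"
      then have "s y = p i y" unfolding s_def by (intro sum1) auto
      moreover have "(\<Sum>i\<in>C. (norm (fst (p i y)))\<^sup>2) = (norm (fst (p i y)))\<^sup>2" using i by (intro sum1) auto
      ultimately show ?thesis by simp
    qed
    have int: "set_integrable \<mu> V (\<lambda>y. (norm (fst (p i y)))\<^sup>2)" if "i \<in> C" for i
      by (intro set_integrable_continuous_\<mu> Vb bV continuous_on_power continuous_on_norm pc[OF that])
    have eq: "(LINT y:V|\<mu>. (norm (fst (s y)))\<^sup>2) = (\<Sum>i\<in>C. LINT y:V|\<mu>. (norm (fst (p i y)))\<^sup>2)"
      unfolding sq using int unfolding set_lebesgue_integral_def set_integrable_def by (simp only: scaleR_sum_right Bochner_Integration.integral_sum)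
    have cov: "(LINT y:V|\<mu>. (gap q z y)\<^sup>2) \<le> (\<Sum>i\<in>C. LINT y:cball i (r i)|\<mu>. (gap q z y)\<^sup>2) + Q\<^sup>2 * \<epsilon>"
    proof -
      let ?E = "D - (\<Union>y\<in>C. cball y (r y))"
      have Eb: "?E \<in> sets borel" "V - D \<in> sets borel" using Vb C(1)
        by (auto intro!: sets.Diff sets.finite_UN)
      have fin: "emeasure \<mu> ?E < \<infinity>" "emeasure \<mu> (V - D) < \<infinity>"
        using finite_\<mu>[OF bounded_subset[OF bD, of ?E] Eb(1)] finite_\<mu>[OF bounded_subset[OF bV, of "V - D"] Eb(2)] by auto
      have ci: "integrable \<mu> (\<lambda>y. indicator (cball i (r i)) y *\<^sub>R (gap q z y)\<^sup>2)" if "i \<in> C" for i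
        using gap_integrable[OF z, of "cball i (r i)"] C(3)[OF that] D(2) by (auto simp: set_integrable_def)
      have i1: "integrable \<mu> (\<lambda>y. indicator ?E y * Q\<^sup>2)" "integrable \<mu> (\<lambda>y. indicator (V - D) y * Q\<^sup>2)"
        using Eb fin by (auto intro!: integrable_mult_left integrable_real_indicator)
      have "(LINT y:V|\<mu>. (gap q z y)\<^sup>2) \<le> (\<integral>y. (\<Sum>i\<in>C. indicator (cball i (r i)) y *\<^sub>R (gap q z y)\<^sup>2) + (indicator ?E y * Q\<^sup>2 + indicator (V - D) y * Q\<^sup>2) \<partial>\<mu>)"
        unfolding set_lebesgue_integral_def
      proof (rule integral_mono)
        show "integrable \<mu> (\<lambda>y. indicator V y *\<^sub>R (gap q z y)\<^sup>2)" using gap_integrable[OF z order_refl Vb(1) bV] by (simp add: set_integrable_def)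
        show "integrable \<mu> (\<lambda>y. (\<Sum>i\<in>C. indicator (cball i (r i)) y *\<^sub>R (gap q z y)\<^sup>2) + (indicator ?E y * Q\<^sup>2 + indicator (V - D) y * Q\<^sup>2))"
          by (intro Bochner_Integration.integrable_add Bochner_Integration.integrable_sum ci i1)
        fix y
        have nn: "0 \<le> (\<Sum>i\<in>C. indicator (cball i (r i)) y *\<^sub>R (gap q z y)\<^sup>2)" by (intro sum_nonneg) auto
        show "indicator V y *\<^sub>R (gap q z y)\<^sup>2 \<le> (\<Sum>i\<in>C. indicator (cball i (r i)) y *\<^sub>R (gap q z y)\<^sup>2) + (indicator ?E y * Q\<^sup>2 + indicator (V - D) y * Q\<^sup>2)"
        proof (cases "\<exists>i\<in>C. y \<in> cball i (r i)")
          case True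
          then obtain i where i: "i \<in> C" "y \<in> cball i (r i)" by blast
          have "indicator (cball i (r i)) y *\<^sub>R (gap q z y)\<^sup>2 \<le> (\<Sum>i\<in>C. indicator (cball i (r i)) y *\<^sub>R (gap q z y)\<^sup>2)"
            by (rule member_le_sum[OF i(1)]) (use C(1) in auto)
          then have "(gap q z y)\<^sup>2 \<le> (\<Sum>i\<in>C. indicator (cball i (r i)) y *\<^sub>R (gap q z y)\<^sup>2)" using i(2) by simp
          moreover have "0 \<le> indicator ?E y * Q\<^sup>2 + indicator (V - D) y * Q\<^sup>2" by simp
          moreover have "indicator V y *\<^sub>R (gap q z y)\<^sup>2 \<le> (gap q z y)\<^sup>2" by (simp add: indicator_def)
          ultimately show ?thesis by linarith
        next
          case False
          show ?thesis
          proof (cases "y \<in> V")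
            case True
            then have "(gap q z y)\<^sup>2 \<le> Q\<^sup>2" using gap_bounds[OF z, of y] by (intro power_mono) auto
            moreover have "indicator ?E y * Q\<^sup>2 + indicator (V - D) y * Q\<^sup>2 = Q\<^sup>2" using False True by (auto simp: indicator_def)
            ultimately show ?thesis using nn True by simp
          next
            case F: False
            then show ?thesis using nn by simp
          qed
        qed
      qed
      also have "\<dots> = (\<Sum>i\<in>C. LINT y:cball i (r i)|\<mu>. (gap q z y)\<^sup>2) + (measure \<mu> ?E * Q\<^sup>2 + measure \<mu> (V - D) * Q\<^sup>2)"
        using ci i1 Eb unfolding set_lebesgue_integral_def
        by (simp add: Bochner_Integration.integral_add Bochner_Integration.integral_sum Bochner_Integration.integrable_sum)
      also have "\<dots> \<le> (\<Sum>i\<in>C. LINT y:cball i (r i)|\<mu>. (gap q z y)\<^sup>2) + Q\<^sup>2 * \<epsilon>"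
        using C(5) D(3) Q by (simp add: mult.commute)
      finally show ?thesis .
    qed
    have "gain Q * (LINT y:V|\<mu>. (gap q z y)\<^sup>2) \<le> gain Q * ((\<Sum>i\<in>C. LINT y:cball i (r i)|\<mu>. (gap q z y)\<^sup>2) + Q\<^sup>2 * \<epsilon>)"
      using cov gp by (intro mult_left_mono) auto
    also have "\<dots> = (\<Sum>i\<in>C. gain Q * (LINT y:cball i (r i)|\<mu>. (gap q z y)\<^sup>2)) + \<delta> / 2"
      using gp Q by (simp add: distrib_left sum_distrib_left \<epsilon>_def)
    also have "(\<Sum>i\<in>C. gain Q * (LINT y:cball i (r i)|\<mu>. (gap q z y)\<^sup>2)) \<le> (\<Sum>i\<in>C. (LINT y:V|\<mu>. (norm (fst (p i y)))\<^sup>2) + \<delta>')"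
      by (intro sum_mono) (use p(5) in force)
    also have "\<dots> = (LINT y:V|\<mu>. (norm (fst (s y)))\<^sup>2) + real (card C) * \<delta>'" by (simp add: sum.distrib eq)
    finally show ?thesis using \<delta>' by simp
  qed
  ultimately show ?thesis by blast
qed

end

section \<open>Saturating the constraint\<close>

context oscillation_measure
begin

lemma set_integrable_cb:
  fixes f :: "spacetime \<Rightarrow> real"
  assumes "V \<in> sets borel" "bounded V" "continuous_on V f" "\<And>y. y \<in> V \<Longrightarrow> \<bar>f y\<bar> \<le> B"
  shows "set_integrable \<mu> V f" "\<bar>LINT y:V|\<mu>. f y\<bar> \<le> B * measure \<mu> V"
  using assms finite_\<mu>[OF assms(2,1)]
  by (intro set_integrable_bounded_finite; auto simp: set_measurable_\<mu> intro!: set_measurable_continuous_on)+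

text \<open>
  Each perturbation is chosen almost orthogonal to all earlier fields; the list of these fields is carried along
  as the second component of the recursion.
\<close>

lemma oscillation_sequence:
  assumes \<Omega>: "open \<Omega>" "bounded \<Omega>" and T: "0 < T"
    and V: "open V" "V \<subseteq> {-T<..<T} \<times> \<Omega>"
    and D: "\<And>k. open (D k)" "\<And>k. D k \<subseteq> V" "\<And>k. measure \<mu> (V - D k) = 0"
    and z: "subsolution V q Q z" and Q: "0 < Q"
    and H: "finite H" "\<forall>h\<in>H. continuous_on V h" and \<delta>: "\<And>k. 0 < \<delta> k"
  shows "\<exists>w :: nat \<Rightarrow> spacetime \<Rightarrow> state. w 0 = (\<lambda>_. 0) \<and> (\<forall>k. subsolution V q Q (\<lambda>y. z y + w k y)) \<and>
    (\<forall>k. perturbation T \<Omega> (D k) (\<lambda>y. w (Suc k) y - w k y)) \<and>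
    (\<forall>k. \<forall>h\<in>H. \<bar>LINT y:V|\<mu>. h y \<bullet> fst (w (Suc k) y - w k y)\<bar> \<le> \<delta> k) \<and>
    (\<forall>k. \<forall>j\<le>k. \<bar>LINT y:V|\<mu>. fst (z y + w j y) \<bullet> fst (w (Suc k) y - w k y)\<bar> \<le> \<delta> k) \<and>
    (\<forall>k. gain Q * (LINT y:V|\<mu>. (gap q (\<lambda>y. z y + w k y) y)\<^sup>2) - \<delta> k \<le> (LINT y:V|\<mu>. (norm (fst (w (Suc k) y - w k y)))\<^sup>2))"
proof -
  define P where "P n x \<longleftrightarrow> (n = 0 \<longrightarrow> x = (\<lambda>_. 0, insert (\<lambda>y. fst (z y)) H)) \<and> subsolution V q Q (\<lambda>y. z y + fst x y) \<and> finite (snd x) \<and> (\<forall>h\<in>snd x. continuous_on V h)"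
    for n :: nat and x :: "(spacetime \<Rightarrow> state) \<times> (spacetime \<Rightarrow> complex) set"
  define R where "R n x x' \<longleftrightarrow> perturbation T \<Omega> (D n) (\<lambda>y. fst x' y - fst x y) \<and>
     (\<forall>h\<in>snd x. \<bar>LINT y:V|\<mu>. h y \<bullet> fst (fst x' y - fst x y)\<bar> \<le> \<delta> n) \<and>
     gain Q * (LINT y:V|\<mu>. (gap q (\<lambda>y. z y + fst x y) y)\<^sup>2) - \<delta> n \<le> (LINT y:V|\<mu>. (norm (fst (fst x' y - fst x y)))\<^sup>2) \<and>
     snd x' = insert (\<lambda>y. fst (z y + fst x' y)) (snd x)"
    for n :: nat and x x' :: "(spacetime \<Rightarrow> state) \<times> (spacetime \<Rightarrow> complex) set"
  have "\<exists>x. \<forall>n. P n (x n) \<and> R n (x n) (x (Suc n))"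
  proof (rule dependent_nat_choice)
    have "continuous_on V (\<lambda>y. fst (z y))" using z by (auto simp: subsolution_def intro!: continuous_intros)
    then show "\<exists>x. P 0 x" using z H by (intro exI[of _ "(\<lambda>_. 0, insert (\<lambda>y. fst (z y)) H)"]) (auto simp: P_def)
    fix x n assume x: "P n x"
    obtain w G where wG: "x = (w, G)" by (cases x)
    have sub: "subsolution V q Q (\<lambda>y. z y + w y)" and G: "finite G" "\<And>h. h \<in> G \<Longrightarrow> continuous_on V h" using x by (auto simp: P_def wG)
    have "\<exists>p. perturbation T \<Omega> (D n) p \<and> (\<forall>y\<in>V. energy ((z y + w y) + p y) < q y) \<and>
       (\<forall>h\<in>G. \<bar>LINT y:V|\<mu>. h y \<bullet> fst (p y)\<bar> \<le> \<delta> n) \<and>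
       gain Q * (LINT y:V|\<mu>. (gap q (\<lambda>y. z y + w y) y)\<^sup>2) - \<delta> n \<le> (LINT y:V|\<mu>. (norm (fst (p y)))\<^sup>2)"
      by (rule perturbation_step[OF \<Omega> T V D sub Q G \<delta>])
    then obtain p where p: "perturbation T \<Omega> (D n) p" "\<forall>y\<in>V. energy ((z y + w y) + p y) < q y"
       "\<forall>h\<in>G. \<bar>LINT y:V|\<mu>. h y \<bullet> fst (p y)\<bar> \<le> \<delta> n"
       "gain Q * (LINT y:V|\<mu>. (gap q (\<lambda>y. z y + w y) y)\<^sup>2) - \<delta> n \<le> (LINT y:V|\<mu>. (norm (fst (p y)))\<^sup>2)"
      by (elim exE conjE) (rule that)
    have "continuous_on V p" using p(1) continuous_on_subset unfolding perturbation_def by blast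
    then have sub': "subsolution V q Q (\<lambda>y. z y + (w y + p y))"
      using sub p(2) by (auto simp: subsolution_def add.assoc[symmetric] intro!: continuous_on_add)
    then have "continuous_on V (\<lambda>y. fst (z y + (w y + p y)))" unfolding subsolution_def by (intro continuous_on_fst) blast
    then have "P (Suc n) (\<lambda>y. w y + p y, insert (\<lambda>y. fst (z y + (w y + p y))) G)"
      using sub' G by (simp add: P_def)
    moreover have "R n x (\<lambda>y. w y + p y, insert (\<lambda>y. fst (z y + (w y + p y))) G)"
      using p by (simp add: R_def wG)
    ultimately show "\<exists>x'. P (Suc n) x' \<and> R n x x'" by blast
  qed
  then obtain x where x: "\<And>n. P n (x n)" "\<And>n. R n (x n) (x (Suc n))" by blast
  have mem: "(\<lambda>y. fst (z y + fst (x j) y)) \<in> snd (x k)" if "j \<le> k" for j k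
    using that
  proof (induction k)
    case 0 then show ?case using x(1)[of 0] by (simp add: P_def)
  next
    case (Suc k)
    then show ?case using x(2)[of k] by (cases "j = Suc k") (auto simp: R_def)
  qed
  have memH: "H \<subseteq> snd (x k)" for k
  proof (induction k)
    case 0 then show ?case using x(1)[of 0] by (auto simp: P_def)
  next
    case (Suc k) then show ?case using x(2)[of k] by (auto simp: R_def)
  qed
  show ?thesis
  proof (intro exI[of _ "\<lambda>k. fst (x k)"] conjI allI ballI impI)
    show "fst (x 0) = (\<lambda>_. 0)" using x(1)[of 0] by (simp add: P_def)
    fix k
    show "subsolution V q Q (\<lambda>y. z y + fst (x k) y)" using x(1)[of k] unfolding P_def by blast
    show "perturbation T \<Omega> (D k) (\<lambda>y. fst (x (Suc k)) y - fst (x k) y)" using x(2)[of k] unfolding R_def by blast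
    show "gain Q * (LINT y:V|\<mu>. (gap q (\<lambda>y. z y + fst (x k) y) y)\<^sup>2) - \<delta> k \<le> (LINT y:V|\<mu>. (norm (fst (fst (x (Suc k)) y - fst (x k) y)))\<^sup>2)"
      using x(2)[of k] unfolding R_def by blast
    show "\<bar>LINT y:V|\<mu>. h y \<bullet> fst (fst (x (Suc k)) y - fst (x k) y)\<bar> \<le> \<delta> k" if "h \<in> H" for h
      using x(2)[of k] memH[of k] that unfolding R_def by blast
    show "\<bar>LINT y:V|\<mu>. fst (z y + fst (x j) y) \<bullet> fst (fst (x (Suc k)) y - fst (x k) y)\<bar> \<le> \<delta> k" if "j \<le> k" for j
      using x(2)[of k] mem[OF that] unfolding R_def by fastforce
  qed
qed

text \<open>
  The square norms are bounded and, up to the summable errors, increase by the squared norms of the increments.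
  So they converge, which makes the gains tend to 0 and, by almost orthogonality, the sequence Cauchy.
\<close>

lemma square_integrable_Cauchy:
  fixes m :: "nat \<Rightarrow> spacetime \<Rightarrow> complex"
  assumes V: "V \<in> sets borel" "bounded V" and m: "\<And>k. continuous_on V (m k)" "\<And>k y. y \<in> V \<Longrightarrow> norm (m k y) \<le> M"
    and orth: "\<And>j k. j \<le> k \<Longrightarrow> \<bar>LINT y:V|\<mu>. m j y \<bullet> (m (Suc k) y - m k y)\<bar> \<le> \<delta> k"
    and \<delta>: "summable \<delta>" "\<And>k. 0 \<le> \<delta> k"
    and incr: "\<And>k. G k - \<delta> k \<le> (LINT y:V|\<mu>. (norm (m (Suc k) y - m k y))\<^sup>2)" "\<And>k. 0 \<le> G k"
  shows "G \<longlonglongrightarrow> 0" and "\<And>e. e > 0 \<Longrightarrow> \<exists>N. \<forall>k\<ge>N. \<forall>l\<ge>N. (LINT y:V|\<mu>. (norm (m k y - m l y))\<^sup>2) < e"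
proof -
  have M: "0 \<le> M \<or> V = {}" using m(2) norm_ge_zero order_trans by blast
  define A where "A k = (LINT y:V|\<mu>. (norm (m k y))\<^sup>2)" for k
  define s where "s k = (\<Sum>i<k. \<delta> i)" for k
  have ii: "set_integrable \<mu> V (\<lambda>y. f y \<bullet> g y)"
    if "continuous_on V f" "continuous_on V g" "\<And>y. y \<in> V \<Longrightarrow> norm (f y) \<le> a" "\<And>y. y \<in> V \<Longrightarrow> norm (g y) \<le> b" for f g :: "spacetime \<Rightarrow> complex" and a b
  proof (rule set_integrable_cb(1)[OF V, where B = "a * b"])
    show "continuous_on V (\<lambda>y. f y \<bullet> g y)" using that by (intro continuous_on_inner)
    fix y assume y: "y \<in> V"
    have "\<bar>f y \<bullet> g y\<bar> \<le> norm (f y) * norm (g y)" by (rule Cauchy_Schwarz_ineq2)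
    also have "\<dots> \<le> a * b" using that(3,4)[OF y] order_trans[OF norm_ge_zero that(3)[OF y]] by (intro mult_mono) auto
    finally show "\<bar>f y \<bullet> g y\<bar> \<le> a * b" .
  qed
  have dc: "continuous_on V (\<lambda>y. m k y - m l y)" "y \<in> V \<Longrightarrow> norm (m k y - m l y) \<le> M + M" for k l y
    using m(2)[of y k] m(2)[of y l] by (auto intro!: continuous_on_diff m order_trans[OF norm_triangle_ineq4])
  have diff: "(LINT y:V|\<mu>. (norm (m l y - m j y))\<^sup>2) = A l - A j - 2 * (LINT y:V|\<mu>. m j y \<bullet> (m l y - m j y))" for j l
  proof -
    have "(LINT y:V|\<mu>. (norm (m l y - m j y))\<^sup>2) = (LINT y:V|\<mu>. (m l y \<bullet> m l y - m j y \<bullet> m j y) - 2 * (m j y \<bullet> (m l y - m j y)))"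
      by (simp add: power2_norm_eq_inner inner_diff_left inner_diff_right inner_commute algebra_simps)
    also have "\<dots> = (LINT y:V|\<mu>. m l y \<bullet> m l y) - (LINT y:V|\<mu>. m j y \<bullet> m j y) - 2 * (LINT y:V|\<mu>. m j y \<bullet> (m l y - m j y))"
      using ii[OF m(1) m(1) m(2) m(2)] ii[OF m(1) dc(1) m(2) dc(2)] by (simp add: set_integral_diff)
    finally show ?thesis by (simp add: A_def power2_norm_eq_inner)
  qed
  have pair: "\<bar>LINT y:V|\<mu>. m j y \<bullet> (m l y - m j y)\<bar> \<le> s l - s j" if "j \<le> l" for j l
    using that
  proof (induction l rule: dec_induct)
    case base then show ?case by (simp add: set_lebesgue_integral_def)
  next
    case (step l)
    have "(LINT y:V|\<mu>. m j y \<bullet> (m (Suc l) y - m j y)) = (LINT y:V|\<mu>. m j y \<bullet> (m (Suc l) y - m l y) + m j y \<bullet> (m l y - m j y))"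
      by (simp add: inner_diff_right)
    also have "\<dots> = (LINT y:V|\<mu>. m j y \<bullet> (m (Suc l) y - m l y)) + (LINT y:V|\<mu>. m j y \<bullet> (m l y - m j y))"
      by (intro set_integral_add ii[OF m(1) dc(1) m(2) dc(2)])
    finally show ?case using step orth[of j l] by (simp add: s_def)
  qed
  (* adding a multiple of the accumulated errors makes the square norms monotone *)
  define B where "B k = A k + 3 * s k" for k
  have Binc: "B k + G k \<le> B (Suc k)" for k
  proof -
    have "(LINT y:V|\<mu>. (norm (m (Suc k) y - m k y))\<^sup>2) \<le> A (Suc k) - A k + 2 * \<delta> k"
      using diff[of "Suc k" k] orth[of k k] by simp
    then show ?thesis using incr(1)[of k] by (simp add: B_def s_def)
  qed
  have Ab: "A k \<le> \<bar>M\<^sup>2 * measure \<mu> V\<bar>" for k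
  proof -
    have "\<bar>A k\<bar> \<le> M\<^sup>2 * measure \<mu> V" unfolding A_def
      using m by (intro set_integrable_cb(2)[OF V]) (auto intro!: continuous_on_power continuous_on_norm power_mono)
    then show ?thesis by simp
  qed
  have sb: "s k \<le> suminf \<delta>" for k unfolding s_def using \<delta> by (intro sum_le_suminf) auto
  have "Bseq B"
  proof (rule BseqI'[where K = "\<bar>B 0\<bar> + \<bar>M\<^sup>2 * measure \<mu> V\<bar> + 3 * \<bar>suminf \<delta>\<bar>"])
    fix k
    have "B 0 \<le> B k"
    proof (induction k)
      case (Suc k) then show ?case using Binc[of k] incr(2)[of k] by simp
    qed simp
    moreover have "B k \<le> \<bar>M\<^sup>2 * measure \<mu> V\<bar> + 3 * \<bar>suminf \<delta>\<bar>" using Ab[of k] sb[of k] unfolding B_def by linarith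
    ultimately show "norm (B k) \<le> \<bar>B 0\<bar> + \<bar>M\<^sup>2 * measure \<mu> V\<bar> + 3 * \<bar>suminf \<delta>\<bar>" unfolding real_norm_def by linarith
  qed
  moreover have "incseq B" using Binc incr(2) by (intro incseq_SucI) (meson add_le_same_cancel1 le_add_same_cancel1 order_trans)
  ultimately have "convergent B" using Bseq_mono_convergent incseqD by blast
  then obtain b where b: "B \<longlonglongrightarrow> b" by (auto simp: convergent_def)
  have "(\<lambda>k. B (Suc k) - B k) \<longlonglongrightarrow> b - b" by (intro tendsto_diff b LIMSEQ_Suc)
  then have "(\<lambda>k. B (Suc k) - B k) \<longlonglongrightarrow> 0" by simp
  then show "G \<longlonglongrightarrow> 0"
    by (rule Lim_null_comparison[rotated]) (use Binc incr(2) in \<open>auto intro!: always_eventually simp: algebra_simps\<close>)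
  (* a convergent sequence whose differences dominate the squared distances *)
  define E where "E k = B k + 2 * s k" for k
  have "s \<longlonglongrightarrow> suminf \<delta>" unfolding s_def[abs_def] using \<delta>(1) by (rule summable_LIMSEQ)
  then have "E \<longlonglongrightarrow> b + 2 * suminf \<delta>" unfolding E_def[abs_def] by (intro tendsto_intros b)
  then have E: "Cauchy E" by (rule LIMSEQ_imp_Cauchy)
  have s0: "s j \<le> s l" if "j \<le> l" for j l unfolding s_def using that \<delta>(2) by (intro sum_mono2) auto
  have key: "(LINT y:V|\<mu>. (norm (m l y - m j y))\<^sup>2) \<le> E l - E j" if "j \<le> l" for j l
    using diff[of l j] pair[OF that] s0[OF that] by (simp add: E_def B_def)
  show "\<exists>N. \<forall>k\<ge>N. \<forall>l\<ge>N. (LINT y:V|\<mu>. (norm (m k y - m l y))\<^sup>2) < e" if "e > 0" for e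
  proof -
    obtain N where N: "\<And>k l. k \<ge> N \<Longrightarrow> l \<ge> N \<Longrightarrow> dist (E k) (E l) < e" using E \<open>e > 0\<close> unfolding Cauchy_def by blast
    have "(LINT y:V|\<mu>. (norm (m k y - m l y))\<^sup>2) < e" if "k \<ge> N" "l \<ge> N" for k l
    proof (cases "l \<le> k")
      case True then show ?thesis using key[OF True] N[OF that] by (simp add: dist_real_def)
    next
      case False
      then have "(LINT y:V|\<mu>. (norm (m l y - m k y))\<^sup>2) < e" using key[of k l] N[OF that] by (simp add: dist_real_def)
      then show ?thesis by (simp add: norm_minus_commute)
    qed
    then show ?thesis by blast
  qed
qed

text \<open>
  Along a subsequence m converges almost everywhere, and so does the gap to 0. The sets \<open>D k\<close> may
  shrink, which allows supports that concentrate at the slice \<open>t = 0\<close>.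
\<close>

lemma saturation:
  assumes \<Omega>: "open \<Omega>" "bounded \<Omega>" and T: "0 < T"
    and V: "open V" "V \<subseteq> {-T<..<T} \<times> \<Omega>"
    and D: "\<And>k. open (D k)" "\<And>k. D k \<subseteq> V" "\<And>k. measure \<mu> (V - D k) = 0"
    and z: "subsolution V q Q z" and Q: "0 < Q"
    and H: "finite H" "\<forall>h\<in>H. continuous_on V h" and \<epsilon>: "0 < \<epsilon>"
  shows "\<exists>(w :: nat \<Rightarrow> spacetime \<Rightarrow> state) r m. w 0 = (\<lambda>_. 0) \<and> (\<forall>k. subsolution V q Q (\<lambda>y. z y + w k y)) \<and>
    (\<forall>k. perturbation T \<Omega> (D k) (\<lambda>y. w (Suc k) y - w k y)) \<and> strict_mono r \<and> m \<in> borel_measurable borel \<and>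
    (AE y in \<mu>. y \<in> V \<longrightarrow> (\<lambda>k. fst (z y + w (r k) y)) \<longlonglongrightarrow> m y \<and> (norm (m y))\<^sup>2 = 2 * q y) \<and>
    (\<forall>k. \<forall>h\<in>H. \<bar>LINT y:V|\<mu>. h y \<bullet> fst (w k y)\<bar> \<le> \<epsilon>)"
proof -
  have bV: "bounded V" using \<Omega>(2) by (intro bounded_subset[OF _ V(2)] bounded_Times) auto
  have Vb: "V \<in> sets borel" using V by auto
  define \<delta> where "\<delta> k = \<epsilon> * (1/2) ^ Suc k" for k
  have \<delta>0: "0 < \<delta> k" for k using \<epsilon> by (simp add: \<delta>_def)
  have \<delta>s: "\<delta> sums \<epsilon>" unfolding \<delta>_def[abs_def] using sums_mult[OF power_half_series, of \<epsilon>] by simp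
  obtain w where w: "w 0 = (\<lambda>_. 0)" "\<forall>k. subsolution V q Q (\<lambda>y. z y + w k y)"
    "\<forall>k. perturbation T \<Omega> (D k) (\<lambda>y. w (Suc k) y - w k y)"
    "\<forall>k. \<forall>h\<in>H. \<bar>LINT y:V|\<mu>. h y \<bullet> fst (w (Suc k) y - w k y)\<bar> \<le> \<delta> k"
    "\<forall>k. \<forall>j\<le>k. \<bar>LINT y:V|\<mu>. fst (z y + w j y) \<bullet> fst (w (Suc k) y - w k y)\<bar> \<le> \<delta> k"
    "\<forall>k. gain Q * (LINT y:V|\<mu>. (gap q (\<lambda>y. z y + w k y) y)\<^sup>2) - \<delta> k \<le> (LINT y:V|\<mu>. (norm (fst (w (Suc k) y - w k y)))\<^sup>2)"
    using oscillation_sequence[where z = z and \<delta> = \<delta> and D = D, OF \<Omega> T V D z Q H \<delta>0] by (elim exE conjE) (rule that)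
  define m where "m k y = fst (z y + w k y)" for k y
  have sub: "subsolution V q Q (\<lambda>y. z y + w k y)" for k using w(2) by blast
  have mc: "continuous_on V (m k)" for k
    using sub[of k] unfolding m_def subsolution_def by (intro continuous_on_fst) blast
  have mb: "norm (m k y) \<le> sqrt (2 * Q)" if "y \<in> V" for k y
    using sub[of k] that energy_bounds(2) unfolding m_def subsolution_def by blast
  have md: "fst (w (Suc k) y - w k y) = m (Suc k) y - m k y" for k y by (simp add: m_def)
  define G where "G k = gain Q * (LINT y:V|\<mu>. (gap q (\<lambda>y. z y + w k y) y)\<^sup>2)" for k
  have gq: "0 < gain Q" using Q c_pos by (simp add: gain_def)
  have G0: "0 \<le> G k" for k unfolding G_def set_lebesgue_integral_def using gq by (intro mult_nonneg_nonneg integral_nonneg_AE) auto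
  have orth: "\<bar>LINT y:V|\<mu>. m j y \<bullet> (m (Suc k) y - m k y)\<bar> \<le> \<delta> k" if "j \<le> k" for j k
    using w(5) that unfolding md m_def by blast
  have incr: "G k - \<delta> k \<le> (LINT y:V|\<mu>. (norm (m (Suc k) y - m k y))\<^sup>2)" for k
    using w(6) unfolding md G_def by blast
  note SC = square_integrable_Cauchy[OF Vb bV mc mb orth sums_summable[OF \<delta>s] less_imp_le[OF \<delta>0] incr G0]
  define M where "M = measure \<mu> V"
  have M: "0 \<le> M" by (simp add: M_def)
  have dc: "continuous_on V (\<lambda>y. norm (m k y - m l y))" for k l by (intro continuous_on_norm continuous_on_diff mc)
  have db: "norm (m k y - m l y) \<le> 2 * sqrt (2 * Q)" if "y \<in> V" for k l y
    using mb[OF that, of k] mb[OF that, of l] norm_triangle_ineq4[of "m k y" "m l y"] by linarith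
  have L1: "\<exists>N. \<forall>k\<ge>N. \<forall>l\<ge>N. (LINT y|\<mu>. norm (indicator V y *\<^sub>R m k y - indicator V y *\<^sub>R m l y)) < e" if e: "e > 0" for e
  proof -
    define \<kappa> where "\<kappa> = e / (M + 1)"
    have \<kappa>: "\<kappa> > 0" using e M by (simp add: \<kappa>_def)
    have \<kappa>M: "\<kappa> * M < e" using e M by (simp add: \<kappa>_def field_simps)
    obtain N where N: "\<forall>k\<ge>N. \<forall>l\<ge>N. (LINT y:V|\<mu>. (norm (m k y - m l y))\<^sup>2) < \<kappa> * e" using SC(2)[of "\<kappa> * e"] \<kappa> e by auto
    have "(LINT y|\<mu>. norm (indicator V y *\<^sub>R m k y - indicator V y *\<^sub>R m l y)) < e" if "k \<ge> N" "l \<ge> N" for k l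
    proof -
      have sq: "set_integrable \<mu> V (\<lambda>y. (norm (m k y - m l y))\<^sup>2)"
      proof (intro set_integrable_cb(1)[OF Vb bV, where B = "(2 * sqrt (2 * Q))\<^sup>2"] continuous_on_power dc)
        show "\<bar>(norm (m k y - m l y))\<^sup>2\<bar> \<le> (2 * sqrt (2 * Q))\<^sup>2" if "y \<in> V" for y
          using power_mono[OF db[OF that, of k l], of 2] by simp
      qed
      have co: "set_integrable \<mu> V (\<lambda>y. \<kappa> / 2)" by (rule set_integrable_cb(1)[OF Vb bV, where B = "\<kappa> / 2"]) (use \<kappa> in auto)
      have "(LINT y|\<mu>. norm (indicator V y *\<^sub>R m k y - indicator V y *\<^sub>R m l y)) = (LINT y:V|\<mu>. norm (m k y - m l y))"
        unfolding set_lebesgue_integral_def by (intro Bochner_Integration.integral_cong) (auto simp: indicator_def)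
      also have "\<dots> \<le> (LINT y:V|\<mu>. 1 / (2 * \<kappa>) * (norm (m k y - m l y))\<^sup>2 + \<kappa> / 2)"
      proof (rule set_integral_mono)
        show "set_integrable \<mu> V (\<lambda>y. norm (m k y - m l y))"
          using db by (intro set_integrable_cb(1)[OF Vb bV, where B = "2 * sqrt (2 * Q)"] dc) simp
        show "set_integrable \<mu> V (\<lambda>y. 1 / (2 * \<kappa>) * (norm (m k y - m l y))\<^sup>2 + \<kappa> / 2)"
          by (intro set_integral_add(1) set_integrable_mult_right sq co)
        fix y
        have "0 \<le> (norm (m k y - m l y) - \<kappa>)\<^sup>2" by simp
        then have "2 * \<kappa> * norm (m k y - m l y) \<le> (norm (m k y - m l y))\<^sup>2 + \<kappa>\<^sup>2" by (simp add: power2_diff mult.commute mult.left_commute)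
        then have "norm (m k y - m l y) \<le> ((norm (m k y - m l y))\<^sup>2 + \<kappa>\<^sup>2) / (2 * \<kappa>)"
          using \<kappa> by (simp add: pos_le_divide_eq mult.commute)
        also have "\<dots> = 1 / (2 * \<kappa>) * (norm (m k y - m l y))\<^sup>2 + \<kappa> / 2"
          using \<kappa> by (simp add: add_divide_distrib power2_eq_square)
        finally show "norm (m k y - m l y) \<le> 1 / (2 * \<kappa>) * (norm (m k y - m l y))\<^sup>2 + \<kappa> / 2" .
      qed
      also have "\<dots> = 1 / (2 * \<kappa>) * (LINT y:V|\<mu>. (norm (m k y - m l y))\<^sup>2) + \<kappa> / 2 * M"
      proof -
        have "(LINT y:V|\<mu>. \<kappa> / 2) = \<kappa> / 2 * M" using Vb by (simp add: set_lebesgue_integral_def M_def)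
        then show ?thesis using set_integral_add(2)[OF set_integrable_mult_right[of "1 / (2 * \<kappa>)", OF sq] co] by simp
      qed
      also have "\<dots> < 1 / (2 * \<kappa>) * (\<kappa> * e) + e / 2"
      proof (rule add_less_le_mono)
        show "1 / (2 * \<kappa>) * (LINT y:V|\<mu>. (norm (m k y - m l y))\<^sup>2) < 1 / (2 * \<kappa>) * (\<kappa> * e)"
          using N that \<kappa> by (intro mult_strict_left_mono) auto
        show "\<kappa> / 2 * M \<le> e / 2" using \<kappa>M by simp
      qed
      also have "\<dots> = e" using \<kappa> by (simp add: field_simps)
      finally show ?thesis .
    qed
    then show ?thesis by blast
  qed
  have im: "(\<lambda>y. indicator V y *\<^sub>R m k y) \<in> borel_measurable borel" for k
    using set_measurable_continuous_on[OF Vb mc] by (simp add: set_borel_measurable_def)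
  have int: "integrable \<mu> (\<lambda>y. indicator V y *\<^sub>R m k y)" for k
  proof -
    have "set_integrable \<mu> V (\<lambda>y. norm (m k y))"
      using mb by (intro set_integrable_cb(1)[OF Vb bV, where B = "sqrt (2 * Q)"] continuous_on_norm mc) simp
    then have "integrable \<mu> (\<lambda>y. norm (indicator V y *\<^sub>R m k y))" by (simp add: set_integrable_def)
    then show ?thesis using im[of k] by (subst integrable_norm_iff[symmetric]) (auto simp: measurable_cong_sets[OF sets_\<mu> refl])
  qed
  obtain r where r: "strict_mono r" "AE y in \<mu>. Cauchy (\<lambda>k. indicator V y *\<^sub>R m (r k) y)"
    using cauchy_L1_AE_cauchy_subseq[where s = "\<lambda>k y. indicator V y *\<^sub>R m k y", OF int L1] by blast
  define m' where "m' y = lim (\<lambda>k. indicator V y *\<^sub>R m (r k) y)" for y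
  have m': "m' \<in> borel_measurable borel" unfolding m'_def[abs_def] by (intro borel_measurable_lim_metric im)
  have conv: "AE y in \<mu>. (\<lambda>k. indicator V y *\<^sub>R m (r k) y) \<longlonglongrightarrow> m' y"
    using r(2) by eventually_elim (simp add: m'_def Cauchy_convergent_iff convergent_LIMSEQ_iff)
  have qc: "continuous_on V q" using z by (simp add: subsolution_def)
  have gap0: "AE y in \<mu>. y \<in> V \<longrightarrow> (norm (m' y))\<^sup>2 = 2 * q y"
  proof -
    let ?g = "\<lambda>y. indicator V y *\<^sub>R (q y - (norm (m' y))\<^sup>2 / 2)\<^sup>2"
    have gm: "?g \<in> borel_measurable \<mu>"
    proof -
      have "(\<lambda>y. indicator V y *\<^sub>R q y) \<in> borel_measurable borel" using set_measurable_continuous_on[OF Vb qc] by (simp add: set_borel_measurable_def)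
      then have "(\<lambda>y. indicator V y *\<^sub>R (indicator V y *\<^sub>R q y - (norm (m' y))\<^sup>2 / 2)\<^sup>2) \<in> borel_measurable borel" using m' Vb by measurable
      moreover have "(\<lambda>y. indicator V y *\<^sub>R (indicator V y *\<^sub>R q y - (norm (m' y))\<^sup>2 / 2)\<^sup>2) = ?g" by (auto simp: indicator_def)
      ultimately show ?thesis by (simp add: measurable_cong_sets[OF sets_\<mu> refl])
    qed
    have wi: "integrable \<mu> (\<lambda>y. indicator V y * Q\<^sup>2)"
      using Vb finite_\<mu>[OF bV Vb] by (intro integrable_mult_left integrable_real_indicator) auto
    have lim: "AE y in \<mu>. (\<lambda>k. indicator V y *\<^sub>R (gap q (\<lambda>y. z y + w (r k) y) y)\<^sup>2) \<longlonglongrightarrow> ?g y"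
      using conv
    proof eventually_elim
      case (elim y)
      then show ?case
      proof (cases "y \<in> V")
        case True
        have e: "gap q (\<lambda>y. z y + w (r k) y) y = q y - (norm (m (r k) y))\<^sup>2 / 2" for k by (simp add: gap_def m_def)
        have "(\<lambda>k. m (r k) y) \<longlonglongrightarrow> m' y" using elim True by simp
        then show ?thesis unfolding e by (intro tendsto_intros) auto
      qed simp
    qed
    have gmk: "(\<lambda>y. indicator V y *\<^sub>R (gap q (\<lambda>y. z y + w (r k) y) y)\<^sup>2) \<in> borel_measurable \<mu>" for k
      using gap_integrable[OF sub order_refl Vb bV] by (auto simp: set_integrable_def)
    have bd: "AE y in \<mu>. norm (indicator V y *\<^sub>R (gap q (\<lambda>y. z y + w (r k) y) y)\<^sup>2) \<le> indicator V y * Q\<^sup>2" for k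
    proof (rule AE_I2)
      fix y
      show "norm (indicator V y *\<^sub>R (gap q (\<lambda>y. z y + w (r k) y) y)\<^sup>2) \<le> indicator V y * Q\<^sup>2"
        using gap_bounds[OF sub[of "r k"], of y] by (cases "y \<in> V") (auto intro!: power_mono)
    qed
    have "(\<lambda>k. G (r k)) \<longlonglongrightarrow> 0" using LIMSEQ_subseq_LIMSEQ[OF SC(1) r(1)] by (simp only: comp_def)
    then have "(\<lambda>k. G (r k) / gain Q) \<longlonglongrightarrow> 0" by (rule tendsto_divide_zero)
    then have "(\<lambda>k. \<integral>y. indicator V y *\<^sub>R (gap q (\<lambda>y. z y + w (r k) y) y)\<^sup>2 \<partial>\<mu>) \<longlonglongrightarrow> 0"
      using gq by (simp add: G_def set_lebesgue_integral_def)
    then have "(\<integral>y. ?g y \<partial>\<mu>) = 0" using integral_dominated_convergence[OF gm gmk wi lim bd] by (rule LIMSEQ_unique[rotated])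
    moreover have "integrable \<mu> ?g" using integrable_dominated_convergence[OF gm gmk wi lim bd] .
    ultimately have "AE y in \<mu>. ?g y = 0" by (subst (asm) integral_nonneg_eq_0_iff_AE) auto
    then show ?thesis by eventually_elim auto
  qed
  have "AE y in \<mu>. y \<in> V \<longrightarrow> (\<lambda>k. fst (z y + w (r k) y)) \<longlonglongrightarrow> m' y \<and> (norm (m' y))\<^sup>2 = 2 * q y"
    unfolding m_def[symmetric] using conv gap0
  proof eventually_elim
    case (elim y)
    then show ?case by (cases "y \<in> V") simp_all
  qed
  moreover have "\<bar>LINT y:V|\<mu>. h y \<bullet> fst (w k y)\<bar> \<le> \<epsilon>" if h: "h \<in> H" for h k
  proof -
    have "set_integrable \<mu> V (\<lambda>y. h y \<bullet> fst (w k y)) \<and> \<bar>LINT y:V|\<mu>. h y \<bullet> fst (w k y)\<bar> \<le> (\<Sum>i<k. \<delta> i)"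
    proof (induction k)
      case 0 then show ?case by (simp add: w(1) set_lebesgue_integral_def set_integrable_def)
    next
      case (Suc k)
      have pk: "perturbation T \<Omega> (D k) (\<lambda>y. w (Suc k) y - w k y)" using w(3) by blast
      have i: "set_integrable \<mu> V (\<lambda>y. h y \<bullet> fst (w (Suc k) y - w k y))"
        by (rule perturbation_pairing_integrable[OF V(1) bV pk D(2) H(2)[rule_format, OF h]])
      have e: "h y \<bullet> fst (w (Suc k) y) = h y \<bullet> fst (w k y) + h y \<bullet> fst (w (Suc k) y - w k y)" for y by (simp add: inner_diff_right)
      have "\<bar>LINT y:V|\<mu>. h y \<bullet> fst (w (Suc k) y - w k y)\<bar> \<le> \<delta> k" using w(4) h by blast
      then show ?case unfolding e using i Suc set_integral_add[of \<mu> V "\<lambda>y. h y \<bullet> fst (w k y)" "\<lambda>y. h y \<bullet> fst (w (Suc k) y - w k y)"] by auto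
    qed
    moreover have "(\<Sum>i<k. \<delta> i) \<le> \<epsilon>" using \<delta>s \<delta>0 sum_le_suminf[of \<delta> "{..<k}"] by (auto simp: sums_iff less_imp_le)
    ultimately show ?thesis by linarith
  qed
  ultimately show ?thesis using w(1-3) r(1) m' by (intro exI[of _ w] exI[of _ r] exI[of _ m']) blast
qed

end

section \<open>Lebesgue measure and its restriction to the initial time\<close>

definition square :: "real^2 \<Rightarrow> real \<Rightarrow> (real^2) set" where
  "square x0 r = {x. \<bar>x $ 1 - x0 $ 1\<bar> \<le> r \<and> \<bar>x $ 2 - x0 $ 2\<bar> \<le> r}"

lemma measure_square: "0 \<le> r \<Longrightarrow> emeasure lborel (square x0 r) = ennreal ((2 * r)\<^sup>2)"
proof -
  assume r: "0 \<le> r"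
  have eq: "square x0 r = cbox (x0 - (\<chi> i. r)) (x0 + (\<chi> i. r))"
    by (auto simp: square_def mem_box_cart forall_2 abs_le_iff algebra_simps)
  have "x0 \<in> cbox (x0 - (\<chi> i. r)) (x0 + (\<chi> i. r))" using r by (simp add: mem_box_cart)
  then have "measure lborel (cbox (x0 - (\<chi> i. r)) (x0 + (\<chi> i. r))) = (2 * r)\<^sup>2"
    by (subst content_cbox_cart) (auto simp: prod.neutral power2_eq_square)
  then show ?thesis unfolding eq using emeasure_lborel_cbox_finite[of "x0 - (\<chi> i. r)" "x0 + (\<chi> i. r)"]
    by (simp add: emeasure_eq_ennreal_measure less_top[symmetric])
qed

lemma cube_eq: "cube y0 r = {fst y0 - r..fst y0 + r} \<times> square (snd y0) r"
  by (auto simp: cube_def square_def abs_le_iff)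

lemma square_borel: "square x0 r \<in> sets borel"
proof -
  have "closed (square x0 r)" unfolding square_def by (intro closed_Collect_conj closed_Collect_le continuous_intros)
  then show ?thesis by (rule borel_closed)
qed

lemma measure_cube: "0 \<le> r \<Longrightarrow> emeasure lborel (cube y0 r) = ennreal ((2 * r) ^ 3)"
proof -
  assume r: "0 \<le> r"
  have "emeasure lborel (cube y0 r) = emeasure (lborel \<Otimes>\<^sub>M lborel) ({fst y0 - r..fst y0 + r} \<times> square (snd y0) r)"
    by (simp add: cube_eq lborel_prod)
  also have "\<dots> = emeasure lborel {fst y0 - r..fst y0 + r} * emeasure lborel (square (snd y0) r)"
    by (intro lborel.emeasure_pair_measure_Times) (auto simp: square_borel)
  also have "\<dots> = ennreal ((2 * r) ^ 3)"
    using r by (simp add: measure_square ennreal_mult[symmetric] power3_eq_cube power2_eq_square algebra_simps)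
  finally show ?thesis .
qed

lemma cball_subset_cube: "cball y0 r \<subseteq> cube y0 r"
proof
  fix y assume "y \<in> cball y0 r"
  then have d: "norm (y - y0) \<le> r" by (simp add: dist_norm norm_minus_commute)
  have "norm (fst (y - y0)) \<le> r" using d norm_fst_le[of "fst (y - y0)" "snd (y - y0)"] unfolding prod.collapse by linarith
  moreover have n: "norm (snd (y - y0)) \<le> r" using d norm_snd_le[of "snd (y - y0)" "fst (y - y0)"] unfolding prod.collapse by linarith
  have "\<bar>snd (y - y0) $ i\<bar> \<le> r" for i using component_le_norm_cart[of "snd (y - y0)" i] n by linarith
  ultimately show "y \<in> cube y0 r" by (simp add: cube_def)
qed

lemma cball_disjoint_dist:
  fixes x y :: "'a::real_normed_vector"
  assumes "cball x r \<inter> cball y s = {}" "0 < r" "0 < s"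
  shows "r + s < dist x y"
proof (rule ccontr)
  assume "\<not> r + s < dist x y"
  then have d: "norm (y - x) \<le> r + s" by (simp add: dist_norm norm_minus_commute)
  define p where "p = x + (r / (r + s)) *\<^sub>R (y - x)"
  have "norm (p - x) = r / (r + s) * norm (y - x)" using assms by (simp add: p_def)
  also have "\<dots> \<le> r / (r + s) * (r + s)" using d assms by (intro mult_left_mono) auto
  also have "\<dots> = r" using assms by simp
  finally have 1: "p \<in> cball x r" by (simp add: dist_norm norm_minus_commute)
  have "y - p = (1 - r / (r + s)) *\<^sub>R (y - x)" by (simp add: p_def algebra_simps)
  also have "1 - r / (r + s) = s / (r + s)" using assms by (simp add: field_simps)
  finally have "norm (y - p) = s / (r + s) * norm (y - x)" using assms by simp
  also have "\<dots> \<le> s / (r + s) * (r + s)" using d assms by (intro mult_left_mono) auto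
  also have "\<dots> = s" using assms by simp
  finally have 2: "p \<in> cball y s" by (simp add: dist_norm)
  show False using 1 2 assms(1) by blast
qed

lemma cball_disjoint_if_dist:
  fixes x y :: "'a::metric_space"
  assumes "r + s < dist x y"
  shows "cball x r \<inter> cball y s = {}"
proof -
  have False if "z \<in> cball x r" "z \<in> cball y s" for z
    using that dist_triangle[of x y z] assms by (simp add: dist_commute)
  then show ?thesis by blast
qed

text \<open>
  The radii are bounded by a prescribed function and the balls stay in D; finitely many of the balls given by
  the Vitali covering theorem already exhaust D up to \<open>\<epsilon>\<close>.
\<close>

lemma finite_vitali:
  fixes D :: "'a::euclidean_space set"
  assumes D: "open D" "bounded D" and \<rho>: "\<And>y. y \<in> D \<Longrightarrow> \<rho> y > 0" and \<epsilon>: "\<epsilon> > 0"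
  shows "\<exists>C r. finite C \<and> C \<subseteq> D \<and> (\<forall>y\<in>C. 0 < r y \<and> r y \<le> \<rho> y \<and> cball y (r y) \<subseteq> D) \<and>
         disjoint_family_on (\<lambda>y. cball y (r y)) C \<and> measure lborel (D - (\<Union>y\<in>C. cball y (r y))) \<le> \<epsilon>"
proof -
  define K where "K = {(y, r). y \<in> D \<and> 0 < r \<and> r \<le> \<rho> y \<and> cball y r \<subseteq> D}"
  have K0: "0 < snd i" if "i \<in> K" for i using that by (auto simp: K_def)
  have fine: "\<exists>i. i \<in> K \<and> x \<in> cball (fst i) (snd i) \<and> snd i < d" if x: "x \<in> D" and d: "0 < d" for x d
  proof -
    obtain e where e: "e > 0" "cball x e \<subseteq> D" using D(1) x open_contains_cball by blast
    define r where "r = min (min e (\<rho> x)) (d / 2)"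
    have r: "0 < r" "r \<le> e" "r \<le> \<rho> x" "r < d" using e \<rho>[OF x] d by (auto simp: r_def)
    have "cball x r \<subseteq> D" using e(2) r(2) by (meson subset_cball subset_trans)
    then have "(x, r) \<in> K" using x r by (simp add: K_def)
    then show ?thesis using r by (intro exI[of _ "(x, r)"]) simp
  qed
  obtain C where C: "countable C" "C \<subseteq> K" "pairwise (\<lambda>i j. disjnt (cball (fst i) (snd i)) (cball (fst j) (snd j))) C"
     "negligible (D - (\<Union>i\<in>C. cball (fst i) (snd i)))"
    by (rule Vitali_covering_theorem_cballs[of K snd D fst]) (erule K0, erule (1) fine, rule that)
  define F where "F n = C \<inter> from_nat_into C ` {..<n}" for n
  define A where "A n = D - (\<Union>i\<in>F n. cball (fst i) (snd i))" for n :: nat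
  have finF: "finite (F n)" for n by (simp add: F_def)
  have Ab: "A n \<in> sets borel" for n unfolding A_def using D(1) finF by (auto intro!: sets.Diff sets.finite_UN)
  have UF: "(\<Union>n. F n) = C"
  proof
    show "(\<Union>n. F n) \<subseteq> C" by (auto simp: F_def)
    show "C \<subseteq> (\<Union>n. F n)"
    proof
      fix i assume i: "i \<in> C"
      obtain n where "from_nat_into C n = i" using from_nat_into_surj[OF C(1) i] by blast
      then have "i \<in> F (Suc n)" using i by (auto simp: F_def)
      then show "i \<in> (\<Union>n. F n)" by blast
    qed
  qed
  have "F i \<subseteq> F j" if "i \<le> j" for i j unfolding F_def using that by (intro Int_mono image_mono) auto
  then have dec: "decseq A" unfolding decseq_def A_def by blast
  have IA: "(\<Inter>n. A n) = D - (\<Union>i\<in>C. cball (fst i) (snd i))"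
    unfolding A_def using UF by blast
  have "(\<lambda>n. measure lborel (A n)) \<longlonglongrightarrow> measure lborel (\<Inter>n. A n)"
  proof (rule Lim_measure_decseq)
    show "range A \<subseteq> sets lborel" using Ab by auto
    show "emeasure lborel (A i) \<noteq> \<infinity>" for i
    proof -
      have "bounded (A i)" by (rule bounded_subset[OF D(2)]) (auto simp: A_def)
      then show ?thesis using emeasure_bounded_finite[of "A i"] by (simp add: less_top)
    qed
  qed (fact dec)
  moreover have "measure lborel (\<Inter>n. A n) = 0"
  proof -
    have "(\<Inter>n. A n) \<in> sets borel" using Ab by (intro sets.countable_INT) auto
    moreover have "measure lebesgue (\<Inter>n. A n) = 0"
      using C(4) unfolding IA[symmetric] by (simp add: negligible_iff_measure0 measure_eq_0_null_sets negligible_iff_null_sets)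
    ultimately show ?thesis by (simp add: measure_completion)
  qed
  ultimately have "(\<lambda>n. measure lborel (A n)) \<longlonglongrightarrow> 0" by simp
  then obtain n where n: "measure lborel (A n) < \<epsilon>"
    using order_tendstoD(2)[of _ 0 sequentially \<epsilon>] \<epsilon> eventually_happens'[OF sequentially_bot] by blast
  have FK: "F n \<subseteq> K" "F n \<subseteq> C" using C(2) by (auto simp: F_def)
  have inj: "i = j" if "i \<in> F n" "j \<in> F n" "fst i = fst j" for i j
  proof (rule ccontr)
    assume "i \<noteq> j"
    then have "disjnt (cball (fst i) (snd i)) (cball (fst j) (snd j))" using C(3) that FK unfolding pairwise_def by blast
    moreover have "fst i \<in> cball (fst i) (snd i)" "fst i \<in> cball (fst j) (snd j)" using K0[of i] K0[of j] that FK by force+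
    ultimately show False unfolding disjnt_def by blast
  qed
  define r where "r y = (THE s. (y, s) \<in> F n)" for y
  have r: "r (fst i) = snd i" if "i \<in> F n" for i
    unfolding r_def
  proof (rule the_equality)
    show "(fst i, snd i) \<in> F n" using that by simp
    show "s = snd i" if "(fst i, s) \<in> F n" for s
    proof -
      have "(fst i, s) = i" using inj[of "(fst i, s)" i] that \<open>i \<in> F n\<close> by simp
      then show ?thesis by (metis snd_conv)
    qed
  qed
  show ?thesis
  proof (intro exI[of _ "fst ` F n"] exI[of _ r] conjI)
    show "finite (fst ` F n)" using finF by simp
    show "fst ` F n \<subseteq> D" using FK by (auto simp: K_def)
    show "\<forall>y\<in>fst ` F n. 0 < r y \<and> r y \<le> \<rho> y \<and> cball y (r y) \<subseteq> D" using FK r by (fastforce simp: K_def)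
    show "disjoint_family_on (\<lambda>y. cball y (r y)) (fst ` F n)"
    proof -
      have "cball (fst i) (snd i) \<inter> cball (fst j) (snd j) = {}" if "i \<in> F n" "j \<in> F n" "fst i \<noteq> fst j" for i j
      proof -
        have "i \<in> C" "j \<in> C" "i \<noteq> j" using that FK by auto
        then show ?thesis using C(3) unfolding pairwise_def disjnt_def by blast
      qed
      then show ?thesis using r by (auto simp: disjoint_family_on_def simp del: disjoint_iff)
    qed
    have "(\<Union>y\<in>fst ` F n. cball y (r y)) = (\<Union>i\<in>F n. cball (fst i) (snd i))" using r by auto
    then show "measure lborel (D - (\<Union>y\<in>fst ` F n. cball y (r y))) \<le> \<epsilon>" using n by (simp add: A_def)
  qed
qed

text \<open>
  A ball of radius r lies in the cube of half side r, whose measure is \<open>4\<^sup>3\<close> times that of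
  the cube of half side \<open>r/4\<close>; on the slice the factor is \<open>4\<^sup>2\<close>, so 1/64 serves
  both measures.
\<close>

interpretation volume: oscillation_measure "lborel :: spacetime measure" UNIV "1/64"
proof
  show "sets (lborel :: spacetime measure) = sets borel" by simp
  show "emeasure lborel A < \<infinity>" if "bounded A" for A :: "spacetime set" using emeasure_bounded_finite[OF that] .
  show "(\<integral>y. F (y + (0, h)) \<partial>lborel) = (\<integral>y. F y \<partial>lborel)" if "F \<in> borel_measurable borel" for F :: "spacetime \<Rightarrow> real" and h
    by (rule integral_translation_lborel[OF that])
  show "(0::real) < 1/64" by simp
  show "1/64 * measure lborel (cball y0 r) \<le> measure lborel (cube y0 (r / 4))" if "0 < r" for y0 :: spacetime and r
  proof -
    have "measure lborel (cball y0 r) \<le> measure lborel (cube y0 r)"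
      using measure_cube[of r y0] that by (intro measure_mono_fmeasurable cball_subset_cube fmeasurableI) (auto simp: compact_cube borel_compact)
    also have "\<dots> = 64 * measure lborel (cube y0 (r / 4))"
      using that by (simp add: measure_def measure_cube power3_eq_cube)
    finally show ?thesis by simp
  qed
  show "\<exists>C r. finite C \<and> C \<subseteq> UNIV \<inter> D \<and> (\<forall>y\<in>C. 0 < r y \<and> r y \<le> \<rho> y \<and> cball y (r y) \<subseteq> D) \<and>
         disjoint_family_on (\<lambda>y. cball y (r y)) C \<and> measure lborel (D - (\<Union>y\<in>C. cball y (r y))) \<le> \<epsilon>"
    if "open D" "bounded D" "\<And>y. y \<in> D \<Longrightarrow> \<rho> y > 0" "\<epsilon> > 0" for D :: "spacetime set" and \<rho> \<epsilon>
    using finite_vitali[OF that] by simp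
qed

definition initial_measure :: "spacetime measure" where
  "initial_measure = distr lborel borel (\<lambda>x. (0, x))"

lemma initial_measurable: "(\<lambda>x::real^2. (0::real, x)) \<in> measurable lborel borel"
  by (simp add: borel_measurable_continuous_onI continuous_on_Pair)

lemma emeasure_initial: "A \<in> sets borel \<Longrightarrow> emeasure initial_measure A = emeasure lborel {x. (0, x) \<in> A}"
  unfolding initial_measure_def by (subst emeasure_distr[OF initial_measurable]) (auto simp: vimage_def)

lemma measure_initial: "A \<in> sets borel \<Longrightarrow> measure initial_measure A = measure lborel {x. (0, x) \<in> A}"
  by (simp add: measure_def emeasure_initial)

lemma slice_bounded:
  assumes "bounded (A :: spacetime set)" shows "bounded {x. (t, x) \<in> A}"
proof -
  have "{x. (t, x) \<in> A} \<subseteq> snd ` A" by force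
  then show ?thesis using bounded_snd[OF assms] bounded_subset by blast
qed

lemma slice_open:
  assumes "open (A :: spacetime set)" shows "open {x. (t, x) \<in> A}"
proof -
  have "open ((\<lambda>x. (t, x)) -` A)" by (intro open_vimage assms continuous_intros)
  then show ?thesis by (simp add: vimage_def)
qed

interpretation initial: oscillation_measure initial_measure "{y. fst y = 0}" "1/64"
proof
  show s: "sets initial_measure = sets borel" by (simp add: initial_measure_def)
  show "emeasure initial_measure A < \<infinity>" if "bounded A" "A \<in> sets borel" for A
    using emeasure_bounded_finite[OF slice_bounded[OF that(1)]] emeasure_initial[OF that(2)] by simp
  show "(\<integral>y. F (y + (0, h)) \<partial>initial_measure) = (\<integral>y. F y \<partial>initial_measure)" if F: "F \<in> borel_measurable borel" for F :: "spacetime \<Rightarrow> real" and h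
  proof -
    have m: "(\<lambda>x. F (0, x)) \<in> borel_measurable borel" using measurable_compose[OF initial_measurable F] by simp
    have "(\<lambda>y. F (y + (0, h))) \<in> borel_measurable borel"
      by (rule measurable_compose[OF _ F]) (intro borel_measurable_continuous_onI continuous_intros)
    then have "(\<integral>y. F (y + (0, h)) \<partial>initial_measure) = (\<integral>x. F (0, x + h) \<partial>lborel)"
      unfolding initial_measure_def by (subst integral_distr[OF initial_measurable]) auto
    also have "\<dots> = (\<integral>x. F (0, x) \<partial>lborel)" by (rule integral_translation_lborel[OF m])
    also have "\<dots> = (\<integral>y. F y \<partial>initial_measure)"
      unfolding initial_measure_def by (subst integral_distr[OF initial_measurable F]) auto
    finally show ?thesis .
  qed
  show "(0::real) < 1/64" by simp
  show "1/64 * measure initial_measure (cball y0 r) \<le> measure initial_measure (cube y0 (r / 4))" if y0: "y0 \<in> {y. fst y = 0}" and r: "0 < r" for y0 :: spacetime and r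
  proof -
    have cu: "{x. (0, x) \<in> cube y0 s} = square (snd y0) s" if "0 < s" for s
      using y0 that by (auto simp: cube_eq)
    have cb: "cube y0 s \<in> sets borel" for s using compact_cube by (simp add: borel_compact)
    have fs: "emeasure initial_measure (cube y0 r) < \<infinity>" unfolding emeasure_initial[OF cb] cu[OF r] using r by (simp add: measure_square)
    have "measure initial_measure (cball y0 r) \<le> measure initial_measure (cube y0 r)"
      using fs cb s by (intro measure_mono_fmeasurable cball_subset_cube fmeasurableI) auto
    also have "\<dots> = 16 * measure initial_measure (cube y0 (r / 4))"
      using r cu[of r] cu[of "r / 4"] by (simp add: measure_initial[OF cb]) (simp add: measure_def measure_square power2_eq_square)
    finally show ?thesis using measure_nonneg[of initial_measure "cube y0 (r / 4)"] by linarith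
  qed
  show "\<exists>C r. finite C \<and> C \<subseteq> {y. fst y = 0} \<inter> D \<and> (\<forall>y\<in>C. 0 < r y \<and> r y \<le> \<rho> y \<and> cball y (r y) \<subseteq> D) \<and>
         disjoint_family_on (\<lambda>y. cball y (r y)) C \<and> measure initial_measure (D - (\<Union>y\<in>C. cball y (r y))) \<le> \<epsilon>"
    if D: "open D" "bounded D" and \<rho>: "\<And>y. y \<in> D \<Longrightarrow> \<rho> y > 0" and \<epsilon>: "\<epsilon> > 0" for D :: "spacetime set" and \<rho> \<epsilon>
  proof -
    define D0 where "D0 = {x. (0, x) \<in> D}"
    have D0: "open D0" "bounded D0" unfolding D0_def using slice_open slice_bounded D by auto
    have "\<exists>e>0. cball (0, x) e \<subseteq> D" if "x \<in> D0" for x :: "real^2" using D(1) that open_contains_cball unfolding D0_def by blast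
    then obtain e where e: "\<And>x. x \<in> D0 \<Longrightarrow> e x > 0 \<and> cball (0::real, x) (e x) \<subseteq> D" by metis
    have pos: "min (\<rho> (0, x)) (e x) > 0" if "x \<in> D0" for x using e[OF that] \<rho>[of "(0, x)"] that by (simp add: D0_def)
    have "\<exists>C r. finite C \<and> C \<subseteq> D0 \<and> (\<forall>x\<in>C. 0 < r x \<and> r x \<le> min (\<rho> (0, x)) (e x) \<and> cball x (r x) \<subseteq> D0) \<and>
         disjoint_family_on (\<lambda>x. cball x (r x)) C \<and> measure lborel (D0 - (\<Union>x\<in>C. cball x (r x))) \<le> \<epsilon>"
      by (rule finite_vitali[OF D0 _ \<epsilon>]) (rule pos)
    then obtain C r where C: "finite C" "C \<subseteq> D0" "\<forall>x\<in>C. 0 < r x \<and> r x \<le> min (\<rho> (0, x)) (e x) \<and> cball x (r x) \<subseteq> D0"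
      "disjoint_family_on (\<lambda>x. cball x (r x)) C" "measure lborel (D0 - (\<Union>x\<in>C. cball x (r x))) \<le> \<epsilon>"
      by (elim exE conjE) (rule that)
    let ?C = "(\<lambda>x. (0::real, x)) ` C" and ?r = "\<lambda>y::spacetime. r (snd y)"
    have sl: "(0::real, x) \<in> cball (0, x') s \<longleftrightarrow> x \<in> cball x' s" for x x' :: "real^2" and s by (simp add: dist_Pair_Pair)
    show ?thesis
    proof (intro exI[of _ ?C] exI[of _ ?r] conjI)
      show "finite ?C" using C(1) by simp
      show "?C \<subseteq> {y. fst y = 0} \<inter> D" using C(2) by (auto simp: D0_def)
      show "\<forall>y\<in>?C. 0 < ?r y \<and> ?r y \<le> \<rho> y \<and> cball y (?r y) \<subseteq> D"
      proof (rule ballI, elim imageE)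
        fix y :: spacetime and x assume y: "y = (0, x)" "x \<in> C"
        have "cball (0, x) (r x) \<subseteq> cball (0::real, x) (e x)" using C(3) y by (intro subset_cball) auto
        then show "0 < ?r y \<and> ?r y \<le> \<rho> y \<and> cball y (?r y) \<subseteq> D" using C(2,3) e[of x] y by auto
      qed
      show "disjoint_family_on (\<lambda>y. cball y (?r y)) ?C"
        unfolding disjoint_family_on_def
      proof (intro ballI impI, elim imageE)
        fix y y' :: spacetime and x x' assume y: "y \<noteq> y'" "y = (0, x)" "x \<in> C" "y' = (0, x')" "x' \<in> C"
        then have "cball x (r x) \<inter> cball x' (r x') = {}" using C(4) by (auto simp: disjoint_family_on_def simp del: disjoint_iff)
        then have "r x + r x' < dist x x'" using C(3) y by (intro cball_disjoint_dist) auto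
        then show "cball y (?r y) \<inter> cball y' (?r y') = {}" using y by (intro cball_disjoint_if_dist) (simp add: dist_Pair_Pair)
      qed
      have "{x. (0, x) \<in> D - (\<Union>y\<in>?C. cball y (?r y))} = D0 - (\<Union>x\<in>C. cball x (r x))"
        using sl by (auto simp: D0_def)
      moreover have "D - (\<Union>y\<in>?C. cball y (?r y)) \<in> sets borel" using D(1) C(1) by (auto intro!: sets.Diff sets.finite_UN)
      ultimately show "measure initial_measure (D - (\<Union>y\<in>?C. cball y (?r y))) \<le> \<epsilon>" using C(5) by (simp add: measure_initial)
    qed
  qed
qed

section \<open>Infinitely many solutions with prescribed modulus\<close>

text \<open>
  Only the linear system is passed to the limit; the nonlinear relation between m and u comes from saturation.
\<close>

lemma weak_euler_limit:
  assumes \<Omega>: "open \<Omega>" "bounded \<Omega>"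
    and z: "\<And>n. set_borel_measurable borel ({0<..<T} \<times> \<Omega>) (zs n)" "\<And>n y. y \<in> {0<..<T} \<times> \<Omega> \<Longrightarrow> norm (zs n y) \<le> B"
    and Z: "bounded_field ({0<..<T} \<times> \<Omega>) z"
    and lim: "AE y in lborel. y \<in> {0<..<T} \<times> \<Omega> \<longrightarrow> (\<lambda>n. zs n y) \<longlonglongrightarrow> z y"
    and i: "\<And>n. set_borel_measurable borel \<Omega> (js n)" "\<And>n x. x \<in> \<Omega> \<Longrightarrow> norm (js n x) \<le> B"
    and I: "set_borel_measurable borel \<Omega> j" "\<And>x. x \<in> \<Omega> \<Longrightarrow> norm (j x) \<le> B'"
    and limi: "AE x in lborel. x \<in> \<Omega> \<longrightarrow> (\<lambda>n. js n x) \<longlonglongrightarrow> j x"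
    and b: "\<And>n. weak_euler T \<Omega> (zs n) (js n)"
  shows "weak_euler T \<Omega> z j"
proof -
  let ?R = "{0<..<T} \<times> \<Omega>"
  have zb: "bounded_field ?R (zs n)" for n using z unfolding bounded_field_def by blast
  note c = bounded_field_components
  have n1: "\<bar>Re (fst v)\<bar> \<le> norm v" "\<bar>Im (fst v)\<bar> \<le> norm v" "\<bar>Re (snd v)\<bar> \<le> norm v" "\<bar>Im (snd v)\<bar> \<le> norm v" for v :: state
    using order_trans[OF abs_Re_le_cmod norm_fst_le[of "fst v" "snd v"]] order_trans[OF abs_Im_le_cmod norm_fst_le[of "fst v" "snd v"]]
      order_trans[OF abs_Re_le_cmod norm_snd_le[of "snd v" "fst v"]] order_trans[OF abs_Im_le_cmod norm_snd_le[of "snd v" "fst v"]] by (simp_all only: prod.collapse)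
  have B: "\<bar>f\<bar> \<le> \<bar>B\<bar>" if "\<bar>f\<bar> \<le> norm (zs n y)" "y \<in> ?R" for f n y using that z(2)[of y n] by linarith
  have meas: "set_borel_measurable borel A f" if "bounded_measurable A f" for A :: "'c::euclidean_space set" and f using that by (simp add: bounded_measurable_def)
  have zero: "bounded_measurable A (\<lambda>_. 0)" for A :: "'c::euclidean_space set"
    by (auto simp: bounded_measurable_def set_borel_measurable_def)
  have li: "AE x in lborel. x \<in> \<Omega> \<longrightarrow> (\<lambda>n. Re (js n x)) \<longlonglongrightarrow> Re (j x)" "AE x in lborel. x \<in> \<Omega> \<longrightarrow> (\<lambda>n. Im (js n x)) \<longlonglongrightarrow> Im (j x)"
  proof -
    show "AE x in lborel. x \<in> \<Omega> \<longrightarrow> (\<lambda>n. Re (js n x)) \<longlonglongrightarrow> Re (j x)" using limi by eventually_elim (auto intro!: tendsto_intros)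
    show "AE x in lborel. x \<in> \<Omega> \<longrightarrow> (\<lambda>n. Im (js n x)) \<longlonglongrightarrow> Im (j x)" using limi by eventually_elim (auto intro!: tendsto_intros)
  qed
  have bi: "\<bar>Re (js n x)\<bar> \<le> \<bar>B\<bar>" "\<bar>Im (js n x)\<bar> \<le> \<bar>B\<bar>" if "x \<in> \<Omega>" for n x
    using i(2)[OF that, of n] abs_Re_le_cmod[of "js n x"] abs_Im_le_cmod[of "js n x"] by linarith+
  have lz: "AE y in lborel. y \<in> ?R \<longrightarrow> (\<lambda>n. f (zs n y)) \<longlonglongrightarrow> f (z y)" if "continuous_on UNIV f" for f :: "state \<Rightarrow> real"
    using lim by eventually_elim (use that in \<open>auto intro: continuous_on_tendsto_compose[of UNIV f]\<close>)
  have cf: "continuous_on UNIV (\<lambda>v::state. Re (fst v))" "continuous_on UNIV (\<lambda>v::state. Im (fst v))" "continuous_on UNIV (\<lambda>v::state. Re (snd v))" "continuous_on UNIV (\<lambda>v::state. Im (snd v))"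
    by (intro continuous_intros)+
  define L where "L f j0 J \<longleftrightarrow> (\<forall>n. balance T \<Omega> (\<lambda>y. f 0 (zs n y)) (\<lambda>y. f 1 (zs n y)) (\<lambda>y. f (2::nat) (zs n y)) (j0 n)) \<longrightarrow>
      balance T \<Omega> (\<lambda>y. f 0 (z y)) (\<lambda>y. f 1 (z y)) (\<lambda>y. f 2 (z y)) J" for f :: "nat \<Rightarrow> state \<Rightarrow> real" and j0 J
  have main: "L f j0 J" if f: "\<And>k. f k \<in> {\<lambda>_. 0, \<lambda>v. Re (fst v), \<lambda>v. Im (fst v), \<lambda>v. Re (snd v), \<lambda>v. Im (snd v), \<lambda>v. - Re (snd v)}"
    and j0: "\<And>n. set_borel_measurable borel \<Omega> (j0 n)" "\<And>n x. x \<in> \<Omega> \<Longrightarrow> \<bar>j0 n x\<bar> \<le> \<bar>B\<bar>" "bounded_measurable \<Omega> J"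
      "AE x in lborel. x \<in> \<Omega> \<longrightarrow> (\<lambda>n. j0 n x) \<longlonglongrightarrow> J x" for f j0 J
    unfolding L_def
  proof
    assume bal: "\<forall>n. balance T \<Omega> (\<lambda>y. f 0 (zs n y)) (\<lambda>y. f 1 (zs n y)) (\<lambda>y. f 2 (zs n y)) (j0 n)"
    have fc: "continuous_on UNIV (f k)" for k using f[of k] cf by (auto intro: continuous_intros)
    have fm: "bounded_measurable ?R (\<lambda>y. f k (w y))" if "bounded_field ?R w" for k w
      using f[of k] c[OF that] zero by (auto intro: bounded_measurable_minus)
    have fb: "\<bar>f k v\<bar> \<le> norm v" for k v using f[of k] n1[of v] by auto
    show "balance T \<Omega> (\<lambda>y. f 0 (z y)) (\<lambda>y. f 1 (z y)) (\<lambda>y. f 2 (z y)) J"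
    proof (rule balance_limit[OF \<Omega>, where g = "\<lambda>n k y. f k (zs n y)" and G = "\<lambda>k y. f k (z y)" and B = "\<bar>B\<bar>" and i = j0])
      show "set_borel_measurable borel ?R (\<lambda>y. f k (zs n y))" for n k by (rule meas[OF fm[OF zb]])
      show "\<bar>f k (zs n y)\<bar> \<le> \<bar>B\<bar>" if "y \<in> ?R" for n k y by (rule B[OF fb that])
      show "bounded_measurable ?R (\<lambda>y. f k (z y))" for k by (rule fm[OF Z])
      show "AE y in lborel. y \<in> ?R \<longrightarrow> (\<lambda>n. f k (zs n y)) \<longlonglongrightarrow> f k (z y)" for k by (rule lz[OF fc])
      show "balance T \<Omega> (\<lambda>y. f 0 (zs n y)) (\<lambda>y. f 1 (zs n y)) (\<lambda>y. f 2 (zs n y)) (j0 n)" for n using bal by blast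
    qed (use j0 in auto)
  qed
  let ?s = "\<lambda>f0 f1 f2 k. if k = (0::nat) then f0 else if k = 1 then f1 else (f2 :: state \<Rightarrow> real)"
  have zi: "bounded_measurable \<Omega> (\<lambda>x. Re (js n x))" "bounded_measurable \<Omega> (\<lambda>x. Im (js n x))" for n
    using bounded_measurable_Re_Im[OF i(1)[of n] i(2)] by auto
  have zI: "bounded_measurable \<Omega> (\<lambda>x. Re (j x))" "bounded_measurable \<Omega> (\<lambda>x. Im (j x))"
    using bounded_measurable_Re_Im[OF I] by auto
  have "L (?s (\<lambda>_. 0) (\<lambda>v. Re (fst v)) (\<lambda>v. Im (fst v))) (\<lambda>_ _. 0) (\<lambda>_. 0)" by (rule main) (use meas[OF zero] zero in auto)
  moreover have "L (?s (\<lambda>v. Re (fst v)) (\<lambda>v. Re (snd v)) (\<lambda>v. Im (snd v))) (\<lambda>n x. Re (js n x)) (\<lambda>x. Re (j x))"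
    by (rule main) (use meas[OF zi(1)] zI li bi in auto)
  moreover have "L (?s (\<lambda>v. Im (fst v)) (\<lambda>v. Im (snd v)) (\<lambda>v. - Re (snd v))) (\<lambda>n x. Im (js n x)) (\<lambda>x. Im (j x))"
    by (rule main) (use meas[OF zi(2)] zI li bi in auto)
  ultimately show ?thesis using b unfolding weak_euler_def L_def by simp
qed

text \<open>
  The largest eigenvalue is the maximum over unit vectors of a function that is convex in m and affine in u.
  This form shows the convexity of the energy.
\<close>

lemma energy_less_iff: "energy z < q \<longleftrightarrow> (\<forall>\<nu>. norm \<nu> = 1 \<longrightarrow> (Re (cnj \<nu> * fst z))\<^sup>2 - Re ((cnj \<nu>)\<^sup>2 * snd z) < q)"
proof -
  obtain m u where z: "z = (m, u)" by (cases z)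
  define W where "W = m\<^sup>2 / 2 - u"
  have e: "energy z = (norm m)\<^sup>2 / 2 + norm W" by (simp add: energy_def z W_def norm_minus_commute)
  have id: "(Re (cnj \<nu> * m))\<^sup>2 - Re ((cnj \<nu>)\<^sup>2 * u) = (norm m)\<^sup>2 / 2 + Re ((cnj \<nu>)\<^sup>2 * W)" if \<nu>: "norm \<nu> = 1" for \<nu>
  proof -
    have sq: "2 * (Re x)\<^sup>2 = (norm x)\<^sup>2 + Re (x\<^sup>2)" for x by (simp add: cmod_power2 Re_power2)
    have "(norm (cnj \<nu> * m))\<^sup>2 = (norm m)\<^sup>2" using \<nu> by (simp add: norm_mult)
    then have "2 * (Re (cnj \<nu> * m))\<^sup>2 = (norm m)\<^sup>2 + Re ((cnj \<nu>)\<^sup>2 * m\<^sup>2)" using sq[of "cnj \<nu> * m"] by (simp add: power_mult_distrib)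
    moreover have "(cnj \<nu>)\<^sup>2 * W = (cnj \<nu>)\<^sup>2 * m\<^sup>2 / 2 - (cnj \<nu>)\<^sup>2 * u" by (simp add: W_def right_diff_distrib)
    then have "Re ((cnj \<nu>)\<^sup>2 * W) = Re ((cnj \<nu>)\<^sup>2 * m\<^sup>2) / 2 - Re ((cnj \<nu>)\<^sup>2 * u)" by (simp only: minus_complex.simps Re_divide_numeral)
    ultimately show ?thesis by linarith
  qed
  show ?thesis
  proof
    assume l: "energy z < q"
    show "\<forall>\<nu>. norm \<nu> = 1 \<longrightarrow> (Re (cnj \<nu> * fst z))\<^sup>2 - Re ((cnj \<nu>)\<^sup>2 * snd z) < q"
    proof (intro allI impI)
      fix \<nu> :: complex assume \<nu>: "norm \<nu> = 1"
      have "Re ((cnj \<nu>)\<^sup>2 * W) \<le> norm W" using complex_Re_le_cmod[of "(cnj \<nu>)\<^sup>2 * W"] \<nu> by (simp add: norm_mult norm_power)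
      then show "(Re (cnj \<nu> * fst z))\<^sup>2 - Re ((cnj \<nu>)\<^sup>2 * snd z) < q" using id[OF \<nu>] l e by (simp add: z)
    qed
  next
    assume r: "\<forall>\<nu>. norm \<nu> = 1 \<longrightarrow> (Re (cnj \<nu> * fst z))\<^sup>2 - Re ((cnj \<nu>)\<^sup>2 * snd z) < q"
    define b where "b = (if W = 0 then 1 else W / of_real (norm W))"
    have b: "norm b = 1" "W = of_real (norm W) * b" by (auto simp: b_def norm_divide)
    define \<nu> where "\<nu> = csqrt b"
    have \<nu>: "norm \<nu> = 1" "\<nu>\<^sup>2 = b" using b by (simp_all add: \<nu>_def)
    have "cnj (\<nu>\<^sup>2) * W = of_real (norm W) * (b * cnj b)" by (subst b(2)) (simp add: \<nu>(2) mult.commute mult.left_commute)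
    also have "\<dots> = of_real (norm W)" using b(1) by (simp add: complex_norm_square[symmetric])
    finally have "Re ((cnj \<nu>)\<^sup>2 * W) = norm W" by simp
    then show "energy z < q" using r[rule_format, OF \<nu>(1)] id[OF \<nu>(1)] e by (simp add: z)
  qed
qed

lemma energy_convex:
  assumes "energy z < q" "energy (z + p) < q" "0 \<le> l" "l \<le> 1"
  shows "energy (z + l *\<^sub>R p) < q"
  unfolding energy_less_iff
proof (intro allI impI)
  fix \<nu> :: complex assume \<nu>: "norm \<nu> = 1"
  define a where "a = Re (cnj \<nu> * fst z)"
  define b where "b = Re (cnj \<nu> * fst p)"
  define c where "c = Re ((cnj \<nu>)\<^sup>2 * snd z)"
  define d where "d = Re ((cnj \<nu>)\<^sup>2 * snd p)"
  have 1: "a\<^sup>2 - c < q" using assms(1) \<nu> unfolding energy_less_iff a_def c_def by blast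
  have 2: "(a + b)\<^sup>2 - (c + d) < q"
  proof -
    have "(Re (cnj \<nu> * fst (z + p)))\<^sup>2 - Re ((cnj \<nu>)\<^sup>2 * snd (z + p)) < q" using assms(2) \<nu> unfolding energy_less_iff by blast
    then show ?thesis by (simp only: fst_add snd_add distrib_left plus_complex.simps a_def b_def c_def d_def)
  qed
  have lin: "Re (x * (y + l *\<^sub>R w)) = Re (x * y) + l * Re (x * w)" for x y w by (simp add: distrib_left algebra_simps)
  have "(a + l * b)\<^sup>2 - (c + l * d) = (1 - l) * (a\<^sup>2 - c) + l * ((a + b)\<^sup>2 - (c + d)) - l * (1 - l) * b\<^sup>2"
    by (simp add: power2_eq_square algebra_simps)
  also have "\<dots> \<le> (1 - l) * (a\<^sup>2 - c) + l * ((a + b)\<^sup>2 - (c + d))" using assms(3,4) by simp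
  also have "\<dots> < q" using 1 2 assms(3,4) convex_bound_lt[of "a\<^sup>2 - c" q "(a + b)\<^sup>2 - (c + d)" "1 - l" l] by simp
  finally show "(Re (cnj \<nu> * fst (z + l *\<^sub>R p)))\<^sup>2 - Re ((cnj \<nu>)\<^sup>2 * snd (z + l *\<^sub>R p)) < q"
    by (simp only: fst_add snd_add fst_scaleR snd_scaleR lin a_def b_def c_def d_def)
qed

lemma subsolution_bounded_field:
  assumes "open A" "subsolution V q Q z" "A \<subseteq> V"
  shows "bounded_field A z" "\<And>y. y \<in> A \<Longrightarrow> norm (z y) \<le> sqrt (2 * Q) + 2 * Q"
proof -
  show b: "norm (z y) \<le> sqrt (2 * Q) + 2 * Q" if "y \<in> A" for y
    using assms that energy_bounds(4) unfolding subsolution_def by blast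
  have "continuous_on A z" using assms unfolding subsolution_def by (blast intro: continuous_on_subset)
  then have "set_borel_measurable borel A z" using assms(1) set_measurable_continuous_on_open by blast
  then show "bounded_field A z" using b unfolding bounded_field_def by blast
qed

text \<open>
  Starting from the zero subsolution, the k-th perturbation is supported in \<open>|t| < T/(k+1)\<close>. At a
  positive time only finitely many perturbations are active, so the limit is still a strict subsolution there,
  while at \<open>t = 0\<close> the modulus is saturated.
\<close>

lemma saturated_initial_data:
  assumes \<Omega>: "open \<Omega>" "bounded \<Omega>" and T: "0 < T" and q: "continuous_on UNIV q" "\<forall>x\<in>\<Omega>. 0 < q x \<and> q x \<le> Q" and Q: "0 < Q"
  shows "\<exists>z m0. subsolution ({0<..<T} \<times> \<Omega>) (\<lambda>y. q (snd y)) Q z \<and> weak_euler T \<Omega> z m0 \<and>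
    m0 \<in> borel_measurable borel \<and> (\<forall>x. norm (m0 x) \<le> sqrt (2 * Q)) \<and> (AE x in lborel. x \<in> \<Omega> \<longrightarrow> (norm (m0 x))\<^sup>2 = 2 * q x)"
proof -
  let ?q = "\<lambda>y::spacetime. q (snd y)" and ?V = "{-T<..<T} \<times> \<Omega>" and ?R = "{0<..<T} \<times> \<Omega>"
  let ?D = "\<lambda>k::nat. {-(T / real (Suc k))<..<T / real (Suc k)} \<times> \<Omega>"
  have V: "open ?V" "?V \<subseteq> {-T<..<T} \<times> \<Omega>" using \<Omega> by (auto intro: open_Times)
  have T1: "0 < T / real (Suc k)" "T / real (Suc k) \<le> T" for k
  proof -
    show "0 < T / real (Suc k)" using T by simp
    have "T / real (Suc k) \<le> T / 1" using T by (intro divide_left_mono) auto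
    then show "T / real (Suc k) \<le> T" by simp
  qed
  have D: "\<And>k. open (?D k)" "\<And>k. ?D k \<subseteq> ?V" "\<And>k. measure initial_measure (?V - ?D k) = 0"
  proof -
    fix k
    show oD: "open (?D k)" using \<Omega> by (intro open_Times) auto
    show "?D k \<subseteq> ?V" using T1(2)[of k] by auto
    have "{x. (0, x) \<in> ?V - ?D k} = {}" using T1(1)[of k] by auto
    moreover have "?V - ?D k \<in> sets borel" using V(1) oD by auto
    ultimately show "measure initial_measure (?V - ?D k) = 0" using measure_initial[of "?V - ?D k"] by (simp only: measure_empty)
  qed
  have qc: "continuous_on UNIV ?q" by (intro continuous_on_compose2[OF q(1)] continuous_intros) auto
  have z0: "subsolution ?V ?q Q (\<lambda>_. 0)" unfolding subsolution_def using q(2) continuous_on_subset[OF qc] by (auto simp: energy_def)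
  have H: "finite ({} :: (spacetime \<Rightarrow> complex) set)" "\<forall>h\<in>{}. continuous_on ?V (h :: spacetime \<Rightarrow> complex)" by auto
  obtain w r m where w: "w 0 = (\<lambda>_. 0)" "\<forall>k. subsolution ?V ?q Q (\<lambda>y. 0 + w k y)"
    "\<forall>k. perturbation T \<Omega> (?D k) (\<lambda>y. w (Suc k) y - w k y)" "strict_mono r" "m \<in> borel_measurable borel"
    "AE y in initial_measure. y \<in> ?V \<longrightarrow> (\<lambda>k. fst (0 + w (r k) y)) \<longlonglongrightarrow> m y \<and> (norm (m y))\<^sup>2 = 2 * ?q y"
    using initial.saturation[where D = ?D and z = "\<lambda>_. 0" and q = ?q, OF \<Omega> T V D z0 Q H zero_less_one] by (elim exE conjE) (rule that)
  have sub: "subsolution ?V ?q Q (w k)" for k using w(2) by simp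
  have wp: "perturbation T \<Omega> ?V (w k)" for k
  proof (induction k)
    case 0 then show ?case using w(1) perturbation_0 by simp
  next
    case (Suc k)
    have "perturbation T \<Omega> ?V (\<lambda>y. w (Suc k) y - w k y)" using w(3) D(2) perturbation_mono by blast
    from perturbation_add[OF \<Omega> Suc this] show ?case by simp
  qed
  have step: "w (Suc k) y = w k y" if "T / real (Suc k) \<le> fst y" for k y
  proof -
    have "y \<notin> ?D k" using that by (cases y) auto
    then have "w (Suc k) y - w k y = 0" using w(3) unfolding perturbation_def by blast
    then show ?thesis by simp
  qed
  have const: "w k y = w n y" if "n \<le> k" "T / real (Suc n) \<le> fst y" for k n y
    using that(1)
  proof (induction k rule: dec_induct)
    case (step k)
    have "T / real (Suc k) \<le> T / real (Suc n)" using T step by (intro divide_left_mono) auto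
    then show ?case using \<open>w k y = w n y\<close> \<open>\<And>k y. T / real (Suc k) \<le> fst y \<Longrightarrow> w (Suc k) y = w k y\<close>[of k y] that(2) by simp
  qed simp
  define N where "N t = nat \<lceil>T / t\<rceil>" for t :: real
  have N: "T / real (Suc (N t)) \<le> t" if "t > 0" for t
  proof -
    have "T / t \<le> real (Suc (N t))" using T that by (simp add: N_def) linarith
    then show ?thesis using that T by (simp add: field_simps)
  qed
  define z where "z y = w (N (fst y)) y" for y
  have zw: "z y = w k y" if "T / real (Suc k) \<le> fst y" "0 < fst y" for k y
  proof (cases "k \<le> N (fst y)")
    case True then show ?thesis using const[OF True that(1)] by (simp add: z_def)
  next
    case False
    then show ?thesis using const[of "N (fst y)" k y] N[OF that(2)] by (simp add: z_def)
  qed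
  have RV: "?R \<subseteq> ?V" using T by auto
  have Ro: "open ?R" using \<Omega> by (intro open_Times) auto
  have zs: "subsolution ?R ?q Q z"
    unfolding subsolution_def
  proof (intro conjI ballI)
    show "continuous_on ?R ?q" using continuous_on_subset[OF qc] by blast
    show "continuous_on ?R z"
      unfolding continuous_on_eq_continuous_at[OF Ro]
    proof
      fix y assume y: "y \<in> ?R"
      then have t: "0 < fst y" by auto
      have ev: "\<forall>\<^sub>F y' in nhds y. z y' = w (N (fst y / 2)) y'"
      proof -
        have "open ({fst y / 2<..} \<times> (UNIV :: (real^2) set))" by (intro open_Times) auto
        moreover have "y \<in> {fst y / 2<..} \<times> UNIV" using t by (cases y) auto
        ultimately have "\<forall>\<^sub>F y' in nhds y. y' \<in> {fst y / 2<..} \<times> UNIV" by (rule eventually_nhds_in_open)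
        then show ?thesis
        proof (rule eventually_mono)
          fix y' :: spacetime assume "y' \<in> {fst y / 2<..} \<times> UNIV"
          then have "fst y / 2 < fst y'" by (cases y') auto
          then show "z y' = w (N (fst y / 2)) y'"
          proof (intro zw)
            have "T / real (Suc (N (fst y / 2))) \<le> fst y / 2" by (rule N) (use t in simp)
            then show "T / real (Suc (N (fst y / 2))) \<le> fst y'" using \<open>fst y / 2 < fst y'\<close> by linarith
            show "0 < fst y'" using \<open>fst y / 2 < fst y'\<close> t by linarith
          qed
        qed
      qed
      have "isCont (w (N (fst y / 2))) y" using wp continuous_on_eq_continuous_at[OF open_UNIV] unfolding perturbation_def by blast
      then show "isCont z y" using isCont_cong[OF ev] by simp
    qed
    fix y assume y: "y \<in> ?R"
    then show "energy (z y) < ?q y" using sub[of "N (fst y)"] RV unfolding z_def subsolution_def by blast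
    show "?q y \<le> Q" using y q(2) by auto
  qed
  define m0 where "m0 x = (if norm (m (0, x)) \<le> sqrt (2 * Q) then m (0, x) else 0)" for x
  have m0m: "m0 \<in> borel_measurable borel"
  proof -
    have [measurable]: "(\<lambda>x. m (0, x)) \<in> borel_measurable borel" using measurable_compose[OF initial_measurable w(5)] by simp
    show ?thesis unfolding m0_def[abs_def] by measurable
  qed
  have m0b: "norm (m0 x) \<le> sqrt (2 * Q)" for x using Q by (simp add: m0_def)
  have ae: "AE x in lborel. x \<in> \<Omega> \<longrightarrow> (\<lambda>k. fst (w (r k) (0, x))) \<longlonglongrightarrow> m0 x \<and> (norm (m0 x))\<^sup>2 = 2 * q x"
    using AE_distrD[OF initial_measurable w(6)[unfolded initial_measure_def]]
  proof eventually_elim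
    case (elim x)
    show ?case
    proof
      assume x: "x \<in> \<Omega>"
      then have "(0, x) \<in> ?V" using T by auto
      then have e: "(\<lambda>k. fst (w (r k) (0, x))) \<longlonglongrightarrow> m (0, x)" "(norm (m (0, x)))\<^sup>2 = 2 * q x" using elim by auto
      then have "norm (m (0, x)) \<le> sqrt (2 * Q)" using q(2)[rule_format, OF x] by (intro real_le_rsqrt) simp
      then show "(\<lambda>k. fst (w (r k) (0, x))) \<longlonglongrightarrow> m0 x \<and> (norm (m0 x))\<^sup>2 = 2 * q x" using e by (simp add: m0_def)
    qed
  qed
  have "weak_euler T \<Omega> z m0"
  proof (rule weak_euler_limit[OF \<Omega>, where zs = "\<lambda>k. w (r k)" and js = "\<lambda>k x. fst (w (r k) (0, x))" and B = "sqrt (2 * Q) + 2 * Q" and B' = "sqrt (2 * Q)"])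
    show "set_borel_measurable borel ?R (w (r n))" for n
      using subsolution_bounded_field(1)[OF Ro sub RV] unfolding bounded_field_def by blast
    show "norm (w (r n) y) \<le> sqrt (2 * Q) + 2 * Q" if "y \<in> ?R" for n y
      using subsolution_bounded_field(2)[OF Ro sub RV that] .
    show "bounded_field ?R z" using subsolution_bounded_field(1)[OF Ro zs] by blast
    show "AE y in lborel. y \<in> ?R \<longrightarrow> (\<lambda>n. w (r n) y) \<longlonglongrightarrow> z y"
    proof (intro AE_I2 impI)
      fix y assume "y \<in> ?R"
      then have t: "0 < fst y" by auto
      have "w (r n) y = z y" if "n \<ge> N (fst y)" for n
        using const[of "N (fst y)" "r n" y] N[OF t] that seq_suble[OF w(4), of n] by (simp add: z_def)
      then show "(\<lambda>n. w (r n) y) \<longlonglongrightarrow> z y" by (intro tendsto_eventually eventually_sequentiallyI)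
    qed
    have cw: "continuous_on UNIV (w k)" for k using wp unfolding perturbation_def by blast
    show "set_borel_measurable borel \<Omega> (\<lambda>x. fst (w (r n) (0, x)))" for n
      using \<Omega> by (intro set_measurable_continuous_on continuous_on_fst continuous_on_compose2[OF cw] continuous_intros) auto
    show "norm (fst (w (r n) (0, x))) \<le> sqrt (2 * Q) + 2 * Q" if "x \<in> \<Omega>" for n x
    proof -
      have "(0, x) \<in> ?V" using that T by auto
      then have "norm (w (r n) (0, x)) \<le> sqrt (2 * Q) + 2 * Q" using subsolution_bounded_field(2)[OF V(1) sub order_refl] by blast
      then show ?thesis using norm_fst_le[of "fst (w (r n) (0, x))" "snd (w (r n) (0, x))"] by simp
    qed
    show "set_borel_measurable borel \<Omega> m0" using m0m \<Omega> by (intro set_measurable_UNIV) auto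
    show "norm (m0 x) \<le> sqrt (2 * Q)" for x by (rule m0b)
    show "AE x in lborel. x \<in> \<Omega> \<longrightarrow> (\<lambda>n. fst (w (r n) (0, x))) \<longlonglongrightarrow> m0 x" using ae by eventually_elim blast
    show "weak_euler T \<Omega> (w (r n)) (\<lambda>x. fst (w (r n) (0, x)))" for n using wp unfolding perturbation_def by blast
  qed
  moreover have "AE x in lborel. x \<in> \<Omega> \<longrightarrow> (norm (m0 x))\<^sup>2 = 2 * q x" using ae by eventually_elim blast
  ultimately show ?thesis using zs m0m m0b by blast
qed

lemma weak_euler_add_interior:
  assumes \<Omega>: "open \<Omega>" "bounded \<Omega>"
    and z: "bounded_field ({0<..<T} \<times> \<Omega>) z" "weak_euler T \<Omega> z i"
    and i: "i \<in> borel_measurable borel" "\<And>x. norm (i x) \<le> B"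
    and p: "perturbation T \<Omega> ({0<..<T} \<times> \<Omega>) p"
  shows "weak_euler T \<Omega> (\<lambda>y. z y + p y) i"
proof -
  have "p (0, x) = 0" for x using p unfolding perturbation_def by fastforce
  moreover have "set_borel_measurable borel \<Omega> i" using i \<Omega> by (intro set_measurable_UNIV) auto
  ultimately show ?thesis
    using weak_euler_add_perturbation[OF \<Omega> z _ _ p] bounded_measurable_Re_Im[of \<Omega> i B] i(2) by simp
qed

text \<open>
  Perturbations supported in \<open>t > 0\<close> keep the initial value. Convergence of the energy bound to
  equality forces \<open>u = m\<^sup>2/2\<close> in the limit.
\<close>

lemma saturated_solution:
  assumes \<Omega>: "open \<Omega>" "bounded \<Omega>" and T: "0 < T" and q: "continuous_on UNIV q" and Q: "0 < Q"
    and z: "subsolution ({0<..<T} \<times> \<Omega>) (\<lambda>y. q (snd y)) Q z" "weak_euler T \<Omega> z m0"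
    and m0: "m0 \<in> borel_measurable borel" "\<And>x. norm (m0 x) \<le> sqrt (2 * Q)"
    and h: "continuous_on UNIV h" and \<epsilon>: "0 < \<epsilon>"
  shows "\<exists>m. m \<in> borel_measurable borel \<and> (\<forall>y. norm (m y) \<le> sqrt (2 * Q)) \<and>
    (AE y in lborel. y \<in> {0<..<T} \<times> \<Omega> \<longrightarrow> (norm (m y))\<^sup>2 = 2 * q (snd y)) \<and>
    weak_euler T \<Omega> (\<lambda>y. (m y, (m y)\<^sup>2 / 2)) m0 \<and>
    \<bar>(LINT y:{0<..<T} \<times> \<Omega>|lborel. h y \<bullet> m y) - (LINT y:{0<..<T} \<times> \<Omega>|lborel. h y \<bullet> fst (z y))\<bar> \<le> \<epsilon>"
proof -
  let ?q = "\<lambda>y::spacetime. q (snd y)" and ?R = "{0<..<T} \<times> \<Omega>"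
  have R: "open ?R" "?R \<subseteq> {-T<..<T} \<times> \<Omega>" "bounded ?R" "?R \<in> sets borel"
    using \<Omega> T by (auto intro: open_Times) (use \<Omega> slab_borel slab_bounded in blast)+
  have Dk: "\<And>k::nat. open ?R" "\<And>k::nat. ?R \<subseteq> ?R" "\<And>k::nat. measure lborel (?R - ?R) = 0" using R(1) by auto
  have H: "finite {h}" "\<forall>h\<in>{h}. continuous_on ?R h" using continuous_on_subset[OF h] by auto
  obtain w r m where w: "w 0 = (\<lambda>_. 0)" "\<forall>k. subsolution ?R ?q Q (\<lambda>y. z y + w k y)"
    "\<forall>k. perturbation T \<Omega> ?R (\<lambda>y. w (Suc k) y - w k y)" "strict_mono r" "m \<in> borel_measurable borel"
    "AE y in lborel. y \<in> ?R \<longrightarrow> (\<lambda>k. fst (z y + w (r k) y)) \<longlonglongrightarrow> m y \<and> (norm (m y))\<^sup>2 = 2 * ?q y"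
    "\<forall>k. \<forall>h\<in>{h}. \<bar>LINT y:?R|lborel. h y \<bullet> fst (w k y)\<bar> \<le> \<epsilon>"
    using volume.saturation[where D = "\<lambda>_. ?R" and z = z and q = ?q and H = "{h}", OF \<Omega> T R(1,2) Dk z(1) Q H \<epsilon>]
    by (elim exE conjE) (rule that)
  have sub: "subsolution ?R ?q Q (\<lambda>y. z y + w k y)" for k using w(2) by blast
  have qQ: "q (snd y) \<le> Q" if "y \<in> ?R" for y using z(1) that unfolding subsolution_def by blast
  (* in the slab the bound fails only on a null set; this version obeys it everywhere *)
  define m' where "m' y = (if norm (m y) \<le> sqrt (2 * Q) then m y else 0)" for y
  have m'm: "m' \<in> borel_measurable borel"
  proof -
    note [measurable] = w(5)
    show ?thesis unfolding m'_def[abs_def] by measurable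
  qed
  have m'b: "norm (m' y) \<le> sqrt (2 * Q)" for y using Q by (simp add: m'_def)
  have ae: "AE y in lborel. y \<in> ?R \<longrightarrow> (\<lambda>k. fst (z y + w (r k) y)) \<longlonglongrightarrow> m' y \<and> (norm (m' y))\<^sup>2 = 2 * q (snd y)"
    using w(6)
  proof eventually_elim
    case (elim y)
    show ?case
    proof
      assume y: "y \<in> ?R"
      then have e: "(\<lambda>k. fst (z y + w (r k) y)) \<longlonglongrightarrow> m y" "(norm (m y))\<^sup>2 = 2 * q (snd y)" using elim by blast+
      then have "norm (m y) \<le> sqrt (2 * Q)" using qQ[OF y] by (intro real_le_rsqrt) simp
      then have "m' y = m y" by (simp add: m'_def)
      then show "(\<lambda>k. fst (z y + w (r k) y)) \<longlonglongrightarrow> m' y \<and> (norm (m' y))\<^sup>2 = 2 * q (snd y)" using e by simp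
    qed
  qed
  have lim: "AE y in lborel. y \<in> ?R \<longrightarrow> (\<lambda>k. z y + w (r k) y) \<longlonglongrightarrow> (m' y, (m' y)\<^sup>2 / 2)"
    using ae
  proof eventually_elim
    case (elim y)
    show ?case
    proof
      assume y: "y \<in> ?R"
      let ?z = "\<lambda>k. z y + w (r k) y"
      have e: "(\<lambda>k. fst (?z k)) \<longlonglongrightarrow> m' y" "(norm (m' y))\<^sup>2 = 2 * q (snd y)" using elim y by blast+
      have "(\<lambda>k. q (snd y) - (norm (fst (?z k)))\<^sup>2 / 2) \<longlonglongrightarrow> q (snd y) - (norm (m' y))\<^sup>2 / 2" by (intro tendsto_intros e) simp
      then have 0: "(\<lambda>k. q (snd y) - (norm (fst (?z k)))\<^sup>2 / 2) \<longlonglongrightarrow> 0" using e(2) by simp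
      have "(\<lambda>k. snd (?z k) - (fst (?z k))\<^sup>2 / 2) \<longlonglongrightarrow> 0"
      proof (rule Lim_null_comparison[OF _ 0], rule always_eventually, rule allI)
        fix k
        have "energy (?z k) < q (snd y)" using sub[of "r k"] y unfolding subsolution_def by blast
        then show "norm (snd (?z k) - (fst (?z k))\<^sup>2 / 2) \<le> q (snd y) - (norm (fst (?z k)))\<^sup>2 / 2" unfolding energy_def by linarith
      qed
      moreover have "(\<lambda>k. (fst (?z k))\<^sup>2 / 2) \<longlonglongrightarrow> (m' y)\<^sup>2 / 2" by (intro tendsto_intros e) simp
      ultimately have "(\<lambda>k. snd (?z k) - (fst (?z k))\<^sup>2 / 2 + (fst (?z k))\<^sup>2 / 2) \<longlonglongrightarrow> 0 + (m' y)\<^sup>2 / 2" by (rule tendsto_add)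
      then have "(\<lambda>k. snd (?z k)) \<longlonglongrightarrow> (m' y)\<^sup>2 / 2" by simp
      then have "(\<lambda>k. (fst (?z k), snd (?z k))) \<longlonglongrightarrow> (m' y, (m' y)\<^sup>2 / 2)" by (intro tendsto_Pair e)
      then show "?z \<longlonglongrightarrow> (m' y, (m' y)\<^sup>2 / 2)" by (simp only: prod.collapse)
    qed
  qed
  have m0': "set_borel_measurable borel \<Omega> m0" using m0(1) \<Omega> by (intro set_measurable_UNIV) auto
  have wk: "weak_euler T \<Omega> (\<lambda>y. z y + w k y) m0" for k
  proof (induction k)
    case 0 then show ?case using z(2) w(1) by simp
  next
    case (Suc k)
    have "weak_euler T \<Omega> (\<lambda>y. (z y + w k y) + (w (Suc k) y - w k y)) m0"
      using w(3) by (intro weak_euler_add_interior[OF \<Omega> subsolution_bounded_field(1)[OF R(1) sub order_refl] Suc m0]) blast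
    then show ?case by simp
  qed
  have "weak_euler T \<Omega> (\<lambda>y. (m' y, (m' y)\<^sup>2 / 2)) m0"
  proof (rule weak_euler_limit[OF \<Omega>, where zs = "\<lambda>k y. z y + w (r k) y" and js = "\<lambda>k. m0" and B = "sqrt (2 * Q) + 2 * Q" and B' = "sqrt (2 * Q)"])
    show "set_borel_measurable borel ?R (\<lambda>y. z y + w (r n) y)" for n
      using subsolution_bounded_field(1)[OF R(1) sub order_refl] unfolding bounded_field_def by blast
    show "norm (z y + w (r n) y) \<le> sqrt (2 * Q) + 2 * Q" if "y \<in> ?R" for n y
      using subsolution_bounded_field(2)[OF R(1) sub order_refl that] .
    show "bounded_field ?R (\<lambda>y. (m' y, (m' y)\<^sup>2 / 2))"
      unfolding bounded_field_def
    proof (intro conjI exI ballI)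
      have "(\<lambda>v::complex. (v, v\<^sup>2 / 2)) \<in> borel_measurable borel" by (intro borel_measurable_continuous_onI continuous_intros) auto
      then show "set_borel_measurable borel ?R (\<lambda>y. (m' y, (m' y)\<^sup>2 / 2))"
        by (intro set_measurable_UNIV R measurable_compose[OF m'm])
      fix y
      have "norm (m' y, (m' y)\<^sup>2 / 2) \<le> norm (m' y) + norm ((m' y)\<^sup>2 / 2)" by (rule norm_Pair_le)
      also have "\<dots> = norm (m' y) + (norm (m' y))\<^sup>2 / 2" by (simp add: norm_divide norm_power)
      also have "\<dots> \<le> sqrt (2 * Q) + (sqrt (2 * Q))\<^sup>2 / 2" using m'b[of y] by (intro add_mono divide_right_mono power_mono) auto
      finally show "norm (m' y, (m' y)\<^sup>2 / 2) \<le> sqrt (2 * Q) + (sqrt (2 * Q))\<^sup>2 / 2" .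
    qed
    show "norm (m0 x) \<le> sqrt (2 * Q) + 2 * Q" for x using m0(2)[of x] Q by simp
    show "norm (m0 x) \<le> sqrt (2 * Q)" for x by (rule m0(2))
    show "set_borel_measurable borel \<Omega> m0" "set_borel_measurable borel \<Omega> m0" by (rule m0')+
    show "AE x in lborel. x \<in> \<Omega> \<longrightarrow> (\<lambda>n. m0 x) \<longlonglongrightarrow> m0 x" by simp
    show "weak_euler T \<Omega> (\<lambda>y. z y + w (r n) y) m0" for n by (rule wk)
    show "AE y in lborel. y \<in> ?R \<longrightarrow> (\<lambda>n. z y + w (r n) y) \<longlonglongrightarrow> (m' y, (m' y)\<^sup>2 / 2)" by (rule lim)
  qed
  moreover have "\<bar>(LINT y:?R|lborel. h y \<bullet> m' y) - (LINT y:?R|lborel. h y \<bullet> fst (z y))\<bar> \<le> \<epsilon>"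
  proof -
    obtain M where M: "M > 0" "\<And>y. y \<in> ?R \<Longrightarrow> norm (h y) \<le> M" using continuous_bounded_on_bounded[OF R(3) h] by metis
    have hz: "set_borel_measurable borel ?R (\<lambda>y. h y \<bullet> fst (z y + w k y))" "y \<in> ?R \<Longrightarrow> \<bar>h y \<bullet> fst (z y + w k y)\<bar> \<le> M * sqrt (2 * Q)" for k y
    proof -
      show "set_borel_measurable borel ?R (\<lambda>y. h y \<bullet> fst (z y + w k y))"
        using sub[of k] unfolding subsolution_def
        by (intro set_measurable_continuous_on R continuous_on_inner continuous_on_fst continuous_on_subset[OF h]) auto
      assume y: "y \<in> ?R"
      have "\<bar>h y \<bullet> fst (z y + w k y)\<bar> \<le> norm (h y) * norm (fst (z y + w k y))" by (rule Cauchy_Schwarz_ineq2)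
      also have "\<dots> \<le> M * sqrt (2 * Q)"
      proof (intro mult_mono M(2)[OF y])
        have "energy (z y + w k y) < q (snd y)" using sub[of k] y unfolding subsolution_def by blast
        from energy_bounds(2)[OF this qQ[OF y]] show "norm (fst (z y + w k y)) \<le> sqrt (2 * Q)" .
      qed (use M in auto)
      finally show "\<bar>h y \<bullet> fst (z y + w k y)\<bar> \<le> M * sqrt (2 * Q)" .
    qed
    have "(\<lambda>k. LINT y:?R|lborel. h y \<bullet> fst (z y + w (r k) y)) \<longlonglongrightarrow> (LINT y:?R|lborel. h y \<bullet> m' y)"
    proof (rule set_integral_dominated_limit[OF R(4,3) hz(1) _ hz(2)])
      show "set_borel_measurable borel ?R (\<lambda>y. h y \<bullet> m' y)"
        using m'm borel_measurable_continuous_onI[OF h] R by (intro set_measurable_UNIV borel_measurable_inner)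
      show "AE y in lborel. y \<in> ?R \<longrightarrow> (\<lambda>n. h y \<bullet> fst (z y + w (r n) y)) \<longlonglongrightarrow> h y \<bullet> m' y"
        using ae
      proof eventually_elim
        case (elim y)
        show ?case
        proof
          assume "y \<in> ?R"
          then have "(\<lambda>k. fst (z y + w (r k) y)) \<longlonglongrightarrow> m' y" using elim by blast
          then show "(\<lambda>n. h y \<bullet> fst (z y + w (r n) y)) \<longlonglongrightarrow> h y \<bullet> m' y" by (intro tendsto_inner tendsto_const)
        qed
      qed
    qed
    then have l: "(\<lambda>k. \<bar>(LINT y:?R|lborel. h y \<bullet> fst (z y + w (r k) y)) - (LINT y:?R|lborel. h y \<bullet> fst (z y))\<bar>) \<longlonglongrightarrow>
       \<bar>(LINT y:?R|lborel. h y \<bullet> m' y) - (LINT y:?R|lborel. h y \<bullet> fst (z y))\<bar>" by (intro tendsto_intros)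
    have "\<bar>(LINT y:?R|lborel. h y \<bullet> fst (z y + w k y)) - (LINT y:?R|lborel. h y \<bullet> fst (z y))\<bar> \<le> \<epsilon>" for k
    proof -
      have i: "set_integrable lborel ?R (\<lambda>y. h y \<bullet> fst (z y + w k y))" for k
        by (rule set_integrable_bounded[OF R(4,3) hz(1) hz(2)])
      have i0: "set_integrable lborel ?R (\<lambda>y. h y \<bullet> fst (z y))" using i[of 0] w(1) by simp
      have "(LINT y:?R|lborel. h y \<bullet> fst (z y + w k y)) - (LINT y:?R|lborel. h y \<bullet> fst (z y)) = (LINT y:?R|lborel. h y \<bullet> fst (z y + w k y) - h y \<bullet> fst (z y))"
        by (rule set_integral_diff(2)[OF i i0, symmetric])
      also have "\<dots> = (LINT y:?R|lborel. h y \<bullet> fst (w k y))" by (simp add: inner_add_right)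
      finally show ?thesis using w(7) by simp
    qed
    then show ?thesis by (intro LIMSEQ_le_const2[OF l]) blast
  qed
  moreover have "AE y in lborel. y \<in> ?R \<longrightarrow> (norm (m' y))\<^sup>2 = 2 * q (snd y)" using ae by eventually_elim blast
  ultimately show ?thesis using m'm m'b by blast
qed

lemma separated_by_scale:
  fixes X Y a b c :: real
  assumes "\<bar>X - (c + a)\<bar> \<le> a / 8" "\<bar>Y - (c + b)\<bar> \<le> b / 8" "b \<le> a / 2" "0 < a"
  shows "X \<noteq> Y"
proof
  assume "X = Y" then show False using assms by linarith
qed

text \<open>
  A nontrivial perturbation p of the subsolution z, scaled by powers of one half, gives subsolutions whose
  pairings with p differ; saturating each of them with an error small compared to its scale keeps the pairings
  different.
\<close>

theorem infinitely_many_saturated_solutions: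
  assumes \<Omega>: "open \<Omega>" "bounded \<Omega>" "\<Omega> \<noteq> {}" and T: "0 < T" and q: "continuous_on UNIV q" "\<forall>x\<in>\<Omega>. 0 < q x \<and> q x \<le> Q" and Q: "0 < Q"
  shows "\<exists>m0 (m :: nat \<Rightarrow> spacetime \<Rightarrow> complex). m0 \<in> borel_measurable borel \<and> (\<forall>x. norm (m0 x) \<le> sqrt (2 * Q)) \<and>
    (AE x in lborel. x \<in> \<Omega> \<longrightarrow> (norm (m0 x))\<^sup>2 = 2 * q x) \<and>
    (\<forall>n. m n \<in> borel_measurable borel \<and> (\<forall>y. norm (m n y) \<le> sqrt (2 * Q)) \<and>
      (AE y in lborel. y \<in> {0<..<T} \<times> \<Omega> \<longrightarrow> (norm (m n y))\<^sup>2 = 2 * q (snd y)) \<and>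
      weak_euler T \<Omega> (\<lambda>y. (m n y, (m n y)\<^sup>2 / 2)) m0) \<and>
    (\<forall>i j. i \<noteq> j \<longrightarrow> \<not> (AE y in lborel. y \<in> {0<..<T} \<times> \<Omega> \<longrightarrow> m i y = m j y))"
proof -
  let ?q = "\<lambda>y::spacetime. q (snd y)" and ?R = "{0<..<T} \<times> \<Omega>"
  have R: "open ?R" "?R \<subseteq> {-T<..<T} \<times> \<Omega>" "bounded ?R" "?R \<in> sets borel"
    using \<Omega> T by (auto intro: open_Times) (use \<Omega> slab_borel slab_bounded in blast)+
  obtain z m0 where z: "subsolution ?R ?q Q z" "weak_euler T \<Omega> z m0" and m0: "m0 \<in> borel_measurable borel" "\<forall>x. norm (m0 x) \<le> sqrt (2 * Q)"
    "AE x in lborel. x \<in> \<Omega> \<longrightarrow> (norm (m0 x))\<^sup>2 = 2 * q x"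
    using saturated_initial_data[OF \<Omega>(1,2) T q Q] by (elim exE conjE) (rule that)
  define \<Gamma> where "\<Gamma> = volume.gain Q * (LINT y:?R|lborel. (gap ?q z y)\<^sup>2)"
  have "\<Gamma> > 0"
  proof -
    have gi: "set_integrable lborel ?R (\<lambda>y. (gap ?q z y)\<^sup>2)" by (rule volume.gap_integrable[OF z(1) order_refl R(4,3)])
    have "0 \<le> (LINT y:?R|lborel. (gap ?q z y)\<^sup>2)" unfolding set_lebesgue_integral_def by (intro integral_nonneg_AE) auto
    moreover have "(LINT y:?R|lborel. (gap ?q z y)\<^sup>2) \<noteq> 0"
    proof
      assume "(LINT y:?R|lborel. (gap ?q z y)\<^sup>2) = 0"
      then have "AE y in lborel. indicator ?R y *\<^sub>R (gap ?q z y)\<^sup>2 = 0"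
        using gi unfolding set_lebesgue_integral_def set_integrable_def by (subst (asm) integral_nonneg_eq_0_iff_AE) auto
      then have "AE y in lborel. y \<notin> ?R"
      proof eventually_elim
        case (elim y)
        then show ?case using gap_bounds(1)[OF z(1), of y] by (auto simp del: mem_Times_iff)
      qed
      then have "?R \<in> null_sets lborel" using R(4) by (simp add: AE_iff_null_sets)
      then have "negligible ?R" by (simp add: negligible_iff_null_sets null_sets_completionI)
      then have "?R = {}" using R(1) by (metis open_not_negligible)
      then show False using \<Omega>(3) T by auto
    qed
    moreover have "volume.gain Q > 0" using Q by (simp add: volume.gain_def)
    ultimately show ?thesis by (simp add: \<Gamma>_def)
  qed
  have H: "finite ({} :: (spacetime \<Rightarrow> complex) set)" by simp
  have "\<exists>p. perturbation T \<Omega> ?R p \<and> (\<forall>y\<in>?R. energy (z y + p y) < ?q y) \<and>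
       (\<forall>h\<in>{}. \<bar>LINT y:?R|lborel. h y \<bullet> fst (p y)\<bar> \<le> \<Gamma> / 2) \<and> \<Gamma> - \<Gamma> / 2 \<le> (LINT y:?R|lborel. (norm (fst (p y)))\<^sup>2)"
    unfolding \<Gamma>_def by (rule volume.perturbation_step[OF \<Omega>(1,2) T R(1,2) R(1) order_refl _ z(1) Q H]) (use \<open>\<Gamma> > 0\<close> in \<open>auto simp: \<Gamma>_def\<close>)
  then obtain p where p: "perturbation T \<Omega> ?R p" "\<forall>y\<in>?R. energy (z y + p y) < ?q y" "\<Gamma> - \<Gamma> / 2 \<le> (LINT y:?R|lborel. (norm (fst (p y)))\<^sup>2)"
    by (elim exE conjE) (rule that)
  define \<gamma> where "\<gamma> = (LINT y:?R|lborel. (norm (fst (p y)))\<^sup>2)"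
  have \<gamma>: "\<gamma> > 0" using p(3) \<open>\<Gamma> > 0\<close> by (simp add: \<gamma>_def)
  have pc: "continuous_on UNIV p" using p(1) unfolding perturbation_def by blast
  (* the pairing of p with the n-th subsolution exceeds that with z by gamma times l n *)
  define l where "l n = (1/2 :: real) ^ n" for n
  have l: "0 < l n" "l n \<le> 1" for n by (auto simp: l_def power_le_one)
  let ?z = "\<lambda>n y. z y + l n *\<^sub>R p y"
  have zn: "subsolution ?R ?q Q (?z n)" for n
    unfolding subsolution_def
  proof (intro conjI ballI)
    show "continuous_on ?R (?z n)" using z(1) unfolding subsolution_def by (intro continuous_intros continuous_on_subset[OF pc]) auto
    show "continuous_on ?R ?q" "\<And>y. y \<in> ?R \<Longrightarrow> ?q y \<le> Q" using z(1) unfolding subsolution_def by blast+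
    show "energy (?z n y) < ?q y" if "y \<in> ?R" for y
      using z(1) p(2) that l[of n] unfolding subsolution_def by (intro energy_convex) auto
  qed
  have wn: "weak_euler T \<Omega> (?z n) m0" for n
    by (rule weak_euler_add_interior[OF \<Omega>(1,2) subsolution_bounded_field(1)[OF R(1) z(1) order_refl] z(2) m0(1) m0(2)[rule_format] perturbation_scale[OF p(1)]])
  have hc: "continuous_on UNIV (\<lambda>y. fst (p y))" by (intro continuous_on_fst pc)
  define S where "S n m \<longleftrightarrow> m \<in> borel_measurable borel \<and> (\<forall>y. norm (m y) \<le> sqrt (2 * Q)) \<and>
    (AE y in lborel. y \<in> ?R \<longrightarrow> (norm (m y))\<^sup>2 = 2 * q (snd y)) \<and> weak_euler T \<Omega> (\<lambda>y. (m y, (m y)\<^sup>2 / 2)) m0 \<and>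
    \<bar>(LINT y:?R|lborel. fst (p y) \<bullet> m y) - (LINT y:?R|lborel. fst (p y) \<bullet> fst (?z n y))\<bar> \<le> \<gamma> * l n / 8" for n m
  have "\<exists>m. S n m" for n
    unfolding S_def using saturated_solution[OF \<Omega>(1,2) T q(1) Q zn wn m0(1) m0(2)[rule_format] hc, of "\<gamma> * l n / 8" n] \<gamma> l(1)[of n] by simp
  then obtain m where m: "\<And>n. S n (m n)" by metis
  have val: "(LINT y:?R|lborel. fst (p y) \<bullet> fst (?z n y)) = (LINT y:?R|lborel. fst (p y) \<bullet> fst (z y)) + \<gamma> * l n" for n
  proof -
    have i1: "set_integrable lborel ?R (\<lambda>y. fst (p y) \<bullet> fst (z y))"
    proof -
      have "continuous_on ?R (\<lambda>y. fst (z y))" using z(1) unfolding subsolution_def by (intro continuous_on_fst) blast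
      from volume.perturbation_pairing_integrable[OF R(1,3) p(1) order_refl this] show ?thesis by (simp add: inner_commute)
    qed
    have i2: "set_integrable lborel ?R (\<lambda>y. l n * (norm (fst (p y)))\<^sup>2)"
      by (intro set_integrable_continuous R continuous_intros pc)
    have "(LINT y:?R|lborel. fst (p y) \<bullet> fst (?z n y)) = (LINT y:?R|lborel. fst (p y) \<bullet> fst (z y) + l n * (norm (fst (p y)))\<^sup>2)"
      by (simp add: inner_add_right power2_norm_eq_inner)
    also have "\<dots> = (LINT y:?R|lborel. fst (p y) \<bullet> fst (z y)) + \<gamma> * l n" unfolding \<gamma>_def using set_integral_add(2)[OF i1 i2] by (simp add: mult.commute)
    finally show ?thesis .
  qed
  have lt: "(LINT y:?R|lborel. fst (p y) \<bullet> m i y) \<noteq> (LINT y:?R|lborel. fst (p y) \<bullet> m j y)" if "i < j" for i j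
  proof -
    have "l j \<le> l (Suc i)" unfolding l_def using that by (intro power_decreasing) auto
    then have "l j \<le> l i / 2" by (simp add: l_def)
    then have "\<gamma> * l j \<le> \<gamma> * (l i / 2)" using \<gamma> by (intro mult_left_mono) auto
    moreover have "0 < \<gamma> * l i" using \<gamma> l by simp
    moreover have "\<bar>(LINT y:?R|lborel. fst (p y) \<bullet> m n y) - ((LINT y:?R|lborel. fst (p y) \<bullet> fst (z y)) + \<gamma> * l n)\<bar> \<le> \<gamma> * l n / 8" for n
      using m[of n] unfolding S_def val by blast
    note this[of i] this[of j]
    ultimately show ?thesis by (intro separated_by_scale[of _ _ "\<gamma> * l i" _ "\<gamma> * l j"]) auto
  qed
  have ne: "\<not> (AE y in lborel. y \<in> ?R \<longrightarrow> m i y = m j y)" if "i \<noteq> j" for i j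
  proof
    assume ae: "AE y in lborel. y \<in> ?R \<longrightarrow> m i y = m j y"
    have mm: "(\<lambda>y. fst (p y) \<bullet> m n y) \<in> borel_measurable borel" for n
      using m[of n] borel_measurable_continuous_onI[OF hc] unfolding S_def by (intro borel_measurable_inner) auto
    have "(LINT y:?R|lborel. fst (p y) \<bullet> m i y) = (LINT y:?R|lborel. fst (p y) \<bullet> m j y)"
      unfolding set_lebesgue_integral_def
    proof (rule integral_cong_AE)
      show "AE y in lborel. indicator ?R y *\<^sub>R (fst (p y) \<bullet> m i y) = indicator ?R y *\<^sub>R (fst (p y) \<bullet> m j y)"
        using ae by eventually_elim (auto simp: indicator_def simp del: mem_Times_iff)
    qed (use mm R(4) in auto)
    then show False using lt[of i j] lt[of j i] that by (metis linorder_neqE_nat)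
  qed
  show ?thesis
    using m0 m ne unfolding S_def by (intro exI[of _ m0] exI[of _ m]) blast
qed

section \<open>The normal trace and the divergence theorem\<close>

lemma C1_diff:
  fixes f g :: "real^2 \<Rightarrow> real"
  assumes "Ck_on 1 UNIV f" "Ck_on 1 UNIV g"
  shows "Ck_on 1 UNIV (\<lambda>y. f y - g y)"
proof (rule C1_I)
  show "((\<lambda>y. f y - g y) has_derivative (\<lambda>v. frechet_derivative f (at y) v - frechet_derivative g (at y) v)) (at y)" for y
    by (intro has_derivative_diff C1_D(1) assms)
qed (intro continuous_on_diff C1_D(2) assms)

text \<open>
  A C1 step function from 0 to 1, as simple as possible: C1 regularity is what the local divergence theorem
  requires.
\<close>

definition step :: "real \<Rightarrow> real" where "step u = 1 - (max 0 (1 - (max 0 u)\<^sup>2))\<^sup>2"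
definition step' :: "real \<Rightarrow> real" where "step' u = 2 * max 0 (1 - (max 0 u)\<^sup>2) * (2 * max 0 u)"

lemma square_positive_part_derivative: "((\<lambda>u::real. (max 0 u)\<^sup>2) has_real_derivative 2 * max 0 u) (at u)"
proof (cases "u = 0")
  case True
  have "((\<lambda>u::real. (max 0 u)\<^sup>2) has_real_derivative 0) (at 0)"
    by (rule has_derivative_zero_of_quadratic[where C = 1]) (auto simp: max_def)
  then show ?thesis using True by simp
next
  case False
  show ?thesis
  proof (cases "u > 0")
    case True
    have "\<forall>\<^sub>F x in nhds u. x \<in> {0<..}" using True by (intro eventually_nhds_in_open) auto
    then have "\<forall>\<^sub>F x in nhds u. (max 0 x)\<^sup>2 = x\<^sup>2" by (rule eventually_mono) auto
    then show ?thesis using True by (subst DERIV_cong_ev[OF refl _ refl]) (auto intro!: derivative_eq_intros)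
  next
    case F: False
    have "\<forall>\<^sub>F x in nhds u. x \<in> {..<0}" using False F by (intro eventually_nhds_in_open) auto
    then have ev: "\<forall>\<^sub>F x in nhds u. (max 0 x)\<^sup>2 = (\<lambda>_. 0) x" by (rule eventually_mono) auto
    have "2 * max 0 u = 0" using F by simp
    then show ?thesis using DERIV_cong_ev[OF refl ev refl] by simp
  qed
qed

lemma step_derivative: "(step has_real_derivative step' u) (at u)"
proof -
  have "((\<lambda>u. 1 - (max 0 u)\<^sup>2) has_real_derivative 0 - 2 * max 0 u) (at u)" by (intro DERIV_diff DERIV_const square_positive_part_derivative)
  from DERIV_diff[OF DERIV_const[of 1] DERIV_chain2[OF square_positive_part_derivative this]]
  show ?thesis unfolding step_def[abs_def] step'_def by (simp add: mult.assoc)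
qed

lemma step'_continuous: "continuous_on UNIV step'"
  unfolding step'_def[abs_def] by (intro continuous_intros)

lemma step'_nonneg: "0 \<le> step' u" by (simp add: step'_def)
lemma step_low: "u \<le> 0 \<Longrightarrow> step u = 0" and step'_low: "u \<le> 0 \<Longrightarrow> step' u = 0" by (simp_all add: step_def step'_def)
lemma step_high: assumes "1 \<le> u" shows "step u = 1" "step' u = 0"
proof -
  have "1 \<le> u\<^sup>2" using assms by (rule one_le_power)
  then have "max 0 (1 - u\<^sup>2) = 0" by simp
  moreover have "max 0 u = u" using assms by simp
  ultimately show "step u = 1" "step' u = 0" by (simp_all add: step_def step'_def)
qed
lemma step_range: "0 \<le> step u" "step u \<le> 1"
proof -
  have "(max 0 (1 - (max 0 u)\<^sup>2))\<^sup>2 \<le> 1\<^sup>2" by (intro power_mono) auto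
  then show "0 \<le> step u" "step u \<le> 1" by (simp_all add: step_def)
qed

definition bump2 :: "(real \<Rightarrow> real) \<Rightarrow> real^2 \<Rightarrow> real \<Rightarrow> real^2 \<Rightarrow> real" where
  "bump2 f x0 r x = f ((x $ 1 - x0 $ 1) / r) * f ((x $ 2 - x0 $ 2) / r)"

lemma bump2_C1:
  assumes f: "\<And>s. (f has_real_derivative f' s) (at s)" "continuous_on UNIV f'" and r: "r \<noteq> 0"
  shows "Ck_on 1 UNIV (bump2 f x0 r)"
proof -
  have "Ck_on 1 UNIV (\<lambda>x::real^2. f ((x $ i - x0 $ i) / r))" for i
  proof (rule C1_I)
    fix x :: "real^2"
    have "((\<lambda>x::real^2. (x $ i - x0 $ i) / r) has_derivative (\<lambda>v. v $ i / r)) (at x)"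
      using r by (auto intro!: derivative_eq_intros bounded_linear_imp_has_derivative bounded_linear_vec_nth simp: field_simps)
    from has_derivative_compose[OF this f(1)[unfolded has_field_derivative_def]]
    show "((\<lambda>x::real^2. f ((x $ i - x0 $ i) / r)) has_derivative (\<lambda>v. f' ((x $ i - x0 $ i) / r) * (v $ i / r))) (at x)" .
  next
    fix v :: "real^2"
    show "continuous_on UNIV (\<lambda>x::real^2. f' ((x $ i - x0 $ i) / r) * (v $ i / r))"
      using r by (intro continuous_intros continuous_on_compose2[OF f(2)]) auto
  qed
  from C1_mult(1)[OF this this] show ?thesis unfolding bump2_def[abs_def] .
qed

lemma bump2_outside: "(\<And>s. 1 \<le> \<bar>s\<bar> \<Longrightarrow> f s = 0) \<Longrightarrow> 0 < r \<Longrightarrow> x \<notin> square x0 r \<Longrightarrow> bump2 f x0 r x = 0"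
proof -
  assume f: "\<And>s. 1 \<le> \<bar>s\<bar> \<Longrightarrow> f s = 0" and r: "0 < r" and x: "x \<notin> square x0 r"
  have "f ((a - b) / r) = 0" if "r < \<bar>a - b\<bar>" for a b using r that by (intro f) simp
  then show ?thesis using x by (auto simp: bump2_def square_def)
qed

definition plateau :: "real \<Rightarrow> real" where "plateau s = step (4 / 3 * (1 - s\<^sup>2))"

lemma plateau_derivative: "(plateau has_real_derivative step' (4 / 3 * (1 - s\<^sup>2)) * (4 / 3 * (0 - 2 * s))) (at s)"
proof -
  have "((\<lambda>s::real. 4 / 3 * (1 - s\<^sup>2)) has_real_derivative 4 / 3 * (0 - 2 * s)) (at s)" by (auto intro!: derivative_eq_intros)
  from DERIV_chain2[OF step_derivative this] show ?thesis unfolding plateau_def[abs_def] .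
qed

lemma plateau_continuous': "continuous_on UNIV (\<lambda>s. step' (4 / 3 * (1 - s\<^sup>2)) * (4 / 3 * (0 - 2 * s)))"
  by (intro continuous_intros continuous_on_compose2[OF step'_continuous]) auto

lemma plateau_outside: "1 \<le> \<bar>s\<bar> \<Longrightarrow> plateau s = 0"
  using one_le_power[of "\<bar>s\<bar>" 2] by (auto simp: plateau_def intro!: step_low)

lemma plateau_inner: "\<bar>s\<bar> \<le> 1 / 2 \<Longrightarrow> plateau s = 1"
proof -
  assume "\<bar>s\<bar> \<le> 1 / 2"
  then have "\<bar>s\<bar>\<^sup>2 \<le> (1/2)\<^sup>2" by (intro power_mono) auto
  then show ?thesis unfolding plateau_def by (intro step_high(1)) (simp add: power2_eq_square)
qed

lemma plateau2_inner: "0 < r \<Longrightarrow> x \<in> square x0 (r / 2) \<Longrightarrow> bump2 plateau x0 r x = 1"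
  by (simp add: bump2_def square_def plateau_inner field_simps)

lemma compact_square: "compact (square x0 r)"
proof -
  have "square x0 r = {x. (fst y, x) \<in> cube y r}" if "snd y = x0" "0 \<le> r" for y using that by (auto simp: cube_eq)
  have "closed (square x0 r)" unfolding square_def by (intro closed_Collect_conj closed_Collect_le continuous_intros)
  moreover have "square x0 r \<subseteq> cbox (x0 - (\<chi> i. r)) (x0 + (\<chi> i. r))"
    by (auto simp: square_def mem_box_cart forall_2 abs_le_iff algebra_simps)
  then have "bounded (square x0 r)" using bounded_cbox bounded_subset by blast
  ultimately show ?thesis by (simp add: compact_eq_bounded_closed)
qed

lemma small_square: "open U \<Longrightarrow> x \<in> U \<Longrightarrow> \<exists>r>0. square x r \<subseteq> U"
proof -
  assume U: "open U" "x \<in> U"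
  obtain e where e: "e > 0" "cball x e \<subseteq> U" using U open_contains_cball by blast
  have "square x (e / 2) \<subseteq> cball x e"
  proof
    fix y assume y: "y \<in> square x (e / 2)"
    have "norm (y - x) \<le> \<bar>(y - x) $ 1\<bar> + \<bar>(y - x) $ 2\<bar>" using norm_le_l1_cart[of "y - x"] by (simp add: sum_2)
    also have "\<dots> \<le> e" using y by (simp add: square_def)
    finally show "y \<in> cball x e" by (simp add: dist_norm norm_minus_commute)
  qed
  then show ?thesis using e by (intro exI[of _ "e / 2"]) auto
qed

definition pdx :: "2 \<Rightarrow> (real^2 \<Rightarrow> real) \<Rightarrow> real^2 \<Rightarrow> real" where
  "pdx i f x = frechet_derivative f (at x) (axis i 1)"

lemma pdx_integral_0:
  assumes "Ck_on 1 UNIV f" "compact K" "\<And>x. x \<notin> K \<Longrightarrow> f x = 0"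
  shows "integrable lborel (pdx i f)" "(\<integral>x. pdx i f x \<partial>lborel) = 0"
proof -
  have z: "pdx i f x = 0" if "x \<notin> K" for x
    unfolding pdx_def by (rule derivative_outside_support[OF C1_D(1)[OF assms(1)] compact_imp_closed[OF assms(2)] assms(3) that])
  have "set_integrable lborel K (pdx i f)"
    using C1_D(2)[OF assms(1)] assms(2) by (intro set_integrable_continuous) (auto simp: pdx_def[abs_def] compact_imp_bounded borel_compact)
  moreover have "indicator K x *\<^sub>R pdx i f x = pdx i f x" for x using z[of x] by (cases "x \<in> K") auto
  ultimately show "integrable lborel (pdx i f)" by (simp only: set_integrable_def)
  show "(\<integral>x. pdx i f x \<partial>lborel) = 0"
    using integral_directional_derivative_eq_0[OF C1_D(1)[OF assms(1)] C1_D(2)[OF assms(1)] assms(2,3), of UNIV "axis i 1"]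
    by (simp add: set_lebesgue_integral_def pdx_def)
qed

lemma pdx_mult:
  assumes "Ck_on 1 UNIV f" "Ck_on 1 UNIV g"
  shows "pdx i (\<lambda>x. f x * g x) x = f x * pdx i g x + pdx i f x * g x"
  unfolding pdx_def by (rule C1_mult(2)[OF assms])

lemma pdx_continuous: "Ck_on 1 UNIV f \<Longrightarrow> continuous_on UNIV (pdx i f)"
  unfolding pdx_def[abs_def] by (rule C1_D(2))

text \<open>
  Composition with the defining function \<open>\<psi>\<close> of the boundary, meaningful only in the chart U;
  the factor F with compact support in U makes it a function on the plane.
\<close>

lemma chart_product_C1:
  assumes U: "open U" and \<psi>: "Ck_on 1 U \<psi>" and k: "\<And>s. (k has_real_derivative k' s) (at s)" "continuous_on UNIV k'"
    and F: "Ck_on 1 UNIV F" and K: "compact K" "K \<subseteq> U" "\<And>x. x \<notin> K \<Longrightarrow> F x = 0"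
  shows "Ck_on 1 UNIV (\<lambda>x. if x \<in> U then k (\<psi> x) * F x else 0)"
    and "x \<in> U \<Longrightarrow> pdx i (\<lambda>x. if x \<in> U then k (\<psi> x) * F x else 0) x = k (\<psi> x) * pdx i F x + k' (\<psi> x) * pdx i \<psi> x * F x"
proof -
  let ?G = "\<lambda>x. if x \<in> U then k (\<psi> x) * F x else 0"
  let ?D = "\<lambda>x v. if x \<in> U then k (\<psi> x) * frechet_derivative F (at x) v + k' (\<psi> x) * frechet_derivative \<psi> (at x) v * F x else 0"
  have F0: "frechet_derivative F (at x) v = 0" if "x \<notin> K" for x v
    by (rule derivative_outside_support[OF C1_D(1)[OF F] compact_imp_closed[OF K(1)] K(3) that])
  have \<psi>d: "(\<psi> has_derivative frechet_derivative \<psi> (at x)) (at x)" if "x \<in> U" for x using \<psi> that by (simp add: One_nat_def frechet_derivative_works)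
  have \<psi>c: "continuous_on U (\<lambda>x. frechet_derivative \<psi> (at x) v)" for v using \<psi> by (simp add: One_nat_def)
  have \<psi>c0: "continuous_on U \<psi>" using \<psi>d by (meson continuous_at_imp_continuous_on has_derivative_continuous)
  have kc: "continuous_on UNIV k" using k(1) by (meson DERIV_isCont continuous_at_imp_continuous_on)
  have d: "(?G has_derivative ?D x) (at x)" for x
  proof (cases "x \<in> U")
    case True
    have "((\<lambda>x. k (\<psi> x)) has_derivative (\<lambda>v. k' (\<psi> x) * frechet_derivative \<psi> (at x) v)) (at x)"
      by (rule has_derivative_compose[OF \<psi>d[OF True] k(1)[unfolded has_field_derivative_def]])
    from has_derivative_mult[OF this C1_D(1)[OF F, of x]]
    have "((\<lambda>x. k (\<psi> x) * F x) has_derivative ?D x) (at x)" using True by simp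
    then show ?thesis by (rule has_derivative_transform_within_open[OF _ U True]) simp
  next
    case False
    have "((\<lambda>x. 0) has_derivative (\<lambda>v. 0)) (at x)" by simp
    then have "(?G has_derivative (\<lambda>v. 0)) (at x)"
      by (rule has_derivative_transform_within_open[where s = "- K"]) (use False K in \<open>auto simp: compact_imp_closed open_Compl\<close>)
    then show ?thesis using False by simp
  qed
  show "Ck_on 1 UNIV ?G"
  proof (rule C1_I[OF d])
    fix v
    show "continuous_on UNIV (\<lambda>x. ?D x v)"
    proof (rule continuous_extension_by_zero[OF U _ K(1,2)])
      show "continuous_on U (\<lambda>x. k (\<psi> x) * frechet_derivative F (at x) v + k' (\<psi> x) * frechet_derivative \<psi> (at x) v * F x)"
        by (intro continuous_intros \<psi>c continuous_on_compose2[OF kc \<psi>c0] continuous_on_compose2[OF k(2) \<psi>c0]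
            continuous_on_subset[OF C1_D(2)[OF F]] continuous_on_subset[OF C1_D(3)[OF F]]) auto
      show "k (\<psi> x) * frechet_derivative F (at x) v + k' (\<psi> x) * frechet_derivative \<psi> (at x) v * F x = 0" if "x \<in> U - K" for x
        using that F0 K(3) by simp
    qed
  qed
  show "x \<in> U \<Longrightarrow> pdx i ?G x = k (\<psi> x) * pdx i F x + k' (\<psi> x) * pdx i \<psi> x * F x"
    by (simp add: pdx_def frechet_derivative_at[OF d, symmetric])
qed

lemma continuous_closed_preimage_Collect_le:
  fixes f :: "'a::topological_space \<Rightarrow> real"
  assumes "continuous_on A f" "closed A"
  shows "closed {x\<in>A. a \<le> f x}"
proof -
  have "closed (A \<inter> f -` {a..})" by (rule continuous_closed_preimage[OF assms closed_atLeast])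
  moreover have "A \<inter> f -` {a..} = {x\<in>A. a \<le> f x}" by auto
  ultimately show ?thesis by simp
qed

text \<open>
  The indicator of \<open>\<Omega>\<close> is approximated by \<open>step (- \<psi> / \<epsilon>)\<close>, which
  leads to the error
  \<open>\<integral> step' (- \<psi> / \<epsilon>) / \<epsilon> (F \<bullet> \<nabla>\<psi>)\<close>. The weight
  lives where \<open>0 < - \<psi> < \<epsilon>\<close>, where \<open>F \<bullet> \<nabla>\<psi>\<close> is small
  by tangency, and its mass stays bounded: since \<open>\<psi>\<close> is strictly monotone in the direction j,
  the weight is, up to a fixed integrable function, at most a multiple of the j-th derivative of a compactly
  supported function, whose integral vanishes.
\<close>

lemma local_divergence_theorem:
  assumes \<Omega>: "open \<Omega>" and U: "open U" and \<psi>: "Ck_on 1 U \<psi>" "\<Omega> \<inter> U = {y\<in>U. \<psi> y < 0}"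
    and r: "0 < r" "square x0 r \<subseteq> U" and mono: "0 < c" "\<And>x. x \<in> square x0 r \<Longrightarrow> c \<le> \<sigma> * pdx j \<psi> x" "\<bar>\<sigma>\<bar> = 1"
    and F: "Ck_on 1 UNIV F1" "Ck_on 1 UNIV F2" "\<And>x. x \<notin> square x0 (r / 2) \<Longrightarrow> F1 x = 0 \<and> F2 x = 0"
    and tangent: "\<And>x. x \<in> square x0 r \<Longrightarrow> \<psi> x = 0 \<Longrightarrow> F1 x * pdx 1 \<psi> x + F2 x * pdx 2 \<psi> x = 0"
  shows "(LINT x:\<Omega>|lborel. pdx 1 F1 x + pdx 2 F2 x) = 0"
proof -
  let ?S = "square x0 r" and ?K = "square x0 (r / 2)"
  have KS: "?K \<subseteq> ?S" using r by (auto simp: square_def)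
  have KU: "?K \<subseteq> U" using KS r by blast
  define W where "W x = F1 x * pdx 1 \<psi> x + F2 x * pdx 2 \<psi> x" for x
  define \<epsilon> where "\<epsilon> n = 1 / real (Suc n)" for n
  have \<epsilon>: "0 < \<epsilon> n" for n by (simp add: \<epsilon>_def)
  let ?k = "\<lambda>n s. step (- s / \<epsilon> n)" and ?k' = "\<lambda>n s. - step' (- s / \<epsilon> n) / \<epsilon> n"
  have k: "(?k n has_real_derivative ?k' n s) (at s)" for n s
  proof -
    have "((\<lambda>s. - s / \<epsilon> n) has_real_derivative - 1 / \<epsilon> n) (at s)" by (rule DERIV_cdivide[OF DERIV_minus[OF DERIV_ident]])
    from DERIV_chain2[OF step_derivative this] show ?thesis by simp
  qed
  have k'c: "continuous_on UNIV (?k' n)" for n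
    using \<epsilon>[of n] by (intro continuous_intros continuous_on_compose2[OF step'_continuous]) auto
  have \<psi>c0: "continuous_on U \<psi>" using \<psi>(1)
    by (auto simp: One_nat_def intro!: continuous_at_imp_continuous_on differentiable_imp_continuous_within)
  have \<psi>c: "continuous_on U (pdx i \<psi>)" for i using \<psi>(1) by (simp add: One_nat_def pdx_def[abs_def])
  let ?G = "\<lambda>n F x. if x \<in> U then ?k n (\<psi> x) * F x else 0"
  have F0: "pdx i F x = 0" if "Ck_on 1 UNIV F" "\<And>x. x \<notin> ?K \<Longrightarrow> F x = 0" "x \<notin> ?K" for F i x
    unfolding pdx_def by (rule derivative_outside_support[OF C1_D(1)[OF that(1)] compact_imp_closed[OF compact_square] that(2,3)])
  have Fz: "\<And>x. x \<notin> ?K \<Longrightarrow> F1 x = 0" "\<And>x. x \<notin> ?K \<Longrightarrow> F2 x = 0" using F(3) by auto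
  have G0: "(\<integral>x. pdx i (?G n F) x \<partial>lborel) = 0" "integrable lborel (pdx i (?G n F))" if "Ck_on 1 UNIV F" "compact L" "L \<subseteq> U" "\<And>x. x \<notin> L \<Longrightarrow> F x = 0" for n F i L
  proof -
    have "?G n F x = 0" if "x \<notin> L" for x using \<open>\<And>x. x \<notin> L \<Longrightarrow> F x = 0\<close>[OF that] by simp
    then show "(\<integral>x. pdx i (?G n F) x \<partial>lborel) = 0" "integrable lborel (pdx i (?G n F))"
      using pdx_integral_0[OF chart_product_C1(1)[OF U \<psi>(1) k k'c that] that(2)] by blast+
  qed
  define dv where "dv x = pdx 1 F1 x + pdx 2 F2 x" for x
  define P where "P n x = (if x \<in> U then ?k n (\<psi> x) * dv x else 0)" for n x
  define J where "J n x = (if x \<in> U then ?k' n (\<psi> x) * W x else 0)" for n x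
  have divc: "continuous_on UNIV dv" unfolding dv_def[abs_def] by (intro continuous_intros pdx_continuous F)
  have div0: "dv x = 0" if "x \<notin> ?K" for x using F0[OF F(1) Fz(1) that] F0[OF F(2) Fz(2) that] by (simp add: dv_def)
  have sum: "pdx 1 (?G n F1) x + pdx 2 (?G n F2) x = P n x + J n x" for n x
  proof (cases "x \<in> U")
    case True
    then show ?thesis
      using chart_product_C1(2)[OF U \<psi>(1) k k'c F(1) compact_square KU Fz(1) True, of 1 n] chart_product_C1(2)[OF U \<psi>(1) k k'c F(2) compact_square KU Fz(2) True, of 2 n]
      by (simp add: P_def J_def W_def dv_def algebra_simps)
  next
    case False
    then have x: "x \<notin> ?K" using KU by blast
    have z: "pdx i (?G n F) x = 0" if "Ck_on 1 UNIV F" "\<And>x. x \<notin> ?K \<Longrightarrow> F x = 0" for i F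
      unfolding pdx_def
      by (rule derivative_outside_support[OF C1_D(1)[OF chart_product_C1(1)[OF U \<psi>(1) k k'c that(1) compact_square KU that(2)]] compact_imp_closed[OF compact_square] _ x])
        (use that(2) in auto)
    show ?thesis using z[OF F(1) Fz(1)] z[OF F(2) Fz(2)] False by (simp add: P_def J_def)
  qed
  have kc: "continuous_on UNIV (?k n)" for n using k by (meson DERIV_isCont continuous_at_imp_continuous_on)
  have k\<psi>: "continuous_on U (\<lambda>x. ?k n (\<psi> x))" and k'\<psi>: "continuous_on U (\<lambda>x. ?k' n (\<psi> x))" for n
    by (rule continuous_on_compose2[OF kc \<psi>c0] continuous_on_compose2[OF k'c \<psi>c0], simp)+
  have Pc: "continuous_on UNIV (P n)" for n
    unfolding P_def[abs_def]
  proof (rule continuous_extension_by_zero[OF U _ compact_square KU])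
    show "continuous_on U (\<lambda>x. ?k n (\<psi> x) * dv x)" by (intro continuous_on_mult k\<psi> continuous_on_subset[OF divc] subset_UNIV)
  qed (simp add: div0)
  have Wc: "continuous_on U W" unfolding W_def[abs_def]
    by (intro continuous_intros \<psi>c continuous_on_subset[OF C1_D(3)[OF F(1)]] continuous_on_subset[OF C1_D(3)[OF F(2)]]) auto
  have W0: "W x = 0" if "x \<notin> ?K" for x using F(3)[OF that] by (simp add: W_def)
  have Jc: "continuous_on UNIV (J n)" for n
    unfolding J_def[abs_def]
  proof (rule continuous_extension_by_zero[OF U _ compact_square KU])
    show "continuous_on U (\<lambda>x. ?k' n (\<psi> x) * W x)" by (intro continuous_on_mult k'\<psi> Wc)
  qed (simp add: W0)
  have iK: "integrable lborel f" if "continuous_on UNIV f" "\<And>x. x \<notin> ?S \<Longrightarrow> f x = 0" for f :: "real^2 \<Rightarrow> real"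
  proof -
    have "set_integrable lborel ?S f" using that(1) by (intro set_integrable_continuous) (auto simp: compact_square borel_compact compact_imp_bounded)
    moreover have "indicator ?S x *\<^sub>R f x = f x" for x using that(2)[of x] by (cases "x \<in> ?S") auto
    ultimately show ?thesis by (simp only: set_integrable_def)
  qed
  have outS: "x \<notin> ?S \<Longrightarrow> x \<notin> ?K" for x using KS by blast
  have iP: "integrable lborel (P n)" and iJ: "integrable lborel (J n)" for n
    by (auto intro!: iK Pc Jc simp: P_def J_def div0 W0 outS)
  have PJ: "(\<integral>x. P n x \<partial>lborel) = - (\<integral>x. J n x \<partial>lborel)" for n
  proof -
    have "(\<integral>x. P n x \<partial>lborel) + (\<integral>x. J n x \<partial>lborel) = (\<integral>x. pdx 1 (?G n F1) x + pdx 2 (?G n F2) x \<partial>lborel)"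
      unfolding sum using iP iJ by simp
    also have "\<dots> = 0" using G0[OF F(1) compact_square KU Fz(1)] G0[OF F(2) compact_square KU Fz(2)] by simp
    finally show ?thesis by simp
  qed
  have "(\<lambda>n. \<integral>x. P n x \<partial>lborel) \<longlonglongrightarrow> (\<integral>x. indicator \<Omega> x *\<^sub>R dv x \<partial>lborel)"
  proof (rule integral_dominated_convergence)
    have "integrable lborel dv" by (rule iK[OF divc]) (auto simp: div0 outS)
    then show "integrable lborel (\<lambda>x. \<bar>dv x\<bar>)" by simp
    show "(\<lambda>x. indicator \<Omega> x *\<^sub>R dv x) \<in> borel_measurable lborel" using \<Omega> borel_measurable_continuous_onI[OF divc] by simp
    show "P n \<in> borel_measurable lborel" for n using borel_measurable_continuous_onI[OF Pc] by simp
    show "AE x in lborel. norm (P n x) \<le> \<bar>dv x\<bar>" for n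
    proof (rule AE_I2)
      fix x
      have "\<bar>?k n (\<psi> x)\<bar> * \<bar>dv x\<bar> \<le> 1 * \<bar>dv x\<bar>" using step_range by (intro mult_right_mono) auto
      then show "norm (P n x) \<le> \<bar>dv x\<bar>" by (simp add: P_def abs_mult)
    qed
    show "AE x in lborel. (\<lambda>n. P n x) \<longlonglongrightarrow> indicator \<Omega> x *\<^sub>R dv x"
    proof (rule AE_I2)
      fix x
      show "(\<lambda>n. P n x) \<longlonglongrightarrow> indicator \<Omega> x *\<^sub>R dv x"
      proof (cases "x \<in> U")
        case True
        show ?thesis
        proof (cases "\<psi> x < 0")
          case neg: True
          then have x\<Omega>: "x \<in> \<Omega>" using \<psi>(2) True by blast
          obtain N :: nat where N: "1 / - \<psi> x < real N" using reals_Archimedean2 by blast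
          have "P n x = dv x" if "n \<ge> N" for n
          proof -
            have "1 / - \<psi> x \<le> real (Suc n)" using N that by simp
            then have "1 \<le> - \<psi> x / \<epsilon> n" using neg by (simp add: \<epsilon>_def field_simps)
            then show ?thesis using True by (simp add: P_def step_high(1))
          qed
          then show ?thesis using x\<Omega> by (intro tendsto_eventually eventually_sequentiallyI[of N]) auto
        next
          case False
          then have "x \<notin> \<Omega>" using \<psi>(2) True by blast
          moreover have "P n x = 0" for n
          proof -
            have "- \<psi> x / \<epsilon> n \<le> 0" using False \<epsilon>[of n] by (simp add: divide_nonpos_pos)
            then show ?thesis by (simp add: P_def step_low)
          qed
          ultimately show ?thesis by simp
        qed
      next
        case False
        then have "dv x = 0" using KU div0 by blast
        then show ?thesis using False by (simp add: P_def)
      qed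
    qed
  qed
  moreover have "(\<lambda>n. \<integral>x. P n x \<partial>lborel) \<longlonglongrightarrow> 0"
  proof -
    define B where "B = bump2 plateau x0 r"
    have BC: "Ck_on 1 UNIV B" unfolding B_def using r by (intro bump2_C1[OF plateau_derivative plateau_continuous']) auto
    have B0: "x \<notin> ?S \<Longrightarrow> B x = 0" for x unfolding B_def by (rule bump2_outside[OF plateau_outside r(1)])
    have Bn: "0 \<le> B x" for x using step_range(1) by (simp add: B_def bump2_def plateau_def)
    have B1: "B x = 1" if "x \<in> ?K" for x unfolding B_def by (rule plateau2_inner[OF r(1) that])
    define M where "M = (\<integral>x. \<bar>pdx j B x\<bar> \<partial>lborel)"
    have iB: "integrable lborel (pdx j B)" using pdx_integral_0[OF BC compact_square B0] by blast
    have M: "0 \<le> M" unfolding M_def by simp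
    define H where "H n x = (if x \<in> U then step' (- \<psi> x / \<epsilon> n) / \<epsilon> n * B x else 0)" for n x
    have Bc: "continuous_on UNIV B" using C1_D(3)[OF BC] .
    have Hc: "continuous_on UNIV (H n)" for n
    proof -
      have "continuous_on UNIV (\<lambda>x. if x \<in> U then - ?k' n (\<psi> x) * B x else 0)"
      proof (rule continuous_extension_by_zero[OF U _ compact_square r(2)])
        show "continuous_on U (\<lambda>x. - ?k' n (\<psi> x) * B x)" by (intro continuous_on_mult continuous_on_minus k'\<psi> continuous_on_subset[OF Bc] subset_UNIV)
      qed (simp add: B0)
      then show ?thesis unfolding H_def[abs_def] by (simp cong: if_cong)
    qed
    have iH: "integrable lborel (H n)" for n by (rule iK[OF Hc]) (simp add: H_def B0)
    have Hn: "0 \<le> H n x" for n x using \<epsilon>[of n] Bn step'_nonneg by (simp add: H_def)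
    have Hb: "(\<integral>x. H n x \<partial>lborel) \<le> M / c" for n
    proof -
      let ?p = "pdx j (?G n B)"
      have "c * H n x \<le> \<bar>pdx j B x\<bar> - \<sigma> * ?p x" for x
      proof (cases "x \<in> U")
        case True
        have p: "?p x = ?k n (\<psi> x) * pdx j B x + ?k' n (\<psi> x) * pdx j \<psi> x * B x"
          by (rule chart_product_C1(2)[OF U \<psi>(1) k k'c BC compact_square r(2) B0 True])
        have "c * H n x \<le> \<sigma> * pdx j \<psi> x * H n x"
        proof (cases "x \<in> ?S")
          case True then show ?thesis using mono(2) Hn by (intro mult_right_mono) auto
        next
          case False then show ?thesis by (simp add: H_def B0)
        qed
        also have "\<dots> = \<sigma> * (?k n (\<psi> x) * pdx j B x) - \<sigma> * ?p x" unfolding p using True by (simp add: H_def algebra_simps)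
        also have "\<sigma> * (?k n (\<psi> x) * pdx j B x) \<le> \<bar>pdx j B x\<bar>"
        proof -
          have "\<bar>\<sigma> * (?k n (\<psi> x) * pdx j B x)\<bar> \<le> \<bar>pdx j B x\<bar>"
            using step_range[of "- \<psi> x / \<epsilon> n"] mono(3) by (simp add: abs_mult mult_left_le_one_le)
          then show ?thesis by linarith
        qed
        finally show ?thesis by simp
      next
        case False
        then have x: "x \<notin> ?S" using r(2) by blast
        have "?p x = 0" unfolding pdx_def
          by (rule derivative_outside_support[OF C1_D(1)[OF chart_product_C1(1)[OF U \<psi>(1) k k'c BC compact_square r(2) B0]] compact_imp_closed[OF compact_square] _ x])
            (use B0 in auto)
        then show ?thesis using False by (simp add: H_def)
      qed
      then have "(\<integral>x. c * H n x \<partial>lborel) \<le> (\<integral>x. \<bar>pdx j B x\<bar> - \<sigma> * ?p x \<partial>lborel)"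
        using iH iB G0(2)[OF BC compact_square r(2) B0] by (intro integral_mono) auto
      also have "\<dots> = M" using iB G0[OF BC compact_square r(2) B0, of j n] by (simp add: M_def)
      finally show ?thesis using mono(1) by (simp add: field_simps)
    qed
    show ?thesis
    proof (rule LIMSEQ_I)
      fix e :: real assume e: "e > 0"
      (* M / c bounds the mass of the weight; this is the size of the normal component that it may meet *)
      define \<eta> where "\<eta> = e * c / (M + 1)"
      have \<eta>: "\<eta> > 0" using e mono(1) M by (simp add: \<eta>_def)
      have "\<exists>\<delta>>0. \<forall>x\<in>?K. \<bar>\<psi> x\<bar> < \<delta> \<longrightarrow> \<bar>W x\<bar> < \<eta>"
      proof -
        define L where "L = {x\<in>?K. \<eta> \<le> \<bar>W x\<bar>}"
        have "continuous_on ?K (\<lambda>x. \<bar>W x\<bar>)" by (intro continuous_intros continuous_on_subset[OF Wc KU])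
        then have "closed L" unfolding L_def by (intro continuous_closed_preimage_Collect_le compact_imp_closed compact_square)
        moreover have "bounded L" using compact_imp_bounded[OF compact_square] by (rule bounded_subset) (auto simp: L_def)
        ultimately have "compact L" by (simp add: compact_eq_bounded_closed)
        show ?thesis
        proof (cases "L = {}")
          case True then show ?thesis by (intro exI[of _ 1]) (force simp: L_def)
        next
          case False
          have "continuous_on L (\<lambda>x. \<bar>\<psi> x\<bar>)" using \<psi>c0 KU by (intro continuous_intros continuous_on_subset[OF \<psi>c0]) (auto simp: L_def)
          then obtain x where x: "x \<in> L" "\<forall>y\<in>L. \<bar>\<psi> x\<bar> \<le> \<bar>\<psi> y\<bar>" using continuous_attains_inf[OF \<open>compact L\<close> False] by blast
          have "\<psi> x \<noteq> 0" using tangent[of x] x(1) KS \<eta> by (auto simp: L_def W_def)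
          then show ?thesis using x(2) by (intro exI[of _ "\<bar>\<psi> x\<bar>"]) (force simp: L_def)
        qed
      qed
      then obtain \<delta> where \<delta>: "\<delta> > 0" "\<And>x. x \<in> ?K \<Longrightarrow> \<bar>\<psi> x\<bar> < \<delta> \<Longrightarrow> \<bar>W x\<bar> < \<eta>" by blast
      obtain N :: nat where N: "1 / \<delta> < real N" using reals_Archimedean2 by blast
      have "norm ((\<integral>x. P n x \<partial>lborel) - 0) < e" if n: "n \<ge> N" for n
      proof -
        have "1 / \<delta> < real (Suc n)" using N n by simp
        then have \<epsilon>\<delta>: "\<epsilon> n < \<delta>" using \<delta>(1) by (simp add: \<epsilon>_def field_simps)
        have "\<bar>J n x\<bar> \<le> \<eta> * H n x" for x
        proof (cases "x \<in> ?K")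
          case True
          then have xU: "x \<in> U" using KU by blast
          show ?thesis
          proof (cases "\<bar>\<psi> x\<bar> < \<delta>")
            case d: True
            have "\<bar>J n x\<bar> = step' (- \<psi> x / \<epsilon> n) / \<epsilon> n * \<bar>W x\<bar>" using xU \<epsilon>[of n] step'_nonneg by (simp add: J_def abs_mult)
            also have "\<dots> \<le> step' (- \<psi> x / \<epsilon> n) / \<epsilon> n * \<eta>" using \<delta>(2)[OF True d] \<epsilon>[of n] step'_nonneg by (intro mult_left_mono) auto
            also have "\<dots> = \<eta> * H n x" using xU B1[OF True] by (simp add: H_def)
            finally show ?thesis .
          next
            case False
            have "step' (- \<psi> x / \<epsilon> n) = 0"
            proof (cases "\<psi> x < 0")
              case True
              then have "1 \<le> - \<psi> x / \<epsilon> n" using False \<epsilon>\<delta> \<epsilon>[of n] by (simp add: field_simps)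
              then show ?thesis by (rule step_high(2))
            next
              case F: False
              then have "- \<psi> x / \<epsilon> n \<le> 0" using \<epsilon>[of n] by (simp add: divide_nonpos_pos)
              then show ?thesis by (rule step'_low)
            qed
            then show ?thesis using Hn \<eta> by (simp add: J_def)
          qed
        next
          case False then show ?thesis using W0 Hn \<eta> by (simp add: J_def)
        qed
        then have "\<bar>\<integral>x. J n x \<partial>lborel\<bar> \<le> (\<integral>x. \<eta> * H n x \<partial>lborel)"
          using iJ[of n] iH[of n] by (intro order_trans[OF integral_abs_bound integral_mono]) auto
        also have "\<dots> \<le> \<eta> * (M / c)" using mult_left_mono[OF Hb[of n], of \<eta>] \<eta> by simp
        also have "\<dots> < e"
        proof -
          have "e * M < e * (M + 1)" using e by simp
          then show ?thesis using mono(1) M by (simp add: \<eta>_def field_simps)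
        qed
        finally show ?thesis using PJ[of n] by simp
      qed
      then show "\<exists>N. \<forall>n\<ge>N. norm ((\<integral>x. P n x \<partial>lborel) - 0) < e" by blast
    qed
  qed
  ultimately have "(\<integral>x. indicator \<Omega> x *\<^sub>R dv x \<partial>lborel) = 0" by (rule LIMSEQ_unique)
  then show ?thesis by (simp add: set_lebesgue_integral_def dv_def)
qed

lemma frechet_derivative_grad:
  fixes f :: "real^2 \<Rightarrow> real"
  assumes "f differentiable (at x)"
  shows "frechet_derivative f (at x) v = grad f x \<bullet> v"
proof -
  interpret linear "frechet_derivative f (at x)" by (rule linear_frechet_derivative[OF assms])
  have "v = (v $ 1) *\<^sub>R axis 1 1 + (v $ 2) *\<^sub>R axis 2 1" by (simp add: vec_eq_iff forall_2 axis_def)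
  then have "frechet_derivative f (at x) v = frechet_derivative f (at x) ((v $ 1) *\<^sub>R axis 1 1 + (v $ 2) *\<^sub>R axis 2 1)" by simp
  also have "\<dots> = grad f x \<bullet> v" by (simp only: add scale) (simp add: grad_def inner_vec_def sum_2)
  finally show ?thesis .
qed

text \<open>
  Following \<open>- \<nabla>\<psi>\<close> from a zero of \<open>\<psi>\<close> one enters
  \<open>\<Omega>\<close>, so every zero of the defining function in the chart is a boundary point, and tangency
  applies there.
\<close>

lemma outer_normal_on_level_set:
  assumes \<Omega>: "open \<Omega>" and U: "open U" "Ck_on 1 U \<psi>" "\<forall>y\<in>U. grad \<psi> y \<noteq> 0" "\<Omega> \<inter> U = {y\<in>U. \<psi> y < 0}"
    and y: "y \<in> U" "\<psi> y = 0"
  shows "outer_normal \<Omega> y (grad \<psi> y /\<^sub>R norm (grad \<psi> y))"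
proof -
  let ?v = "grad \<psi> y"
  have diff: "\<psi> differentiable (at y)" using U(2) y(1) by (simp add: One_nat_def)
  have "((\<lambda>s. \<psi> (y - s *\<^sub>R ?v)) has_derivative (\<lambda>s. frechet_derivative \<psi> (at y) (- (s *\<^sub>R ?v)))) (at 0)"
  proof (rule has_derivative_compose[where f = "\<lambda>s. y - s *\<^sub>R ?v"])
    show "((\<lambda>s. y - s *\<^sub>R ?v) has_derivative (\<lambda>s. - (s *\<^sub>R ?v))) (at 0)" by (auto intro!: derivative_eq_intros)
    show "(\<psi> has_derivative frechet_derivative \<psi> (at y)) (at (y - 0 *\<^sub>R ?v))" using diff by (simp add: frechet_derivative_works)
  qed
  then have d: "((\<lambda>s. \<psi> (y - s *\<^sub>R ?v)) has_real_derivative - (?v \<bullet> ?v)) (at 0)"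
    unfolding has_field_derivative_def frechet_derivative_grad[OF diff]
    by (rule has_derivative_eq_rhs) (simp add: fun_eq_iff mult.commute)
  moreover have "- (?v \<bullet> ?v) < 0" using U(3) y(1) by simp
  ultimately obtain d where d: "d > 0" "\<And>h. 0 < h \<Longrightarrow> h < d \<Longrightarrow> \<psi> (y - h *\<^sub>R ?v) < 0"
    using DERIV_neg_dec_right[OF d] y(2) by auto
  obtain e where e: "e > 0" "ball y e \<subseteq> U" using U(1) y(1) open_contains_ball by blast
  have "y \<in> closure \<Omega>" unfolding closure_approachable
  proof (intro allI impI)
    fix \<epsilon> :: real assume \<epsilon>: "\<epsilon> > 0"
    have v: "norm ?v > 0" using U(3) y(1) by simp
    define h where "h = min (d / 2) (min \<epsilon> e / (2 * norm ?v))"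
    have h: "0 < h" "h < d" using d(1) e(1) \<epsilon> v by (auto simp: h_def)
    have "h * norm ?v \<le> min \<epsilon> e / (2 * norm ?v) * norm ?v" unfolding h_def by (intro mult_right_mono) auto
    also have "\<dots> = min \<epsilon> e / 2" using v by simp
    also have "\<dots> < min \<epsilon> e" using \<epsilon> e(1) by (simp add: min_def)
    finally have hd: "dist (y - h *\<^sub>R ?v) y < \<epsilon>" "dist (y - h *\<^sub>R ?v) y < e" using h by (simp_all add: dist_norm)
    have "y - h *\<^sub>R ?v \<in> U" using e(2) hd(2) by (auto simp: dist_commute)
    then have "y - h *\<^sub>R ?v \<in> \<Omega>" using d(2)[OF h] U(4) by blast
    then show "\<exists>z\<in>\<Omega>. dist z y < \<epsilon>" using hd(1) by blast
  qed
  moreover have "y \<notin> \<Omega>"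
  proof
    assume "y \<in> \<Omega>"
    then have "y \<in> {y\<in>U. \<psi> y < 0}" unfolding U(4)[symmetric] using y(1) by blast
    then show False using y(2) by simp
  qed
  ultimately have "y \<in> frontier \<Omega>" using \<Omega> by (simp add: frontier_def interior_open)
  then show ?thesis unfolding outer_normal_def using U y(1) by blast
qed

definition tangential :: "(real^2) set \<Rightarrow> (real^2 \<Rightarrow> real) \<Rightarrow> (real^2 \<Rightarrow> real) \<Rightarrow> bool" where
  "tangential \<Omega> F1 F2 \<longleftrightarrow> (\<forall>y\<in>frontier \<Omega>. \<forall>n. outer_normal \<Omega> y n \<longrightarrow> F1 y * n $ 1 + F2 y * n $ 2 = 0)"

lemma tangential_scale: "tangential \<Omega> F1 F2 \<Longrightarrow> tangential \<Omega> (\<lambda>x. b x * F1 x) (\<lambda>x. b x * F2 x)"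
proof -
  have "b y * F1 y * n1 + b y * F2 y * n2 = b y * (F1 y * n1 + F2 y * n2)" for y n1 n2 by (simp add: distrib_left)
  moreover assume "tangential \<Omega> F1 F2"
  ultimately show ?thesis unfolding tangential_def by simp
qed

lemma boundary_chart:
  assumes \<Omega>: "open \<Omega>" "regular_boundary \<Omega>" "x0 \<in> frontier \<Omega>"
  shows "\<exists>r>0. \<forall>F1 F2. Ck_on 1 UNIV F1 \<longrightarrow> Ck_on 1 UNIV F2 \<longrightarrow> tangential \<Omega> F1 F2 \<longrightarrow>
    (\<forall>x. x \<notin> square x0 (r / 2) \<longrightarrow> F1 x = 0 \<and> F2 x = 0) \<longrightarrow> (LINT x:\<Omega>|lborel. pdx 1 F1 x + pdx 2 F2 x) = 0"
proof -
  obtain U \<psi> where U: "open U" "x0 \<in> U" "Ck_on 1 U \<psi>" "\<forall>y\<in>U. grad \<psi> y \<noteq> 0" "\<Omega> \<inter> U = {y\<in>U. \<psi> y < 0}"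
  proof -
    obtain n where "outer_normal \<Omega> x0 n" using \<Omega>(2,3) unfolding regular_boundary_def by blast
    then show ?thesis unfolding outer_normal_def by (elim conjE exE) (rule that)
  qed
  have "\<exists>j. pdx j \<psi> x0 \<noteq> 0" using U(2,4) by (auto simp: grad_def pdx_def vec_eq_iff)
  then obtain j where j: "pdx j \<psi> x0 \<noteq> 0" by blast
  define \<sigma> where "\<sigma> = sgn (pdx j \<psi> x0)"
  have \<sigma>: "\<bar>\<sigma>\<bar> = 1" using j by (simp add: \<sigma>_def abs_sgn_eq)
  define c where "c = \<bar>pdx j \<psi> x0\<bar> / 2"
  have c: "c > 0" using j by (simp add: c_def)
  have cont: "continuous_on U (\<lambda>x. \<sigma> * pdx j \<psi> x)" using U(3) by (auto simp: One_nat_def pdx_def[abs_def] intro!: continuous_intros)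
  have "open (U \<inter> (\<lambda>x. \<sigma> * pdx j \<psi> x) -` {c<..})" by (rule continuous_open_preimage[OF cont U(1) open_greaterThan])
  moreover have "\<sigma> * pdx j \<psi> x0 = \<bar>pdx j \<psi> x0\<bar>" by (simp add: \<sigma>_def sgn_real_def abs_if)
  then have "x0 \<in> U \<inter> (\<lambda>x. \<sigma> * pdx j \<psi> x) -` {c<..}" using U(2) j by (simp add: c_def)
  ultimately obtain r where r: "r > 0" "square x0 r \<subseteq> U \<inter> (\<lambda>x. \<sigma> * pdx j \<psi> x) -` {c<..}" using small_square by blast
  show ?thesis
  proof (intro exI[of _ r] conjI allI impI r(1))
    fix F1 F2 assume F: "Ck_on 1 UNIV F1" "Ck_on 1 UNIV F2" "tangential \<Omega> F1 F2" "\<forall>x. x \<notin> square x0 (r / 2) \<longrightarrow> F1 x = 0 \<and> F2 x = 0"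
    show "(LINT x:\<Omega>|lborel. pdx 1 F1 x + pdx 2 F2 x) = 0"
    proof (rule local_divergence_theorem[OF \<Omega>(1) U(1,3,5) r(1) _ c _ \<sigma> F(1,2) F(4)[rule_format]])
      show "square x0 r \<subseteq> U" using r(2) by blast
      show "c \<le> \<sigma> * pdx j \<psi> x" if "x \<in> square x0 r" for x
      proof -
        have "\<sigma> * pdx j \<psi> x \<in> {c<..}" using subsetD[OF r(2) that] by blast
        then show ?thesis by simp
      qed
      show "F1 y * pdx 1 \<psi> y + F2 y * pdx 2 \<psi> y = 0" if y: "y \<in> square x0 r" "\<psi> y = 0" for y
      proof -
        have yU: "y \<in> U" using y(1) r(2) by blast
        have n: "outer_normal \<Omega> y (grad \<psi> y /\<^sub>R norm (grad \<psi> y))" by (rule outer_normal_on_level_set[OF \<Omega>(1) U(1,3,4,5) yU y(2)])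
        then have "y \<in> frontier \<Omega>" by (simp add: outer_normal_def)
        with n F(3) have "F1 y * (grad \<psi> y /\<^sub>R norm (grad \<psi> y)) $ 1 + F2 y * (grad \<psi> y /\<^sub>R norm (grad \<psi> y)) $ 2 = 0"
          unfolding tangential_def by blast
        then have "(F1 y * pdx 1 \<psi> y + F2 y * pdx 2 \<psi> y) / norm (grad \<psi> y) = 0"
          by (simp add: grad_def pdx_def divide_inverse algebra_simps)
        then show ?thesis using U(4) yU by simp
      qed
    qed
  qed
qed

lemma divergence_integral_0_interior:
  assumes \<Omega>: "open \<Omega>" "bounded \<Omega>" and F: "Ck_on 1 UNIV F" and N: "open N" "frontier \<Omega> \<subseteq> N" "\<And>x. x \<in> N \<Longrightarrow> F x = 0"
  shows "set_integrable lborel \<Omega> (pdx i F)" "(LINT x:\<Omega>|lborel. pdx i F x) = 0"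
proof -
  let ?G = "\<lambda>x. if x \<in> \<Omega> then F x else 0"
  let ?K = "closure \<Omega> - N"
  have K: "compact ?K" using \<Omega>(2) N(1) by (simp add: compact_closure compact_diff)
  have K\<Omega>: "?K \<subseteq> \<Omega>" using N(2) \<Omega>(1) by (auto simp: frontier_def interior_open)
  have d: "(?G has_derivative (\<lambda>v. if x \<in> \<Omega> then frechet_derivative F (at x) v else 0)) (at x)" for x
  proof (cases "x \<in> \<Omega>")
    case True
    then have "(?G has_derivative frechet_derivative F (at x)) (at x)"
      by (intro has_derivative_transform_within_open[OF C1_D(1)[OF F] \<Omega>(1)]) auto
    then show ?thesis using True by simp
  next
    case False
    have x: "x \<in> - closure \<Omega> \<union> N" using False N(2) \<Omega>(1) by (auto simp: frontier_def interior_open)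
    have "((\<lambda>x. 0) has_derivative (\<lambda>v. 0)) (at x)" by simp
    then have "(?G has_derivative (\<lambda>v. 0)) (at x)"
      by (rule has_derivative_transform_within_open[OF _ _ x]) (use N closure_subset[of \<Omega>] in auto)
    then show ?thesis using False by simp
  qed
  have zero: "frechet_derivative F (at x) v = 0" if "x \<in> N" for x v
  proof -
    have "((\<lambda>x. 0) has_derivative (\<lambda>v. 0)) (at x)" by simp
    then have "(F has_derivative (\<lambda>v. 0)) (at x)" by (rule has_derivative_transform_within_open[OF _ N(1) that]) (simp add: N(3))
    from has_derivative_unique[OF C1_D(1)[OF F] this] show ?thesis by simp
  qed
  have C: "Ck_on 1 UNIV ?G"
  proof (rule C1_I[OF d])
    fix v show "continuous_on UNIV (\<lambda>x. if x \<in> \<Omega> then frechet_derivative F (at x) v else 0)"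
    proof (rule continuous_extension_by_zero[OF \<Omega>(1) continuous_on_subset[OF C1_D(2)[OF F] subset_UNIV] K K\<Omega>])
      fix x assume "x \<in> \<Omega> - ?K"
      then have "x \<in> N" using closure_subset[of \<Omega>] by blast
      then show "frechet_derivative F (at x) v = 0" by (rule zero)
    qed
  qed
  have "?G x = 0" if "x \<notin> ?K" for x using that N(3) closure_subset[of \<Omega>] by auto
  note 0 = pdx_integral_0[OF C K this, of i]
  have eq: "pdx i ?G = (\<lambda>x. indicator \<Omega> x *\<^sub>R pdx i F x)"
    by (rule ext) (simp add: pdx_def frechet_derivative_at[OF d, symmetric])
  show "set_integrable lborel \<Omega> (pdx i F)" using 0(1) unfolding eq set_integrable_def .
  show "(LINT x:\<Omega>|lborel. pdx i F x) = 0" using 0(2) unfolding eq set_lebesgue_integral_def .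
qed

lemma C1_add:
  fixes f g :: "real^2 \<Rightarrow> real"
  assumes "Ck_on 1 UNIV f" "Ck_on 1 UNIV g"
  shows "Ck_on 1 UNIV (\<lambda>y. f y + g y)" "pdx i (\<lambda>y. f y + g y) x = pdx i f x + pdx i g x"
proof -
  have d: "((\<lambda>y. f y + g y) has_derivative (\<lambda>v. frechet_derivative f (at y) v + frechet_derivative g (at y) v)) (at y)" for y
    by (intro has_derivative_add C1_D(1) assms)
  then show "Ck_on 1 UNIV (\<lambda>y. f y + g y)"
    by (rule C1_I) (intro continuous_on_add C1_D(2) assms)
  show "pdx i (\<lambda>y. f y + g y) x = pdx i f x + pdx i g x"
    unfolding pdx_def by (simp add: frechet_derivative_at[OF d, symmetric])
qed

text \<open>
  Partition of unity by induction over the charts: cut off with a plateau function of one chart at a time, so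
  that the remaining field vanishes on a growing open set N, and finally near the whole boundary.
\<close>

lemma divergence_theorem_induct:
  assumes \<Omega>: "open \<Omega>" "bounded \<Omega>"
    and chart: "\<And>x0 F1 F2. x0 \<in> D \<Longrightarrow> Ck_on 1 UNIV F1 \<Longrightarrow> Ck_on 1 UNIV F2 \<Longrightarrow> tangential \<Omega> F1 F2 \<Longrightarrow>
        (\<forall>x. x \<notin> square x0 (r x0 / 2) \<longrightarrow> F1 x = 0 \<and> F2 x = 0) \<Longrightarrow> (LINT x:\<Omega>|lborel. pdx 1 F1 x + pdx 2 F2 x) = 0"
    and r: "\<And>x. x \<in> D \<Longrightarrow> 0 < r x"
    and "finite D" "open N" "frontier \<Omega> \<subseteq> N \<union> (\<Union>x\<in>D. interior (square x (r x / 4)))"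
    and "Ck_on 1 UNIV F1" "Ck_on 1 UNIV F2" "tangential \<Omega> F1 F2" "\<And>x. x \<in> N \<Longrightarrow> F1 x = 0 \<and> F2 x = 0"
  shows "(LINT x:\<Omega>|lborel. pdx 1 F1 x + pdx 2 F2 x) = 0"
  using assms(5,3,4,6-)
proof (induction D arbitrary: N F1 F2)
  case empty
  then have N: "frontier \<Omega> \<subseteq> N" by simp
  have z: "\<And>x. x \<in> N \<Longrightarrow> F1 x = 0" "\<And>x. x \<in> N \<Longrightarrow> F2 x = 0" using empty.prems(8) by auto
  note 1 = divergence_integral_0_interior[OF \<Omega> empty.prems(5) \<open>open N\<close> N z(1), of 1]
  note 2 = divergence_integral_0_interior[OF \<Omega> empty.prems(6) \<open>open N\<close> N z(2), of 2]
  show ?case using set_integral_add(2)[OF 1(1) 2(1)] 1(2) 2(2) by simp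
next
  case (insert x0 D)
  define \<beta> where "\<beta> = bump2 plateau x0 (r x0 / 2)"
  have r0: "0 < r x0" using insert.prems(2) by simp
  have \<beta>C: "Ck_on 1 UNIV \<beta>" unfolding \<beta>_def using r0 by (intro bump2_C1[OF plateau_derivative plateau_continuous']) auto
  have \<beta>0: "x \<notin> square x0 (r x0 / 2) \<Longrightarrow> \<beta> x = 0" for x unfolding \<beta>_def using r0 by (intro bump2_outside[OF plateau_outside]) auto
  have \<beta>1: "\<beta> x = 1" if "x \<in> square x0 (r x0 / 4)" for x unfolding \<beta>_def using r0 that by (intro plateau2_inner) auto
  have c: "Ck_on 1 UNIV (\<lambda>x. 1 - \<beta> x)" by (rule C1_diff[OF _ \<beta>C]) (rule C1_I[where F = "\<lambda>_ _. 0"]; simp)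
  note F = insert.prems(5-7)
  note C = C1_mult(1)[OF \<beta>C F(1)] C1_mult(1)[OF \<beta>C F(2)] C1_mult(1)[OF c F(1)] C1_mult(1)[OF c F(2)]
  have 1: "(LINT x:\<Omega>|lborel. pdx 1 (\<lambda>x. \<beta> x * F1 x) x + pdx 2 (\<lambda>x. \<beta> x * F2 x) x) = 0"
    by (rule insert.prems(1)[OF insertI1 C(1,2) tangential_scale[OF F(3)]]) (simp add: \<beta>0)
  have 2: "(LINT x:\<Omega>|lborel. pdx 1 (\<lambda>x. (1 - \<beta> x) * F1 x) x + pdx 2 (\<lambda>x. (1 - \<beta> x) * F2 x) x) = 0"
  proof (rule insert.IH[OF _ _ _ _ C(3,4) tangential_scale[OF F(3)]])
    show "open (N \<union> interior (square x0 (r x0 / 4)))" using insert.prems(3) by blast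
    show "frontier \<Omega> \<subseteq> N \<union> interior (square x0 (r x0 / 4)) \<union> (\<Union>x\<in>D. interior (square x (r x / 4)))" using insert.prems(4) by auto
    show "(1 - \<beta> x) * F1 x = 0 \<and> (1 - \<beta> x) * F2 x = 0" if "x \<in> N \<union> interior (square x0 (r x0 / 4))" for x
      using that insert.prems(8)[of x] \<beta>1[of x] interior_subset[of "square x0 (r x0 / 4)"] by auto
    show "0 < r x" if "x \<in> D" for x using insert.prems(2) that by blast
    show "(LINT x:\<Omega>|lborel. pdx 1 F1 x + pdx 2 F2 x) = 0"
      if "y \<in> D" "Ck_on 1 UNIV F1" "Ck_on 1 UNIV F2" "tangential \<Omega> F1 F2" "\<forall>x. x \<notin> square y (r y / 2) \<longrightarrow> F1 x = 0 \<and> F2 x = 0" for y F1 F2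
      by (rule insert.prems(1)[OF insertI2[OF that(1)] that(2-)])
  qed
  have i: "set_integrable lborel \<Omega> (pdx k f)" if "Ck_on 1 UNIV f" for k f
    using \<Omega> pdx_continuous[OF that] by (intro set_integrable_continuous) auto
  have split: "pdx k F x = pdx k (\<lambda>x. \<beta> x * F x) x + pdx k (\<lambda>x. (1 - \<beta> x) * F x) x" if "Ck_on 1 UNIV F" for k F x
  proof -
    have "((\<lambda>x. 1 - \<beta> x) has_derivative (\<lambda>v. 0 - frechet_derivative \<beta> (at x) v)) (at x)"
      by (intro has_derivative_diff has_derivative_const C1_D(1) \<beta>C)
    from frechet_derivative_at[OF this, symmetric] have "pdx k (\<lambda>x. 1 - \<beta> x) x = - pdx k \<beta> x" by (simp add: pdx_def)
    then show ?thesis unfolding pdx_mult[OF \<beta>C that] pdx_mult[OF c that] by (simp add: algebra_simps)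
  qed
  have "(LINT x:\<Omega>|lborel. pdx 1 F1 x + pdx 2 F2 x) =
    (LINT x:\<Omega>|lborel. (pdx 1 (\<lambda>x. \<beta> x * F1 x) x + pdx 2 (\<lambda>x. \<beta> x * F2 x) x) + (pdx 1 (\<lambda>x. (1 - \<beta> x) * F1 x) x + pdx 2 (\<lambda>x. (1 - \<beta> x) * F2 x) x))"
    unfolding split[OF F(1)] split[OF F(2)] by (simp add: algebra_simps)
  also have "\<dots> = 0" using 1 2 i[OF C(1)] i[OF C(2)] i[OF C(3)] i[OF C(4)] by (subst set_integral_add) (auto intro!: set_integral_add)
  finally show ?case .
qed

lemma divergence_theorem_tangential:
  assumes \<Omega>: "open \<Omega>" "bounded \<Omega>" "regular_boundary \<Omega>"
    and F: "Ck_on 1 UNIV F1" "Ck_on 1 UNIV F2" "tangential \<Omega> F1 F2"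
  shows "(LINT x:\<Omega>|lborel. pdx 1 F1 x + pdx 2 F2 x) = 0"
proof -
  let ?P = "\<lambda>x0 r. r > 0 \<and> (\<forall>F1 F2. Ck_on 1 UNIV F1 \<longrightarrow> Ck_on 1 UNIV F2 \<longrightarrow> tangential \<Omega> F1 F2 \<longrightarrow>
    (\<forall>x. x \<notin> square x0 (r / 2) \<longrightarrow> F1 x = 0 \<and> F2 x = 0) \<longrightarrow> (LINT x:\<Omega>|lborel. pdx 1 F1 x + pdx 2 F2 x) = 0)"
  have "\<forall>x\<in>frontier \<Omega>. \<exists>r. ?P x r" using boundary_chart[OF \<Omega>(1,3)] by simp
  from bchoice[OF this] obtain r where P: "\<forall>x\<in>frontier \<Omega>. ?P x (r x)" by (rule exE)
  have r: "0 < r x" if "x \<in> frontier \<Omega>" for x using P that by blast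
  have chart: "(LINT x:\<Omega>|lborel. pdx 1 F1 x + pdx 2 F2 x) = 0"
    if "x0 \<in> frontier \<Omega>" "Ck_on 1 UNIV F1" "Ck_on 1 UNIV F2" "tangential \<Omega> F1 F2" "\<forall>x. x \<notin> square x0 (r x0 / 2) \<longrightarrow> F1 x = 0 \<and> F2 x = 0" for x0 F1 F2
    using P[THEN bspec, OF that(1)] that(2-) by (elim conjE allE[of _ F1] allE[of _ F2]) simp
  have "x \<in> interior (square x s)" if "s > 0" for x s
  proof (rule interiorI)
    show "open {y. \<bar>y $ 1 - x $ 1\<bar> < s \<and> \<bar>y $ 2 - x $ 2\<bar> < s}" by (intro open_Collect_conj open_Collect_less continuous_intros)
  qed (use that in \<open>auto simp: square_def\<close>)
  then have "x \<in> interior (square x (r x / 4))" if "x \<in> frontier \<Omega>" for x using r[OF that] by simp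
  then have "frontier \<Omega> \<subseteq> (\<Union>x\<in>frontier \<Omega>. interior (square x (r x / 4)))" by blast
  from compactE_image[OF compact_frontier_bounded[OF \<Omega>(2)] _ this]
  obtain D where D: "D \<subseteq> frontier \<Omega>" "finite D" "frontier \<Omega> \<subseteq> (\<Union>x\<in>D. interior (square x (r x / 4)))" by auto
  show ?thesis
  proof (rule divergence_theorem_induct[OF \<Omega>(1,2) _ _ D(2) open_empty _ F])
    show "(LINT x:\<Omega>|lborel. pdx 1 F1 x + pdx 2 F2 x) = 0"
      if "x0 \<in> D" "Ck_on 1 UNIV F1" "Ck_on 1 UNIV F2" "tangential \<Omega> F1 F2" "\<forall>x. x \<notin> square x0 (r x0 / 2) \<longrightarrow> F1 x = 0 \<and> F2 x = 0" for x0 F1 F2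
      by (rule chart[OF subsetD[OF D(1) that(1)] that(2-)])
    show "0 < r x" if "x \<in> D" for x using r D(1) that by blast
    show "frontier \<Omega> \<subseteq> {} \<union> (\<Union>x\<in>D. interior (square x (r x / 4)))" using D(3) by simp
  qed simp
qed

section \<open>Mollification\<close>

lemma Ck_on_continuous: "Ck_on k S f \<Longrightarrow> continuous_on S f"
proof (cases k)
  case (Suc j)
  moreover assume "Ck_on k S f"
  ultimately show ?thesis by (intro continuous_at_imp_continuous_on) (simp add: differentiable_imp_continuous_within)
qed simp

lemma Ck_on_mono: "Ck_on k S f \<Longrightarrow> 1 \<le> k \<Longrightarrow> Ck_on 1 S f"
proof (cases k)
  case (Suc j)
  moreover assume "Ck_on k S f"
  ultimately have "\<forall>x\<in>S. f differentiable (at x)" "Ck_on j S (\<lambda>x. frechet_derivative f (at x) v)" for v by simp_all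
  then show ?thesis by (simp add: One_nat_def Ck_on_continuous[of j])
qed simp

lemma smooth_on_C1: "smooth_on S f \<Longrightarrow> Ck_on 1 S f"
  by (simp add: smooth_on_def)

lemma Ck_on_add:
  assumes "Ck_on k UNIV f" "Ck_on k UNIV g"
  shows "Ck_on k UNIV (\<lambda>x. f x + g x)"
  using assms
proof (induction k arbitrary: f g)
  case 0 then show ?case by (simp add: continuous_on_add)
next
  case (Suc k)
  have d: "((\<lambda>x. f x + g x) has_derivative (\<lambda>v. frechet_derivative f (at x) v + frechet_derivative g (at x) v)) (at x)" for x
    using Suc.prems by (intro has_derivative_add) (simp_all add: frechet_derivative_works)
  have "frechet_derivative (\<lambda>x. f x + g x) (at x) v = frechet_derivative f (at x) v + frechet_derivative g (at x) v" for x v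
    by (simp add: frechet_derivative_at[OF d, symmetric])
  moreover have "(\<lambda>x. f x + g x) differentiable at x" for x using d differentiable_def by blast
  ultimately show ?case using Suc by simp
qed

text \<open>
  The kernel is smooth while f is merely continuous with compact support, so the derivatives have to fall on the
  kernel.
\<close>

definition conv :: "(real^2 \<Rightarrow> real) \<Rightarrow> (real^2 \<Rightarrow> real) \<Rightarrow> real^2 \<Rightarrow> real" where
  "conv h f x = (\<integral>t. h (x - t) * f t \<partial>lborel)"

lemma conv_integrable:
  assumes "continuous_on UNIV h" "continuous_on UNIV f" "\<forall>x. x \<notin> cbox a b \<longrightarrow> f x = 0"
  shows "integrable lborel (\<lambda>t. h (x - t) * f t)"
    and "(\<lambda>t. h (x - t) * f t) integrable_on cbox a b"
    and "conv h f x = integral (cbox a b) (\<lambda>t. h (x - t) * f t)"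
proof -
  have c: "continuous_on UNIV (\<lambda>t. h (x - t) * f t)"
    by (intro continuous_on_mult assms(2) continuous_on_compose2[OF assms(1)] continuous_intros) auto
  have s: "set_integrable lborel (cbox a b) (\<lambda>t. h (x - t) * f t)"
    by (intro set_integrable_continuous c) auto
  have eq: "indicator (cbox a b) t *\<^sub>R (h (x - t) * f t) = h (x - t) * f t" for t
    using assms(3) by (cases "t \<in> cbox a b") auto
  show "integrable lborel (\<lambda>t. h (x - t) * f t)" using s unfolding set_integrable_def eq .
  show "(\<lambda>t. h (x - t) * f t) integrable_on cbox a b" by (rule set_borel_integral_eq_integral(1)[OF s])
  show "conv h f x = integral (cbox a b) (\<lambda>t. h (x - t) * f t)"
    using set_borel_integral_eq_integral(2)[OF s] unfolding set_lebesgue_integral_def eq conv_def .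
qed

lemma conv_continuous:
  assumes "continuous_on UNIV h" "continuous_on UNIV f" "\<forall>x. x \<notin> cbox a b \<longrightarrow> f x = 0"
  shows "continuous_on UNIV (conv h f)"
proof -
  have "continuous_on (UNIV \<times> cbox a b) (\<lambda>(x, t). h (x - t) * f t)"
    unfolding split_beta
    by (intro continuous_on_mult continuous_on_compose2[OF assms(1)] continuous_on_compose2[OF assms(2)] continuous_intros) auto
  from integral_continuous_on_param[OF this] show ?thesis
    unfolding conv_integrable(3)[OF assms, abs_def] .
qed

lemma conv_derivative:
  assumes h: "Ck_on 1 UNIV h" and f: "continuous_on UNIV f" "\<forall>x. x \<notin> cbox a b \<longrightarrow> f x = 0"
  shows "(conv h f has_derivative (\<lambda>v. conv (\<lambda>y. frechet_derivative h (at y) v) f x)) (at x)"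
proof -
  define D where "D x t = Blinfun (\<lambda>v. frechet_derivative h (at (x - t)) v * f t)" for x t
  have D: "blinfun_apply (D x t) = (\<lambda>v. frechet_derivative h (at (x - t)) v * f t)" for x t
    unfolding D_def
    by (intro bounded_linear_Blinfun_apply bounded_linear_mult_const has_derivative_bounded_linear[OF C1_D(1)[OF h]])
  have Dc: "continuous_on (UNIV \<times> cbox a b) (\<lambda>(x, t). D x t)"
  proof (rule continuous_on_blinfun_componentwise)
    fix i :: "real^2" assume "i \<in> Basis"
    show "continuous_on (UNIV \<times> cbox a b) (\<lambda>z. blinfun_apply (case z of (x, t) \<Rightarrow> D x t) i)"
      unfolding split_beta D
      by (intro continuous_on_mult continuous_on_compose2[OF C1_D(2)[OF h]] continuous_on_compose2[OF f(1)] continuous_intros) auto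
  qed
  have "((\<lambda>x. integral (cbox a b) (\<lambda>t. h (x - t) * f t)) has_derivative integral (cbox a b) (D x)) (at x within UNIV)"
  proof (rule leibniz_rule[OF _ _ Dc])
    fix y t :: "real^2"
    have "((\<lambda>y. y - t) has_derivative (\<lambda>v. v)) (at y)" by (auto intro!: derivative_eq_intros)
    from has_derivative_mult_left[OF has_derivative_compose[OF this C1_D(1)[OF h]], of "f t"]
    show "((\<lambda>y. h (y - t) * f t) has_derivative blinfun_apply (D y t)) (at y within UNIV)" unfolding D .
  qed (use conv_integrable(2)[OF C1_D(3)[OF h] f] in auto)
  moreover have "blinfun_apply (integral (cbox a b) (D x)) v = conv (\<lambda>y. frechet_derivative h (at y) v) f x" for v
  proof -
    have "continuous_on (cbox a b) (\<lambda>t. D x t)"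
    proof -
      have "continuous_on (cbox a b) (\<lambda>t. (\<lambda>(x, t). D x t) (x, t))"
        by (rule continuous_on_compose2[OF Dc]) (auto intro!: continuous_intros)
      then show ?thesis by simp
    qed
    then show ?thesis
      by (simp add: blinfun_apply_integral[OF integrable_continuous] D conv_integrable(3)[OF C1_D(2)[OF h] f])
  qed
  then have "blinfun_apply (integral (cbox a b) (D x)) = (\<lambda>v. conv (\<lambda>y. frechet_derivative h (at y) v) f x)" by (rule ext)
  ultimately show ?thesis unfolding conv_integrable(3)[OF C1_D(3)[OF h] f, abs_def] by simp
qed

lemma conv_Ck:
  assumes "Ck_on k UNIV h" "continuous_on UNIV f" "\<forall>x. x \<notin> cbox a b \<longrightarrow> f x = 0"
  shows "Ck_on k UNIV (conv h f)"
  using assms(1)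
proof (induction k arbitrary: h)
  case 0 then show ?case using conv_continuous[OF _ assms(2,3)] by simp
next
  case (Suc k)
  have h: "Ck_on 1 UNIV h" by (rule Ck_on_mono[OF Suc.prems]) simp
  note d = conv_derivative[OF h assms(2,3)]
  have "frechet_derivative (conv h f) (at x) v = conv (\<lambda>y. frechet_derivative h (at y) v) f x" for x v
    by (simp add: frechet_derivative_at[OF d, symmetric])
  moreover have "conv h f differentiable at x" for x using d differentiable_def by blast
  ultimately show ?case using Suc by simp
qed

text \<open>
  Products of derivatives of the one-dimensional bump; this family is closed under differentiation up to sums,
  which gives smoothness by induction.
\<close>

definition kernel :: "real \<Rightarrow> nat \<Rightarrow> nat \<Rightarrow> real \<Rightarrow> real^2 \<Rightarrow> real" where
  "kernel c i j n y = c * (bump i (n * y $ 1) * bump j (n * y $ 2))"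

lemma kernel_derivative:
  "(kernel c i j n has_derivative (\<lambda>v. kernel (c * (n * v $ 1)) (Suc i) j n y + kernel (c * (n * v $ 2)) i (Suc j) n y)) (at y)"
proof -
  have b: "((\<lambda>y::real^2. bump i (n * y $ k)) has_derivative (\<lambda>v. bump (Suc i) (n * y $ k) * (n * v $ k))) (at y)" for i k
  proof -
    have "((\<lambda>y::real^2. n * y $ k) has_derivative (\<lambda>v. n * v $ k)) (at y)"
      by (intro has_derivative_mult_right bounded_linear_imp_has_derivative bounded_linear_vec_nth)
    from has_derivative_compose[OF this bump_derivative[unfolded has_field_derivative_def]] show ?thesis .
  qed
  have "(kernel c i j n has_derivative (\<lambda>v. c * (bump i (n * y $ 1) * (bump (Suc j) (n * y $ 2) * (n * v $ 2)) + bump (Suc i) (n * y $ 1) * (n * v $ 1) * bump j (n * y $ 2)))) (at y)"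
    unfolding kernel_def[abs_def] by (intro has_derivative_mult_right has_derivative_mult b)
  then show ?thesis by (rule has_derivative_eq_rhs) (simp add: kernel_def fun_eq_iff algebra_simps)
qed

lemma kernel_Ck: "Ck_on k UNIV (kernel c i j n)"
proof (induction k arbitrary: c i j)
  case 0
  show ?case using kernel_derivative by (auto intro!: continuous_at_imp_continuous_on has_derivative_continuous)
next
  case (Suc k)
  have "frechet_derivative (kernel c i j n) (at y) v = kernel (c * (n * v $ 1)) (Suc i) j n y + kernel (c * (n * v $ 2)) i (Suc j) n y" for y v
    by (simp add: frechet_derivative_at[OF kernel_derivative, symmetric])
  moreover have "kernel c i j n differentiable at y" for y using kernel_derivative differentiable_def by blast
  ultimately show ?case by (simp add: Ck_on_add[OF Suc Suc])
qed

definition mollifier :: "real \<Rightarrow> real^2 \<Rightarrow> real" where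
  "mollifier n = kernel (inverse (\<integral>y. kernel 1 0 0 n y \<partial>lborel)) 0 0 n"

lemma kernel_outside:
  assumes "0 < n" "y \<notin> square 0 (1 / n)"
  shows "kernel c i j n y = 0"
proof -
  have "\<bar>n * y $ 1\<bar> \<ge> 1 \<or> \<bar>n * y $ 2\<bar> \<ge> 1" using assms by (auto simp: square_def abs_mult field_simps)
  then show ?thesis using bump_outside by (auto simp: kernel_def)
qed

lemma kernel_continuous: "continuous_on UNIV (kernel c i j n)"
  using kernel_Ck[of 0] by simp

lemma kernel_integrable:
  assumes n: "0 < n"
  shows "integrable lborel (kernel c i j n)"
proof -
  have "set_integrable lborel (square 0 (1 / n)) (kernel c i j n)"
    by (intro set_integrable_continuous kernel_continuous square_borel compact_imp_bounded compact_square)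
  moreover have "indicator (square 0 (1 / n)) y *\<^sub>R kernel c i j n y = kernel c i j n y" for y
    using kernel_outside[OF n] by (cases "y \<in> square 0 (1 / n)") auto
  ultimately show ?thesis by (simp only: set_integrable_def)
qed

lemma kernel_integral_pos:
  assumes n: "0 < n"
  shows "0 < (\<integral>y. kernel 1 0 0 n y \<partial>lborel)"
proof -
  let ?S = "square 0 (1 / (2 * n))"
  have "measure lborel ?S = (2 * (1 / (2 * n)))\<^sup>2" using measure_square[of "1 / (2 * n)" 0] n by (simp add: measure_def)
  then have m: "0 < measure lborel ?S" using n by simp
  have S: "?S \<in> sets lborel" "emeasure lborel ?S < \<infinity>" using measure_square[of "1 / (2 * n)" 0] n square_borel by simp_all
  have "exp (-4/3) * exp (-4/3) * measure lborel ?S = (\<integral>y. indicator ?S y * (exp (-4/3) * exp (-4/3)) \<partial>lborel)" using S by simp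
  also have "\<dots> \<le> (\<integral>y. kernel 1 0 0 n y \<partial>lborel)"
  proof (intro integral_mono kernel_integrable n)
    show "integrable lborel (\<lambda>y. indicator ?S y * (exp (-4/3) * exp (-4/3) :: real))" using S by (intro integrable_mult_left) simp
    fix y :: "real^2"
    show "indicator ?S y * (exp (-4/3) * exp (-4/3)) \<le> kernel 1 0 0 n y"
    proof (cases "y \<in> ?S")
      case True
      then have "\<bar>n * y $ 1\<bar> \<le> 1/2" "\<bar>n * y $ 2\<bar> \<le> 1/2" using n by (simp_all add: square_def abs_mult field_simps)
      then have "exp (-4/3) * exp (-4/3) \<le> bump 0 (n * y $ 1) * bump 0 (n * y $ 2)" by (intro mult_mono bump_inner bump_range) auto
      then show ?thesis using True by (simp add: kernel_def)
    next
      case False then show ?thesis using bump_range by (simp add: kernel_def)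
    qed
  qed
  finally show ?thesis using m by (smt (verit) exp_gt_zero mult_pos_pos)
qed

lemma mollifier_nonneg: "0 < n \<Longrightarrow> 0 \<le> mollifier n y"
  using kernel_integral_pos[of n] bump_range by (simp add: mollifier_def kernel_def)

lemma mollifier_integral:
  assumes n: "0 < n"
  shows "integrable lborel (\<lambda>t. mollifier n (x - t))" "(\<integral>t. mollifier n (x - t) \<partial>lborel) = 1"
proof -
  have "bump 0 (- s) = bump 0 s" for s using bump_spec by (simp add: bump_term_def)
  then have "bump 0 (n * (a - b)) = bump 0 (n * (b - a))" for a b
    by (metis minus_diff_eq mult_minus_right)
  then have sym: "mollifier n (x - t) = mollifier n (t + (- x))" for t by (simp add: mollifier_def kernel_def)
  have c: "continuous_on UNIV (\<lambda>t. mollifier n (x - t))" unfolding mollifier_def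
    by (rule continuous_on_compose2[OF kernel_continuous]) (auto intro!: continuous_intros)
  have "set_integrable lborel (square x (1 / n)) (\<lambda>t. mollifier n (x - t))"
    by (intro set_integrable_continuous c square_borel compact_imp_bounded compact_square)
  moreover have "indicator (square x (1 / n)) t *\<^sub>R mollifier n (x - t) = mollifier n (x - t)" for t
  proof (cases "t \<in> square x (1 / n)")
    case False
    then have "x - t \<notin> square 0 (1 / n)" by (auto simp: square_def abs_minus_commute)
    then show ?thesis using kernel_outside[OF n] by (simp add: mollifier_def)
  qed simp
  ultimately show "integrable lborel (\<lambda>t. mollifier n (x - t))" by (simp only: set_integrable_def)
  have "(\<integral>t. mollifier n (x - t) \<partial>lborel) = (\<integral>t. mollifier n t \<partial>lborel)"
    unfolding sym by (rule integral_translation_lborel) (simp add: mollifier_def borel_measurable_continuous_onI kernel_continuous)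
  also have "\<dots> = (\<integral>t. inverse (\<integral>y. kernel 1 0 0 n y \<partial>lborel) * kernel 1 0 0 n t \<partial>lborel)"
    by (simp add: mollifier_def kernel_def)
  also have "\<dots> = 1" using kernel_integral_pos[OF n] by simp
  finally show "(\<integral>t. mollifier n (x - t) \<partial>lborel) = 1" .
qed

text \<open>
  A weighted average of values close to c is close to c; with \<open>c = f x\<close> this gives convergence,
  with \<open>c = 0\<close> a uniform bound.
\<close>

lemma mollifier_average:
  assumes n: "0 < n" and f: "continuous_on UNIV f" "\<forall>x. x \<notin> cbox a b \<longrightarrow> f x = 0"
    and close: "\<And>t. t \<in> square x (1 / n) \<Longrightarrow> \<bar>f t - c\<bar> \<le> e"
  shows "\<bar>conv (mollifier n) f x - c\<bar> \<le> e"
proof -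
  have mc: "continuous_on UNIV (mollifier n)" unfolding mollifier_def by (rule kernel_continuous)
  note i = conv_integrable(1)[OF mc f, of x] mollifier_integral[OF n, of x]
  have "conv (mollifier n) f x - c = (\<integral>t. mollifier n (x - t) * f t - mollifier n (x - t) * c \<partial>lborel)"
    using i unfolding conv_def by (subst Bochner_Integration.integral_diff) auto
  also have "\<bar>\<dots>\<bar> \<le> (\<integral>t. mollifier n (x - t) * e \<partial>lborel)"
  proof (rule order_trans[OF integral_abs_bound integral_mono])
    show "integrable lborel (\<lambda>t. \<bar>mollifier n (x - t) * f t - mollifier n (x - t) * c\<bar>)" using i by auto
    show "integrable lborel (\<lambda>t. mollifier n (x - t) * e)" using i by auto
    fix t
    show "\<bar>mollifier n (x - t) * f t - mollifier n (x - t) * c\<bar> \<le> mollifier n (x - t) * e"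
    proof (cases "t \<in> square x (1 / n)")
      case True
      from mult_left_mono[OF close[OF True] mollifier_nonneg[OF n, of "x - t"]] show ?thesis
        using mollifier_nonneg[OF n, of "x - t"] by (simp add: abs_mult flip: right_diff_distrib)
    next
      case False
      then have "x - t \<notin> square 0 (1 / n)" by (auto simp: square_def abs_minus_commute)
      then have "mollifier n (x - t) = 0" unfolding mollifier_def by (rule kernel_outside[OF n])
      then show ?thesis by simp
    qed
  qed
  also have "\<dots> = e" using i by simp
  finally show ?thesis .
qed

lemma mollifier_tendsto:
  assumes f: "continuous_on UNIV f" "\<forall>x. x \<notin> cbox a b \<longrightarrow> f x = 0"
  shows "(\<lambda>n. conv (mollifier (real (Suc n))) f x) \<longlonglongrightarrow> f x"
proof (rule LIMSEQ_I)
  fix e :: real assume e: "e > 0"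
  have "open (f -` ball (f x) (e / 2))" by (rule open_vimage[OF open_ball f(1)])
  then obtain r where r: "r > 0" "square x r \<subseteq> f -` ball (f x) (e / 2)"
    using small_square[of "f -` ball (f x) (e / 2)" x] e by auto
  obtain N :: nat where N: "1 / r < real N" using reals_Archimedean2 by blast
  have "norm (conv (mollifier (real (Suc n))) f x - f x) < e" if "n \<ge> N" for n
  proof -
    have "1 / r < real (Suc n)" using N that by simp
    then have "1 / real (Suc n) \<le> r" using r(1) by (simp add: field_simps)
    then have sub: "square x (1 / real (Suc n)) \<subseteq> f -` ball (f x) (e / 2)" using r(2) by (fastforce simp: square_def)
    have "\<bar>conv (mollifier (real (Suc n))) f x - f x\<bar> \<le> e / 2"
    proof (rule mollifier_average[OF _ f])
      fix t assume "t \<in> square x (1 / real (Suc n))"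
      then have "f t \<in> ball (f x) (e / 2)" using sub by blast
      then show "\<bar>f t - f x\<bar> \<le> e / 2" by (simp add: dist_real_def abs_minus_commute)
    qed simp
    then show ?thesis using e by simp
  qed
  then show "\<exists>N. \<forall>n\<ge>N. norm (conv (mollifier (real (Suc n))) f x - f x) < e" by blast
qed

text \<open>
  Integration by parts moves the derivative from the kernel to f.
\<close>

lemma pdx_conv:
  assumes h: "Ck_on 1 UNIV h" and f: "Ck_on 1 UNIV f" "\<forall>x. x \<notin> cbox a b \<longrightarrow> f x = 0"
  shows "pdx i (conv h f) x = conv h (pdx i f) x"
proof -
  have f0: "\<forall>x. x \<notin> cbox a b \<longrightarrow> pdx i f x = 0"
    unfolding pdx_def by (intro allI impI derivative_outside_support[OF C1_D(1)[OF f(1)] closed_cbox f(2)[rule_format]])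
  have d: "((\<lambda>t. h (x - t)) has_derivative (\<lambda>v. frechet_derivative h (at (x - t)) (- v))) (at t)" for t
    by (rule has_derivative_compose[OF _ C1_D(1)[OF h]]) (auto intro!: derivative_eq_intros)
  have neg: "frechet_derivative h (at y) (- v) = - frechet_derivative h (at y) v" for y v
    by (rule linear_neg[OF has_derivative_linear[OF C1_D(1)[OF h]]])
  have hC: "Ck_on 1 UNIV (\<lambda>t. h (x - t))"
  proof (rule C1_I[OF d])
    fix v show "continuous_on UNIV (\<lambda>t. frechet_derivative h (at (x - t)) (- v))"
      by (rule continuous_on_compose2[OF C1_D(2)[OF h]]) (auto intro!: continuous_intros)
  qed
  have "pdx i (\<lambda>t. h (x - t)) t = - pdx i h (x - t)" for t
    unfolding pdx_def by (simp add: frechet_derivative_at[OF d, symmetric] neg)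
  then have prod: "pdx i (\<lambda>t. h (x - t) * f t) t = h (x - t) * pdx i f t - pdx i h (x - t) * f t" for t
    using pdx_mult[OF hC f(1), of i t] by simp
  have "(\<integral>t. pdx i (\<lambda>t. h (x - t) * f t) t \<partial>lborel) = 0"
    by (rule pdx_integral_0(2)[OF C1_mult(1)[OF hC f(1)] compact_cbox[of a b]]) (simp add: f(2))
  moreover have "(\<integral>t. pdx i (\<lambda>t. h (x - t) * f t) t \<partial>lborel) = conv h (pdx i f) x - conv (pdx i h) f x"
    unfolding prod conv_def
    by (intro Bochner_Integration.integral_diff conv_integrable(1)[OF C1_D(3)[OF h] pdx_continuous[OF f(1)] f0]
        conv_integrable(1)[OF pdx_continuous[OF h] C1_D(3)[OF f(1)] f(2)])
  moreover have "pdx i (conv h f) x = conv (pdx i h) f x"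
    by (simp add: pdx_def[abs_def] frechet_derivative_at[OF conv_derivative[OF h C1_D(3)[OF f(1)] f(2)], symmetric])
  ultimately show ?thesis by simp
qed

lemma conv_mollifier_Cc_smooth:
  assumes n: "1 \<le> n" and f: "continuous_on UNIV f" "\<forall>x. x \<notin> cbox a b \<longrightarrow> f x = 0"
  shows "conv (mollifier n) f \<in> Cc_smooth"
proof -
  let ?K = "{t + y |t y. t \<in> cbox a b \<and> y \<in> square 0 1}"
  have "compact ?K" by (intro compact_sums compact_cbox compact_square)
  moreover have "conv (mollifier n) f x = 0" if x: "x \<notin> ?K" for x
  proof -
    have "mollifier n (x - t) * f t = 0" for t
    proof (cases "t \<in> cbox a b")
      case True
      have "x - t \<notin> square 0 1"
      proof
        assume "x - t \<in> square 0 1"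
        then have "x \<in> ?K" using True by (intro CollectI exI[of _ t] exI[of _ "x - t"]) simp
        then show False using x by blast
      qed
      moreover have "square 0 (1 / n) \<subseteq> square (0::real^2) 1"
      proof -
        have "1 / n \<le> 1" using n by simp
        then show ?thesis by (auto simp: square_def)
      qed
      ultimately have "x - t \<notin> square 0 (1 / n)" by blast
      then have "mollifier n (x - t) = 0" unfolding mollifier_def using n by (intro kernel_outside) auto
      then show ?thesis by simp
    next
      case False then show ?thesis using f(2) by simp
    qed
    then show ?thesis unfolding conv_def by (simp only:) simp
  qed
  moreover have "smooth_on UNIV (conv (mollifier n) f)"
    unfolding smooth_on_def mollifier_def by (intro allI conv_Ck[OF kernel_Ck f])
  ultimately show ?thesis unfolding Cc_smooth_def by blast
qed

section \<open>Fields with vanishing normal trace\<close>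

lemma frechet_derivative_component:
  fixes v :: "'a::real_normed_vector \<Rightarrow> real^'n"
  assumes "v differentiable (at x)"
  shows "frechet_derivative (\<lambda>x. v x $ i) (at x) h = frechet_derivative v (at x) h $ i"
proof -
  have "((\<lambda>x. v x $ i) has_derivative (\<lambda>h. frechet_derivative v (at x) h $ i)) (at x)"
    using assms by (intro bounded_linear.has_derivative[OF bounded_linear_vec_nth]) (simp add: frechet_derivative_works)
  from frechet_derivative_at[OF this, symmetric] show ?thesis by simp
qed

lemma C1_component:
  fixes v :: "'a::real_normed_vector \<Rightarrow> real^'n"
  assumes "Ck_on 1 UNIV v"
  shows "Ck_on 1 UNIV (\<lambda>x. v x $ i)"
proof (rule C1_I)
  show "((\<lambda>x. v x $ i) has_derivative (\<lambda>h. frechet_derivative v (at y) h $ i)) (at y)" for y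
    by (rule bounded_linear.has_derivative[OF bounded_linear_vec_nth C1_D(1)[OF assms]])
  show "continuous_on UNIV (\<lambda>y. frechet_derivative v (at y) h $ i)" for h
    by (intro continuous_on_component C1_D(2) assms)
qed

lemma divergence_eq:
  assumes "v differentiable (at x)"
  shows "divergence v x = pdx 1 (\<lambda>x. v x $ 1) x + pdx 2 (\<lambda>x. v x $ 2) x"
  using assms by (simp add: divergence_def trace_def jacobian_def matrix_def sum_2 pdx_def frechet_derivative_component)

lemma divergence_pairing:
  fixes v :: "real^2 \<Rightarrow> real^2"
  assumes v: "\<And>x. v differentiable (at x)" "\<And>i. Ck_on 1 UNIV (\<lambda>x. v x $ i)" and g: "Ck_on 1 UNIV g"
  shows "g x * divergence v x + v x \<bullet> grad g x = pdx 1 (\<lambda>x. g x * v x $ 1) x + pdx 2 (\<lambda>x. g x * v x $ 2) x"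
  using pdx_mult[OF g v(2), of 1 1 x] pdx_mult[OF g v(2), of 2 2 x]
  by (simp add: divergence_eq[OF v(1)] inner_vec_def sum_2 grad_def pdx_def algebra_simps)

lemma lebesgue_set_integral:
  fixes f :: "'a::euclidean_space \<Rightarrow> real"
  assumes "set_integrable lborel A f"
  shows "set_integrable lebesgue A f" "(LINT x:A|lebesgue. f x) = (LINT x:A|lborel. f x)"
proof -
  have m: "(\<lambda>x. indicator A x *\<^sub>R f x) \<in> borel_measurable lborel"
    using assms unfolding set_integrable_def by (rule borel_measurable_integrable)
  show "set_integrable lebesgue A f" using assms unfolding set_integrable_def integrable_completion[OF m] .
  show "(LINT x:A|lebesgue. f x) = (LINT x:A|lborel. f x)"
    unfolding set_lebesgue_integral_def by (rule integral_completion[OF m])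
qed

section \<open>Constant density and temperature\<close>

text \<open>
  For a regular boundary apply the divergence theorem to the tangential field \<open>g v\<close>. Otherwise the
  identity is known for smooth compactly supported g; cut g off outside \<open>\<Omega>\<close> and mollify, so
  that values and gradients converge boundedly.
\<close>

lemma zero_normal_trace_pairing:
  fixes v :: "real^2 \<Rightarrow> real^2"
  assumes \<Omega>: "open \<Omega>" "bounded \<Omega>" and trace: "zero_normal_trace \<Omega> v"
    and v: "\<And>x. v differentiable (at x)" "\<And>i. Ck_on 1 UNIV (\<lambda>x. v x $ i)" and g: "Ck_on 1 UNIV g"
  shows "(LINT x:\<Omega>|lborel. g x * divergence v x + v x \<bullet> grad g x) = 0"
proof (cases "regular_boundary \<Omega>")
  case True
  have "tangential \<Omega> (\<lambda>x. g x * v x $ 1) (\<lambda>x. g x * v x $ 2)"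
    using trace True by (intro tangential_scale) (simp add: tangential_def zero_normal_trace_def inner_vec_def sum_2)
  from divergence_theorem_tangential[OF \<Omega> True C1_mult(1)[OF g v(2)] C1_mult(1)[OF g v(2)] this]
  show ?thesis unfolding divergence_pairing[OF v g] .
next
  case False
  obtain R where R: "\<And>x. x \<in> \<Omega> \<Longrightarrow> norm x \<le> R" using \<Omega>(2) bounded_iff by blast
  define S where "S = max 1 R"
  have S: "0 < S" and RS: "R \<le> S" by (simp_all add: S_def)
  have \<Omega>S: "x \<in> square 0 S" if "x \<in> \<Omega>" for x
    using R[OF that] component_le_norm_cart[of x 1] component_le_norm_cart[of x 2] RS by (auto simp: square_def)
  define \<beta> where "\<beta> = bump2 plateau 0 (2 * S)"
  have \<beta>C: "Ck_on 1 UNIV \<beta>" unfolding \<beta>_def using S by (intro bump2_C1[OF plateau_derivative plateau_continuous']) auto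
  have \<beta>1: "\<beta> x = 1" if "x \<in> \<Omega>" for x unfolding \<beta>_def using S \<Omega>S[OF that] by (intro plateau2_inner) auto
  define f where "f x = \<beta> x * g x" for x
  have fC: "Ck_on 1 UNIV f" unfolding f_def[abs_def] by (rule C1_mult(1)[OF \<beta>C g])
  let ?a = "0 - (\<chi> i. 2 * S) :: real^2" and ?b = "0 + (\<chi> i. 2 * S) :: real^2"
  have "square 0 (2 * S) = cbox ?a ?b" by (auto simp: square_def mem_box_cart forall_2 abs_le_iff algebra_simps)
  then have f0: "\<forall>x. x \<notin> cbox ?a ?b \<longrightarrow> f x = 0"
    using bump2_outside[where f = plateau and r = "2 * S" and ?x0.0 = 0, OF plateau_outside] S by (auto simp: f_def \<beta>_def)
  have p0: "\<forall>x. x \<notin> cbox ?a ?b \<longrightarrow> pdx i f x = 0" for i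
    unfolding pdx_def by (intro allI impI derivative_outside_support[OF C1_D(1)[OF fC] closed_cbox f0[rule_format]])
  have bnd: "\<exists>M\<ge>0. \<forall>x. \<bar>k x\<bar> \<le> M" if k: "continuous_on UNIV k" "\<forall>x. x \<notin> cbox ?a ?b \<longrightarrow> k x = 0" for k :: "real^2 \<Rightarrow> real"
  proof -
    obtain B where B: "\<And>y. y \<in> cbox ?a ?b \<Longrightarrow> norm (k y) \<le> B" using continuous_bounded_on_bounded[OF bounded_cbox k(1)] by metis
    have "\<bar>k x\<bar> \<le> max B 0" for x using B[of x] k(2) by (cases "x \<in> cbox ?a ?b") auto
    then show ?thesis by (intro exI[of _ "max B 0"]) auto
  qed
  define \<psi> where "\<psi> n = conv (mollifier (real (Suc n))) f" for n
  have \<psi>: "\<psi> n \<in> Cc_smooth" for n unfolding \<psi>_def by (rule conv_mollifier_Cc_smooth[OF _ C1_D(3)[OF fC] f0]) simp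
  then have \<psi>C: "Ck_on 1 UNIV (\<psi> n)" for n unfolding Cc_smooth_def using smooth_on_C1 by blast
  have mC: "Ck_on 1 UNIV (mollifier n)" for n unfolding mollifier_def by (rule kernel_Ck)
  have p\<psi>: "pdx i (\<psi> n) = conv (mollifier (real (Suc n))) (pdx i f)" for i n
    unfolding \<psi>_def by (rule ext) (rule pdx_conv[OF mC fC f0])
  have cb: "\<bar>conv (mollifier (real (Suc n))) k x\<bar> \<le> M" if "continuous_on UNIV k" "\<forall>x. x \<notin> cbox ?a ?b \<longrightarrow> k x = 0" "\<forall>x. \<bar>k x\<bar> \<le> M" for k M n x
    using mollifier_average[OF _ that(1,2), of "real (Suc n)" x 0 M] that(3) by simp
  obtain M0 where M0: "0 \<le> M0" "\<forall>x. \<bar>f x\<bar> \<le> M0" using bnd[OF C1_D(3)[OF fC] f0] by blast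
  obtain M1 where M1: "0 \<le> M1" "\<forall>x. \<bar>pdx 1 f x\<bar> \<le> M1" using bnd[OF pdx_continuous[OF fC] p0] by blast
  obtain M2 where M2: "0 \<le> M2" "\<forall>x. \<bar>pdx 2 f x\<bar> \<le> M2" using bnd[OF pdx_continuous[OF fC] p0] by blast
  define J where "J h x = h x * (pdx 1 (\<lambda>x. v x $ 1) x + pdx 2 (\<lambda>x. v x $ 2) x) + (v x $ 1 * pdx 1 h x + v x $ 2 * pdx 2 h x)" for h x
  have J: "h x * divergence v x + v x \<bullet> grad h x = J h x" for h x
    by (simp add: J_def divergence_eq[OF v(1)] inner_vec_def sum_2 grad_def pdx_def)
  have dc: "continuous_on UNIV (\<lambda>x. pdx 1 (\<lambda>x. v x $ 1) x + pdx 2 (\<lambda>x. v x $ 2) x)"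
    by (intro continuous_on_add pdx_continuous v)
  have vc: "continuous_on UNIV (\<lambda>x. v x $ i)" for i by (rule C1_D(3)[OF v(2)])
  have Jc: "continuous_on UNIV (J h)" if "Ck_on 1 UNIV h" for h
    unfolding J_def[abs_def] by (intro continuous_on_add continuous_on_mult dc vc pdx_continuous that C1_D(3)[OF that] v)
  obtain D where D: "\<And>x. x \<in> \<Omega> \<Longrightarrow> norm (pdx 1 (\<lambda>x. v x $ 1) x + pdx 2 (\<lambda>x. v x $ 2) x) \<le> D" using continuous_bounded_on_bounded[OF \<Omega>(2) dc] by metis
  obtain V1 where V1: "\<And>x. x \<in> \<Omega> \<Longrightarrow> norm (v x $ 1) \<le> V1" using continuous_bounded_on_bounded[OF \<Omega>(2) vc[of 1]] by metis
  obtain V2 where V2: "\<And>x. x \<in> \<Omega> \<Longrightarrow> norm (v x $ 2) \<le> V2" using continuous_bounded_on_bounded[OF \<Omega>(2) vc[of 2]] by metis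
  have \<Omega>b: "\<Omega> \<in> sets borel" using \<Omega>(1) by simp
  have "(\<lambda>n. LINT x:\<Omega>|lborel. J (\<psi> n) x) \<longlonglongrightarrow> (LINT x:\<Omega>|lborel. J f x)"
  proof (rule set_integral_dominated_limit[OF \<Omega>b \<Omega>(2)])
    show "set_borel_measurable borel \<Omega> (J (\<psi> n))" "set_borel_measurable borel \<Omega> (J f)" for n
      by (intro set_measurable_UNIV borel_measurable_continuous_onI Jc \<psi>C fC \<Omega>b)+
    show "\<bar>J (\<psi> n) x\<bar> \<le> M0 * D + (V1 * M1 + V2 * M2)" if x: "x \<in> \<Omega>" for n x
    proof -
      have "\<bar>J (\<psi> n) x\<bar> \<le> \<bar>\<psi> n x\<bar> * \<bar>pdx 1 (\<lambda>x. v x $ 1) x + pdx 2 (\<lambda>x. v x $ 2) x\<bar> + (\<bar>v x $ 1\<bar> * \<bar>pdx 1 (\<psi> n) x\<bar> + \<bar>v x $ 2\<bar> * \<bar>pdx 2 (\<psi> n) x\<bar>)"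
        unfolding J_def abs_mult[symmetric] by (intro order_trans[OF abs_triangle_ineq] add_mono order_refl)
      also have "\<dots> \<le> M0 * D + (V1 * M1 + V2 * M2)"
      proof (intro add_mono mult_mono)
        show "\<bar>\<psi> n x\<bar> \<le> M0" unfolding \<psi>_def by (rule cb[OF C1_D(3)[OF fC] f0 M0(2)])
        show "\<bar>pdx 1 (\<psi> n) x\<bar> \<le> M1" unfolding p\<psi> by (rule cb[OF pdx_continuous[OF fC] p0 M1(2)])
        show "\<bar>pdx 2 (\<psi> n) x\<bar> \<le> M2" unfolding p\<psi> by (rule cb[OF pdx_continuous[OF fC] p0 M2(2)])
        show "0 \<le> V1" "0 \<le> V2" using V1[OF x] V2[OF x] norm_ge_zero order_trans by blast+
      qed (use D[OF x] V1[OF x] V2[OF x] M0(1) in auto)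
      finally show ?thesis .
    qed
    show "AE x in lborel. x \<in> \<Omega> \<longrightarrow> (\<lambda>n. J (\<psi> n) x) \<longlonglongrightarrow> J f x"
      unfolding J_def p\<psi> unfolding \<psi>_def
      by (intro AE_I2 impI tendsto_add tendsto_mult tendsto_const mollifier_tendsto[OF C1_D(3)[OF fC] f0] mollifier_tendsto[OF pdx_continuous[OF fC] p0])
  qed
  moreover have "(LINT x:\<Omega>|lborel. J (\<psi> n) x) = 0" for n
    using trace False \<psi>[of n] lebesgue_set_integral(2)[OF set_integrable_continuous[OF \<Omega>b \<Omega>(2) Jc[OF \<psi>C[of n]]]]
    by (simp add: zero_normal_trace_def J)
  ultimately have "(LINT x:\<Omega>|lborel. J f x) = 0" by (simp add: LIMSEQ_const_iff)
  moreover have "J f x = g x * divergence v x + v x \<bullet> grad g x" if x: "x \<in> \<Omega>" for x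
  proof -
    have "(f has_derivative frechet_derivative g (at x)) (at x)"
      by (rule has_derivative_transform_within_open[OF C1_D(1)[OF g] \<Omega>(1) x]) (simp add: f_def \<beta>1)
    from frechet_derivative_at[OF this] have "pdx i f x = pdx i g x" for i by (simp add: pdx_def)
    moreover have "f x = g x" using x by (simp add: f_def \<beta>1)
    ultimately show ?thesis unfolding J by (simp add: J_def)
  qed
  ultimately show ?thesis using set_lebesgue_integral_cong[of \<Omega> lborel "J f" "\<lambda>x. g x * divergence v x + v x \<bullet> grad g x"] \<Omega>b by simp
qed

section \<open>From saturated fields to the balance laws\<close>

lemma C1_const: "Ck_on 1 UNIV (\<lambda>_::'a::real_normed_vector. c)"
  by (rule C1_I[where F = "\<lambda>_ _. 0"]) simp_all

lemma pdx_const: "pdx i (\<lambda>_. c) x = 0"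
  by (simp add: pdx_def frechet_derivative_const)

lemma grad_pdx: "grad f x = (\<chi> i. pdx i f x)"
  by (simp add: grad_def pdx_def)

lemma time_deriv_eq: "Ck_on 1 UNIV \<phi> \<Longrightarrow> time_deriv \<phi> t x = frechet_derivative \<phi> (at (t, x)) tdir"
  unfolding time_deriv_def by (rule vector_derivative_at[OF time_derivative])

lemma slice_derivative:
  assumes "Ck_on 1 UNIV \<phi>"
  shows "((\<lambda>x. \<phi> (t, x)) has_derivative (\<lambda>h. frechet_derivative \<phi> (at (t, x)) (0, h))) (at x)"
proof -
  have "((\<lambda>x. (t, x)) has_derivative (\<lambda>h. (0, h))) (at x)" by (auto intro!: derivative_eq_intros)
  from has_derivative_compose[OF this C1_D(1)[OF assms]] show ?thesis .
qed

lemma slice_C1: "Ck_on 1 UNIV \<phi> \<Longrightarrow> Ck_on 1 UNIV (\<lambda>x. \<phi> (t, x))"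
  by (rule C1_I[OF slice_derivative]) (auto intro!: continuous_on_compose2[OF C1_D(2)] continuous_intros)

lemma slice_frechet: "Ck_on 1 UNIV \<phi> \<Longrightarrow> frechet_derivative (\<lambda>x. \<phi> (t, x)) (at x) h = frechet_derivative \<phi> (at (t, x)) (0, h)"
  using frechet_derivative_at[OF slice_derivative, of \<phi> t x] by metis

lemma slice_grad: "Ck_on 1 UNIV \<phi> \<Longrightarrow> grad (\<lambda>x. \<phi> (t, x)) x $ i = pd \<phi> (xdir i) (t, x)"
  by (simp add: grad_def slice_frechet pd_def xdir_def)

lemma C1_snd:
  assumes "Ck_on 1 UNIV g"
  shows "Ck_on 1 UNIV (\<lambda>y::'a::real_normed_vector \<times> 'b::real_normed_vector. g (snd y))"
    "frechet_derivative (\<lambda>y::'a \<times> 'b. g (snd y)) (at y) v = frechet_derivative g (at (snd y)) (snd v)"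
proof -
  have d: "((\<lambda>y::'a \<times> 'b. g (snd y)) has_derivative (\<lambda>v. frechet_derivative g (at (snd y)) (snd v))) (at y)" for y
    by (rule has_derivative_compose[OF has_derivative_snd[OF has_derivative_ident] C1_D(1)[OF assms]])
  show "Ck_on 1 UNIV (\<lambda>y::'a \<times> 'b. g (snd y))"
    by (rule C1_I[OF d]) (auto intro!: continuous_on_compose2[OF C1_D(2)[OF assms]] continuous_intros)
  show "frechet_derivative (\<lambda>y::'a \<times> 'b. g (snd y)) (at y) v = frechet_derivative g (at (snd y)) (snd v)"
    by (simp add: frechet_derivative_at[OF d, symmetric])
qed

definition vec2 :: "complex \<Rightarrow> real^2" where "vec2 z = (\<chi> i. if i = 1 then Re z else Im z)"

lemma vec2_nth [simp]: "vec2 z $ 1 = Re z" "vec2 z $ 2 = Im z" by (simp_all add: vec2_def)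

lemma norm_vec2 [simp]: "norm (vec2 z) = norm z"
  by (simp add: norm_vec_def L2_set_def sum_2 cmod_def)

lemma vec2_inner: "vec2 z \<bullet> w = Re z * w $ 1 + Im z * w $ 2"
  by (simp add: inner_vec_def sum_2)

lemma vec2_inject: "vec2 z = vec2 w \<longleftrightarrow> z = w"
  by (auto simp: vec_eq_iff forall_2 complex_eq_iff)

lemma vec2_continuous: "continuous_on UNIV vec2"
proof -
  have "continuous_on UNIV (\<lambda>z. if i = 1 then Re z else Im z)" for i :: 2
    by (cases "i = 1") (simp_all add: continuous_on_Re continuous_on_Im)
  then show ?thesis unfolding vec2_def[abs_def] by (intro continuous_on_vec_lambda)
qed

lemma vec2_measurable: "f \<in> borel_measurable M \<Longrightarrow> (\<lambda>x. vec2 (f x)) \<in> borel_measurable M"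
  by (rule measurable_compose[OF _ borel_measurable_continuous_onI[OF vec2_continuous]])

locale saturated_flow =
  fixes \<Omega> :: "(real^2) set" and T B :: real and m :: "spacetime \<Rightarrow> complex" and m0 :: "real^2 \<Rightarrow> complex"
  assumes open_\<Omega>: "open \<Omega>" and bounded_\<Omega>: "bounded \<Omega>" and T: "0 < T"
    and m: "m \<in> borel_measurable borel" "\<And>y. norm (m y) \<le> B"
    and m0: "m0 \<in> borel_measurable borel" "\<And>x. norm (m0 x) \<le> B"
    and euler: "weak_euler T \<Omega> (\<lambda>y. (m y, (m y)\<^sup>2 / 2)) m0"
begin

abbreviation slab :: "spacetime set" where "slab \<equiv> {0<..<T} \<times> \<Omega>"

lemma slab: "slab \<in> sets borel" "bounded slab" and \<Omega>: "\<Omega> \<in> sets borel"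
  using open_\<Omega> bounded_\<Omega> by (auto intro: slab_borel slab_bounded)

lemma bm_m: "bounded_measurable slab (\<lambda>y. Re (m y))" "bounded_measurable slab (\<lambda>y. Im (m y))"
  using bounded_measurable_Re_Im[OF set_measurable_UNIV[OF slab(1) m(1)], of B] m(2) by blast+

lemma bm_m0: "bounded_measurable \<Omega> (\<lambda>x. Re (m0 x))" "bounded_measurable \<Omega> (\<lambda>x. Im (m0 x))"
proof -
  have a: "bounded_measurable \<Omega> (\<lambda>x. f (m0 x))" if f: "continuous_on UNIV f" "\<And>z. \<bar>f z\<bar> \<le> norm z" for f :: "complex \<Rightarrow> real"
  proof -
    have "(\<lambda>x. f (m0 x)) \<in> borel_measurable borel" by (rule measurable_compose[OF m0(1) borel_measurable_continuous_onI[OF f(1)]])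
    moreover have "\<bar>f (m0 x)\<bar> \<le> B" for x using f(2)[of "m0 x"] m0(2)[of x] by linarith
    ultimately show ?thesis unfolding bounded_measurable_def using set_measurable_UNIV[OF \<Omega>] by blast
  qed
  show "bounded_measurable \<Omega> (\<lambda>x. Re (m0 x))" by (rule a[OF continuous_on_Re[OF continuous_on_id] abs_Re_le_cmod])
  show "bounded_measurable \<Omega> (\<lambda>x. Im (m0 x))" by (rule a[OF continuous_on_Im[OF continuous_on_id] abs_Im_le_cmod])
qed

lemma bm_cont: "continuous_on UNIV f \<Longrightarrow> bounded_measurable slab f"
  by (rule bounded_measurable_continuous[OF slab])

lemma bm_cont0: "continuous_on UNIV f \<Longrightarrow> bounded_measurable \<Omega> f"
  by (rule bounded_measurable_continuous[OF \<Omega> bounded_\<Omega>])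

lemma bm_pd: "Ck_on 1 UNIV \<phi> \<Longrightarrow> bounded_measurable slab (pd \<phi> v)"
  unfolding pd_def[abs_def] by (intro bm_cont C1_D(2))

lemma bm_space: "continuous_on UNIV g \<Longrightarrow> bounded_measurable slab (\<lambda>y. g (snd y))"
  by (intro bm_cont continuous_on_compose2[OF _ continuous_on_snd[OF continuous_on_id] subset_UNIV])

lemma bm_integrable: "bounded_measurable slab f \<Longrightarrow> set_integrable lborel slab f"
  by (rule bounded_measurable_integrable[OF slab])

lemmas bm = bounded_measurable_add bounded_measurable_mult bm_m bm_pd

text \<open>
  The function \<open>(g + c) \<phi>\<close> is an admissible test function for \<open>div v = 0\<close>; the
  time derivative is integrated out because g does not depend on time. Constant g gives conservation of mass and
  entropy, \<open>g = \<rho>0 (q + e)\<close> with \<open>c = p\<close> the energy balance.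
\<close>

lemma transport_balance:
  assumes g: "Ck_on 1 UNIV g" and \<phi>: "Ck_on 1 UNIV \<phi>" and final: "\<And>x. x \<in> \<Omega> \<Longrightarrow> \<phi> (T, x) = 0"
  shows "set_integrable lborel slab (\<lambda>y. g (snd y) * pd \<phi> tdir y + (g (snd y) + c) * (Re (m y) * pd \<phi> (xdir 1) y + Im (m y) * pd \<phi> (xdir 2) y))"
    and "set_integrable lborel slab (\<lambda>y. (Re (m y) * pdx 1 g (snd y) + Im (m y) * pdx 2 g (snd y)) * \<phi> y)"
    and "(LINT y:slab|lborel. g (snd y) * pd \<phi> tdir y + (g (snd y) + c) * (Re (m y) * pd \<phi> (xdir 1) y + Im (m y) * pd \<phi> (xdir 2) y)) =
      - (LINT x:\<Omega>|lborel. g x * \<phi> (0, x)) - (LINT y:slab|lborel. (Re (m y) * pdx 1 g (snd y) + Im (m y) * pdx 2 g (snd y)) * \<phi> y)"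
proof -
  let ?A = "\<lambda>y. g (snd y) * pd \<phi> tdir y" and ?B = "\<lambda>y. (g (snd y) + c) * (Re (m y) * pd \<phi> (xdir 1) y + Im (m y) * pd \<phi> (xdir 2) y)"
    and ?D = "\<lambda>y. (Re (m y) * pdx 1 g (snd y) + Im (m y) * pdx 2 g (snd y)) * \<phi> y"
  have A: "set_integrable lborel slab ?A" by (intro bm_integrable bm bm_space C1_D(3)[OF g] \<phi>)
  have Bi: "set_integrable lborel slab ?B" by (intro bm_integrable bm bm_space C1_D(3)[OF g] continuous_on_const \<phi> bm_cont)
  show D: "set_integrable lborel slab ?D" by (intro bm_integrable bm bm_space pdx_continuous g bm_cont C1_D(3)[OF \<phi>])
  show "set_integrable lborel slab (\<lambda>y. ?A y + ?B y)" by (rule set_integral_add(1)[OF A Bi])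
  (* the constant c contributes nothing, since phi itself is a test function for div v = 0 *)
  define \<chi>' where "\<chi>' y = (g (snd y) + c) * \<phi> y" for y
  have gc: "Ck_on 1 UNIV (\<lambda>x. g x + c)" "pdx i (\<lambda>x. g x + c) x = pdx i g x" for i x
    using C1_add[OF g C1_const[of c]] pdx_const[of _ c] by simp_all
  have \<chi>C: "Ck_on 1 UNIV \<chi>'" unfolding \<chi>'_def[abs_def] by (rule C1_mult(1)[OF C1_snd(1)[OF gc(1)] \<phi>])
  have p: "pd \<chi>' (xdir i) y = (g (snd y) + c) * pd \<phi> (xdir i) y + pdx i g (snd y) * \<phi> y" for i y
    using C1_mult(2)[OF C1_snd(1)[OF gc(1)] \<phi>, of y "xdir i"] gc(2)[of i "snd y"]
    unfolding \<chi>'_def[abs_def] pd_def C1_snd(2)[OF gc(1)] by (simp add: pdx_def xdir_def)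
  have "(LINT y:slab|lborel. 0 * pd \<chi>' tdir y + Re (m y) * pd \<chi>' (xdir 1) y + Im (m y) * pd \<chi>' (xdir 2) y) = - (LINT x:\<Omega>|lborel. 0 * \<chi>' (0, x))"
    using euler \<chi>C unfolding weak_euler_def balance_def by simp
  moreover have "0 * pd \<chi>' tdir y + Re (m y) * pd \<chi>' (xdir 1) y + Im (m y) * pd \<chi>' (xdir 2) y = ?B y + ?D y" for y
    unfolding p by (simp add: algebra_simps)
  ultimately have BD: "(LINT y:slab|lborel. ?B y) + (LINT y:slab|lborel. ?D y) = 0"
    using set_integral_add(2)[OF Bi D] by simp
  obtain W where W: "\<And>x. x \<in> \<Omega> \<Longrightarrow> norm (g x) \<le> W" using continuous_bounded_on_bounded[OF bounded_\<Omega> C1_D(3)[OF g]] by metis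
  have "(LINT y:slab|lborel. ?A y) = (LINT x:\<Omega>|lborel. g x * (\<phi> (T, x) - \<phi> (0, x)))"
  proof (rule integral_time_derivative[OF _ _ _ _ \<Omega> bounded_\<Omega> T])
    show "((\<lambda>\<tau>. \<phi> (\<tau>, x)) has_real_derivative pd \<phi> tdir (t, x)) (at t)" for t x
      unfolding pd_def has_real_derivative_iff_has_vector_derivative by (rule time_derivative[OF \<phi>])
    show "continuous_on UNIV (pd \<phi> tdir)" unfolding pd_def[abs_def] by (rule C1_D(2)[OF \<phi>])
    show "set_borel_measurable borel \<Omega> g" by (intro set_measurable_UNIV \<Omega> borel_measurable_continuous_onI C1_D(3)[OF g])
    show "\<bar>g x\<bar> \<le> W" if "x \<in> \<Omega>" for x using W[OF that] by simp
  qed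
  also have "\<dots> = (LINT x:\<Omega>|lborel. - (g x * \<phi> (0, x)))"
    using \<Omega> final by (intro set_lebesgue_integral_cong) auto
  also have "\<dots> = - (LINT x:\<Omega>|lborel. g x * \<phi> (0, x))" by (simp add: set_lebesgue_integral_def)
  finally show "(LINT y:slab|lborel. ?A y + ?B y) = - (LINT x:\<Omega>|lborel. g x * \<phi> (0, x)) - (LINT y:slab|lborel. ?D y)"
    using set_integral_add(2)[OF A Bi] BD by simp
qed

text \<open>
  The traceless part of \<open>v \<otimes> v\<close> is covered by the linear system. The isotropic part
  \<open>|v|\<^sup>2/2 + P = q + P\<close> is paired with \<open>div \<phi>\<close> at each fixed time, where
  the vanishing normal trace of \<open>\<phi>\<close> turns it into the force \<open>\<nabla>q\<close>.
\<close>

lemma momentum_pairing: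
  fixes \<phi> :: "spacetime \<Rightarrow> real^2" and P :: real
  assumes q: "Ck_on 1 UNIV q" and m_q: "AE y in lborel. y \<in> slab \<longrightarrow> (norm (m y))\<^sup>2 = 2 * q (snd y)"
    and \<phi>: "Ck_on 1 UNIV \<phi>" and trace: "\<And>t. t \<in> {0..<T} \<Longrightarrow> zero_normal_trace \<Omega> (\<lambda>x. \<phi> (t, x))"
  defines "F \<equiv> \<lambda>y. vec2 (m y) \<bullet> frechet_derivative \<phi> (at y) tdir + tensor (vec2 (m y)) (vec2 (m y)) \<bullet> jacobian (\<lambda>x. \<phi> (fst y, x)) (at (snd y))
      + P * divergence (\<lambda>x. \<phi> (fst y, x)) (snd y)"
  shows "set_integrable lborel slab F" "set_integrable lborel \<Omega> (\<lambda>x. vec2 (m0 x) \<bullet> \<phi> (0, x))" "set_integrable lborel slab (\<lambda>y. grad q (snd y) \<bullet> \<phi> y)"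
    and "(LINT y:slab|lborel. F y) = - (LINT x:\<Omega>|lborel. vec2 (m0 x) \<bullet> \<phi> (0, x)) - (LINT y:slab|lborel. grad q (snd y) \<bullet> \<phi> y)"
proof -
  have C: "Ck_on 1 UNIV (\<lambda>y. \<phi> y $ i)" for i by (rule C1_component[OF \<phi>])
  have Cs: "Ck_on 1 UNIV (\<lambda>x. \<phi> (t, x))" for t by (rule slice_C1[OF \<phi>])
  have diff: "(\<lambda>x. \<phi> (t, x)) differentiable (at x)" for t x using slice_derivative[OF \<phi>] differentiable_def by blast
  have comp: "frechet_derivative \<phi> (at y) v $ i = pd (\<lambda>y. \<phi> y $ i) v y" for y v i
    unfolding pd_def using C1_D(1)[OF \<phi>, of y] by (intro frechet_derivative_component[symmetric]) (auto simp: differentiable_def)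
  define p where "p i v = pd (\<lambda>y. \<phi> y $ i) v" for i v
  have jac: "jacobian (\<lambda>x. \<phi> (fst y, x)) (at (snd y)) $ i $ j = p i (xdir j) y" for y i j
    by (simp add: jacobian_def matrix_def slice_frechet[OF \<phi>] comp p_def xdir_def)
  define dv where "dv y = p 1 (xdir 1) y + p 2 (xdir 2) y" for y
  have dv: "divergence (\<lambda>x. \<phi> (fst y, x)) (snd y) = dv y" for y
    unfolding divergence_def trace_def jac dv_def by (simp add: sum_2)
  let ?z = "\<lambda>y. (m y)\<^sup>2 / 2"
  let ?F1 = "\<lambda>y. Re (m y) * p 1 tdir y + Re (?z y) * p 1 (xdir 1) y + Im (?z y) * p 1 (xdir 2) y"
  let ?F2 = "\<lambda>y. Im (m y) * p 2 tdir y + Im (?z y) * p 2 (xdir 1) y + (- Re (?z y)) * p 2 (xdir 2) y"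
  let ?F3 = "\<lambda>y. (((Re (m y) * Re (m y) + Im (m y) * Im (m y)) * (1/2)) + P) * dv y"
  have z: "Re (?z y) = (Re (m y) * Re (m y) + (-1) * (Im (m y) * Im (m y))) * (1/2)" "Im (?z y) = Re (m y) * Im (m y)" for y
    by (simp_all add: power2_eq_square)
  have bp: "bounded_measurable slab (p i v)" for i v unfolding p_def by (rule bm_pd[OF C])
  have bc: "bounded_measurable slab (\<lambda>_. c)" for c by (intro bm_cont continuous_on_const)
  have bd: "bounded_measurable slab dv" unfolding dv_def[abs_def] by (intro bm bp)
  have bz: "bounded_measurable slab (\<lambda>y. Re (?z y))" "bounded_measurable slab (\<lambda>y. Im (?z y))" "bounded_measurable slab (\<lambda>y. - Re (?z y))"
    unfolding z by (intro bounded_measurable_minus bm bc)+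
  have i1: "set_integrable lborel slab ?F1" by (intro bm_integrable bounded_measurable_add bounded_measurable_mult bm_m bz bp)
  have i2: "set_integrable lborel slab ?F2" by (intro bm_integrable bounded_measurable_add bounded_measurable_mult bm_m bz bp)
  have i3: "set_integrable lborel slab ?F3" by (intro bm_integrable bounded_measurable_add bounded_measurable_mult bm_m bc bd)
  have F: "F y = ?F1 y + ?F2 y + ?F3 y" for y
  proof -
    have "tensor (vec2 (m y)) (vec2 (m y)) \<bullet> jacobian (\<lambda>x. \<phi> (fst y, x)) (at (snd y)) =
      Re (m y) * Re (m y) * p 1 (xdir 1) y + Re (m y) * Im (m y) * p 1 (xdir 2) y + (Im (m y) * Re (m y) * p 2 (xdir 1) y + Im (m y) * Im (m y) * p 2 (xdir 2) y)"
      by (simp add: inner_vec_def sum_2 jac tensor_def)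
    moreover have "vec2 (m y) \<bullet> frechet_derivative \<phi> (at y) tdir = Re (m y) * p 1 tdir y + Im (m y) * p 2 tdir y"
      by (simp add: vec2_inner comp p_def)
    ultimately show ?thesis unfolding F_def dv z by (simp add: dv_def algebra_simps)
  qed
  then have F': "F = (\<lambda>y. ?F1 y + ?F2 y + ?F3 y)" by (rule ext)
  show "set_integrable lborel slab F" unfolding F' by (intro set_integral_add(1) i1 i2 i3)
  have c\<phi>: "continuous_on UNIV (\<lambda>y. \<phi> y $ i)" for i by (rule C1_D(3)[OF C])
  have c\<phi>0: "continuous_on UNIV (\<lambda>x. \<phi> (0, x) $ i)" for i by (rule continuous_on_compose2[OF c\<phi>]) (auto intro!: continuous_intros)
  have j1: "set_integrable lborel \<Omega> (\<lambda>x. Re (m0 x) * \<phi> (0, x) $ 1)" and j2: "set_integrable lborel \<Omega> (\<lambda>x. Im (m0 x) * \<phi> (0, x) $ 2)"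
    by (intro bounded_measurable_integrable[OF \<Omega> bounded_\<Omega>] bounded_measurable_mult bm_m0 bm_cont0 c\<phi>0)+
  show "set_integrable lborel \<Omega> (\<lambda>x. vec2 (m0 x) \<bullet> \<phi> (0, x))" unfolding vec2_inner by (rule set_integral_add(1)[OF j1 j2])
  have gr: "grad q (snd y) \<bullet> \<phi> y = pdx 1 q (snd y) * \<phi> y $ 1 + pdx 2 q (snd y) * \<phi> y $ 2" for y
    by (simp add: inner_vec_def sum_2 grad_def pdx_def)
  show ig: "set_integrable lborel slab (\<lambda>y. grad q (snd y) \<bullet> \<phi> y)"
    unfolding gr by (intro bm_integrable bounded_measurable_add bounded_measurable_mult bm_space pdx_continuous q bm_cont c\<phi>)
  have I1: "(LINT y:slab|lborel. ?F1 y) = - (LINT x:\<Omega>|lborel. Re (m0 x) * \<phi> (0, x) $ 1)"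
    using euler C[of 1] unfolding weak_euler_def balance_def p_def fst_conv snd_conv by blast
  have I2: "(LINT y:slab|lborel. ?F2 y) = - (LINT x:\<Omega>|lborel. Im (m0 x) * \<phi> (0, x) $ 2)"
    using euler C[of 2] unfolding weak_euler_def balance_def p_def fst_conv snd_conv by blast
  let ?G = "\<lambda>y. (q (snd y) + P) * dv y"
  have iG: "set_integrable lborel slab ?G" by (intro bm_integrable bounded_measurable_add bounded_measurable_mult bm_space C1_D(3)[OF q] bc bd)
  have I3: "(LINT y:slab|lborel. ?F3 y) = (LINT y:slab|lborel. ?G y)"
    unfolding set_lebesgue_integral_def
  proof (rule integral_cong_AE)
    show "(\<lambda>y. indicator slab y *\<^sub>R ?F3 y) \<in> borel_measurable lborel" using i3 unfolding set_integrable_def by (rule borel_measurable_integrable)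
    show "(\<lambda>y. indicator slab y *\<^sub>R ?G y) \<in> borel_measurable lborel" using iG unfolding set_integrable_def by (rule borel_measurable_integrable)
    show "AE y in lborel. indicator slab y *\<^sub>R ?F3 y = indicator slab y *\<^sub>R ?G y"
      using m_q
    proof eventually_elim
      case (elim y)
      show ?case
      proof (cases "y \<in> slab")
        case True
        then have "(norm (m y))\<^sup>2 = 2 * q (snd y)" using elim by blast
        then have "(Re (m y) * Re (m y) + Im (m y) * Im (m y)) * (1/2) = q (snd y)" unfolding cmod_power2 by (simp add: power2_eq_square)
        then show ?thesis by simp
      qed simp
    qed
  qed
  have "(LINT y:slab|lborel. ?G y + grad q (snd y) \<bullet> \<phi> y) = (LINT t:{0<..<T}|lborel. LINT x:\<Omega>|lborel. ?G (t, x) + grad q (snd (t, x)) \<bullet> \<phi> (t, x))"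
    by (rule set_integral_product_iterated(2)[OF set_integral_add(1)[OF iG ig]])
  also have "\<dots> = (LINT t:{0<..<T}|lborel. 0)"
  proof (rule set_lebesgue_integral_cong)
    show "\<forall>t. t \<in> {0<..<T} \<longrightarrow> (LINT x:\<Omega>|lborel. ?G (t, x) + grad q (snd (t, x)) \<bullet> \<phi> (t, x)) = 0"
    proof (intro allI impI)
      fix t assume t: "t \<in> {0<..<T}"
      have qP: "Ck_on 1 UNIV (\<lambda>x. q x + P)" "grad (\<lambda>x. q x + P) x = grad q x" for x
      proof -
        show "Ck_on 1 UNIV (\<lambda>x. q x + P)" by (rule C1_add(1)[OF q C1_const])
        show "grad (\<lambda>x. q x + P) x = grad q x"
          using C1_add(2)[OF q C1_const[of P]] pdx_const[of _ P] by (simp add: grad_pdx)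
      qed
      have "(LINT x:\<Omega>|lborel. (q x + P) * divergence (\<lambda>x. \<phi> (t, x)) x + \<phi> (t, x) \<bullet> grad (\<lambda>x. q x + P) x) = 0"
        using t by (intro zero_normal_trace_pairing[OF open_\<Omega> bounded_\<Omega> trace diff C1_component[OF Cs] qP(1)]) auto
      then show "(LINT x:\<Omega>|lborel. ?G (t, x) + grad q (snd (t, x)) \<bullet> \<phi> (t, x)) = 0"
        using dv[of "(t, x)" for x] by (simp add: qP(2) inner_commute)
    qed
  qed simp
  finally have I4: "(LINT y:slab|lborel. ?G y) + (LINT y:slab|lborel. grad q (snd y) \<bullet> \<phi> y) = 0"
    using set_integral_add(2)[OF iG ig] by (simp add: set_lebesgue_integral_def)
  show "(LINT y:slab|lborel. F y) = - (LINT x:\<Omega>|lborel. vec2 (m0 x) \<bullet> \<phi> (0, x)) - (LINT y:slab|lborel. grad q (snd y) \<bullet> \<phi> y)"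
    unfolding F' vec2_inner
    using I1 I2 I3 I4 set_integral_add(2)[OF set_integral_add(1)[OF i1 i2] i3] set_integral_add(2)[OF i1 i2] set_integral_add(2)[OF j1 j2] by linarith
qed

end

lemma set_integral_scale:
  fixes f :: "'a \<Rightarrow> real"
  shows "(LINT x:A|M. c * f x) = c * (LINT x:A|M. f x)"
proof -
  have "indicator A x *\<^sub>R (c * f x) = c * (indicator A x *\<^sub>R f x)" for x by simp
  then show ?thesis unfolding set_lebesgue_integral_def by (simp only: Bochner_Integration.integral_mult_right_zero)
qed

lemma set_integral_cong_AE:
  fixes f g :: "'a::euclidean_space \<Rightarrow> real"
  assumes "set_integrable lborel A f" "set_integrable lborel A g" "AE y in lborel. y \<in> A \<longrightarrow> f y = g y"
  shows "(LINT y:A|lborel. f y) = (LINT y:A|lborel. g y)"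
  unfolding set_lebesgue_integral_def
proof (rule integral_cong_AE)
  show "(\<lambda>x. indicator A x *\<^sub>R f x) \<in> borel_measurable lborel" "(\<lambda>x. indicator A x *\<^sub>R g x) \<in> borel_measurable lborel"
    by (rule borel_measurable_integrable, use assms in \<open>simp only: set_integrable_def\<close>)+
  show "AE x in lborel. indicator A x *\<^sub>R f x = indicator A x *\<^sub>R g x"
    using assms(3)
  proof eventually_elim
    case (elim x) then show ?case by (cases "x \<in> A") auto
  qed
qed

text \<open>
  Thermodynamic stability makes the temperature unique, so the state determined by the energy below is exactly
  the one with constant temperature.
\<close>

lemma internal_energy_strict_mono:
  assumes th: "thermodynamics p e s" and "0 < \<rho>" "0 < \<theta>" "\<theta> < \<theta>'"
  shows "e (\<rho>, \<theta>) < e (\<rho>, \<theta>')"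
proof (rule DERIV_pos_imp_increasing[OF assms(4), where f = "\<lambda>\<tau>. e (\<rho>, \<tau>)"])
  fix \<tau> assume "\<theta> \<le> \<tau>"
  then have \<tau>: "0 < \<tau>" using assms(3) by simp
  have "Ck_on 1 ({0<..} \<times> {0<..}) e" using th unfolding thermodynamics_def smooth_on_def by blast
  then have "e differentiable (at (\<rho>, \<tau>))" using assms(2) \<tau> by (simp add: One_nat_def)
  then have "(e has_derivative frechet_derivative e (at (\<rho>, \<tau>))) (at (\<rho>, \<tau>))" by (simp add: frechet_derivative_works)
  moreover have "((\<lambda>\<tau>. (\<rho>, \<tau>)) has_derivative (\<lambda>v. (0, v))) (at \<tau>)" by (auto intro!: derivative_eq_intros)
  ultimately have "(\<lambda>\<tau>. e (\<rho>, \<tau>)) differentiable (at \<tau>)" using has_derivative_compose differentiable_def by blast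
  then have "DERIV (\<lambda>\<tau>. e (\<rho>, \<tau>)) \<tau> :> deriv (\<lambda>\<tau>. e (\<rho>, \<tau>)) \<tau>" by (simp add: DERIV_deriv_iff_real_differentiable)
  moreover have "0 < deriv (\<lambda>\<tau>. e (\<rho>, \<tau>)) \<tau>" using th assms(2) \<tau> unfolding thermodynamics_def by blast
  ultimately show "\<exists>y. DERIV (\<lambda>\<tau>. e (\<rho>, \<tau>)) \<tau> :> y \<and> 0 < y" by blast
qed

lemma is_temperature_iff:
  assumes th: "thermodynamics p e s" and pos: "0 < \<rho>" "0 < \<theta>"
  shows "is_temperature e \<rho> (\<rho> *\<^sub>R v) (1/2 * \<rho> * (norm v)\<^sup>2 + \<rho> * e (\<rho>, \<theta>)) \<tau> \<longleftrightarrow> \<tau> = \<theta>"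
proof -
  have "1/2 * \<rho> * (norm v)\<^sup>2 + \<rho> * e (\<rho>, \<theta>) - 1/2 * (norm (\<rho> *\<^sub>R v))\<^sup>2 / \<rho> = \<rho> * e (\<rho>, \<theta>)"
    using pos by (simp add: power2_eq_square)
  then have "is_temperature e \<rho> (\<rho> *\<^sub>R v) (1/2 * \<rho> * (norm v)\<^sup>2 + \<rho> * e (\<rho>, \<theta>)) \<tau> \<longleftrightarrow> 0 < \<tau> \<and> e (\<rho>, \<tau>) = e (\<rho>, \<theta>)"
    unfolding is_temperature_def using pos by simp
  also have "\<dots> \<longleftrightarrow> \<tau> = \<theta>"
    using internal_energy_strict_mono[OF th pos(1), of \<tau> \<theta>] internal_energy_strict_mono[OF th pos(1), of \<theta> \<tau>] pos(2)
    by (cases \<tau> \<theta> rule: linorder_cases) auto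
  finally show ?thesis .
qed

lemma temperature_eq:
  assumes "thermodynamics p e s" "0 < \<rho>" "0 < \<theta>"
  shows "temperature e \<rho> (\<rho> *\<^sub>R v) (1/2 * \<rho> * (norm v)\<^sup>2 + \<rho> * e (\<rho>, \<theta>)) = \<theta>"
  unfolding temperature_def is_temperature_iff[OF assms] by simp

lemma test_function_C1: "\<phi> \<in> test_functions T A \<Longrightarrow> Ck_on 1 UNIV \<phi>"
  unfolding test_functions_def using smooth_on_C1 by blast

text \<open>
  The support stays away from \<open>t = T\<close>, but the extension beyond T is arbitrary; the value at T
  follows by continuity from the left.
\<close>

lemma test_function_final:
  assumes \<phi>: "\<phi> \<in> test_functions T A" and T: "0 < T" and x: "x \<in> A"
  shows "\<phi> (T, x) = 0"
proof (rule ccontr)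
  assume n: "\<phi> (T, x) \<noteq> 0"
  obtain K where K: "compact K" "K \<subseteq> {0..<T} \<times> A" "\<forall>z\<in>{0..<T} \<times> A - K. \<phi> z = 0"
    using \<phi> unfolding test_functions_def by blast
  have "open (\<phi> -` (- {0}))" by (rule open_vimage[OF _ C1_D(3)[OF test_function_C1[OF \<phi>]]]) auto
  then have "open (\<phi> -` (- {0}) \<inter> - K)" using K(1) by (intro open_Int open_Compl compact_imp_closed)
  moreover have "(T, x) \<in> \<phi> -` (- {0}) \<inter> - K" using n K(2) by auto
  ultimately obtain d where d: "d > 0" "ball (T, x) d \<subseteq> \<phi> -` (- {0}) \<inter> - K" using open_contains_ball by blast
  define t where "t = T - min (d / 2) T"
  have t: "0 \<le> t" "t < T" "T - t < d" using d(1) T by (auto simp: t_def min_def)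
  then have "(t, x) \<in> ball (T, x) d" by (simp add: dist_prod_def dist_real_def)
  then have "(t, x) \<notin> K" "\<phi> (t, x) \<noteq> 0" using d(2) by auto
  then show False using K(3) t x by auto
qed

text \<open>
  A velocity field with squared modulus \<open>2 (\<Phi> + C)\<close>, completed to a thermodynamic state. G is
  a C1 extension of the potential to the plane.
\<close>

locale isothermal_flow = saturated_flow +
  fixes p e s :: "real \<times> real \<Rightarrow> real" and \<rho>0 \<theta>0 C :: real and \<Phi> G :: "real^2 \<Rightarrow> real"
  assumes th: "thermodynamics p e s" and pos: "0 < \<rho>0" "0 < \<theta>0"
    and G: "Ck_on 1 UNIV G" "\<And>x. x \<in> closure \<Omega> \<Longrightarrow> \<Phi> x = G x"
    and m_sat: "AE y in lborel. y \<in> {0<..<T} \<times> \<Omega> \<longrightarrow> (norm (m y))\<^sup>2 = 2 * (G (snd y) + C)"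
    and m0_sat: "AE x in lborel. x \<in> \<Omega> \<longrightarrow> (norm (m0 x))\<^sup>2 = 2 * (G x + C)"
begin

abbreviation "mom \<equiv> \<lambda>y. \<rho>0 *\<^sub>R vec2 (m y)"
abbreviation "en v \<equiv> 1/2 * \<rho>0 * (norm v)\<^sup>2 + \<rho>0 * e (\<rho>0, \<theta>0)"

lemma state_pressure_eq: "state_pressure p e \<rho>0 (\<rho>0 *\<^sub>R v) (en v) = p (\<rho>0, \<theta>0)"
  unfolding state_pressure_def temperature_eq[OF th pos] using pos by simp

lemma state_entropy_eq: "state_entropy e s \<rho>0 (\<rho>0 *\<^sub>R v) (en v) = s (\<rho>0, \<theta>0)"
  unfolding state_entropy_def temperature_eq[OF th pos] using pos by simp

lemma grad_\<Phi>: "x \<in> \<Omega> \<Longrightarrow> grad \<Phi> x = grad G x"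
proof -
  assume x: "x \<in> \<Omega>"
  have "(\<Phi> has_derivative frechet_derivative G (at x)) (at x)"
    by (rule has_derivative_transform_within_open[OF C1_D(1)[OF G(1)] open_\<Omega> x]) (simp add: G(2) subsetD[OF closure_subset])
  from frechet_derivative_at[OF this] show ?thesis by (simp add: grad_def)
qed

lemma vec2_grad: "Ck_on 1 UNIV \<phi> \<Longrightarrow> vec2 z \<bullet> grad (\<lambda>x. \<phi> (t, x)) x = Re z * pd \<phi> (xdir 1) (t, x) + Im z * pd \<phi> (xdir 2) (t, x)"
  by (simp add: vec2_inner slice_grad)

lemma time_deriv_pd: "Ck_on 1 UNIV \<phi> \<Longrightarrow> time_deriv \<phi> t x = pd \<phi> tdir (t, x)" for \<phi> :: "spacetime \<Rightarrow> real"
  by (simp add: time_deriv_eq pd_def)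

lemma initial_cont: "Ck_on 1 UNIV \<phi> \<Longrightarrow> continuous_on UNIV (\<lambda>x. \<phi> (0::real, x))"
  by (rule C1_D(3)[OF slice_C1])

lemma conserved_density:
  fixes a :: real and \<phi> :: "spacetime \<Rightarrow> real"
  assumes "\<phi> \<in> test_functions T UNIV"
  defines "f \<equiv> \<lambda>(t, x). a * time_deriv \<phi> t x + a * (vec2 (m (t, x)) \<bullet> grad (\<lambda>y. \<phi> (t, y)) x)"
  shows "set_integrable lebesgue slab f" "set_integrable lebesgue \<Omega> (\<lambda>x. a * \<phi> (0, x))"
    "(LINT y:slab|lebesgue. f y) = - (LINT x:\<Omega>|lebesgue. a * \<phi> (0, x))"
proof -
  note \<phi> = test_function_C1[OF assms(1)]
  have f: "f = (\<lambda>y. a * pd \<phi> tdir y + (a + 0) * (Re (m y) * pd \<phi> (xdir 1) y + Im (m y) * pd \<phi> (xdir 2) y))"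
    unfolding f_def by (rule ext) (simp add: vec2_grad[OF \<phi>] time_deriv_pd[OF \<phi>] split: prod.split)
  note tb0 = transport_balance[OF C1_const[of a] \<phi> test_function_final[OF assms(1) T UNIV_I]]
  note tb = tb0(1)[of 0] tb0(2) tb0(3)[of 0]
  have i0: "set_integrable lborel \<Omega> (\<lambda>x. a * \<phi> (0, x))"
    by (intro bounded_measurable_integrable[OF \<Omega> bounded_\<Omega>] bounded_measurable_mult bm_cont0 continuous_on_const initial_cont \<phi>)
  show "set_integrable lebesgue slab f" "set_integrable lebesgue \<Omega> (\<lambda>x. a * \<phi> (0, x))"
    unfolding f by (rule lebesgue_set_integral(1)[OF tb(1)] lebesgue_set_integral(1)[OF i0])+
  show "(LINT y:slab|lebesgue. f y) = - (LINT x:\<Omega>|lebesgue. a * \<phi> (0, x))"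
    unfolding f lebesgue_set_integral(2)[OF tb(1)] lebesgue_set_integral(2)[OF i0] tb(3)
    by (simp add: pdx_const set_lebesgue_integral_def)
qed

lemma mass: "mass_balance T \<Omega> (\<lambda>x. \<rho>0) (\<lambda>_. \<rho>0) mom"
  unfolding mass_balance_def Let_def
  using conserved_density[of _ \<rho>0] by (simp add: inner_scaleR_left)

lemma entropy_integrand_eq:
  "entropy_integrand e s Z (\<lambda>_. \<rho>0) mom (\<lambda>y. en (vec2 (m y))) \<phi> =
   (\<lambda>(t, x). \<rho>0 * Z (s (\<rho>0, \<theta>0)) * time_deriv \<phi> t x + \<rho>0 * Z (s (\<rho>0, \<theta>0)) * (vec2 (m (t, x)) \<bullet> grad (\<lambda>y. \<phi> (t, y)) x))"
  unfolding entropy_integrand_def Let_def state_entropy_eq by (simp add: fun_eq_iff inner_scaleR_left)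

lemma entropy:
  assumes "\<phi> \<in> test_functions T UNIV"
  shows "set_integrable lebesgue slab (entropy_integrand e s Z (\<lambda>_. \<rho>0) mom (\<lambda>y. en (vec2 (m y))) \<phi>)"
    "set_integrable lebesgue \<Omega> (\<lambda>x. \<rho>0 * Z (s (\<rho>0, \<theta>0)) * \<phi> (0, x))"
    "(LINT y:slab|lebesgue. entropy_integrand e s Z (\<lambda>_. \<rho>0) mom (\<lambda>y. en (vec2 (m y))) \<phi> y) =
      - (LINT x:\<Omega>|lebesgue. \<rho>0 * Z (s (\<rho>0, \<theta>0)) * \<phi> (0, x))"
  unfolding entropy_integrand_eq by (rule conserved_density[OF assms])+

lemma energy: "energy_balance p e T \<Omega> \<Phi> (\<lambda>x. en (vec2 (m0 x))) (\<lambda>_. \<rho>0) mom (\<lambda>y. en (vec2 (m y)))"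
proof -
  define \<epsilon> where "\<epsilon> x = \<rho>0 * G x + (\<rho>0 * C + \<rho>0 * e (\<rho>0, \<theta>0))" for x
  have \<rho>G: "Ck_on 1 UNIV (\<lambda>x. \<rho>0 * G x)" "pdx i (\<lambda>x. \<rho>0 * G x) x = \<rho>0 * pdx i G x" for i x
    using C1_mult(1)[OF C1_const[of \<rho>0] G(1)] pdx_mult[OF C1_const[of \<rho>0] G(1), of i x] by (simp_all add: pdx_const)
  have \<epsilon>: "Ck_on 1 UNIV \<epsilon>" "pdx i \<epsilon> x = \<rho>0 * pdx i G x" for i x
    unfolding \<epsilon>_def[abs_def] using C1_add[OF \<rho>G(1) C1_const] \<rho>G(2) by (simp_all add: pdx_const)
  let ?P = "p (\<rho>0, \<theta>0)"
  show ?thesis unfolding energy_balance_def Let_def state_pressure_eq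
  proof (rule ballI)
    fix \<phi> :: "spacetime \<Rightarrow> real" assume test: "\<phi> \<in> test_functions T UNIV"
    note \<phi> = test_function_C1[OF test]
    note tb0 = transport_balance[OF \<epsilon>(1) \<phi> test_function_final[OF test T UNIV_I]]
    note tb = tb0(1)[of ?P] tb0(2) tb0(3)[of ?P]
    let ?F = "\<lambda>(t, x). en (vec2 (m (t, x))) * time_deriv \<phi> t x + (en (vec2 (m (t, x))) + ?P) * ((mom (t, x) /\<^sub>R \<rho>0) \<bullet> grad (\<lambda>y. \<phi> (t, y)) x)"
    let ?I = "\<lambda>x. en (vec2 (m0 x)) * \<phi> (0, x)"
    let ?g = "\<lambda>(t, x). (grad \<Phi> x \<bullet> mom (t, x)) * \<phi> (t, x)"
    define E' where "E' z = (Re z * Re z + Im z * Im z) * (\<rho>0 / 2) + \<rho>0 * e (\<rho>0, \<theta>0)" for z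
    have E': "en (vec2 z) = E' z" for z unfolding E'_def norm_vec2 cmod_power2 by (simp add: power2_eq_square algebra_simps)
    have F: "?F = (\<lambda>y. E' (m y) * pd \<phi> tdir y + (E' (m y) + ?P) * (Re (m y) * pd \<phi> (xdir 1) y + Im (m y) * pd \<phi> (xdir 2) y))"
      unfolding E' using pos by (intro ext) (simp add: vec2_grad[OF \<phi>] time_deriv_pd[OF \<phi>] split: prod.split)
    have bE: "bounded_measurable slab (\<lambda>y. E' (m y))" unfolding E'_def
      by (intro bounded_measurable_add bounded_measurable_mult bm_m bm_cont continuous_on_const)
    have bE0: "bounded_measurable \<Omega> (\<lambda>x. E' (m0 x))" unfolding E'_def
      by (intro bounded_measurable_add bounded_measurable_mult bm_m0 bm_cont0 continuous_on_const)
    have iF: "set_integrable lborel slab ?F" unfolding F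
      by (intro bm_integrable bounded_measurable_add bounded_measurable_mult bm_m bm_pd \<phi> bE bm_cont continuous_on_const)
    have iF0: "set_integrable lborel \<Omega> ?I" unfolding E'
      by (intro bounded_measurable_integrable[OF \<Omega> bounded_\<Omega>] bounded_measurable_mult bE0 bm_cont0 initial_cont \<phi>)
    have i\<epsilon>: "set_integrable lborel \<Omega> (\<lambda>x. \<epsilon> x * \<phi> (0, x))"
      by (intro bounded_measurable_integrable[OF \<Omega> bounded_\<Omega>] bounded_measurable_mult bm_cont0 initial_cont \<phi> C1_D(3)[OF \<epsilon>(1)])
    have sat: "E' z = \<epsilon> x" if "(norm z)\<^sup>2 = 2 * (G x + C)" for z x
      unfolding E'[symmetric] norm_vec2 that by (simp add: \<epsilon>_def algebra_simps)
    have 1: "(LINT y:slab|lborel. ?F y) = (LINT y:slab|lborel. \<epsilon> (snd y) * pd \<phi> tdir y + (\<epsilon> (snd y) + ?P) * (Re (m y) * pd \<phi> (xdir 1) y + Im (m y) * pd \<phi> (xdir 2) y))"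
    proof (rule set_integral_cong_AE[OF iF tb(1)])
      show "AE y in lborel. y \<in> slab \<longrightarrow> ?F y = \<epsilon> (snd y) * pd \<phi> tdir y + (\<epsilon> (snd y) + ?P) * (Re (m y) * pd \<phi> (xdir 1) y + Im (m y) * pd \<phi> (xdir 2) y)"
        using m_sat unfolding F
      proof eventually_elim
        case (elim y) then show ?case using sat by simp
      qed
    qed
    have 2: "(LINT x:\<Omega>|lborel. ?I x) = (LINT x:\<Omega>|lborel. \<epsilon> x * \<phi> (0, x))"
    proof (rule set_integral_cong_AE[OF iF0 i\<epsilon>])
      show "AE x in lborel. x \<in> \<Omega> \<longrightarrow> ?I x = \<epsilon> x * \<phi> (0, x)"
        using m0_sat unfolding E'
      proof eventually_elim
        case (elim x) then show ?case using sat by simp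
      qed
    qed
    have g: "?g y = (Re (m y) * pdx 1 \<epsilon> (snd y) + Im (m y) * pdx 2 \<epsilon> (snd y)) * \<phi> y" if y: "y \<in> slab" for y
    proof -
      obtain t x where [simp]: "y = (t, x)" by (cases y)
      have x: "x \<in> \<Omega>" using y by simp
      have "grad \<Phi> x \<bullet> vec2 (m (t, x)) = Re (m (t, x)) * pdx 1 G x + Im (m (t, x)) * pdx 2 G x"
        unfolding grad_\<Phi>[OF x] by (subst inner_commute) (simp add: vec2_inner grad_pdx)
      then show ?thesis by (simp add: \<epsilon>(2) algebra_simps)
    qed
    have ig: "set_integrable lborel slab ?g"
      using tb(2) set_integrable_cong[OF refl refl, of slab ?g "\<lambda>y. (Re (m y) * pdx 1 \<epsilon> (snd y) + Im (m y) * pdx 2 \<epsilon> (snd y)) * \<phi> y" lborel] g by blast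
    have 3: "(LINT y:slab|lborel. ?g y) = (LINT y:slab|lborel. (Re (m y) * pdx 1 \<epsilon> (snd y) + Im (m y) * pdx 2 \<epsilon> (snd y)) * \<phi> y)"
      by (rule set_lebesgue_integral_cong) (use slab g in auto)
    show "set_integrable lebesgue slab ?F \<and> set_integrable lebesgue \<Omega> ?I \<and> set_integrable lebesgue slab ?g \<and>
      (LINT y:slab|lebesgue. ?F y) = - (LINT x:\<Omega>|lebesgue. ?I x) - (LINT y:slab|lebesgue. ?g y)"
      unfolding lebesgue_set_integral(2)[OF iF] lebesgue_set_integral(2)[OF iF0] lebesgue_set_integral(2)[OF ig] 1 2 3 tb(3)
      by (intro conjI lebesgue_set_integral(1) iF iF0 ig refl)
  qed
qed

lemma momentum: "momentum_balance p e T \<Omega> \<Phi> (\<lambda>x. \<rho>0 *\<^sub>R vec2 (m0 x)) (\<lambda>_. \<rho>0) mom (\<lambda>y. en (vec2 (m y)))"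
proof -
  define q where "q x = G x + C" for x
  have q: "Ck_on 1 UNIV q" "grad q x = grad G x" for x
    unfolding q_def[abs_def] using C1_add[OF G(1) C1_const[of C]] by (simp_all add: pdx_const grad_pdx)
  have sat: "AE y in lborel. y \<in> slab \<longrightarrow> (norm (m y))\<^sup>2 = 2 * q (snd y)" using m_sat unfolding q_def .
  let ?P = "p (\<rho>0, \<theta>0)"
  show ?thesis unfolding momentum_balance_def Let_def state_pressure_eq
  proof (intro ballI impI)
    fix \<phi> :: "spacetime \<Rightarrow> real^2" assume test: "\<phi> \<in> test_functions T (closure \<Omega>)" and trace: "\<forall>t\<in>{0..<T}. zero_normal_trace \<Omega> (\<lambda>x. \<phi> (t, x))"
    note \<phi> = test_function_C1[OF test]
    note mp0 = momentum_pairing[OF q(1) sat \<phi> trace[rule_format]]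
    note mp = mp0(1)[of "?P / \<rho>0"] mp0(2,3) mp0(4)[of "?P / \<rho>0"]
    let ?F = "\<lambda>(t, x). mom (t, x) \<bullet> time_deriv \<phi> t x + (tensor (mom (t, x)) (mom (t, x)) /\<^sub>R \<rho>0) \<bullet> jacobian (\<lambda>y. \<phi> (t, y)) (at x)
      + ?P * divergence (\<lambda>y. \<phi> (t, y)) x"
    let ?H = "\<lambda>y. vec2 (m y) \<bullet> frechet_derivative \<phi> (at y) tdir + tensor (vec2 (m y)) (vec2 (m y)) \<bullet> jacobian (\<lambda>x. \<phi> (fst y, x)) (at (snd y))
      + ?P / \<rho>0 * divergence (\<lambda>x. \<phi> (fst y, x)) (snd y)"
    let ?I = "\<lambda>x. (\<rho>0 *\<^sub>R vec2 (m0 x)) \<bullet> \<phi> (0, x)"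
    let ?g = "\<lambda>(t, x). \<rho>0 * (grad \<Phi> x \<bullet> \<phi> (t, x))"
    have tens: "tensor (\<rho>0 *\<^sub>R v) (\<rho>0 *\<^sub>R v) /\<^sub>R \<rho>0 = \<rho>0 *\<^sub>R tensor v v" for v
      using pos by (simp add: tensor_def vec_eq_iff)
    have F: "?F = (\<lambda>y. \<rho>0 * ?H y)"
    proof (rule ext)
      fix y show "?F y = \<rho>0 * ?H y"
        using pos by (cases y) (simp add: tens time_deriv_eq[OF \<phi>] distrib_left)
    qed
    have iF: "set_integrable lborel slab ?F" unfolding F by (rule set_integrable_mult_right) (rule mp(1))
    have iF0: "set_integrable lborel \<Omega> ?I" unfolding inner_scaleR_left by (rule set_integrable_mult_right) (rule mp(2))
    have g: "?g y = \<rho>0 * (grad q (snd y) \<bullet> \<phi> y)" if y: "y \<in> slab" for y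
    proof -
      obtain t x where [simp]: "y = (t, x)" by (cases y)
      have "x \<in> \<Omega>" using y by simp
      then show ?thesis by (simp add: grad_\<Phi> q(2))
    qed
    have ig': "set_integrable lborel slab (\<lambda>y. \<rho>0 * (grad q (snd y) \<bullet> \<phi> y))" by (rule set_integrable_mult_right) (rule mp(3))
    have ig: "set_integrable lborel slab ?g"
      using ig' set_integrable_cong[OF refl refl, of slab ?g "\<lambda>y. \<rho>0 * (grad q (snd y) \<bullet> \<phi> y)" lborel] g by blast
    have 3: "(LINT y:slab|lborel. ?g y) = (LINT y:slab|lborel. \<rho>0 * (grad q (snd y) \<bullet> \<phi> y))"
      by (rule set_lebesgue_integral_cong) (use slab g in auto)
    have "(LINT y:slab|lborel. ?F y) = - (LINT x:\<Omega>|lborel. ?I x) - (LINT y:slab|lborel. ?g y)"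
    proof -
      have "(LINT y:slab|lborel. ?H y) = - (LINT x:\<Omega>|lborel. vec2 (m0 x) \<bullet> \<phi> (0, x)) - (LINT y:slab|lborel. grad q (snd y) \<bullet> \<phi> y)"
        using mp(4) by simp
      from arg_cong[OF this, of "\<lambda>a. \<rho>0 * a"] show ?thesis
        unfolding F unfolding 3 unfolding inner_scaleR_left unfolding set_integral_scale right_diff_distrib mult_minus_right .
    qed
    then show "set_integrable lebesgue slab ?F \<and> set_integrable lebesgue \<Omega> ?I \<and> set_integrable lebesgue slab ?g \<and>
      (LINT y:slab|lebesgue. ?F y) = - (LINT x:\<Omega>|lebesgue. ?I x) - (LINT y:slab|lebesgue. ?g y)"
      unfolding lebesgue_set_integral(2)[OF iF] lebesgue_set_integral(2)[OF iF0] lebesgue_set_integral(2)[OF ig]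
      by (intro conjI lebesgue_set_integral(1) iF iF0 ig)
  qed
qed

lemma entropy_solution_isothermal:
  "entropy_solution p e s T \<Omega> \<Phi> (\<lambda>x. \<rho>0) (\<lambda>x. \<rho>0 *\<^sub>R vec2 (m0 x)) (\<lambda>x. en (vec2 (m0 x))) (\<lambda>_. \<rho>0) mom (\<lambda>y. en (vec2 (m y)))"
proof -
  have meas: "set_borel_measurable lebesgue slab f" if "f \<in> borel_measurable borel" for f :: "spacetime \<Rightarrow> 'b::euclidean_space"
    using set_measurable_UNIV[OF slab(1) that] unfolding set_borel_measurable_def by (simp add: measurable_completion)
  have vm: "(\<lambda>y. vec2 (m y)) \<in> borel_measurable borel" by (rule vec2_measurable[OF m(1)])
  have "entropy_inequality e s T \<Omega> (\<lambda>x. \<rho>0) (\<lambda>x. \<rho>0 *\<^sub>R vec2 (m0 x)) (\<lambda>x. en (vec2 (m0 x))) (\<lambda>_. \<rho>0) mom (\<lambda>y. en (vec2 (m y)))"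
    unfolding entropy_inequality_def Let_def state_entropy_eq using entropy by simp
  moreover have "set_borel_measurable lebesgue slab mom" "set_borel_measurable lebesgue slab (\<lambda>y. en (vec2 (m y)))" "set_borel_measurable lebesgue slab (\<lambda>_. \<rho>0)"
    by (rule meas; use vm in measurable)+
  moreover have "AE z in lebesgue. z \<in> slab \<longrightarrow> 0 \<le> \<rho>0 \<and> (\<rho>0 = 0 \<longrightarrow> mom z = 0) \<and>
      (0 < \<rho>0 \<longrightarrow> (\<exists>\<theta>. is_temperature e \<rho>0 (mom z) (en (vec2 (m z))) \<theta>))"
  proof (rule AE_I2)
    fix z
    have "is_temperature e \<rho>0 (mom z) (en (vec2 (m z))) \<theta>0" unfolding is_temperature_iff[OF th pos] ..
    then show "z \<in> slab \<longrightarrow> 0 \<le> \<rho>0 \<and> (\<rho>0 = 0 \<longrightarrow> mom z = 0) \<and>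
      (0 < \<rho>0 \<longrightarrow> (\<exists>\<theta>. is_temperature e \<rho>0 (mom z) (en (vec2 (m z))) \<theta>))"
      using pos by (intro conjI impI exI) simp_all
  qed
  ultimately show ?thesis unfolding entropy_solution_def by (intro conjI mass momentum energy)
qed

end

theorem theorem2p8:
  fixes \<Omega> :: "(real^2) set" and T :: real and \<Phi> :: "real^2 \<Rightarrow> real"
    and p e s :: "real \<times> real \<Rightarrow> real" and \<rho>0 \<theta>0 :: real
  assumes "thermodynamics p e s"
    and "open \<Omega>" "connected \<Omega>" "\<Omega> \<noteq> {}" "bounded \<Omega>"
    and "T > 0"
    and "\<Phi> \<in> C1_closure \<Omega>"
    and "\<rho>0 > 0" "\<theta>0 > 0"
  shows "\<exists>u0 \<in> Linfty \<Omega>. \<exists>S. infinite S \<and> pairwise (\<lambda>U V. \<not> ae_equal T \<Omega> U V) S \<and>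
    (\<forall>(\<rho>, m, E) \<in> S.
       entropy_solution p e s T \<Omega> \<Phi>
         (\<lambda>x. \<rho>0) (\<lambda>x. \<rho>0 *\<^sub>R u0 x) (\<lambda>x. 1/2 * \<rho>0 * (norm (u0 x))\<^sup>2 + \<rho>0 * e (\<rho>0, \<theta>0))
         \<rho> m E \<and>
       (\<forall>Z \<in> renormalizers. \<forall>\<phi> \<in> test_functions T UNIV.
          set_integrable lebesgue ({0<..<T} \<times> \<Omega>) (entropy_integrand e s Z \<rho> m E \<phi>) \<and>
          set_lebesgue_integral lebesgue ({0<..<T} \<times> \<Omega>) (entropy_integrand e s Z \<rho> m E \<phi>) =
            - set_lebesgue_integral lebesgue \<Omega> (\<lambda>x. \<rho>0 * Z (s (\<rho>0, \<theta>0)) * \<phi> (0, x))))"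
proof -
  obtain G where G: "Ck_on 1 UNIV G" "\<And>x. x \<in> closure \<Omega> \<Longrightarrow> \<Phi> x = G x"
    using assms(7) unfolding C1_closure_def by blast
  obtain W where W: "W > 0" "\<And>x. x \<in> \<Omega> \<Longrightarrow> norm (G x) \<le> W"
    by (rule continuous_bounded_on_bounded[OF assms(5) C1_D(3)[OF G(1)]]) (rule that)
  (* the constant makes the prescribed energy at least 1 on the domain *)
  define C where "C = W + 1"
  define Q where "Q = 2 * W + 1"
  have Q: "0 < Q" using W(1) by (simp add: Q_def)
  have qc: "continuous_on UNIV (\<lambda>x. G x + C)" by (intro continuous_intros C1_D(3)[OF G(1)])
  have q: "\<forall>x\<in>\<Omega>. 0 < G x + C \<and> G x + C \<le> Q"
    using W(2) by (fastforce simp: C_def Q_def abs_le_iff)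
  obtain m0 and m :: "nat \<Rightarrow> spacetime \<Rightarrow> complex" where
    m0: "m0 \<in> borel_measurable borel" "\<forall>x. norm (m0 x) \<le> sqrt (2 * Q)" "AE x in lborel. x \<in> \<Omega> \<longrightarrow> (norm (m0 x))\<^sup>2 = 2 * (G x + C)"
    and m: "\<forall>n. m n \<in> borel_measurable borel \<and> (\<forall>y. norm (m n y) \<le> sqrt (2 * Q)) \<and>
      (AE y in lborel. y \<in> {0<..<T} \<times> \<Omega> \<longrightarrow> (norm (m n y))\<^sup>2 = 2 * (G (snd y) + C)) \<and>
      weak_euler T \<Omega> (\<lambda>y. (m n y, (m n y)\<^sup>2 / 2)) m0"
    and ne: "\<forall>i j. i \<noteq> j \<longrightarrow> \<not> (AE y in lborel. y \<in> {0<..<T} \<times> \<Omega> \<longrightarrow> m i y = m j y)"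
    using infinitely_many_saturated_solutions[OF assms(2,5,4,6) qc q Q] by (elim exE conjE) (rule that)
  have flow: "isothermal_flow \<Omega> T (sqrt (2 * Q)) (m n) m0 p e s \<rho>0 \<theta>0 C \<Phi> G" for n
  proof (unfold_locales)
    show "(AE y in lborel. y \<in> {0<..<T} \<times> \<Omega> \<longrightarrow> (norm (m n y))\<^sup>2 = 2 * (G (snd y) + C))"
      "weak_euler T \<Omega> (\<lambda>y. (m n y, (m n y)\<^sup>2 / 2)) m0" "m n \<in> borel_measurable borel" "norm (m n y) \<le> sqrt (2 * Q)" for y
      using m by blast+
    show "norm (m0 x) \<le> sqrt (2 * Q)" for x using m0(2) by blast
  qed (fact assms G m0)+
  define U where "U n = ((\<lambda>_::spacetime. \<rho>0), (\<lambda>y. \<rho>0 *\<^sub>R vec2 (m n y)),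
    (\<lambda>y. 1/2 * \<rho>0 * (norm (vec2 (m n y)))\<^sup>2 + \<rho>0 * e (\<rho>0, \<theta>0)))" for n
  have distinct: "\<not> ae_equal T \<Omega> (U i) (U j)" if "i \<noteq> j" for i j
  proof
    assume "ae_equal T \<Omega> (U i) (U j)"
    then have "AE y in lborel. y \<in> {0<..<T} \<times> \<Omega> \<longrightarrow> \<rho>0 *\<^sub>R vec2 (m i y) = \<rho>0 *\<^sub>R vec2 (m j y) \<and>
      1/2 * \<rho>0 * (norm (vec2 (m i y)))\<^sup>2 + \<rho>0 * e (\<rho>0, \<theta>0) = 1/2 * \<rho>0 * (norm (vec2 (m j y)))\<^sup>2 + \<rho>0 * e (\<rho>0, \<theta>0)"
      unfolding ae_equal_def U_def AE_completion_iff prod.case by simp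
    then have "AE y in lborel. y \<in> {0<..<T} \<times> \<Omega> \<longrightarrow> m i y = m j y"
    proof eventually_elim
      case (elim y)
      then show ?case using assms(8) by (auto simp: vec2_inject)
    qed
    then show False using ne that by blast
  qed
  have refl: "ae_equal T \<Omega> V V" for V unfolding ae_equal_def by (simp split: prod.split)
  have "inj U" by (rule injI) (metis distinct refl)
  then have inf: "infinite (range U)" using finite_imageD infinite_UNIV_nat by blast
  have pw: "pairwise (\<lambda>U V. \<not> ae_equal T \<Omega> U V) (range U)"
  proof (rule pairwiseI)
    fix V W assume "V \<in> range U" "W \<in> range U" "V \<noteq> W"
    then obtain i j where "V = U i" "W = U j" "i \<noteq> j" by blast
    then show "\<not> ae_equal T \<Omega> V W" using distinct by simp
  qed
  have bounded_initial: "(\<lambda>x. vec2 (m0 x)) \<in> Linfty \<Omega>"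
  proof -
    have "set_borel_measurable borel \<Omega> (\<lambda>x. vec2 (m0 x))"
      using assms(2) vec2_measurable[OF m0(1)] by (intro set_measurable_UNIV) auto
    then have "set_borel_measurable lebesgue \<Omega> (\<lambda>x. vec2 (m0 x))" unfolding set_borel_measurable_def by (simp add: measurable_completion)
    moreover have "AE x in lebesgue. x \<in> \<Omega> \<longrightarrow> norm (vec2 (m0 x)) \<le> sqrt (2 * Q)" using m0(2) by simp
    ultimately show ?thesis unfolding Linfty_def by blast
  qed
  show ?thesis
    by (intro bexI[OF _ bounded_initial] exI[of _ "range U"] conjI inf pw ballI, erule rangeE, hypsubst, unfold U_def prod.case)
      (intro conjI ballI isothermal_flow.entropy_solution_isothermal[OF flow] isothermal_flow.entropy(1,3)[OF flow])
qed

end
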